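(* Let $n\ge 1$, let $\widehat{C}=\operatorname{Spec} R$ be a germ of a (possibly non-reduced, possibly reducible) complex plane curve singularity, $R=\mathbb{C}[[x,t]]/(f)$, where $f$ is a Weierstrass polynomial of $x$-degree $n$, $$f(x,t)=x^n-a_{n-1}(t)x^{n-1}-\dots-a_1(t)x-a_0(t),\qquad a_i(t)\in t\,\mathbb{C}[[t]].$$ Let $\gamma$ be the companion matrix of $f$, let $e_n$ be the $n$-th standard basis vector of $V=\mathbb{C}^n$, and let $v=(\gamma,e_n)\in(\mathrm{Ad}\oplus V)(\mathbb{C}((t)))$. Then for the generalized $\mathrm{Ad}\oplus V$-affine Springer fiber $M_v\subset \mathrm{Gr}_{GL_n}$ there is an isomorphism of (ind-)schemes $$\varphi: M_v\longrightarrow \mathrm{Hilb}^\bullet(\widehat{C}).$$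
   Context: Notation: $\mathcal{K}=\mathbb{C}((t))$, $\mathcal{O}=\mathbb{C}[[t]]$, $G=GL_n$; $\mathrm{Ad}=\mathfrak{gl}_n$ is the adjoint representation, $V=\mathbb{C}^n$ the vector representation (column vectors), $N=\mathrm{Ad}\oplus V$, so $g.(\gamma,e)=(g\gamma g^{-1},ge)$. $\mathrm{Gr}_{GL_n}$ is the affine Grassmannian, with $\mathbb{C}$-points $GL_n(\mathcal{K})/GL_n(\mathcal{O})$. Companion matrix: $\gamma$ is the $n\times n$ matrix with $\gamma_{i,i+1}=1$ for $1\le i\le n-1$, last row $(a_0,a_1,\dots,a_{n-1})$, and all other entries $0$. Generalized affine Springer fiber: for $v\in N(\mathcal{K})$, $M_v$ is the closed sub-ind-scheme of $\mathrm{Gr}_{GL_n}$ whose functor of points on $\mathbb{C}$-algebras $A$ is $$M_v(A)=\{g\in GL_n(A((t)))\mid g^{-1}.v\in \mathfrak{gl}_n(A[[t]])\oplus A[[t]]^n\}/GL_n(A[[t]])$$ (understood, as for the affine Grassmannian itself, after sheafification). The paper remarks that $M_v$ is in general highly non-reduced, and that in practice it may work with the reduced structure only. Hilbert scheme: $\mathrm{Hilb}^m(\widehat{C})$ represents the functor $A\mapsto\{\text{colength } m\text{ ideals in }A[[x,t]]/f\}$ on $\mathbb{C}$-algebras, and $\mathrm{Hilb}^\bullet(\widehat{C})=\bigsqcup_{m\ge0}\mathrm{Hilb}^m(\widehat{C})$.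
   Formalization: Colength m ideals of A[[x,t]]/f are additionally required to contain a power of (x,t) (automatic over fields); without this the claim fails, e.g. f=x, A=C[[s]] has uncountably many colength 1 ideals (t-cs) while M_v(A) is countable. *)

theory Defs
  imports
    "Jordan_Normal_Form.Matrix"
    "HOL-Algebra.Algebraic_Closure_Type"
    "HOL-Computational_Algebra.Formal_Laurent_Series"
    "HOL-Computational_Algebra.Polynomial_FPS"
begin

text \<open>
  Schemes and ind-schemes enter through their functors of points. Everything is a functor on the
  category of commutative complex algebras whose carrier is a subset of a type \<open>'u\<close>, which plays
  the role of a Grothendieck universe and is arbitrary. By Yoneda, isomorphisms of (ind-)schemes
  are natural isomorphisms of functors of points.
\<close>

section \<open>Complex algebras\<close>

type_synonym 'u calg = "(complex, 'u) module"

definition is_calg :: "'u calg \<Rightarrow> bool" where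
  "is_calg A \<longleftrightarrow> algebra (ring_of_type_algebra :: complex ring) A"

text \<open>Homomorphisms are extensional, so that they are equal as soon as they agree on the carrier.\<close>

definition calg_hom :: "'u calg \<Rightarrow> 'u calg \<Rightarrow> ('u \<Rightarrow> 'u) set" where
  "calg_hom A B = {\<phi> \<in> ring_hom A B \<inter> extensional (carrier A).
     \<forall>c. \<forall>x\<in>carrier A. \<phi> (c \<odot>\<^bsub>A\<^esub> x) = c \<odot>\<^bsub>B\<^esub> \<phi> x}"

definition scalar :: "'u calg \<Rightarrow> complex \<Rightarrow> 'u" where
  "scalar A c = c \<odot>\<^bsub>A\<^esub> \<one>\<^bsub>A\<^esub>"

section \<open>Zariski sheafification\<close>

record ('u, 's) presheaf =
  sections :: "'u calg \<Rightarrow> 's set"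
  restr :: "'u calg \<Rightarrow> 'u calg \<Rightarrow> ('u \<Rightarrow> 'u) \<Rightarrow> 's \<Rightarrow> 's"

definition presheaf_iso :: "('u, 's) presheaf \<Rightarrow> ('u, 'r) presheaf \<Rightarrow> bool" where
  "presheaf_iso F G \<longleftrightarrow> (\<exists>\<eta>.
     (\<forall>A. is_calg A \<longrightarrow> bij_betw (\<eta> A) (sections F A) (sections G A)) \<and>
     (\<forall>A B \<phi>. is_calg A \<and> is_calg B \<and> \<phi> \<in> calg_hom A B \<longrightarrow>
        (\<forall>x\<in>sections F A. \<eta> B (restr F A B \<phi> x) = restr G A B \<phi> (\<eta> A x))))"

text \<open>\<open>\<phi>\<close> exhibits \<open>B\<close> as the localization \<open>A[1/s]\<close>.\<close>

definition is_localization :: "'u calg \<Rightarrow> 'u \<Rightarrow> 'u calg \<Rightarrow> ('u \<Rightarrow> 'u) \<Rightarrow> bool" where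
  "is_localization A s B \<phi> \<longleftrightarrow> is_calg B \<and> \<phi> \<in> calg_hom A B \<and> \<phi> s \<in> Units B \<and>
     (\<forall>b\<in>carrier B. \<exists>a\<in>carrier A. \<exists>k::nat. b \<otimes>\<^bsub>B\<^esub> \<phi> s [^]\<^bsub>B\<^esub> k = \<phi> a) \<and>
     (\<forall>a\<in>carrier A. \<phi> a = \<zero>\<^bsub>B\<^esub> \<longrightarrow> (\<exists>k::nat. s [^]\<^bsub>A\<^esub> k \<otimes>\<^bsub>A\<^esub> a = \<zero>\<^bsub>A\<^esub>))"

type_synonym 'u arrow = "'u calg \<times> ('u \<Rightarrow> 'u)"

text \<open>A sieve on \<open>Spec A\<close>: a set of homomorphisms out of \<open>A\<close>, each given with its codomain.\<close>

definition is_sieve :: "'u calg \<Rightarrow> 'u arrow set \<Rightarrow> bool" where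
  "is_sieve A S \<longleftrightarrow> (\<forall>(B, \<phi>)\<in>S. is_calg B \<and> \<phi> \<in> calg_hom A B \<and>
     (\<forall>C. is_calg C \<longrightarrow> (\<forall>\<psi>\<in>calg_hom B C. (C, compose (carrier A) \<psi> \<phi>) \<in> S)))"

definition zariski_covering :: "'u calg \<Rightarrow> 'u arrow set \<Rightarrow> bool" where
  "zariski_covering A S \<longleftrightarrow> is_sieve A S \<and>
     (\<exists>T\<subseteq>carrier A. genideal A T = carrier A \<and>
        (\<forall>s\<in>T. \<exists>(B, \<phi>)\<in>S. is_localization A s B \<phi>))"

text \<open>Matching families on covering sieves, identified when they agree on a common covering
  refinement; this is the plus construction.\<close>

definition matching_families ::
    "('u, 's) presheaf \<Rightarrow> 'u calg \<Rightarrow> ('u arrow set \<times> ('u arrow \<Rightarrow> 's)) set" where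
  "matching_families F A = {(S, x). zariski_covering A S \<and>
     x \<in> (\<Pi>\<^sub>E p\<in>S. sections F (fst p)) \<and>
     (\<forall>(B, \<phi>)\<in>S. \<forall>C. is_calg C \<longrightarrow> (\<forall>\<psi>\<in>calg_hom B C.
        restr F B C \<psi> (x (B, \<phi>)) = x (C, compose (carrier A) \<psi> \<phi>)))}"

definition matching_rel ::
    "('u, 's) presheaf \<Rightarrow> 'u calg \<Rightarrow> ('u arrow set \<times> ('u arrow \<Rightarrow> 's)) rel" where
  "matching_rel F A = {((S, x), (S', x')).
     (S, x) \<in> matching_families F A \<and> (S', x') \<in> matching_families F A \<and>
     (\<exists>R\<subseteq>S \<inter> S'. zariski_covering A R \<and> (\<forall>p\<in>R. x p = x' p))}"

definition sieve_pullback :: "'u calg \<Rightarrow> 'u calg \<Rightarrow> ('u \<Rightarrow> 'u) \<Rightarrow> 'u arrow set \<Rightarrow> 'u arrow set" where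
  "sieve_pullback A B \<phi> S =
     {(C, \<psi>). is_calg C \<and> \<psi> \<in> calg_hom B C \<and> (C, compose (carrier A) \<psi> \<phi>) \<in> S}"

definition matching_pullback :: "'u calg \<Rightarrow> 'u calg \<Rightarrow> ('u \<Rightarrow> 'u) \<Rightarrow>
    'u arrow set \<times> ('u arrow \<Rightarrow> 's) \<Rightarrow> 'u arrow set \<times> ('u arrow \<Rightarrow> 's)" where
  "matching_pullback A B \<phi> = (\<lambda>(S, x). (sieve_pullback A B \<phi> S,
     restrict (\<lambda>(C, \<psi>). x (C, compose (carrier A) \<psi> \<phi>)) (sieve_pullback A B \<phi> S)))"

definition plus_construction ::
    "('u, 's) presheaf \<Rightarrow> ('u, ('u arrow set \<times> ('u arrow \<Rightarrow> 's)) set) presheaf" where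
  "plus_construction F =
     \<lparr>sections = (\<lambda>A. matching_families F A // matching_rel F A),
      restr = (\<lambda>A B \<phi> c. \<Union>p\<in>c. matching_rel F B `` {matching_pullback A B \<phi> p})\<rparr>"

text \<open>One application yields a separated presheaf, two yield the associated sheaf. As for the affine
  Grassmannian of \<open>GL\<^sub>n\<close>, the Zariski topology suffices: a vector bundle on \<open>Spec A[[t]]\<close> is trivial
  Zariski-locally on \<open>Spec A\<close>, so finer topologies give the same sheaf.\<close>

definition sheafification where
  "sheafification F = plus_construction (plus_construction F)"

section \<open>Laurent and power series over an algebra\<close>

definition laurent :: "('u, 'x) ring_scheme \<Rightarrow> (int \<Rightarrow> 'u) ring" where
  "laurent A =
     \<lparr>carrier = {F. (\<forall>i. F i \<in> carrier A) \<and> (\<exists>N. \<forall>i<N. F i = \<zero>\<^bsub>A\<^esub>)},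
      mult = (\<lambda>F G k. \<Oplus>\<^bsub>A\<^esub> i\<in>{i. F i \<noteq> \<zero>\<^bsub>A\<^esub> \<and> G (k - i) \<noteq> \<zero>\<^bsub>A\<^esub>}. F i \<otimes>\<^bsub>A\<^esub> G (k - i)),
      one = (\<lambda>k. if k = 0 then \<one>\<^bsub>A\<^esub> else \<zero>\<^bsub>A\<^esub>),
      zero = (\<lambda>k. \<zero>\<^bsub>A\<^esub>),
      add = (\<lambda>F G k. F k \<oplus>\<^bsub>A\<^esub> G k)\<rparr>"

text \<open>\<open>A[[t]]\<close> as a subring of \<open>A((t))\<close>.\<close>

definition power_series :: "('u, 'x) ring_scheme \<Rightarrow> (int \<Rightarrow> 'u) ring" where
  "power_series A = (laurent A)
     \<lparr>carrier := {F \<in> carrier (laurent A). \<forall>i<0. F i = \<zero>\<^bsub>A\<^esub>}\<rparr>"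

text \<open>\<open>A[[x,t]]\<close> is \<open>A[[t]][[x]]\<close>: the coefficient of \<open>x\<^sup>i t\<^sup>j\<close> in \<open>F\<close> is \<open>F i j\<close>.\<close>

definition power_series2 :: "('u, 'x) ring_scheme \<Rightarrow> (int \<Rightarrow> int \<Rightarrow> 'u) ring" where
  "power_series2 A = power_series (power_series A)"

definition const2 :: "('u, 'x) ring_scheme \<Rightarrow> 'u \<Rightarrow> int \<Rightarrow> int \<Rightarrow> 'u" where
  "const2 A c = (\<lambda>i j. if i = 0 \<and> j = 0 then c else \<zero>\<^bsub>A\<^esub>)"

section \<open>Matrices over a ring given by its carrier\<close>

definition mat_ring :: "('s, 'x) ring_scheme \<Rightarrow> nat \<Rightarrow> 's mat ring" where
  "mat_ring S n =
     \<lparr>carrier = {M \<in> carrier_mat n n. \<forall>i<n. \<forall>j<n. index_mat M (i, j) \<in> carrier S},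
      mult = (\<lambda>M L. mat n n (\<lambda>(i, j).
        \<Oplus>\<^bsub>S\<^esub> k\<in>{..<n}. index_mat M (i, k) \<otimes>\<^bsub>S\<^esub> index_mat L (k, j))),
      one = mat n n (\<lambda>(i, j). if i = j then \<one>\<^bsub>S\<^esub> else \<zero>\<^bsub>S\<^esub>),
      zero = mat n n (\<lambda>_. \<zero>\<^bsub>S\<^esub>),
      add = (\<lambda>M L. mat n n (\<lambda>p. index_mat M p \<oplus>\<^bsub>S\<^esub> index_mat L p))\<rparr>"

definition GL :: "nat \<Rightarrow> ('s, 'x) ring_scheme \<Rightarrow> 's mat set" where
  "GL n S = Units (mat_ring S n)"

definition mat_vec :: "('s, 'x) ring_scheme \<Rightarrow> nat \<Rightarrow> 's mat \<Rightarrow> 's vec \<Rightarrow> 's vec" where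
  "mat_vec S n M e = vec n (\<lambda>i. \<Oplus>\<^bsub>S\<^esub> k\<in>{..<n}. index_mat M (i, k) \<otimes>\<^bsub>S\<^esub> vec_index e k)"

text \<open>The \<open>S\<close>-points of the representation \<open>Ad \<oplus> V\<close> of \<open>GL\<^sub>n\<close>, and the action of \<open>GL\<^sub>n(S)\<close>.\<close>

definition AdV :: "nat \<Rightarrow> ('s, 'x) ring_scheme \<Rightarrow> ('s mat \<times> 's vec) set" where
  "AdV n S = carrier (mat_ring S n) \<times> {e \<in> carrier_vec n. \<forall>i<n. vec_index e i \<in> carrier S}"

definition AdV_act ::
    "nat \<Rightarrow> ('s, 'x) ring_scheme \<Rightarrow> 's mat \<Rightarrow> 's mat \<times> 's vec \<Rightarrow> 's mat \<times> 's vec" where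
  "AdV_act n S g = (\<lambda>(\<gamma>, e).
     (g \<otimes>\<^bsub>mat_ring S n\<^esub> \<gamma> \<otimes>\<^bsub>mat_ring S n\<^esub> inv\<^bsub>mat_ring S n\<^esub> g, mat_vec S n g e))"

section \<open>Generalized affine Springer fibers\<close>

text \<open>The image of \<open>v \<in> (Ad \<oplus> V)(\<complex>((t)))\<close> in \<open>(Ad \<oplus> V)(A((t)))\<close>.\<close>

definition fls_scalar :: "'u calg \<Rightarrow> complex fls \<Rightarrow> int \<Rightarrow> 'u" where
  "fls_scalar A F = (\<lambda>k. scalar A (fls_nth F k))"

definition AdV_scalar ::
    "'u calg \<Rightarrow> complex fls mat \<times> complex fls vec \<Rightarrow> (int \<Rightarrow> 'u) mat \<times> (int \<Rightarrow> 'u) vec" where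
  "AdV_scalar A = (\<lambda>(\<gamma>, e). (map_mat (fls_scalar A) \<gamma>, map_vec (fls_scalar A) e))"

definition springer_presheaf ::
    "nat \<Rightarrow> complex fls mat \<times> complex fls vec \<Rightarrow> ('u, (int \<Rightarrow> 'u) mat set) presheaf" where
  "springer_presheaf n v =
     \<lparr>sections = (\<lambda>A. {g <#\<^bsub>mat_ring (laurent A) n\<^esub> GL n (power_series A) | g.
        g \<in> GL n (laurent A) \<and>
        AdV_act n (laurent A) (inv\<^bsub>mat_ring (laurent A) n\<^esub> g) (AdV_scalar A v)
          \<in> AdV n (power_series A)}),
      restr = (\<lambda>A B \<phi> Y. \<Union>g\<in>Y.
        map_mat (\<lambda>F k. \<phi> (F k)) g <#\<^bsub>mat_ring (laurent B) n\<^esub> GL n (power_series B))\<rparr>"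

definition springer_fiber where
  "springer_fiber n v = sheafification (springer_presheaf n v)"

section \<open>Hilbert schemes of plane curve germs\<close>

text \<open>\<open>M\<close> is locally free of rank \<open>m\<close>: there are \<open>s \<in> T\<close> generating the unit ideal such that
  \<open>M[1/s]\<close> is free over \<open>A[1/s]\<close>. After clearing denominators a basis may be taken from the
  image of \<open>M\<close>; the two conditions on \<open>b\<close> say that it spans \<open>M[1/s]\<close> and is independent there.\<close>

definition locally_free :: "('a, 'x) ring_scheme \<Rightarrow> ('a, 'm, 'y) module_scheme \<Rightarrow> nat \<Rightarrow> bool" where
  "locally_free A M m \<longleftrightarrow> (\<exists>T\<subseteq>carrier A. genideal A T = carrier A \<and>
     (\<forall>s\<in>T. \<exists>b\<in>{..<m} \<rightarrow> carrier M.
        (\<forall>y\<in>carrier M. \<exists>k::nat. \<exists>c\<in>{..<m} \<rightarrow> carrier A.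
           s [^]\<^bsub>A\<^esub> k \<odot>\<^bsub>M\<^esub> y = (\<Oplus>\<^bsub>M\<^esub> i\<in>{..<m}. c i \<odot>\<^bsub>M\<^esub> b i)) \<and>
        (\<forall>c\<in>{..<m} \<rightarrow> carrier A. (\<Oplus>\<^bsub>M\<^esub> i\<in>{..<m}. c i \<odot>\<^bsub>M\<^esub> b i) = \<zero>\<^bsub>M\<^esub> \<longrightarrow>
           (\<forall>i<m. \<exists>k::nat. s [^]\<^bsub>A\<^esub> k \<otimes>\<^bsub>A\<^esub> c i = \<zero>\<^bsub>A\<^esub>))))"

text \<open>The image in \<open>A[[x,t]]\<close> of \<open>f \<in> \<complex>[[t]][[x]]\<close>; the outer series variable of \<open>f\<close> is \<open>x\<close>.\<close>

definition equation :: "complex fps fps \<Rightarrow> 'u calg \<Rightarrow> int \<Rightarrow> int \<Rightarrow> 'u" where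
  "equation f A = (\<lambda>i j. if i \<ge> 0 \<and> j \<ge> 0
     then scalar A (fps_nth (fps_nth f (nat i)) (nat j)) else \<zero>\<^bsub>A\<^esub>)"

definition equation_ideal :: "complex fps fps \<Rightarrow> 'u calg \<Rightarrow> (int \<Rightarrow> int \<Rightarrow> 'u) set" where
  "equation_ideal f A = cgenideal (power_series2 A) (equation f A)"

text \<open>\<open>A[[x,t]]/f\<close> and the class in it of a series.\<close>

definition curve_ring :: "complex fps fps \<Rightarrow> 'u calg \<Rightarrow> (int \<Rightarrow> int \<Rightarrow> 'u) set ring" where
  "curve_ring f A = power_series2 A Quot equation_ideal f A"

definition curve_class ::
    "complex fps fps \<Rightarrow> 'u calg \<Rightarrow> (int \<Rightarrow> int \<Rightarrow> 'u) \<Rightarrow> (int \<Rightarrow> int \<Rightarrow> 'u) set" where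
  "curve_class f A F = equation_ideal f A +>\<^bsub>power_series2 A\<^esub> F"

definition quotient_module :: "complex fps fps \<Rightarrow> 'u calg \<Rightarrow> (int \<Rightarrow> int \<Rightarrow> 'u) set set \<Rightarrow>
    ('u, (int \<Rightarrow> int \<Rightarrow> 'u) set set) module" where
  "quotient_module f A I = ring.extend (curve_ring f A Quot I)
     \<lparr>module.smult = (\<lambda>c q. (I +>\<^bsub>curve_ring f A\<^esub> curve_class f A (const2 A c)) \<otimes>\<^bsub>curve_ring f A Quot I\<^esub> q)\<rparr>"

text \<open>Ideals are required to be open in the \<open>(x,t)\<close>-adic topology, i.e. to contain a power of
  \<open>(x,t)\<close>: only these define families, flat and finite over \<open>Spec A\<close>, of subschemes of the germ.
  For \<open>A\<close> a field this is automatic. In general it is not: over \<open>A = \<complex>[[s]]\<close> the ideal \<open>(t - s)\<close>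
  of \<open>A[[x,t]]/(x)\<close> has quotient \<open>A\<close>, but its generic fibre is not supported at the origin.\<close>

definition open_ideal :: "complex fps fps \<Rightarrow> 'u calg \<Rightarrow> (int \<Rightarrow> int \<Rightarrow> 'u) set set \<Rightarrow> bool" where
  "open_ideal f A I \<longleftrightarrow> (\<exists>N. \<forall>F\<in>carrier (power_series2 A).
     (\<forall>i j. i + j < N \<longrightarrow> F i j = \<zero>\<^bsub>A\<^esub>) \<longrightarrow> curve_class f A F \<in> I)"

definition hilb ::
    "complex fps fps \<Rightarrow> nat \<Rightarrow> ('u, (int \<Rightarrow> int \<Rightarrow> 'u) set set) presheaf" where
  "hilb f m =
     \<lparr>sections = (\<lambda>A. {I. ideal I (curve_ring f A) \<and> open_ideal f A I \<and>
        locally_free A (quotient_module f A I) m}),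
      restr = (\<lambda>A B \<phi> I. genideal (curve_ring f B)
        {curve_class f B (\<lambda>i j. \<phi> (F i j)) | F.
           F \<in> carrier (power_series2 A) \<and> curve_class f A F \<in> I})\<rparr>"

text \<open>The disjoint union of schemes is the coproduct of sheaves, the sheafification of the
  coproduct of presheaves.\<close>

definition presheaf_coproduct :: "(nat \<Rightarrow> ('u, 's) presheaf) \<Rightarrow> ('u, nat \<times> 's) presheaf" where
  "presheaf_coproduct F =
     \<lparr>sections = (\<lambda>A. SIGMA m:UNIV. sections (F m) A),
      restr = (\<lambda>A B \<phi> (m, x). (m, restr (F m) A B \<phi> x))\<rparr>"

definition hilb_all where
  "hilb_all f = sheafification (presheaf_coproduct (hilb f))"

section \<open>Weierstrass polynomials and companion matrices\<close>

definition weierstrass :: "nat \<Rightarrow> (nat \<Rightarrow> complex fps) \<Rightarrow> complex fps poly" where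
  "weierstrass n a = Polynomial.monom 1 n - (\<Sum>i<n. Polynomial.monom (a i) i)"

text \<open>Rows and columns are numbered from \<open>0\<close>.\<close>

definition companion :: "nat \<Rightarrow> (nat \<Rightarrow> complex fps) \<Rightarrow> complex fls mat" where
  "companion n a = mat n n (\<lambda>(i, j).
     if i = n - 1 then fps_to_fls (a j) else if j = i + 1 then 1 else 0)"

end

theory Submission
  imports Defs "Jordan_Normal_Form.Determinant"
begin

text \<open>
  Both functors are compared with lattices. By Weierstrass division \<open>A[[x,t]]/f\<close> is free over
  \<open>A[[t]]\<close> with basis \<open>1, x, ..., x\<^sup>n\<^sup>-\<^sup>1\<close>, and multiplication by \<open>x\<close> on row vectors is multiplication by
  the companion matrix \<open>\<gamma>\<close> from the right; so open ideals are the \<open>\<gamma>\<close>-stable sublattices \<open>L\<close> of \<open>A[[t]]\<^sup>n\<close>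
  that contain some \<open>t\<^sup>N A[[t]]\<^sup>n\<close>. A coset \<open>g GL\<^sub>n(A[[t]])\<close> gives the lattice of all \<open>w\<close> with \<open>w g\<close>
  integral. Since \<open>g\<^sup>-\<^sup>1 e\<^sub>n\<close> is the last column of \<open>g\<^sup>-\<^sup>1\<close> and \<open>g\<^sup>-\<^sup>1 \<gamma> g\<close> is integral, descending
  through the columns shows that \<open>g\<^sup>-\<^sup>1\<close> is integral, so the lattice lies in \<open>A[[t]]\<^sup>n\<close> and is \<open>\<gamma>\<close>-stable.
  The quotient by the lattice of a matrix is a projective \<open>A\<close>-module and a lattice with locally free
  quotient is locally the lattice of a matrix, in both cases because maximal minors of a split
  presentation generate the unit ideal. Hence the two presheaves correspond to each other locally,
  and their sheafifications are isomorphic.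
\<close>

text \<open>Carriers are handled by lifting to a single type-class ring. Equality in
  \<open>A\<close> becomes congruence modulo the ideal \<open>ker A\<close> of that ring, and a
  lattice is replaced by its preimage, which contains every vector with coefficients in
  \<open>ker A\<close>; this is why statements about lattices carry an ideal \<open>K\<close>. The
  dictionary through lattices is not a map of presheaves in either direction, since ranks are only
  locally constant and bases exist only locally. So a relation is sheafified: the first plus
  construction turns local uniqueness of partners into uniqueness, the second turns their local
  existence into existence. Coverings are tested on the homomorphisms that invert a given element,
  which requires that localizations exist inside the universe; hence the cardinality
  argument.\<close>

section \<open>Complex algebras and their homomorphisms\<close>

lemma is_calgD:
  assumes "is_calg A"
  shows "algebra (ring_of_type_algebra :: complex ring) A" "cring A" "ring A"
    "module (ring_of_type_algebra :: complex ring) A"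
  using assms unfolding is_calg_def
  by (auto intro: algebra.axioms cring.axioms)

lemma ring_of_type_algebra_simps [simp]:
  "carrier (ring_of_type_algebra :: 'a::ring_1 ring) = UNIV"
  "x \<otimes>\<^bsub>ring_of_type_algebra\<^esub> y = x * y"
  "x \<oplus>\<^bsub>ring_of_type_algebra\<^esub> y = x + y"
  "\<one>\<^bsub>ring_of_type_algebra\<^esub> = (1::'a)"
  "\<zero>\<^bsub>ring_of_type_algebra\<^esub> = (0::'a)"
  by (simp_all add: ring_of_type_algebra_def)

lemma scalar_simps:
  assumes "is_calg A"
  shows "scalar A c \<in> carrier A" "scalar A 0 = \<zero>\<^bsub>A\<^esub>" "scalar A 1 = \<one>\<^bsub>A\<^esub>"
    "scalar A (c + d) = scalar A c \<oplus>\<^bsub>A\<^esub> scalar A d"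
    "scalar A (c * d) = scalar A c \<otimes>\<^bsub>A\<^esub> scalar A d"
    "x \<in> carrier A \<Longrightarrow> c \<odot>\<^bsub>A\<^esub> x = scalar A c \<otimes>\<^bsub>A\<^esub> x"
proof -
  interpret algebra "ring_of_type_algebra :: complex ring" A
    using is_calgD(1)[OF assms] .
  show "scalar A c \<in> carrier A" "scalar A 1 = \<one>\<^bsub>A\<^esub>"
    using smult_one[of "\<one>\<^bsub>A\<^esub>"] by (auto simp: scalar_def)
  show "scalar A (c + d) = scalar A c \<oplus>\<^bsub>A\<^esub> scalar A d"
    using smult_l_distr[of c d "\<one>\<^bsub>A\<^esub>"] by (simp add: scalar_def)
  show "scalar A 0 = \<zero>\<^bsub>A\<^esub>"
    using smult_l_null[of "\<one>\<^bsub>A\<^esub>"] by (simp add: scalar_def)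
  show s: "c \<odot>\<^bsub>A\<^esub> x = scalar A c \<otimes>\<^bsub>A\<^esub> x" if "x \<in> carrier A" for c x
    using smult_assoc2[of c "\<one>\<^bsub>A\<^esub>" x] that by (simp add: scalar_def)
  show "scalar A (c * d) = scalar A c \<otimes>\<^bsub>A\<^esub> scalar A d"
    using smult_assoc1[of c d "\<one>\<^bsub>A\<^esub>"] s[of "scalar A d" c] smult_closed[of d "\<one>\<^bsub>A\<^esub>"]
    by (simp add: scalar_def)
qed

lemma calg_homD:
  assumes "\<phi> \<in> calg_hom A B"
  shows "\<phi> \<in> ring_hom A B" "\<phi> \<in> extensional (carrier A)"
    "\<And>x. x \<in> carrier A \<Longrightarrow> \<phi> x \<in> carrier B"
    "\<And>x y. x \<in> carrier A \<Longrightarrow> y \<in> carrier A \<Longrightarrow> \<phi> (x \<otimes>\<^bsub>A\<^esub> y) = \<phi> x \<otimes>\<^bsub>B\<^esub> \<phi> y"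
    "\<And>x y. x \<in> carrier A \<Longrightarrow> y \<in> carrier A \<Longrightarrow> \<phi> (x \<oplus>\<^bsub>A\<^esub> y) = \<phi> x \<oplus>\<^bsub>B\<^esub> \<phi> y"
    "\<phi> \<one>\<^bsub>A\<^esub> = \<one>\<^bsub>B\<^esub>"
    "\<And>x c. x \<in> carrier A \<Longrightarrow> \<phi> (c \<odot>\<^bsub>A\<^esub> x) = c \<odot>\<^bsub>B\<^esub> \<phi> x"
  using assms unfolding calg_hom_def ring_hom_def by (auto simp: Pi_iff)

lemma calg_hom_zero:
  assumes "is_calg A" "is_calg B" "\<phi> \<in> calg_hom A B"
  shows "\<phi> \<zero>\<^bsub>A\<^esub> = \<zero>\<^bsub>B\<^esub>"
  using ring_hom_zero[OF calg_homD(1)[OF assms(3)] is_calgD(3)[OF assms(1)] is_calgD(3)[OF assms(2)]] .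

lemma calg_hom_scalar:
  assumes "is_calg A" "\<phi> \<in> calg_hom A B"
  shows "\<phi> (scalar A c) = scalar B c"
proof -
  interpret cring A using is_calgD(2)[OF assms(1)] .
  show ?thesis using calg_homD(6,7)[OF assms(2)] by (simp add: scalar_def)
qed

lemma calg_homI:
  assumes "is_calg A" "is_calg B" "\<phi> \<in> ring_hom A B" "\<phi> \<in> extensional (carrier A)"
    and "\<And>c. \<phi> (scalar A c) = scalar B c"
  shows "\<phi> \<in> calg_hom A B"
proof -
  have "\<phi> (c \<odot>\<^bsub>A\<^esub> x) = c \<odot>\<^bsub>B\<^esub> \<phi> x" if "x \<in> carrier A" for c x
    using that assms scalar_simps(1)[OF assms(1), of c]
    by (simp add: scalar_simps(6)[OF assms(1)] scalar_simps(6)[OF assms(2)]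
        ring_hom_mult[OF assms(3)] ring_hom_closed[OF assms(3)])
  thus ?thesis using assms by (auto simp: calg_hom_def)
qed

lemma calg_hom_compose:
  assumes "\<phi> \<in> calg_hom A B" "\<psi> \<in> calg_hom B C" "is_calg A"
  shows "compose (carrier A) \<psi> \<phi> \<in> calg_hom A C"
proof -
  interpret module "ring_of_type_algebra :: complex ring" A
    using is_calgD(4)[OF assms(3)] .
  interpret cring A using is_calgD(2)[OF assms(3)] .
  show ?thesis
    using calg_homD[OF assms(1)] calg_homD[OF assms(2)]
    unfolding calg_hom_def ring_hom_def by (auto simp: compose_def)
qed

definition id_hom :: "'u calg \<Rightarrow> 'u \<Rightarrow> 'u" where
  "id_hom A = (\<lambda>x\<in>carrier A. x)"

lemma id_hom: "is_calg A \<Longrightarrow> id_hom A \<in> calg_hom A A"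
proof -
  assume "is_calg A"
  then interpret algebra "ring_of_type_algebra :: complex ring" A
    using is_calgD(1) by blast
  show ?thesis unfolding calg_hom_def ring_hom_def id_hom_def by auto
qed

lemma compose_id_hom [simp]:
  assumes "\<phi> \<in> calg_hom A B"
  shows "compose (carrier A) (id_hom B) \<phi> = \<phi>" "compose (carrier A) \<phi> (id_hom A) = \<phi>"
  using calg_homD[OF assms]
  by (auto simp: compose_def id_hom_def fun_eq_iff extensional_def)

lemma compose_hom_assoc:
  assumes "\<phi> \<in> calg_hom A B"
  shows "compose (carrier A) (compose (carrier B) \<chi> \<psi>) \<phi> = compose (carrier A) \<chi> (compose (carrier A) \<psi> \<phi>)"
  using calg_homD[OF assms] by (auto simp: compose_def fun_eq_iff)

section \<open>Existence of localizations\<close>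

lemma ring_hom_nat_pow:
  assumes "ring R" "ring S" "h \<in> ring_hom R S" "x \<in> carrier R"
  shows "h (x [^]\<^bsub>R\<^esub> (k::nat)) = h x [^]\<^bsub>S\<^esub> k"
proof -
  interpret ring_hom_ring R S h by (rule ring_hom_ringI2[OF assms(1-3)])
  show ?thesis by (induction k) (use assms(4) in simp_all)
qed

text \<open>The complex numbers act through the scalars of \<open>A\<close>, so every commutative
  ring under \<open>A\<close> becomes an algebra. This turns the localization, which is constructed
  as a bare ring, into an object of the category.\<close>

lemma is_calg_extend:
  assumes A: "is_calg A" and B: "cring B" and h: "h \<in> ring_hom A B"
  defines "B' \<equiv> ring.extend B \<lparr>module.smult = (\<lambda>c x. h (scalar A c) \<otimes>\<^bsub>B\<^esub> x)\<rparr>"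
  shows "is_calg B'" "h \<in> ring_hom A B'" "carrier B' = carrier B" "\<zero>\<^bsub>B'\<^esub> = \<zero>\<^bsub>B\<^esub>"
    "restrict h (carrier A) \<in> calg_hom A B'"
    "x \<otimes>\<^bsub>B'\<^esub> y = x \<otimes>\<^bsub>B\<^esub> y" "\<one>\<^bsub>B'\<^esub> = \<one>\<^bsub>B\<^esub>"
    "x \<oplus>\<^bsub>B'\<^esub> y = x \<oplus>\<^bsub>B\<^esub> y"
proof -
  interpret A: cring A using is_calgD(2)[OF A] .
  interpret B: cring B using B .
  have simps: "carrier B' = carrier B" "mult B' = mult B" "add B' = add B" "one B' = one B" "zero B' = zero B"
    "module.smult B' = (\<lambda>c x. h (scalar A c) \<otimes>\<^bsub>B\<^esub> x)"
    by (simp_all add: B'_def ring.defs)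
  note hs = ring_hom_closed[OF h] ring_hom_mult[OF h] ring_hom_add[OF h] ring_hom_one[OF h]
  have cr: "cring B'"
    unfolding cring_def ring_def ring_axioms_def abelian_group_def abelian_group_axioms_def
      abelian_monoid_def comm_monoid_def comm_monoid_axioms_def comm_group_def group_def monoid_def simps group_axioms_def
    using B.l_distr B.r_distr B.m_assoc B.m_comm B.a_assoc B.a_comm B.add.Units_eq
    by (auto simp: Units_def simps)
  have "algebra (ring_of_type_algebra :: complex ring) B'"
  proof (rule algebra.intro[OF module.intro])
    show "cring (ring_of_type_algebra :: complex ring)" by (rule cring_from_type_algebra)
    show "cring B'" by fact
    thus "abelian_group B'" by (simp add: cring_def ring_def)
    show "module_axioms (ring_of_type_algebra :: complex ring) B'"
      by (rule module_axioms.intro)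
        (simp_all add: simps scalar_simps[OF A] hs B.l_distr B.r_distr B.m_assoc)
    show "algebra_axioms (ring_of_type_algebra :: complex ring) B'"
      by (rule algebra_axioms.intro) (simp_all add: simps scalar_simps[OF A] hs B.m_assoc)
  qed
  thus c: "is_calg B'" by (simp add: is_calg_def)
  show h': "h \<in> ring_hom A B'" using h unfolding ring_hom_def simps by auto
  show "carrier B' = carrier B" "\<zero>\<^bsub>B'\<^esub> = \<zero>\<^bsub>B\<^esub>" "x \<otimes>\<^bsub>B'\<^esub> y = x \<otimes>\<^bsub>B\<^esub> y" "\<one>\<^bsub>B'\<^esub> = \<one>\<^bsub>B\<^esub>"
    "x \<oplus>\<^bsub>B'\<^esub> y = x \<oplus>\<^bsub>B\<^esub> y" by (auto simp: simps)
  show "restrict h (carrier A) \<in> calg_hom A B'"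
  proof (rule calg_homI[OF A c])
    show "restrict h (carrier A) \<in> ring_hom A B'" using h' unfolding ring_hom_def by auto
    fix d show "restrict h (carrier A) (scalar A d) = scalar B' d"
      using scalar_simps[OF A] hs by (simp add: scalar_def[of B'] simps)
  qed auto
qed

text \<open>Coefficients of multiples of s X - 1. When such a multiple is constant they become a
  recursion for the coefficients of \<open>p\<close>, from which the kernel of the localization is
  read off.\<close>

lemma (in UP_cring) monom_mult_coeff:
  assumes "p \<in> carrier P" "s \<in> carrier R"
  shows "up_ring.coeff P (p \<otimes>\<^bsub>P\<^esub> (up_ring.monom P s 1 \<ominus>\<^bsub>P\<^esub> \<one>\<^bsub>P\<^esub>)) 0 = \<ominus> up_ring.coeff P p 0"
    "up_ring.coeff P (p \<otimes>\<^bsub>P\<^esub> (up_ring.monom P s 1 \<ominus>\<^bsub>P\<^esub> \<one>\<^bsub>P\<^esub>)) (Suc k) = up_ring.coeff P p k \<otimes> s \<ominus> up_ring.coeff P p (Suc k)"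
proof -
  have mon: "up_ring.monom P s 1 = s \<odot>\<^bsub>P\<^esub> up_ring.monom P \<one> 1" 
    using monom_mult_smult[of s \<one> 1] assms by simp
  have eq: "p \<otimes>\<^bsub>P\<^esub> (up_ring.monom P s 1 \<ominus>\<^bsub>P\<^esub> \<one>\<^bsub>P\<^esub>) = (s \<odot>\<^bsub>P\<^esub> (p \<otimes>\<^bsub>P\<^esub> up_ring.monom P \<one> 1)) \<ominus>\<^bsub>P\<^esub> p"
  proof -
    have "p \<otimes>\<^bsub>P\<^esub> (up_ring.monom P s 1 \<ominus>\<^bsub>P\<^esub> \<one>\<^bsub>P\<^esub>) = p \<otimes>\<^bsub>P\<^esub> up_ring.monom P s 1 \<ominus>\<^bsub>P\<^esub> p"
      using assms by (simp add: P.minus_eq P.r_distr P.r_minus)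
    also have "p \<otimes>\<^bsub>P\<^esub> up_ring.monom P s 1 = s \<odot>\<^bsub>P\<^esub> (p \<otimes>\<^bsub>P\<^esub> up_ring.monom P \<one> 1)"
      unfolding mon using assms P.m_comm UP_smult_assoc2 by simp
    finally show ?thesis .
  qed
  have m0: "up_ring.coeff P (p \<otimes>\<^bsub>P\<^esub> up_ring.monom P \<one> 1) 0 = \<zero>" "up_ring.coeff P (p \<otimes>\<^bsub>P\<^esub> up_ring.monom P \<one> 1) (Suc k) = up_ring.coeff P p k" for k
  proof -
    have "up_ring.coeff P (p \<otimes>\<^bsub>P\<^esub> up_ring.monom P \<one> 1) 0 = (\<Oplus>i \<in> {..0}. up_ring.coeff P p i \<otimes> up_ring.coeff P (up_ring.monom P \<one> 1) (0 - i))"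
      using assms by (subst coeff_mult) auto
    thus "up_ring.coeff P (p \<otimes>\<^bsub>P\<^esub> up_ring.monom P \<one> 1) 0 = \<zero>" using assms by simp
    have "up_ring.coeff P (p \<otimes>\<^bsub>P\<^esub> up_ring.monom P \<one> 1) (Suc k) = (\<Oplus>i \<in> {..Suc k}. up_ring.coeff P p i \<otimes> up_ring.coeff P (up_ring.monom P \<one> 1) (Suc k - i))"
      using assms by (subst coeff_mult) auto
    also have "\<dots> = (\<Oplus>i \<in> {..Suc k}. if k = i then up_ring.coeff P p i else \<zero>)"
      using assms by (intro R.finsum_cong') auto
    also have "\<dots> = up_ring.coeff P p k" using assms by (subst R.finsum_singleton) auto
    finally show "up_ring.coeff P (p \<otimes>\<^bsub>P\<^esub> up_ring.monom P \<one> 1) (Suc k) = up_ring.coeff P p k" .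
  qed
  show "up_ring.coeff P (p \<otimes>\<^bsub>P\<^esub> (up_ring.monom P s 1 \<ominus>\<^bsub>P\<^esub> \<one>\<^bsub>P\<^esub>)) 0 = \<ominus> up_ring.coeff P p 0"
    "up_ring.coeff P (p \<otimes>\<^bsub>P\<^esub> (up_ring.monom P s 1 \<ominus>\<^bsub>P\<^esub> \<one>\<^bsub>P\<^esub>)) (Suc k) = up_ring.coeff P p k \<otimes> s \<ominus> up_ring.coeff P p (Suc k)"
    unfolding eq using assms by (simp_all add: P.minus_eq R.minus_eq m0 R.m_comm del: coeff_mult One_nat_def)
qed


text \<open>The model is R[X]/(s X - 1), with \<open>x\<close> the class of X. If a = p (s X - 1),
  comparing coefficients gives p_k = - s^k a, and this vanishes beyond the degree of
  \<open>p\<close>; so a power of \<open>s\<close> kills \<open>a\<close>.\<close>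

lemma (in UP_cring) universal_localization:
  assumes s: "s \<in> carrier R"
  obtains Q :: "(nat \<Rightarrow> 'a) set ring" and c x where "cring Q" "c \<in> ring_hom R Q" "x \<in> carrier Q"
    "c s \<otimes>\<^bsub>Q\<^esub> x = \<one>\<^bsub>Q\<^esub>"
    "\<And>q. q \<in> carrier Q \<Longrightarrow> \<exists>a\<in>carrier R. \<exists>k::nat. q = c a \<otimes>\<^bsub>Q\<^esub> x [^]\<^bsub>Q\<^esub> k"
    "\<And>a. a \<in> carrier R \<Longrightarrow> c a = \<zero>\<^bsub>Q\<^esub> \<Longrightarrow> \<exists>k::nat. s [^] k \<otimes> a = \<zero>"
proof -
  define g where "g = up_ring.monom P s 1 \<ominus>\<^bsub>P\<^esub> \<one>\<^bsub>P\<^esub>"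
  define J where "J = PIdl\<^bsub>P\<^esub> g"
  have g: "g \<in> carrier P" using s by (simp add: g_def)
  interpret J: ideal J P unfolding J_def by (rule P.cgenideal_ideal[OF g])
  define Q where "Q = P Quot J"
  define q where "q p = J +>\<^bsub>P\<^esub> p" for p
  have Q: "cring Q" unfolding Q_def by (rule J.quotient_is_cring) (rule P.is_cring)
  interpret Q: cring Q by (rule Q)
  have qh: "q \<in> ring_hom P Q" unfolding q_def Q_def by (rule J.rcos_ring_hom)
  note qs = ring_hom_closed[OF qh] ring_hom_mult[OF qh] ring_hom_add[OF qh] ring_hom_one[OF qh]
  define c where "c = q \<circ> (\<lambda>a. up_ring.monom P a 0)"
  have mh: "(\<lambda>a. up_ring.monom P a 0) \<in> ring_hom R P" by (rule const_ring_hom)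
  have ch: "c \<in> ring_hom R Q"
    unfolding c_def by (rule ring_hom_trans[OF mh qh])
  note cs = ring_hom_closed[OF ch] ring_hom_mult[OF ch] ring_hom_add[OF ch] ring_hom_one[OF ch]
  define x where "x = q (up_ring.monom P \<one> 1)"
  have x: "x \<in> carrier Q" unfolding x_def by (rule qs) simp
  have q0: "q p = \<zero>\<^bsub>Q\<^esub> \<longleftrightarrow> p \<in> J" if "p \<in> carrier P" for p
    unfolding Q_def q_def FactRing_def using J.rcos_const_imp_mem[OF that] P.a_rcos_zero[OF J.ideal_axioms] by auto
  have sx: "c s \<otimes>\<^bsub>Q\<^esub> x = \<one>\<^bsub>Q\<^esub>"
  proof -
    have "g \<oplus>\<^bsub>P\<^esub> \<one>\<^bsub>P\<^esub> = up_ring.monom P s 1" using s unfolding g_def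
      by (simp add: P.minus_eq P.a_assoc P.l_neg)
    also have "\<dots> = up_ring.monom P s 0 \<otimes>\<^bsub>P\<^esub> up_ring.monom P \<one> 1"
      using monom_mult[of s \<one> 0 1] s by simp
    finally have "q (g \<oplus>\<^bsub>P\<^esub> \<one>\<^bsub>P\<^esub>) = q (up_ring.monom P s 0 \<otimes>\<^bsub>P\<^esub> up_ring.monom P \<one> 1)" by simp
    hence "q g \<oplus>\<^bsub>Q\<^esub> q \<one>\<^bsub>P\<^esub> = c s \<otimes>\<^bsub>Q\<^esub> x"
      using s g qs(2)[of "up_ring.monom P s 0" "up_ring.monom P \<one> 1"] qs(3)[OF g P.one_closed]
      by (simp add: c_def x_def del: One_nat_def)
    moreover have "q g = \<zero>\<^bsub>Q\<^esub>" using q0[OF g] P.cgenideal_self[OF g] J_def by simp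
    ultimately show ?thesis using qs by simp
  qed
  have px: "q (up_ring.monom P \<one> k) = x [^]\<^bsub>Q\<^esub> k" for k
  proof (induction k)
    case 0 then show ?case using qs by simp
  next
    case (Suc k) then show ?case unfolding monom_one_Suc[of k] by (simp add: qs x_def del: One_nat_def)
  qed
  have px': "q (up_ring.monom P a k) = c a \<otimes>\<^bsub>Q\<^esub> x [^]\<^bsub>Q\<^esub> k" if "a \<in> carrier R" for a k
    using monom_mult[of a \<one> 0 k] that by (simp add: qs px[symmetric] c_def)
  have ssx: "c (s [^] k) \<otimes>\<^bsub>Q\<^esub> x [^]\<^bsub>Q\<^esub> k = \<one>\<^bsub>Q\<^esub>" for k :: nat
  proof (induction k)
    case 0 then show ?case using cs by simp
  next
    case (Suc k)
    have "c (s [^] Suc k) \<otimes>\<^bsub>Q\<^esub> x [^]\<^bsub>Q\<^esub> Suc k = (c (s [^] k) \<otimes>\<^bsub>Q\<^esub> c s) \<otimes>\<^bsub>Q\<^esub> (x [^]\<^bsub>Q\<^esub> k \<otimes>\<^bsub>Q\<^esub> x)"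
      using s cs by simp
    also have "\<dots> = (c (s [^] k) \<otimes>\<^bsub>Q\<^esub> x [^]\<^bsub>Q\<^esub> k) \<otimes>\<^bsub>Q\<^esub> (c s \<otimes>\<^bsub>Q\<^esub> x)"
      using s cs x by (simp add: Q.m_ac)
    also have "\<dots> = \<one>\<^bsub>Q\<^esub>" using Suc sx by simp
    finally show ?case .
  qed
  \<comment> \<open>The fractions a / s^k. They are closed under addition and contain the class of
    each monomial, hence fill \<open>Q\<close>.\<close>
  define H where "H = {q. \<exists>a\<in>carrier R. \<exists>k::nat. q = c a \<otimes>\<^bsub>Q\<^esub> x [^]\<^bsub>Q\<^esub> k}"
  have Hadd: "u \<oplus>\<^bsub>Q\<^esub> v \<in> H" if uv: "u \<in> H" "v \<in> H" for u v
  proof -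
    obtain a k b l where a: "a \<in> carrier R" "b \<in> carrier R" "u = c a \<otimes>\<^bsub>Q\<^esub> x [^]\<^bsub>Q\<^esub> (k::nat)" "v = c b \<otimes>\<^bsub>Q\<^esub> x [^]\<^bsub>Q\<^esub> (l::nat)"
      using uv unfolding H_def by blast
    have e: "c d \<otimes>\<^bsub>Q\<^esub> x [^]\<^bsub>Q\<^esub> j = c (d \<otimes> s [^] i) \<otimes>\<^bsub>Q\<^esub> x [^]\<^bsub>Q\<^esub> (j + i)" if d: "d \<in> carrier R" for d and i j :: nat
    proof -
      have "c (d \<otimes> s [^] i) \<otimes>\<^bsub>Q\<^esub> x [^]\<^bsub>Q\<^esub> (j + i) = (c d \<otimes>\<^bsub>Q\<^esub> c (s [^] i)) \<otimes>\<^bsub>Q\<^esub> (x [^]\<^bsub>Q\<^esub> j \<otimes>\<^bsub>Q\<^esub> x [^]\<^bsub>Q\<^esub> i)"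
        using d s x cs by (simp add: Q.nat_pow_mult)
      also have "\<dots> = (c d \<otimes>\<^bsub>Q\<^esub> x [^]\<^bsub>Q\<^esub> j) \<otimes>\<^bsub>Q\<^esub> (c (s [^] i) \<otimes>\<^bsub>Q\<^esub> x [^]\<^bsub>Q\<^esub> i)"
        using d s x cs by (simp add: Q.m_ac)
      also have "\<dots> = c d \<otimes>\<^bsub>Q\<^esub> x [^]\<^bsub>Q\<^esub> j" using ssx d s x cs by simp
      finally show ?thesis by simp
    qed
    have "u \<oplus>\<^bsub>Q\<^esub> v = c (a \<otimes> s [^] l \<oplus> b \<otimes> s [^] k) \<otimes>\<^bsub>Q\<^esub> x [^]\<^bsub>Q\<^esub> (k + l)"
      using a e[of a k l] e[of b l k] s x cs by (simp add: Q.l_distr add.commute)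
    thus ?thesis unfolding H_def using a s by blast
  qed
  have sum: "q (\<Oplus>\<^bsub>P\<^esub> i \<in> I. up_ring.monom P (f i) i) \<in> H"
    if "finite I" "f \<in> UNIV \<rightarrow> carrier R" for I f
    using that
  proof (induction I)
    case empty
    have "q \<zero>\<^bsub>P\<^esub> = c \<zero> \<otimes>\<^bsub>Q\<^esub> x [^]\<^bsub>Q\<^esub> (0::nat)" using px'[of \<zero> 0] by simp
    hence "q \<zero>\<^bsub>P\<^esub> \<in> H" unfolding H_def using R.zero_closed by blast
    then show ?case by (simp only: P.finsum_empty)
  next
    case (insert i I)
    have "(\<Oplus>\<^bsub>P\<^esub> i \<in> insert i I. up_ring.monom P (f i) i) = up_ring.monom P (f i) i \<oplus>\<^bsub>P\<^esub> (\<Oplus>\<^bsub>P\<^esub> i \<in> I. up_ring.monom P (f i) i)"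
      using insert by (subst P.finsum_insert) (auto simp: Pi_iff)
    moreover have "q (up_ring.monom P (f i) i) \<in> H" unfolding H_def using px'[of "f i" i] insert by auto
    ultimately show ?case using insert Hadd qs by (simp add: Pi_iff)
  qed
  have inH: "p \<in> H" if p: "p \<in> carrier Q" for p
  proof -
    obtain r where r: "r \<in> carrier P" "p = q r" using p unfolding Q_def FactRing_def q_def A_RCOSETS_def' by auto
    have "q (\<Oplus>\<^bsub>P\<^esub> i \<in> {..deg R r}. up_ring.monom P (up_ring.coeff P r i) i) \<in> H"
      by (rule sum) (use r(1) in auto)
    thus ?thesis unfolding up_repr[OF r(1)] r(2) .
  qed
  have ker: "\<exists>k::nat. s [^] k \<otimes> a = \<zero>" if a: "a \<in> carrier R" "c a = \<zero>\<^bsub>Q\<^esub>" for a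
  proof -
    have "up_ring.monom P a 0 \<in> J" using a q0 by (simp add: c_def)
    then obtain p where p: "p \<in> carrier P" "up_ring.monom P a 0 = p \<otimes>\<^bsub>P\<^esub> g"
      unfolding J_def cgenideal_def by auto
    have c0: "up_ring.coeff P p 0 = \<ominus> a"
    proof -
      have "a = \<ominus> up_ring.coeff P p 0"
        using arg_cong[OF p(2), of "\<lambda>r. up_ring.coeff P r 0"] monom_mult_coeff(1)[OF p(1) s, folded g_def] a(1)
        by (simp del: coeff_mult)
      thus ?thesis using p(1) by simp
    qed
    have cS: "up_ring.coeff P p (Suc k) = s \<otimes> up_ring.coeff P p k" for k
    proof -
      have "\<zero> = up_ring.coeff P p k \<otimes> s \<ominus> up_ring.coeff P p (Suc k)"
        using arg_cong[OF p(2), of "\<lambda>r. up_ring.coeff P r (Suc k)"]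
          monom_mult_coeff(2)[OF p(1) s, of k, folded g_def] a(1)
        by (simp del: coeff_mult)
      hence "up_ring.coeff P p k \<otimes> s = up_ring.coeff P p (Suc k)" using p(1) s R.r_right_minus_eq[of "up_ring.coeff P p k \<otimes> s" "up_ring.coeff P p (Suc k)"] by simp
      thus ?thesis using p(1) s by (simp only: R.m_comm coeff_closed)
    qed
    have "up_ring.coeff P p k = \<ominus> (s [^] k \<otimes> a)" for k
    proof (induction k)
      case 0 then show ?case using a c0 by simp
    next
      case (Suc k)
      have "s [^] Suc k \<otimes> a = s \<otimes> (s [^] k \<otimes> a)"
        unfolding R.nat_pow_Suc2[OF s, of k] using a s by (simp only: R.m_assoc R.nat_pow_closed)
      then show ?case unfolding cS[of k] Suc.IH using a s by (simp only: R.r_minus R.m_closed R.nat_pow_closed)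
    qed
    \<comment> \<open>The first exponent that is certainly beyond the degree of
      \<open>p\<close>.\<close>
    from this[of "Suc (deg R p)"] have "\<ominus> (s [^] (Suc (deg R p)) \<otimes> a) = \<zero>"
      using deg_aboveD[OF _ p(1), of "Suc (deg R p)"] by simp
    hence "s [^] (Suc (deg R p)) \<otimes> a = \<zero>" 
      using a s R.minus_minus[of "s [^] (Suc (deg R p)) \<otimes> a"] by simp
    thus ?thesis by blast
  qed
  show ?thesis using that[OF Q ch x sx _ ker] inH unfolding H_def by blast
qed

lemma is_localization_zero:
  assumes "is_calg A" "s \<in> carrier A" "\<one>\<^bsub>A\<^esub> = \<zero>\<^bsub>A\<^esub>"
  shows "is_localization A s A (id_hom A)"
proof -
  interpret cring A using is_calgD(2)[OF assms(1)] .
  have c: "carrier A = {\<zero>\<^bsub>A\<^esub>}" using one_zeroD assms(3) by simp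
  have eq: "x = y" if "x \<in> carrier A" "y \<in> carrier A" for x y using that c by simp
  have idc: "id_hom A x \<in> carrier A" if "x \<in> carrier A" for x using that by (simp add: id_hom_def)
  have "id_hom A s = \<one>\<^bsub>A\<^esub>" by (rule eq) (use idc assms(2) in auto)
  hence u: "id_hom A s \<in> Units A" using Units_one_closed by simp
  show ?thesis unfolding is_localization_def
  proof (intro conjI ballI impI)
    fix b assume b: "b \<in> carrier A"
    have "b \<otimes>\<^bsub>A\<^esub> id_hom A s [^]\<^bsub>A\<^esub> (0::nat) = id_hom A b" by (rule eq) (use idc b in auto)
    thus "\<exists>a\<in>carrier A. \<exists>k::nat. b \<otimes>\<^bsub>A\<^esub> id_hom A s [^]\<^bsub>A\<^esub> k = id_hom A a" using b by blast
    have "s [^]\<^bsub>A\<^esub> (0::nat) \<otimes>\<^bsub>A\<^esub> b = \<zero>\<^bsub>A\<^esub>" by (rule eq) (use b in auto)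
    thus "\<exists>k::nat. s [^]\<^bsub>A\<^esub> k \<otimes>\<^bsub>A\<^esub> b = \<zero>\<^bsub>A\<^esub>" by blast
  qed (use assms id_hom u in auto)
qed

text \<open>A nonzero complex number acts invertibly, so the scalars embed the complex numbers
  unless the algebra is zero. The infinite carrier absorbs the factor of natural numbers in
  \<open>localization_exists\<close>.\<close>

lemma infinite_calg:
  assumes A: "is_calg A" and "\<one>\<^bsub>A\<^esub> \<noteq> \<zero>\<^bsub>A\<^esub>"
  shows "infinite (carrier A)"
proof -
  interpret cring A using is_calgD(2)[OF A] .
  have "inj (scalar A)"
  proof (rule injI)
    fix c d assume e: "scalar A c = scalar A d"
    have "scalar A (c - d) = \<zero>\<^bsub>A\<^esub>"
      using scalar_simps(4)[OF A, of "c - d" d] e scalar_simps(1)[OF A] 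
      by (metis add.r_cancel_one' diff_add_cancel)
    hence "scalar A (inverse (c - d) * (c - d)) = \<zero>\<^bsub>A\<^esub>"
      using scalar_simps[OF A] by simp
    thus "c = d" using assms(2) scalar_simps(3)[OF A] by (cases "c = d") auto
  qed
  moreover have "infinite (UNIV :: complex set)" by (rule infinite_UNIV_char_0)
  ultimately have "infinite (range (scalar A))" using finite_imageD by blast
  moreover have "range (scalar A) \<subseteq> carrier A" using scalar_simps(1)[OF A] by auto
  ultimately show ?thesis using finite_subset by blast
qed

text \<open>The localization is a quotient of \<open>A \<times> \<nat>\<close>, hence no larger than \<open>A\<close>, so that it can be
  realized inside the universe \<open>'u\<close>.\<close>

lemma localization_exists:
  fixes A :: "'u calg"
  assumes A: "is_calg A" and s: "s \<in> carrier A"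
  obtains B \<phi> where "is_localization A s B \<phi>"
proof (cases "\<one>\<^bsub>A\<^esub> = \<zero>\<^bsub>A\<^esub>")
  \<comment> \<open>The zero algebra has a finite carrier, so counting does not apply to it; it is
    its own localization.\<close>
  case True
  then show ?thesis using is_localization_zero[OF A s] that by blast
next
  case False
  interpret A: cring A using is_calgD(2)[OF A] .
  obtain Q :: "(nat \<Rightarrow> 'u) set ring" and c x where Q: "cring Q" "c \<in> ring_hom A Q" "x \<in> carrier Q"
    "c s \<otimes>\<^bsub>Q\<^esub> x = \<one>\<^bsub>Q\<^esub>"
    and Qx: "\<And>q. q \<in> carrier Q \<Longrightarrow> \<exists>a\<in>carrier A. \<exists>k::nat. q = c a \<otimes>\<^bsub>Q\<^esub> x [^]\<^bsub>Q\<^esub> k"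
    and Qk: "\<And>a. a \<in> carrier A \<Longrightarrow> c a = \<zero>\<^bsub>Q\<^esub> \<Longrightarrow> \<exists>k::nat. s [^]\<^bsub>A\<^esub> k \<otimes>\<^bsub>A\<^esub> a = \<zero>\<^bsub>A\<^esub>"
    by (rule UP_cring.universal_localization[OF UP_cring.intro[OF A.is_cring] s]) blast
  interpret Q: cring Q by fact
  have inf: "infinite (carrier A)" by (rule infinite_calg[OF A False])
  have "(card_of (carrier A \<times> (UNIV :: nat set)), card_of (carrier A)) \<in> ordIso"
    using card_of_Times_infinite[OF inf, of "UNIV :: nat set"] inf infinite_iff_card_of_nat by auto
  then obtain j :: "'u \<times> nat \<Rightarrow> 'u" where j: "inj_on j (carrier A \<times> (UNIV :: nat set))"
    using card_of_ordLeq[of "carrier A \<times> (UNIV::nat set)" "carrier A"] ordIso_imp_ordLeq by blast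
  \<comment> \<open>A representative numerator and exponent for each element. The element is
    recovered from them, so \<open>r\<close> is injective.\<close>
  define r where "r q = (SOME p. fst p \<in> carrier A \<and> q = c (fst p) \<otimes>\<^bsub>Q\<^esub> x [^]\<^bsub>Q\<^esub> (snd p :: nat))" for q
  have r: "fst (r q) \<in> carrier A \<and> q = c (fst (r q)) \<otimes>\<^bsub>Q\<^esub> x [^]\<^bsub>Q\<^esub> (snd (r q))" if q: "q \<in> carrier Q" for q
  proof -
    obtain a and k :: nat where "a \<in> carrier A" "q = c a \<otimes>\<^bsub>Q\<^esub> x [^]\<^bsub>Q\<^esub> k" using Qx[OF q] by blast
    hence "fst (a, k) \<in> carrier A \<and> q = c (fst (a, k)) \<otimes>\<^bsub>Q\<^esub> x [^]\<^bsub>Q\<^esub> (snd (a, k))" by simp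
    thus ?thesis unfolding r_def by (rule someI)
  qed
  define i where "i = j \<circ> r"
  have inj: "inj_on i (carrier Q)"
    unfolding i_def
  proof (rule comp_inj_on)
    show "inj_on r (carrier Q)" using r by (metis inj_on_def)
    have "r ` carrier Q \<subseteq> carrier A \<times> UNIV"
    proof
      fix p assume "p \<in> r ` carrier Q"
      then obtain q where q: "q \<in> carrier Q" "p = r q" by blast
      have "fst p \<in> carrier A" using r[OF q(1)] unfolding q(2) by (rule conjunct1)
      thus "p \<in> carrier A \<times> UNIV" by (cases p) simp
    qed
    thus "inj_on j (r ` carrier Q)" by (rule inj_on_subset[OF j])
  qed
  define B0 where "B0 = image_ring i Q"
  have iso: "i \<in> ring_iso Q B0" unfolding B0_def by (rule inj_imp_image_ring_iso[OF inj])
  have z: "B0 \<lparr>zero := i \<zero>\<^bsub>Q\<^esub>\<rparr> = B0" by (simp add: B0_def image_ring_def image_group_def monoid.defs)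
  have B0: "cring B0" using Q.ring_iso_imp_img_cring[OF iso] z by simp
  interpret B0: cring B0 by fact
  have ih: "i \<in> ring_hom Q B0" using iso by (simp add: ring_iso_def)
  have hh: "i \<circ> c \<in> ring_hom A B0" by (rule ring_hom_trans[OF Q(2) ih])
  define B where "B = ring.extend B0 \<lparr>module.smult = (\<lambda>d y. (i \<circ> c) (scalar A d) \<otimes>\<^bsub>B0\<^esub> y)\<rparr>"
  note B = is_calg_extend[OF A B0 hh, folded B_def]
  define \<phi> where "\<phi> = restrict (i \<circ> c) (carrier A)"
  interpret B: cring B using is_calgD(2)[OF B(1)] .
  note ih' = ring_hom_closed[OF ih] ring_hom_mult[OF ih] ring_hom_one[OF ih]
  note cs = ring_hom_closed[OF Q(2)]
  have ph: "\<phi> a = i (c a)" if "a \<in> carrier A" for a unfolding \<phi>_def restrict_apply'[OF that] comp_apply ..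
  have u: "\<phi> s \<otimes>\<^bsub>B\<^esub> i x = \<one>\<^bsub>B\<^esub>"
    unfolding ph[OF s] B(6,7) ih'(2)[OF cs[OF s] Q(3), symmetric] Q(4) by (rule ih'(3))
  have pc: "\<phi> a \<in> carrier B" if "a \<in> carrier A" for a
    unfolding ph[OF that] B(3) by (rule ih'(1)[OF cs[OF that]])
  have us: "\<phi> s \<in> carrier B" "i x \<in> carrier B"
    using pc[OF s] ih'(1)[OF Q(3)] unfolding B(3) by blast+
  have pw: "\<phi> s [^]\<^bsub>B\<^esub> k \<otimes>\<^bsub>B\<^esub> i x [^]\<^bsub>B\<^esub> k = \<one>\<^bsub>B\<^esub>" for k :: nat
    unfolding B.nat_pow_distrib[OF us, symmetric] u by (rule B.nat_pow_one)
  have iB: "i \<in> ring_hom Q B"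
    by (rule ring_hom_memI) (simp_all only: B(3,6,7,8) ring_hom_closed[OF ih] ring_hom_mult[OF ih] ring_hom_add[OF ih] ring_hom_one[OF ih])
  have ipow: "i (x [^]\<^bsub>Q\<^esub> (k::nat)) = i x [^]\<^bsub>B\<^esub> k" for k
    by (rule ring_hom_nat_pow[OF Q.ring_axioms B.ring_axioms iB Q(3)])
  have "is_localization A s B \<phi>"
    unfolding is_localization_def
  proof (intro conjI ballI impI)
    show "is_calg B" "\<phi> \<in> calg_hom A B" using B(1,5) unfolding \<phi>_def by blast+
    have "i x \<otimes>\<^bsub>B\<^esub> \<phi> s = \<one>\<^bsub>B\<^esub>" using B.m_comm[OF us] u by (rule subst)
    thus "\<phi> s \<in> Units B" unfolding Units_def using us u
      by blast
  next
    fix b assume "b \<in> carrier B"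
    hence "b \<in> i ` carrier Q" unfolding B(3) B0_def image_ring_carrier .
    then obtain q where q: "q \<in> carrier Q" "b = i q" by blast
    obtain a and k :: nat where ak: "a \<in> carrier A" "q = c a \<otimes>\<^bsub>Q\<^esub> x [^]\<^bsub>Q\<^esub> k" using Qx[OF q(1)] by blast
    have e0: "b = \<phi> a \<otimes>\<^bsub>B\<^esub> i x [^]\<^bsub>B\<^esub> k"
      unfolding q(2) ak(2) ipow[symmetric] B(6) ih'(2)[OF cs[OF ak(1)] Q.nat_pow_closed[OF Q(3)]]
      ph[OF ak(1)] ..
    have e1: "b \<otimes>\<^bsub>B\<^esub> \<phi> s [^]\<^bsub>B\<^esub> k = \<phi> a \<otimes>\<^bsub>B\<^esub> (i x [^]\<^bsub>B\<^esub> k \<otimes>\<^bsub>B\<^esub> \<phi> s [^]\<^bsub>B\<^esub> k)"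
      unfolding e0 by (rule B.m_assoc[OF pc[OF ak(1)] B.nat_pow_closed[OF us(2)] B.nat_pow_closed[OF us(1)]])
    have e2: "i x [^]\<^bsub>B\<^esub> k \<otimes>\<^bsub>B\<^esub> \<phi> s [^]\<^bsub>B\<^esub> k = \<one>\<^bsub>B\<^esub>"
      by (rule trans[OF B.m_comm[OF B.nat_pow_closed[OF us(2)] B.nat_pow_closed[OF us(1)]] pw])
    have "b \<otimes>\<^bsub>B\<^esub> \<phi> s [^]\<^bsub>B\<^esub> k = \<phi> a" unfolding e1 e2 by (rule B.r_one[OF pc[OF ak(1)]])
    thus "\<exists>a\<in>carrier A. \<exists>k::nat. b \<otimes>\<^bsub>B\<^esub> \<phi> s [^]\<^bsub>B\<^esub> k = \<phi> a" using ak(1) by blast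
  next
    fix a assume a: "a \<in> carrier A" "\<phi> a = \<zero>\<^bsub>B\<^esub>"
    have "i (c a) = i \<zero>\<^bsub>Q\<^esub>" using a(2) unfolding ph[OF a(1)] B(4) B0_def image_ring_zero .
    hence "c a = \<zero>\<^bsub>Q\<^esub>" by (rule inj_onD[OF inj _ cs[OF a(1)] Q.zero_closed])
    thus "\<exists>k::nat. s [^]\<^bsub>A\<^esub> k \<otimes>\<^bsub>A\<^esub> a = \<zero>\<^bsub>A\<^esub>" using Qk a(1) by blast
  qed
  thus ?thesis using that by blast
qed

section \<open>The Zariski topology\<close>

lemma is_sieveD:
  assumes "is_sieve A S" "(B, \<phi>) \<in> S"
  shows "is_calg B" "\<phi> \<in> calg_hom A B"
    "is_calg C \<Longrightarrow> \<psi> \<in> calg_hom B C \<Longrightarrow> (C, compose (carrier A) \<psi> \<phi>) \<in> S"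
  using assms unfolding is_sieve_def by blast+

lemma is_sieveI:
  assumes "\<And>B \<phi>. (B, \<phi>) \<in> S \<Longrightarrow> is_calg B \<and> \<phi> \<in> calg_hom A B"
    and "\<And>B \<phi> C \<psi>. (B, \<phi>) \<in> S \<Longrightarrow> is_calg C \<Longrightarrow> \<psi> \<in> calg_hom B C \<Longrightarrow> (C, compose (carrier A) \<psi> \<phi>) \<in> S"
  shows "is_sieve A S"
  using assms unfolding is_sieve_def by blast

lemma zariski_covering_sieve: "zariski_covering A S \<Longrightarrow> is_sieve A S"
  by (simp add: zariski_covering_def)

lemma zariski_coveringI:
  assumes "is_sieve A S" "T \<subseteq> carrier A" "genideal A T = carrier A"
    and "\<And>s. s \<in> T \<Longrightarrow> \<exists>B \<phi>. (B, \<phi>) \<in> S \<and> is_localization A s B \<phi>"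
  shows "zariski_covering A S"
proof -
  have "\<forall>s\<in>T. \<exists>(B, \<phi>)\<in>S. is_localization A s B \<phi>" using assms(4) by blast
  thus ?thesis using assms(1-3) unfolding zariski_covering_def by blast
qed

lemma zariski_coveringD:
  assumes "zariski_covering A S"
  obtains T where "T \<subseteq> carrier A" "genideal A T = carrier A"
    "\<And>s. s \<in> T \<Longrightarrow> \<exists>B \<phi>. (B, \<phi>) \<in> S \<and> is_localization A s B \<phi>"
proof -
  obtain T where T: "T \<subseteq> carrier A" "genideal A T = carrier A"
    "\<forall>s\<in>T. \<exists>(B, \<phi>)\<in>S. is_localization A s B \<phi>"
    using assms unfolding zariski_covering_def by blast
  thus ?thesis using that[of T] by blast
qed

lemma is_localization_one: "is_calg A \<Longrightarrow> is_localization A \<one>\<^bsub>A\<^esub> A (id_hom A)"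
proof -
  assume A: "is_calg A"
  interpret cring A using is_calgD(2)[OF A] .
  have i: "id_hom A x = x" if "x \<in> carrier A" for x using that by (simp add: id_hom_def)
  show ?thesis unfolding is_localization_def
  proof (intro conjI ballI impI)
    fix b assume b: "b \<in> carrier A"
    have "b \<otimes>\<^bsub>A\<^esub> id_hom A \<one>\<^bsub>A\<^esub> [^]\<^bsub>A\<^esub> (0::nat) = id_hom A b" using i b by simp
    thus "\<exists>a\<in>carrier A. \<exists>k::nat. b \<otimes>\<^bsub>A\<^esub> id_hom A \<one>\<^bsub>A\<^esub> [^]\<^bsub>A\<^esub> k = id_hom A a" using b by blast
    assume "id_hom A b = \<zero>\<^bsub>A\<^esub>"
    hence "\<one>\<^bsub>A\<^esub> [^]\<^bsub>A\<^esub> (0::nat) \<otimes>\<^bsub>A\<^esub> b = \<zero>\<^bsub>A\<^esub>" using b i by simp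
    thus "\<exists>k::nat. \<one>\<^bsub>A\<^esub> [^]\<^bsub>A\<^esub> k \<otimes>\<^bsub>A\<^esub> b = \<zero>\<^bsub>A\<^esub>" by blast
  qed (use A id_hom i in auto)
qed

definition max_sieve :: "'u calg \<Rightarrow> 'u arrow set" where
  "max_sieve A = {(B, \<phi>). is_calg B \<and> \<phi> \<in> calg_hom A B}"

lemma is_sieve_max: "is_calg A \<Longrightarrow> is_sieve A (max_sieve A)"
  by (rule is_sieveI) (auto simp: max_sieve_def intro: calg_hom_compose)

lemma covering_id:
  assumes "is_calg A" "is_sieve A S" "(A, id_hom A) \<in> S"
  shows "zariski_covering A S"
proof -
  interpret cring A using is_calgD(2)[OF assms(1)] .
  show ?thesis
  proof (rule zariski_coveringI[OF assms(2)])
    show "{\<one>\<^bsub>A\<^esub>} \<subseteq> carrier A" by simp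
    show "genideal A {\<one>\<^bsub>A\<^esub>} = carrier A" by (rule genideal_one)
  qed (use assms is_localization_one in blast)
qed

lemma covering_max: "is_calg A \<Longrightarrow> zariski_covering A (max_sieve A)"
  by (rule covering_id[OF _ is_sieve_max]) (auto simp: max_sieve_def id_hom)

lemma covering_subset:
  assumes "zariski_covering A S" "is_sieve A R" "S \<subseteq> R"
  shows "zariski_covering A R"
proof -
  obtain T where "T \<subseteq> carrier A" "genideal A T = carrier A"
    "\<And>s. s \<in> T \<Longrightarrow> \<exists>B \<phi>. (B, \<phi>) \<in> S \<and> is_localization A s B \<phi>"
    using zariski_coveringD[OF assms(1)] by blast
  thus ?thesis using assms by (intro zariski_coveringI[of A R T]) blast+
qed

text \<open>In the zero ring the empty set already generates the unit ideal, so even the empty sieve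
  covers. This is how a contradiction between two ranks is absorbed in
  \<open>rank_unique\<close>.\<close>

lemma covering_zero:
  assumes "is_calg A" "\<one>\<^bsub>A\<^esub> = \<zero>\<^bsub>A\<^esub>" "is_sieve A S"
  shows "zariski_covering A S"
proof -
  interpret cring A using is_calgD(2)[OF assms(1)] .
  have c: "carrier A = {\<zero>\<^bsub>A\<^esub>}" using one_zeroD assms(2) by simp
  interpret J: ideal "genideal A {}" A by (rule genideal_ideal) simp
  have "genideal A {} = carrier A" unfolding c using J.zero_closed J.Icarr c by blast
  thus ?thesis by (intro zariski_coveringI[OF assms(3), of "{}"]) auto
qed

lemma is_sieve_pullback:
  assumes "is_sieve A S" "\<phi> \<in> calg_hom A B" "is_calg B"
  shows "is_sieve B (sieve_pullback A B \<phi> S)"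
proof (rule is_sieveI)
  fix C \<psi> assume "(C, \<psi>) \<in> sieve_pullback A B \<phi> S"
  thus "is_calg C \<and> \<psi> \<in> calg_hom B C" by (simp add: sieve_pullback_def)
next
  fix C \<psi> D \<chi> assume a: "(C, \<psi>) \<in> sieve_pullback A B \<phi> S" "is_calg D" "\<chi> \<in> calg_hom C D"
  hence b: "is_calg C" "\<psi> \<in> calg_hom B C" "(C, compose (carrier A) \<psi> \<phi>) \<in> S" by (auto simp: sieve_pullback_def)
  have "(D, compose (carrier A) \<chi> (compose (carrier A) \<psi> \<phi>)) \<in> S"
    using is_sieveD(3)[OF assms(1) b(3) a(2,3)] .
  hence "(D, compose (carrier A) (compose (carrier B) \<chi> \<psi>) \<phi>) \<in> S"
    unfolding compose_hom_assoc[OF assms(2)] .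
  thus "(D, compose (carrier B) \<chi> \<psi>) \<in> sieve_pullback A B \<phi> S"
    using calg_hom_compose[OF b(2) a(3) assms(3)] a(2) by (simp add: sieve_pullback_def)
qed

lemma (in cring) fraction_add:
  assumes "x \<in> carrier R" "y \<in> carrier R" "p \<in> carrier R" "q \<in> carrier R"
  shows "(x \<oplus> y) \<otimes> (p \<otimes> q) = (x \<otimes> p) \<otimes> q \<oplus> (y \<otimes> q) \<otimes> p"
proof -
  have "y \<otimes> (p \<otimes> q) = (y \<otimes> q) \<otimes> p" using assms by (simp only: m_ac m_closed)
  thus ?thesis using assms by (simp only: l_distr m_assoc[symmetric] m_closed)
qed

text \<open>If \<open>C\<close> inverts the image of \<open>s\<close>, every homomorphism to \<open>C\<close> factors through \<open>A[1/s]\<close>.\<close>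

lemma localization_lift:
  fixes A :: "'u calg"
  assumes A: "is_calg A" and s: "s \<in> carrier A" and L: "is_localization A s B \<phi>"
    and C: "is_calg C" and \<psi>: "\<psi> \<in> calg_hom A C" and u: "\<psi> s \<in> Units C"
  obtains \<chi> where "\<chi> \<in> calg_hom B C" "compose (carrier A) \<chi> \<phi> = \<psi>"
proof -
  interpret A: cring A using is_calgD(2)[OF A] .
  interpret C: cring C using is_calgD(2)[OF C] .
  have B: "is_calg B" and \<phi>: "\<phi> \<in> calg_hom A B" and us: "\<phi> s \<in> Units B"
    and frac: "\<And>b. b \<in> carrier B \<Longrightarrow> \<exists>a\<in>carrier A. \<exists>k::nat. b \<otimes>\<^bsub>B\<^esub> \<phi> s [^]\<^bsub>B\<^esub> k = \<phi> a"
    and ker: "\<And>a. a \<in> carrier A \<Longrightarrow> \<phi> a = \<zero>\<^bsub>B\<^esub> \<Longrightarrow> \<exists>k::nat. s [^]\<^bsub>A\<^esub> k \<otimes>\<^bsub>A\<^esub> a = \<zero>\<^bsub>A\<^esub>"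
    using L unfolding is_localization_def by auto
  interpret B: cring B using is_calgD(2)[OF B] .
  note ph = calg_homD[OF \<phi>] and ps = calg_homD[OF \<psi>]
  interpret ph: ring_hom_cring A B \<phi>
    by unfold_locales (rule ph(1))
  interpret ps: ring_hom_cring A C \<psi>
    by unfold_locales (rule ps(1))
  have pw [simp]: "\<phi> (s [^]\<^bsub>A\<^esub> k) = \<phi> s [^]\<^bsub>B\<^esub> k" "\<psi> (s [^]\<^bsub>A\<^esub> k) = \<psi> s [^]\<^bsub>C\<^esub> k" for k :: nat
    using ring_hom_nat_pow[OF A.ring_axioms B.ring_axioms ph(1) s] ring_hom_nat_pow[OF A.ring_axioms C.ring_axioms ps(1) s] .
  note sA [simp] = s ph.hom_closed[OF s] ps.hom_closed[OF s]
  have upB: "\<phi> s [^]\<^bsub>B\<^esub> k \<in> Units B" for k :: nat using us by (induction k) auto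
  have upC: "\<psi> s [^]\<^bsub>C\<^esub> k \<in> Units C" for k :: nat using u by (induction k) auto
  have canB: "b = b'" if "b \<otimes>\<^bsub>B\<^esub> w = b' \<otimes>\<^bsub>B\<^esub> w" "w \<in> Units B" "b \<in> carrier B" "b' \<in> carrier B" for b b' w
    using that by (simp add: B.m_comm[of _ w] B.Units_closed)
  have canC: "b = b'" if "b \<otimes>\<^bsub>C\<^esub> w = b' \<otimes>\<^bsub>C\<^esub> w" "w \<in> Units C" "b \<in> carrier C" "b' \<in> carrier C" for b b' w
    using that by (simp add: C.m_comm[of _ w] C.Units_closed)
  \<comment> \<open>The difference is killed by a power of \<open>s\<close>, and this power becomes
    a unit in \<open>C\<close>.\<close>
  have eqA: "\<psi> a = \<psi> a'" if "\<phi> a = \<phi> a'" "a \<in> carrier A" "a' \<in> carrier A" for a a'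
  proof -
    have "\<phi> (a \<ominus>\<^bsub>A\<^esub> a') = \<zero>\<^bsub>B\<^esub>" using that by (simp add: A.minus_eq B.r_neg)
    from ker[OF A.minus_closed[OF that(2,3)] this]
    obtain k :: nat where "s [^]\<^bsub>A\<^esub> k \<otimes>\<^bsub>A\<^esub> (a \<ominus>\<^bsub>A\<^esub> a') = \<zero>\<^bsub>A\<^esub>" ..
    hence "\<psi> (s [^]\<^bsub>A\<^esub> k \<otimes>\<^bsub>A\<^esub> (a \<ominus>\<^bsub>A\<^esub> a')) = \<zero>\<^bsub>C\<^esub>" by simp
    hence "\<psi> s [^]\<^bsub>C\<^esub> k \<otimes>\<^bsub>C\<^esub> (\<psi> a \<ominus>\<^bsub>C\<^esub> \<psi> a') = \<zero>\<^bsub>C\<^esub>" using that s by (simp add: A.minus_eq C.minus_eq)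
    hence "\<psi> a \<ominus>\<^bsub>C\<^esub> \<psi> a' = \<zero>\<^bsub>C\<^esub>" using upC[of k] that
      by (metis C.Units_l_cancel C.Units_closed C.minus_closed C.r_null C.zero_closed ps.hom_closed)
    thus ?thesis using that by simp
  qed
  \<comment> \<open>The graph of the wanted homomorphism. Existence of a value is clearing of
    denominators; uniqueness is \<open>eqA\<close> after two fractions are brought to a common
    denominator.\<close>
  define P where "P b c \<longleftrightarrow> c \<in> carrier C \<and> (\<exists>a\<in>carrier A. \<exists>k::nat. b \<otimes>\<^bsub>B\<^esub> \<phi> s [^]\<^bsub>B\<^esub> k = \<phi> a \<and> c \<otimes>\<^bsub>C\<^esub> \<psi> s [^]\<^bsub>C\<^esub> k = \<psi> a)" for b c
  have Pex: "\<exists>c. P b c" if b: "b \<in> carrier B" for b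
  proof -
    obtain a and k :: nat where ak: "a \<in> carrier A" "b \<otimes>\<^bsub>B\<^esub> \<phi> s [^]\<^bsub>B\<^esub> k = \<phi> a" using frac[OF b] by blast
    have "\<psi> a \<otimes>\<^bsub>C\<^esub> inv\<^bsub>C\<^esub> (\<psi> s [^]\<^bsub>C\<^esub> k) \<otimes>\<^bsub>C\<^esub> \<psi> s [^]\<^bsub>C\<^esub> k = \<psi> a"
      using upC[of k] ak(1) by (simp add: C.m_assoc C.Units_closed C.Units_l_inv)
    thus ?thesis unfolding P_def using ak upC[of k] ps.hom_closed[OF ak(1)] by (intro exI conjI bexI) auto
  qed
  have Puniq: "c = c'" if P: "P b c" "P b c'" and b: "b \<in> carrier B" for b c c'
  proof -
    obtain a and k :: nat where ak: "a \<in> carrier A" "b \<otimes>\<^bsub>B\<^esub> \<phi> s [^]\<^bsub>B\<^esub> k = \<phi> a" "c \<otimes>\<^bsub>C\<^esub> \<psi> s [^]\<^bsub>C\<^esub> k = \<psi> a" "c \<in> carrier C"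
      using P(1) unfolding P_def by blast
    obtain a' and l :: nat where al: "a' \<in> carrier A" "b \<otimes>\<^bsub>B\<^esub> \<phi> s [^]\<^bsub>B\<^esub> l = \<phi> a'" "c' \<otimes>\<^bsub>C\<^esub> \<psi> s [^]\<^bsub>C\<^esub> l = \<psi> a'" "c' \<in> carrier C"
      using P(2) unfolding P_def by blast
    have sB: "\<phi> s [^]\<^bsub>B\<^esub> i \<in> carrier B" "\<psi> s [^]\<^bsub>C\<^esub> i \<in> carrier C" for i :: nat using s by simp_all
    have "\<phi> (a \<otimes>\<^bsub>A\<^esub> s [^]\<^bsub>A\<^esub> l) = (b \<otimes>\<^bsub>B\<^esub> \<phi> s [^]\<^bsub>B\<^esub> k) \<otimes>\<^bsub>B\<^esub> \<phi> s [^]\<^bsub>B\<^esub> l" using ak s by simp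
    also have "\<dots> = (b \<otimes>\<^bsub>B\<^esub> \<phi> s [^]\<^bsub>B\<^esub> l) \<otimes>\<^bsub>B\<^esub> \<phi> s [^]\<^bsub>B\<^esub> k"
      by (simp only: B.m_ac b sB B.m_closed)
    also have "\<dots> = \<phi> (a' \<otimes>\<^bsub>A\<^esub> s [^]\<^bsub>A\<^esub> k)" using al s by simp
    finally have "\<psi> (a \<otimes>\<^bsub>A\<^esub> s [^]\<^bsub>A\<^esub> l) = \<psi> (a' \<otimes>\<^bsub>A\<^esub> s [^]\<^bsub>A\<^esub> k)" by (rule eqA) (use ak al s in auto)
    hence "(c \<otimes>\<^bsub>C\<^esub> \<psi> s [^]\<^bsub>C\<^esub> k) \<otimes>\<^bsub>C\<^esub> \<psi> s [^]\<^bsub>C\<^esub> l = (c' \<otimes>\<^bsub>C\<^esub> \<psi> s [^]\<^bsub>C\<^esub> l) \<otimes>\<^bsub>C\<^esub> \<psi> s [^]\<^bsub>C\<^esub> k"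
      using ak al s by simp
    hence "c \<otimes>\<^bsub>C\<^esub> (\<psi> s [^]\<^bsub>C\<^esub> k \<otimes>\<^bsub>C\<^esub> \<psi> s [^]\<^bsub>C\<^esub> l) = c' \<otimes>\<^bsub>C\<^esub> (\<psi> s [^]\<^bsub>C\<^esub> k \<otimes>\<^bsub>C\<^esub> \<psi> s [^]\<^bsub>C\<^esub> l)"
      by (simp only: C.m_ac sB ak(4) al(4) C.m_closed)
    thus ?thesis by (rule canC) (use upC ak al in auto)
  qed
  define \<chi> where "\<chi> = (\<lambda>b\<in>carrier B. THE c. P b c)"
  have \<chi>P: "P b (\<chi> b)" if "b \<in> carrier B" for b
    unfolding \<chi>_def using Pex[OF that] Puniq that by (simp, metis theI)
  have \<chi>I: "\<chi> b = c" if "P b c" "b \<in> carrier B" for b c using Puniq[OF \<chi>P[OF that(2)] that] .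
  have \<chi>\<phi>: "\<chi> (\<phi> a) = \<psi> a" if a: "a \<in> carrier A" for a
    by (rule \<chi>I) (use a in \<open>auto simp: P_def intro!: bexI[of _ a] exI[of _ "0::nat"]\<close>)
  have \<chi>c: "\<chi> b \<in> carrier C" if "b \<in> carrier B" for b using \<chi>P[OF that] by (simp add: P_def)
  have op: "\<chi> (b \<otimes>\<^bsub>B\<^esub> b') = \<chi> b \<otimes>\<^bsub>C\<^esub> \<chi> b'" "\<chi> (b \<oplus>\<^bsub>B\<^esub> b') = \<chi> b \<oplus>\<^bsub>C\<^esub> \<chi> b'"
    if b: "b \<in> carrier B" "b' \<in> carrier B" for b b'
  proof -
    obtain a and k :: nat where ak: "a \<in> carrier A" "b \<otimes>\<^bsub>B\<^esub> \<phi> s [^]\<^bsub>B\<^esub> k = \<phi> a" "\<chi> b \<otimes>\<^bsub>C\<^esub> \<psi> s [^]\<^bsub>C\<^esub> k = \<psi> a"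
      using \<chi>P[OF b(1)] unfolding P_def by blast
    obtain a' and l :: nat where al: "a' \<in> carrier A" "b' \<otimes>\<^bsub>B\<^esub> \<phi> s [^]\<^bsub>B\<^esub> l = \<phi> a'" "\<chi> b' \<otimes>\<^bsub>C\<^esub> \<psi> s [^]\<^bsub>C\<^esub> l = \<psi> a'"
      using \<chi>P[OF b(2)] unfolding P_def by blast
    have sB: "\<phi> s [^]\<^bsub>B\<^esub> i \<in> carrier B" "\<psi> s [^]\<^bsub>C\<^esub> i \<in> carrier C" for i :: nat using s by simp_all
    note c = \<chi>c[OF b(1)] \<chi>c[OF b(2)]
    have pwB: "\<phi> s [^]\<^bsub>B\<^esub> (k + l) = \<phi> s [^]\<^bsub>B\<^esub> k \<otimes>\<^bsub>B\<^esub> \<phi> s [^]\<^bsub>B\<^esub> l" and pwC: "\<psi> s [^]\<^bsub>C\<^esub> (k + l) = \<psi> s [^]\<^bsub>C\<^esub> k \<otimes>\<^bsub>C\<^esub> \<psi> s [^]\<^bsub>C\<^esub> l"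
      using s by (simp_all add: B.nat_pow_mult C.nat_pow_mult)
    have "(b \<otimes>\<^bsub>B\<^esub> b') \<otimes>\<^bsub>B\<^esub> \<phi> s [^]\<^bsub>B\<^esub> (k + l) = (b \<otimes>\<^bsub>B\<^esub> \<phi> s [^]\<^bsub>B\<^esub> k) \<otimes>\<^bsub>B\<^esub> (b' \<otimes>\<^bsub>B\<^esub> \<phi> s [^]\<^bsub>B\<^esub> l)"
      unfolding pwB by (simp only: B.m_ac b sB B.m_closed)
    moreover have "(\<chi> b \<otimes>\<^bsub>C\<^esub> \<chi> b') \<otimes>\<^bsub>C\<^esub> \<psi> s [^]\<^bsub>C\<^esub> (k + l) = (\<chi> b \<otimes>\<^bsub>C\<^esub> \<psi> s [^]\<^bsub>C\<^esub> k) \<otimes>\<^bsub>C\<^esub> (\<chi> b' \<otimes>\<^bsub>C\<^esub> \<psi> s [^]\<^bsub>C\<^esub> l)"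
      unfolding pwC by (simp only: C.m_ac c sB C.m_closed)
    ultimately have "P (b \<otimes>\<^bsub>B\<^esub> b') (\<chi> b \<otimes>\<^bsub>C\<^esub> \<chi> b')"
      unfolding P_def using ak al c by (intro conjI bexI[of _ "a \<otimes>\<^bsub>A\<^esub> a'"] exI[of _ "k + l"]) simp_all
    thus "\<chi> (b \<otimes>\<^bsub>B\<^esub> b') = \<chi> b \<otimes>\<^bsub>C\<^esub> \<chi> b'" using \<chi>I b by simp
    have "(b \<oplus>\<^bsub>B\<^esub> b') \<otimes>\<^bsub>B\<^esub> \<phi> s [^]\<^bsub>B\<^esub> (k + l) = (b \<otimes>\<^bsub>B\<^esub> \<phi> s [^]\<^bsub>B\<^esub> k) \<otimes>\<^bsub>B\<^esub> \<phi> s [^]\<^bsub>B\<^esub> l \<oplus>\<^bsub>B\<^esub> (b' \<otimes>\<^bsub>B\<^esub> \<phi> s [^]\<^bsub>B\<^esub> l) \<otimes>\<^bsub>B\<^esub> \<phi> s [^]\<^bsub>B\<^esub> k"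
      unfolding pwB by (rule B.fraction_add[OF b sB(1) sB(1)])
    moreover have "(\<chi> b \<oplus>\<^bsub>C\<^esub> \<chi> b') \<otimes>\<^bsub>C\<^esub> \<psi> s [^]\<^bsub>C\<^esub> (k + l) = (\<chi> b \<otimes>\<^bsub>C\<^esub> \<psi> s [^]\<^bsub>C\<^esub> k) \<otimes>\<^bsub>C\<^esub> \<psi> s [^]\<^bsub>C\<^esub> l \<oplus>\<^bsub>C\<^esub> (\<chi> b' \<otimes>\<^bsub>C\<^esub> \<psi> s [^]\<^bsub>C\<^esub> l) \<otimes>\<^bsub>C\<^esub> \<psi> s [^]\<^bsub>C\<^esub> k"
      unfolding pwC by (rule C.fraction_add[OF c sB(2) sB(2)])
    ultimately have "P (b \<oplus>\<^bsub>B\<^esub> b') (\<chi> b \<oplus>\<^bsub>C\<^esub> \<chi> b')"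
      unfolding P_def using ak al c s
      by (intro conjI bexI[of _ "a \<otimes>\<^bsub>A\<^esub> s [^]\<^bsub>A\<^esub> l \<oplus>\<^bsub>A\<^esub> a' \<otimes>\<^bsub>A\<^esub> s [^]\<^bsub>A\<^esub> k"] exI[of _ "k + l"]) simp_all
    thus "\<chi> (b \<oplus>\<^bsub>B\<^esub> b') = \<chi> b \<oplus>\<^bsub>C\<^esub> \<chi> b'" using \<chi>I b by simp
  qed
  have "\<chi> \<in> calg_hom B C"
  proof (rule calg_homI[OF B C])
    show "\<chi> \<in> extensional (carrier B)" by (simp add: \<chi>_def)
    show "\<chi> \<in> ring_hom B C"
      using op \<chi>c \<chi>\<phi>[of "\<one>\<^bsub>A\<^esub>"] by (intro ring_hom_memI) auto
    show "\<chi> (scalar B c) = scalar C c" for c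
      using \<chi>\<phi>[OF scalar_simps(1)[OF A], of c] calg_hom_scalar[OF A \<phi>] calg_hom_scalar[OF A \<psi>] by simp
  qed
  moreover have "compose (carrier A) \<chi> \<phi> = \<psi>"
    using \<chi>\<phi> ps(2) by (auto simp: compose_def fun_eq_iff extensional_def)
  ultimately show ?thesis using that by blast
qed

text \<open>The preimage of the ideal generated by the image contains \<open>T\<close>, hence
  1.\<close>

lemma genideal_image:
  assumes A: "is_calg A" and B: "is_calg B" and \<phi>: "\<phi> \<in> calg_hom A B"
    and T: "T \<subseteq> carrier A" "genideal A T = carrier A"
  shows "\<phi> ` T \<subseteq> carrier B" "genideal B (\<phi> ` T) = carrier B"
proof -
  interpret A: cring A using is_calgD(2)[OF A] .
  interpret B: cring B using is_calgD(2)[OF B] .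
  interpret ph: ring_hom_ring A B \<phi>
    by (rule ring_hom_ringI2) (use calg_homD(1)[OF \<phi>] A.ring_axioms B.ring_axioms in auto)
  show sub: "\<phi> ` T \<subseteq> carrier B" using T ph.hom_closed by auto
  have id: "ideal (genideal B (\<phi> ` T)) B" by (rule B.genideal_ideal[OF sub])
  have "ideal {r \<in> carrier A. \<phi> r \<in> genideal B (\<phi> ` T)} A" by (rule ph.ideal_vimage[OF id])
  moreover have "T \<subseteq> {r \<in> carrier A. \<phi> r \<in> genideal B (\<phi> ` T)}" using T B.genideal_self[OF sub] by auto
  ultimately have "genideal A T \<subseteq> {r \<in> carrier A. \<phi> r \<in> genideal B (\<phi> ` T)}" by (rule A.genideal_minimal)
  hence "\<phi> \<one>\<^bsub>A\<^esub> \<in> genideal B (\<phi> ` T)" using T A.one_closed by blast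
  thus "genideal B (\<phi> ` T) = carrier B" using ideal.one_imp_carrier[OF id] by simp
qed


section \<open>Coverings in terms of inverted elements\<close>

text \<open>The sieve generated by a localization at \<open>s\<close>, described without choosing
  one.\<close>

definition inverting :: "'u calg \<Rightarrow> 'u \<Rightarrow> 'u arrow set" where
  "inverting A s = {(C, \<psi>). is_calg C \<and> \<psi> \<in> calg_hom A C \<and> \<psi> s \<in> Units C}"

text \<open>One direction is the universal property of A[1/s], the other its existence in the
  universe. In this form coverings are easily pulled back: a composite inverts \<open>s\<close> as
  soon as its second factor inverts the image of \<open>s\<close>.\<close>

lemma covering_inverting:
  assumes A: "is_calg A"
  shows "zariski_covering A S \<longleftrightarrow> is_sieve A S \<and>
    (\<exists>T\<subseteq>carrier A. genideal A T = carrier A \<and> (\<forall>s\<in>T. inverting A s \<subseteq> S))"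
proof
  assume S: "zariski_covering A S"
  obtain T where T: "T \<subseteq> carrier A" "genideal A T = carrier A"
    "\<And>s. s \<in> T \<Longrightarrow> \<exists>B \<phi>. (B, \<phi>) \<in> S \<and> is_localization A s B \<phi>"
    using zariski_coveringD[OF S] by blast
  have "(C, \<psi>) \<in> S" if s: "s \<in> T" and C: "(C, \<psi>) \<in> inverting A s" for s C \<psi>
  proof -
    obtain B \<phi> where B: "(B, \<phi>) \<in> S" "is_localization A s B \<phi>" using T(3)[OF s] by blast
    have C': "is_calg C" "\<psi> \<in> calg_hom A C" "\<psi> s \<in> Units C" using C by (auto simp: inverting_def)
    have sA: "s \<in> carrier A" using s T by blast
    obtain \<chi> where "\<chi> \<in> calg_hom B C" "compose (carrier A) \<chi> \<phi> = \<psi>"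
      using localization_lift[OF A sA B(2) C'] by blast
    thus ?thesis using is_sieveD(3)[OF zariski_covering_sieve[OF S] B(1) C'(1)] by blast
  qed
  thus "is_sieve A S \<and> (\<exists>T\<subseteq>carrier A. genideal A T = carrier A \<and> (\<forall>s\<in>T. inverting A s \<subseteq> S))"
    using zariski_covering_sieve[OF S] T(1,2) by (intro conjI exI[of _ T]) auto
next
  assume "is_sieve A S \<and> (\<exists>T\<subseteq>carrier A. genideal A T = carrier A \<and> (\<forall>s\<in>T. inverting A s \<subseteq> S))"
  then obtain T where T: "is_sieve A S" "T \<subseteq> carrier A" "genideal A T = carrier A" "\<forall>s\<in>T. inverting A s \<subseteq> S" by blast
  show "zariski_covering A S"
  proof (rule zariski_coveringI[OF T(1-3)])
    fix s assume s: "s \<in> T"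
    hence "s \<in> carrier A" using T by blast
    then obtain B \<phi> where B: "is_localization A s B \<phi>" using localization_exists[OF A] by blast
    hence "(B, \<phi>) \<in> inverting A s" by (auto simp: inverting_def is_localization_def)
    thus "\<exists>B \<phi>. (B, \<phi>) \<in> S \<and> is_localization A s B \<phi>" using B T(4) s by blast
  qed
qed

lemma covering_pullback:
  assumes A: "is_calg A" and S: "zariski_covering A S" and \<phi>: "\<phi> \<in> calg_hom A B" and B: "is_calg B"
  shows "zariski_covering B (sieve_pullback A B \<phi> S)"
proof -
  obtain T where T: "T \<subseteq> carrier A" "genideal A T = carrier A" "\<And>s. s \<in> T \<Longrightarrow> inverting A s \<subseteq> S"
    using S covering_inverting[OF A] by metis
  have "(C, \<psi>) \<in> sieve_pullback A B \<phi> S" if s: "s \<in> T" and C: "(C, \<psi>) \<in> inverting B (\<phi> s)" for s C \<psi>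
  proof -
    have C': "is_calg C" "\<psi> \<in> calg_hom B C" "\<psi> (\<phi> s) \<in> Units C" using C by (auto simp: inverting_def)
    have "(C, compose (carrier A) \<psi> \<phi>) \<in> inverting A s"
      using C' calg_hom_compose[OF \<phi> C'(2) A] T(1) s by (auto simp: inverting_def compose_def)
    thus ?thesis using T(3)[OF s] C' by (auto simp: sieve_pullback_def)
  qed
  thus ?thesis
    using genideal_image[OF A B \<phi> T(1,2)] is_sieve_pullback[OF zariski_covering_sieve[OF S] \<phi> B]
    unfolding covering_inverting[OF B] by (intro conjI exI[of _ "\<phi> ` T"]) auto
qed

text \<open>A substitute for the binomial theorem: one factor of the power is expanded and the
  resulting \<open>a\<close> or \<open>b\<close> is absorbed into \<open>x\<close>, which is why
  \<open>x\<close> takes part in the induction.\<close>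

lemma (in cring) radical_add:
  assumes J: "ideal J R" and ab: "a \<in> carrier R" "b \<in> carrier R"
  shows "x \<in> carrier R \<Longrightarrow> x \<otimes> a [^] (m::nat) \<in> J \<Longrightarrow> x \<otimes> b [^] (n::nat) \<in> J \<Longrightarrow> x \<otimes> (a \<oplus> b) [^] (m + n) \<in> J"
proof (induction "m + n" arbitrary: m n x)
  case 0
  then show ?case by simp
next
  case (Suc k)
  have ab': "a \<oplus> b \<in> carrier R" using ab by simp
  interpret ideal J R by fact
  show ?case
  proof (cases "m = 0 \<or> n = 0")
    case True
    hence "x \<in> J" using Suc by auto
    thus ?thesis using I_r_closed ab by simp
  next
    case False
    then obtain m' n' where mn: "m = Suc m'" "n = Suc n'" using not0_implies_Suc by blast
    have ax: "x \<otimes> a \<otimes> a [^] m' = x \<otimes> a [^] m" "x \<otimes> b \<otimes> b [^] n' = x \<otimes> b [^] n"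
      "x \<otimes> a \<otimes> b [^] n = x \<otimes> b [^] n \<otimes> a" "x \<otimes> b \<otimes> a [^] m = x \<otimes> a [^] m \<otimes> b"
      using Suc.prems(1) ab by (simp_all only: mn nat_pow_Suc m_ac m_closed nat_pow_closed)
    have "x \<otimes> a \<otimes> (a \<oplus> b) [^] (m' + n) \<in> J"
      by (rule Suc.hyps(1)) (use Suc.hyps(2) mn Suc.prems ab ax I_r_closed in auto)
    moreover have "x \<otimes> b \<otimes> (a \<oplus> b) [^] (m + n') \<in> J"
      by (rule Suc.hyps(1)) (use Suc.hyps(2) mn Suc.prems ab ax I_r_closed in auto)
    moreover have "x \<otimes> (a \<oplus> b) [^] (m + n) = x \<otimes> a \<otimes> (a \<oplus> b) [^] (m' + n) \<oplus> x \<otimes> b \<otimes> (a \<oplus> b) [^] (m + n')"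
    proof -
      have e: "m + n = Suc (m' + n)" "m + n' = m' + n" using mn by auto
      show ?thesis unfolding e nat_pow_Suc2[OF ab']
        using Suc.prems(1) ab ab' by (simp only: m_assoc[symmetric] r_distr l_distr m_closed nat_pow_closed)
    qed
    ultimately show ?thesis by simp
  qed
qed

lemma (in cring) ideal_radical:
  assumes J: "ideal J R"
  shows "ideal {r \<in> carrier R. \<exists>k::nat. r [^] k \<in> J} R"
proof -
  interpret J: ideal J R by fact
  let ?I = "{r \<in> carrier R. \<exists>k::nat. r [^] k \<in> J}"
  have mult: "a \<otimes> r \<in> ?I" if r: "r \<in> ?I" "a \<in> carrier R" for a r
  proof -
    obtain k :: nat where "r [^] k \<in> J" using r by blast
    hence "(a \<otimes> r) [^] k \<in> J" using r nat_pow_distrib[of a r k] J.I_l_closed by simp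
    thus ?thesis using r by blast
  qed
  show ?thesis
  proof (rule idealI[OF ring_axioms])
    show "subgroup ?I (add_monoid R)"
    proof (rule add.subgroupI)
      have "\<zero> [^] (1::nat) \<in> J" by simp
      thus "?I \<noteq> {}" by blast
      fix r assume r: "r \<in> ?I"
      have "\<ominus> r = (\<ominus> \<one>) \<otimes> r" using r by (simp add: l_minus)
      thus "\<ominus> r \<in> ?I" using mult[OF r, of "\<ominus> \<one>"] by simp
      fix s assume s: "s \<in> ?I"
      obtain m n :: nat where "r [^] m \<in> J" "s [^] n \<in> J" using r s by blast
      hence "\<one> \<otimes> (r \<oplus> s) [^] (m + n) \<in> J" using r s by (intro radical_add[OF J]) auto
      hence "(r \<oplus> s) [^] (m + n) \<in> J" using r s by simp
      thus "r \<oplus> s \<in> ?I" using r s by blast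
    qed auto
  next
    fix a r assume "a \<in> ?I" "r \<in> carrier R"
    thus "r \<otimes> a \<in> ?I" "a \<otimes> r \<in> ?I" using mult[of a r] m_comm[of a r] by auto
  qed
qed

text \<open>The elements whose inversion lands in \<open>R\<close> generate an ideal
  \<open>J\<close>. It contains a power of every \<open>s\<close> in \<open>T\<close>, so its
  radical, hence \<open>J\<close> itself, is everything. The power is found in A[1/s], where the
  extension of \<open>J\<close> contains the generators \<open>T'\<close> of the unit ideal.\<close>

lemma covering_trans:
  assumes A: "is_calg A" and S: "zariski_covering A S" and R: "is_sieve A R"
    and SR: "\<And>B \<phi>. (B, \<phi>) \<in> S \<Longrightarrow> zariski_covering B (sieve_pullback A B \<phi> R)"
  shows "zariski_covering A R"
proof -
  interpret A: cring A using is_calgD(2)[OF A] .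
  obtain T where T: "T \<subseteq> carrier A" "genideal A T = carrier A" "\<And>s. s \<in> T \<Longrightarrow> \<exists>B \<phi>. (B, \<phi>) \<in> S \<and> is_localization A s B \<phi>"
    using zariski_coveringD[OF S] by blast
  define U where "U = {u \<in> carrier A. inverting A u \<subseteq> R}"
  have U: "U \<subseteq> carrier A" by (auto simp: U_def)
  define J where "J = genideal A U"
  have J: "ideal J A" unfolding J_def by (rule A.genideal_ideal[OF U])
  interpret J: ideal J A by fact
  have UJ: "U \<subseteq> J" unfolding J_def by (rule A.genideal_self[OF U])
  have rad: "\<exists>k::nat. s [^]\<^bsub>A\<^esub> k \<in> J" if s: "s \<in> T" for s
  proof -
    have sA: "s \<in> carrier A" using s T by blast
    obtain B \<phi> where B: "(B, \<phi>) \<in> S" "is_localization A s B \<phi>" using T(3)[OF s] by blast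
    have B': "is_calg B" "\<phi> \<in> calg_hom A B" "\<phi> s \<in> Units B" using B(2) by (auto simp: is_localization_def)
    have frac: "\<And>b. b \<in> carrier B \<Longrightarrow> \<exists>a\<in>carrier A. \<exists>k::nat. b \<otimes>\<^bsub>B\<^esub> \<phi> s [^]\<^bsub>B\<^esub> k = \<phi> a"
      and ker: "\<And>a. a \<in> carrier A \<Longrightarrow> \<phi> a = \<zero>\<^bsub>B\<^esub> \<Longrightarrow> \<exists>k::nat. s [^]\<^bsub>A\<^esub> k \<otimes>\<^bsub>A\<^esub> a = \<zero>\<^bsub>A\<^esub>"
      using B(2) unfolding is_localization_def by auto
    interpret B: cring B using is_calgD(2)[OF B'(1)] .
    interpret ph: ring_hom_cring A B \<phi> by unfold_locales (rule calg_homD(1)[OF B'(2)])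
    have pw: "\<phi> (s [^]\<^bsub>A\<^esub> k) = \<phi> s [^]\<^bsub>B\<^esub> k" for k :: nat
      by (rule ring_hom_nat_pow[OF A.ring_axioms B.ring_axioms calg_homD(1)[OF B'(2)] sA])
    have sB: "\<phi> s [^]\<^bsub>B\<^esub> k \<in> carrier B" "\<phi> s \<in> carrier B" for k :: nat using sA by simp_all
    obtain T' where T': "T' \<subseteq> carrier B" "genideal B T' = carrier B" "\<And>t. t \<in> T' \<Longrightarrow> inverting B t \<subseteq> sieve_pullback A B \<phi> R"
      using SR[OF B(1)] covering_inverting[OF B'(1)] by metis
    \<comment> \<open>The extension of \<open>J\<close> to the localization.\<close>
    define J' where "J' = {b \<in> carrier B. \<exists>a\<in>J. \<exists>k::nat. b \<otimes>\<^bsub>B\<^esub> \<phi> s [^]\<^bsub>B\<^esub> k = \<phi> a}"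
    have mult: "c \<otimes>\<^bsub>B\<^esub> b \<in> J'" if b: "b \<in> J'" "c \<in> carrier B" for b c
    proof -
      obtain a k where ak: "a \<in> J" "b \<otimes>\<^bsub>B\<^esub> \<phi> s [^]\<^bsub>B\<^esub> (k::nat) = \<phi> a" "b \<in> carrier B" using b(1) by (auto simp: J'_def)
      obtain d l where dl: "d \<in> carrier A" "c \<otimes>\<^bsub>B\<^esub> \<phi> s [^]\<^bsub>B\<^esub> (l::nat) = \<phi> d" using frac[OF b(2)] by blast
      have "(c \<otimes>\<^bsub>B\<^esub> b) \<otimes>\<^bsub>B\<^esub> (\<phi> s [^]\<^bsub>B\<^esub> l \<otimes>\<^bsub>B\<^esub> \<phi> s [^]\<^bsub>B\<^esub> k) = (c \<otimes>\<^bsub>B\<^esub> \<phi> s [^]\<^bsub>B\<^esub> l) \<otimes>\<^bsub>B\<^esub> (b \<otimes>\<^bsub>B\<^esub> \<phi> s [^]\<^bsub>B\<^esub> k)"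
        using b(2) ak(3) sB by (simp only: B.m_ac B.m_closed)
      also have "\<dots> = \<phi> (d \<otimes>\<^bsub>A\<^esub> a)" using ak dl J.Icarr by simp
      finally have "(c \<otimes>\<^bsub>B\<^esub> b) \<otimes>\<^bsub>B\<^esub> \<phi> s [^]\<^bsub>B\<^esub> (l + k) = \<phi> (d \<otimes>\<^bsub>A\<^esub> a)" using sB by (simp add: B.nat_pow_mult)
      thus ?thesis using ak(1,3) dl(1) b(2) J.I_l_closed unfolding J'_def by blast
    qed
    have "ideal J' B"
    proof (rule idealI[OF B.ring_axioms])
      show "subgroup J' (add_monoid B)"
      proof (rule B.add.subgroupI)
        show "J' \<subseteq> carrier B" by (auto simp: J'_def)
        have "\<zero>\<^bsub>B\<^esub> \<otimes>\<^bsub>B\<^esub> \<phi> s [^]\<^bsub>B\<^esub> (0::nat) = \<phi> \<zero>\<^bsub>A\<^esub>" using sB by simp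
        hence "\<zero>\<^bsub>B\<^esub> \<in> J'" unfolding J'_def using J.zero_closed B.zero_closed by blast
        thus "J' \<noteq> {}" by blast
        fix b assume b: "b \<in> J'"
        have bB: "b \<in> carrier B" using b by (auto simp: J'_def)
        have "\<ominus>\<^bsub>B\<^esub> b = (\<ominus>\<^bsub>B\<^esub> \<one>\<^bsub>B\<^esub>) \<otimes>\<^bsub>B\<^esub> b" using bB by (simp add: B.l_minus)
        thus "\<ominus>\<^bsub>B\<^esub> b \<in> J'" using mult[OF b, of "\<ominus>\<^bsub>B\<^esub> \<one>\<^bsub>B\<^esub>"] by simp
        fix c assume c: "c \<in> J'"
        have cB: "c \<in> carrier B" using c by (auto simp: J'_def)
        obtain a k where ak: "a \<in> J" "b \<otimes>\<^bsub>B\<^esub> \<phi> s [^]\<^bsub>B\<^esub> (k::nat) = \<phi> a" using b by (auto simp: J'_def)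
        obtain d l where dl: "d \<in> J" "c \<otimes>\<^bsub>B\<^esub> \<phi> s [^]\<^bsub>B\<^esub> (l::nat) = \<phi> d" using c by (auto simp: J'_def)
        have "(b \<oplus>\<^bsub>B\<^esub> c) \<otimes>\<^bsub>B\<^esub> (\<phi> s [^]\<^bsub>B\<^esub> k \<otimes>\<^bsub>B\<^esub> \<phi> s [^]\<^bsub>B\<^esub> l) = (b \<otimes>\<^bsub>B\<^esub> \<phi> s [^]\<^bsub>B\<^esub> k) \<otimes>\<^bsub>B\<^esub> \<phi> s [^]\<^bsub>B\<^esub> l \<oplus>\<^bsub>B\<^esub> (c \<otimes>\<^bsub>B\<^esub> \<phi> s [^]\<^bsub>B\<^esub> l) \<otimes>\<^bsub>B\<^esub> \<phi> s [^]\<^bsub>B\<^esub> k"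
          by (rule B.fraction_add[OF bB cB sB(1) sB(1)])
        also have "\<dots> = \<phi> (a \<otimes>\<^bsub>A\<^esub> s [^]\<^bsub>A\<^esub> l \<oplus>\<^bsub>A\<^esub> d \<otimes>\<^bsub>A\<^esub> s [^]\<^bsub>A\<^esub> k)" using ak dl sA J.Icarr by (simp add: pw)
        finally have "(b \<oplus>\<^bsub>B\<^esub> c) \<otimes>\<^bsub>B\<^esub> \<phi> s [^]\<^bsub>B\<^esub> (k + l) = \<phi> (a \<otimes>\<^bsub>A\<^esub> s [^]\<^bsub>A\<^esub> l \<oplus>\<^bsub>A\<^esub> d \<otimes>\<^bsub>A\<^esub> s [^]\<^bsub>A\<^esub> k)" using sB by (simp add: B.nat_pow_mult)
        moreover have "a \<otimes>\<^bsub>A\<^esub> s [^]\<^bsub>A\<^esub> l \<oplus>\<^bsub>A\<^esub> d \<otimes>\<^bsub>A\<^esub> s [^]\<^bsub>A\<^esub> k \<in> J" using ak dl sA J.I_r_closed by simp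
        ultimately show "b \<oplus>\<^bsub>B\<^esub> c \<in> J'" unfolding J'_def using B.a_closed[OF bB cB] by blast
      qed
    next
      fix a x assume a: "a \<in> J'" "x \<in> carrier B"
      have "a \<in> carrier B" using a by (auto simp: J'_def)
      thus "x \<otimes>\<^bsub>B\<^esub> a \<in> J'" "a \<otimes>\<^bsub>B\<^esub> x \<in> J'" using mult[OF a] B.m_comm[OF _ a(2), of a] by auto
    qed
    moreover have "T' \<subseteq> J'"
    proof
      fix t assume t: "t \<in> T'"
      have tB: "t \<in> carrier B" using t T' by blast
      obtain a k where ak: "a \<in> carrier A" "t \<otimes>\<^bsub>B\<^esub> \<phi> s [^]\<^bsub>B\<^esub> (k::nat) = \<phi> a" using frac[OF tB] by blast
      \<comment> \<open>The extra factor \<open>s\<close> forces a homomorphism that inverts the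
        product to factor through \<open>B\<close>, where its factorization then inverts
        \<open>t\<close>.\<close>
      have "inverting A (a \<otimes>\<^bsub>A\<^esub> s) \<subseteq> R"
      proof (rule subrelI)
        fix C \<chi> assume "(C, \<chi>) \<in> inverting A (a \<otimes>\<^bsub>A\<^esub> s)"
        hence C: "is_calg C" "\<chi> \<in> calg_hom A C" "\<chi> (a \<otimes>\<^bsub>A\<^esub> s) \<in> Units C" by (auto simp: inverting_def)
        interpret C: cring C using is_calgD(2)[OF C(1)] .
        note ch = calg_homD[OF C(2)]
        have u: "\<chi> a \<otimes>\<^bsub>C\<^esub> \<chi> s \<in> Units C" using C(3) ch(4)[OF ak(1) sA] by simp
        have us: "\<chi> s \<in> Units C" "\<chi> a \<in> Units C"
          using C.unit_factor[of "\<chi> s" "\<chi> a"] C.unit_factor[of "\<chi> a" "\<chi> s"] u ch(3) ak(1) sA C.m_comm by metis+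
        obtain \<chi>' where X: "\<chi>' \<in> calg_hom B C" "compose (carrier A) \<chi>' \<phi> = \<chi>"
          using localization_lift[OF A sA B(2) C(1,2) us(1)] by blast
        have Xa: "\<chi>' (\<phi> d) = \<chi> d" if "d \<in> carrier A" for d using X(2) that by (auto simp: compose_def)
        note xh = calg_homD[OF X(1)]
        have "\<chi>' t \<otimes>\<^bsub>C\<^esub> \<chi>' (\<phi> s [^]\<^bsub>B\<^esub> k) = \<chi> a" using xh(4)[OF tB sB(1)] ak Xa by metis
        hence "\<chi>' t \<otimes>\<^bsub>C\<^esub> \<chi>' (\<phi> s [^]\<^bsub>B\<^esub> k) \<in> Units C" using us by simp
        hence "\<chi>' t \<in> Units C" by (rule C.unit_factor) (use xh(3) tB sB in auto)
        hence "(C, \<chi>') \<in> inverting B t" using C X by (auto simp: inverting_def)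
        hence "(C, \<chi>') \<in> sieve_pullback A B \<phi> R" using T'(3)[OF t] by blast
        thus "(C, \<chi>) \<in> R" using X(2) by (simp add: sieve_pullback_def)
      qed
      hence "a \<otimes>\<^bsub>A\<^esub> s \<in> J" using UJ ak(1) sA by (auto simp: U_def)
      moreover have "t \<otimes>\<^bsub>B\<^esub> \<phi> s [^]\<^bsub>B\<^esub> (Suc k) = \<phi> (a \<otimes>\<^bsub>A\<^esub> s)"
        using ak sA tB sB by (simp add: B.m_assoc[symmetric])
      ultimately show "t \<in> J'" unfolding J'_def using tB by blast
    qed
    ultimately have "genideal B T' \<subseteq> J'" by (rule B.genideal_minimal)
    hence "\<one>\<^bsub>B\<^esub> \<in> J'" using T'(2) B.one_closed by blast
    then obtain a k where ak: "a \<in> J" "\<phi> s [^]\<^bsub>B\<^esub> (k::nat) = \<phi> a" using sB by (auto simp: J'_def)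
    have aA: "a \<in> carrier A" using ak J.Icarr by blast
    have "\<phi> (s [^]\<^bsub>A\<^esub> k \<ominus>\<^bsub>A\<^esub> a) = \<zero>\<^bsub>B\<^esub>" using ak aA sA by (simp add: A.minus_eq pw B.r_neg)
    then obtain l :: nat where "s [^]\<^bsub>A\<^esub> l \<otimes>\<^bsub>A\<^esub> (s [^]\<^bsub>A\<^esub> k \<ominus>\<^bsub>A\<^esub> a) = \<zero>\<^bsub>A\<^esub>" using ker aA sA by (metis A.minus_closed A.nat_pow_closed)
    hence "s [^]\<^bsub>A\<^esub> l \<otimes>\<^bsub>A\<^esub> s [^]\<^bsub>A\<^esub> k \<ominus>\<^bsub>A\<^esub> s [^]\<^bsub>A\<^esub> l \<otimes>\<^bsub>A\<^esub> a = \<zero>\<^bsub>A\<^esub>"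
      using aA sA by (simp add: A.minus_eq A.r_distr A.r_minus)
    hence "s [^]\<^bsub>A\<^esub> l \<otimes>\<^bsub>A\<^esub> s [^]\<^bsub>A\<^esub> k = s [^]\<^bsub>A\<^esub> l \<otimes>\<^bsub>A\<^esub> a" using aA sA by simp
    hence "s [^]\<^bsub>A\<^esub> (l + k) \<in> J" using sA J.I_l_closed[OF ak(1), of "s [^]\<^bsub>A\<^esub> l"] by (simp add: A.nat_pow_mult)
    thus ?thesis by blast
  qed
  have "T \<subseteq> {r \<in> carrier A. \<exists>k::nat. r [^]\<^bsub>A\<^esub> k \<in> J}" using rad T(1) by auto
  hence "genideal A T \<subseteq> {r \<in> carrier A. \<exists>k::nat. r [^]\<^bsub>A\<^esub> k \<in> J}"
    by (rule A.genideal_minimal[OF A.ideal_radical[OF J]])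
  then obtain k :: nat where "\<one>\<^bsub>A\<^esub> [^]\<^bsub>A\<^esub> k \<in> J" using T(2) A.one_closed by blast
  hence "genideal A U = carrier A" using J.one_imp_carrier J_def by simp
  thus ?thesis using covering_inverting[OF A, of R] R U U_def by blast
qed

lemma covering_inter:
  assumes A: "is_calg A" and S: "zariski_covering A S" and S': "zariski_covering A S'"
  shows "zariski_covering A (S \<inter> S')"
proof (rule covering_trans[OF A S])
  have sv: "is_sieve A S" "is_sieve A S'" using S S' zariski_covering_sieve by auto
  show "is_sieve A (S \<inter> S')" by (rule is_sieveI) (use is_sieveD[OF sv(1)] is_sieveD[OF sv(2)] in blast)+
  fix B \<phi> assume b: "(B, \<phi>) \<in> S"
  have B: "is_calg B" "\<phi> \<in> calg_hom A B" using is_sieveD[OF sv(1) b] by auto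
  have "sieve_pullback A B \<phi> (S \<inter> S') = sieve_pullback A B \<phi> S'"
    using is_sieveD(3)[OF sv(1) b] by (auto simp: sieve_pullback_def)
  thus "zariski_covering B (sieve_pullback A B \<phi> (S \<inter> S'))"
    using covering_pullback[OF A S' B(2,1)] by simp
qed

section \<open>Sheafification and local isomorphisms\<close>

definition functorial :: "('u, 's) presheaf \<Rightarrow> bool" where
  "functorial F \<longleftrightarrow>
     (\<forall>A B \<phi> x. is_calg A \<and> is_calg B \<and> \<phi> \<in> calg_hom A B \<and> x \<in> sections F A \<longrightarrow> restr F A B \<phi> x \<in> sections F B) \<and>
     (\<forall>A x. is_calg A \<and> x \<in> sections F A \<longrightarrow> restr F A A (id_hom A) x = x) \<and>
     (\<forall>A B C \<phi> \<psi> x. is_calg A \<and> is_calg B \<and> is_calg C \<and> \<phi> \<in> calg_hom A B \<and> \<psi> \<in> calg_hom B C \<and> x \<in> sections F A \<longrightarrow>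
        restr F B C \<psi> (restr F A B \<phi> x) = restr F A C (compose (carrier A) \<psi> \<phi>) x)"

lemma functorialD:
  assumes "functorial F" "is_calg A" "x \<in> sections F A"
  shows "is_calg B \<Longrightarrow> \<phi> \<in> calg_hom A B \<Longrightarrow> restr F A B \<phi> x \<in> sections F B"
    "restr F A A (id_hom A) x = x"
    "is_calg B \<Longrightarrow> is_calg C \<Longrightarrow> \<phi> \<in> calg_hom A B \<Longrightarrow> \<psi> \<in> calg_hom B C \<Longrightarrow>
      restr F B C \<psi> (restr F A B \<phi> x) = restr F A C (compose (carrier A) \<psi> \<phi>) x"
  using assms unfolding functorial_def by blast+

lemma matching_familiesD:
  assumes "(S, x) \<in> matching_families F A"
  shows "zariski_covering A S" "is_sieve A S" "x \<in> extensional S"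
    "\<And>B \<phi>. (B, \<phi>) \<in> S \<Longrightarrow> x (B, \<phi>) \<in> sections F B"
    "\<And>B \<phi> C \<psi>. (B, \<phi>) \<in> S \<Longrightarrow> is_calg C \<Longrightarrow> \<psi> \<in> calg_hom B C \<Longrightarrow> restr F B C \<psi> (x (B, \<phi>)) = x (C, compose (carrier A) \<psi> \<phi>)"
  using assms zariski_covering_sieve unfolding matching_families_def PiE_def Pi_def by fastforce+

lemma matching_familiesI:
  assumes "zariski_covering A S" "x \<in> extensional S"
    and "\<And>B \<phi>. (B, \<phi>) \<in> S \<Longrightarrow> x (B, \<phi>) \<in> sections F B"
    and "\<And>B \<phi> C \<psi>. (B, \<phi>) \<in> S \<Longrightarrow> is_calg C \<Longrightarrow> \<psi> \<in> calg_hom B C \<Longrightarrow> restr F B C \<psi> (x (B, \<phi>)) = x (C, compose (carrier A) \<psi> \<phi>)"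
  shows "(S, x) \<in> matching_families F A"
  using assms unfolding matching_families_def PiE_def Pi_def by auto

lemma matching_relI:
  assumes "(S, x) \<in> matching_families F A" "(S', x') \<in> matching_families F A"
    and "zariski_covering A R" "\<And>p. p \<in> R \<Longrightarrow> p \<in> S \<and> p \<in> S' \<and> x p = x' p"
  shows "((S, x), (S', x')) \<in> matching_rel F A"
  using assms unfolding matching_rel_def by blast

lemma matching_relD:
  assumes "((S, x), (S', x')) \<in> matching_rel F A"
  obtains R where "(S, x) \<in> matching_families F A" "(S', x') \<in> matching_families F A"
    "zariski_covering A R" "\<And>p. p \<in> R \<Longrightarrow> p \<in> S \<and> p \<in> S' \<and> x p = x' p"
  using assms unfolding matching_rel_def by blast

lemma equiv_matching_rel:
  assumes A: "is_calg A"
  shows "equiv (matching_families F A) (matching_rel F A)"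
proof (rule equivI)
  show "matching_rel F A \<subseteq> matching_families F A \<times> matching_families F A"
    by (auto simp: matching_rel_def)
  show "refl_on (matching_families F A) (matching_rel F A)"
  proof (rule refl_onI)
    fix p assume p: "p \<in> matching_families F A"
    obtain S x where e: "p = (S, x)" by (cases p)
    show "(p, p) \<in> matching_rel F A" unfolding e
      using p[unfolded e] by (intro matching_relI[OF _ _ matching_familiesD(1)[OF p[unfolded e]]]) auto
  qed
  show "sym (matching_rel F A)"
    unfolding sym_def by (auto elim!: matching_relD intro!: matching_relI)
  show "trans (matching_rel F A)"
  proof (rule transI)
    fix p q r assume pq: "(p, q) \<in> matching_rel F A" and qr: "(q, r) \<in> matching_rel F A"
    obtain S x S' x' S'' x'' where e: "p = (S, x)" "q = (S', x')" "r = (S'', x'')" by (metis prod.exhaust)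
    obtain R where R: "(S, x) \<in> matching_families F A" "zariski_covering A R" "\<And>p. p \<in> R \<Longrightarrow> p \<in> S \<and> p \<in> S' \<and> x p = x' p"
      using pq unfolding e by (rule matching_relD) blast
    obtain R' where R': "(S'', x'') \<in> matching_families F A" "zariski_covering A R'" "\<And>p. p \<in> R' \<Longrightarrow> p \<in> S' \<and> p \<in> S'' \<and> x' p = x'' p"
      using qr unfolding e by (rule matching_relD) blast
    show "(p, r) \<in> matching_rel F A" unfolding e
      by (rule matching_relI[OF R(1) R'(1) covering_inter[OF A R(2) R'(2)]]) (use R(3) R'(3) in fastforce)
  qed
qed

definition mclass :: "('u, 's) presheaf \<Rightarrow> 'u calg \<Rightarrow> 'u arrow set \<times> ('u arrow \<Rightarrow> 's) \<Rightarrow> ('u arrow set \<times> ('u arrow \<Rightarrow> 's)) set" where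
  "mclass F A p = matching_rel F A `` {p}"

lemma sections_plus:
  "c \<in> sections (plus_construction F) A \<longleftrightarrow> (\<exists>S x. (S, x) \<in> matching_families F A \<and> c = mclass F A (S, x))"
  by (auto simp: plus_construction_def quotient_def mclass_def)

lemma mclass_eq:
  assumes "is_calg A" "p \<in> matching_families F A" "q \<in> matching_families F A"
  shows "mclass F A p = mclass F A q \<longleftrightarrow> (p, q) \<in> matching_rel F A"
  unfolding mclass_def by (rule eq_equiv_class_iff[OF equiv_matching_rel[OF assms(1)] assms(2,3)])

lemma mclass_eqI:
  assumes "is_calg A" "(p, q) \<in> matching_rel F A"
  shows "mclass F A p = mclass F A q"
  unfolding mclass_def using equiv_class_eq[OF equiv_matching_rel[OF assms(1)] assms(2)] .

lemma matching_pullback: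
  assumes A: "is_calg A" and B: "is_calg B" and \<phi>: "\<phi> \<in> calg_hom A B" and p: "p \<in> matching_families F A"
  shows "matching_pullback A B \<phi> p \<in> matching_families F B"
proof -
  obtain S x where e: "p = (S, x)" by (cases p)
  note S = matching_familiesD[OF p[unfolded e]]
  show ?thesis unfolding e matching_pullback_def prod.case
  proof (rule matching_familiesI)
    show "zariski_covering B (sieve_pullback A B \<phi> S)" by (rule covering_pullback[OF A S(1) \<phi> B])
    fix C \<psi> assume c: "(C, \<psi>) \<in> sieve_pullback A B \<phi> S"
    hence c': "(C, compose (carrier A) \<psi> \<phi>) \<in> S" "\<psi> \<in> calg_hom B C" by (auto simp: sieve_pullback_def)
    show "restrict (\<lambda>(C, \<psi>). x (C, compose (carrier A) \<psi> \<phi>)) (sieve_pullback A B \<phi> S) (C, \<psi>) \<in> sections F C"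
      using S(4)[OF c'(1)] c by simp
    fix D \<chi> assume d: "is_calg D" "\<chi> \<in> calg_hom C D"
    have "(D, compose (carrier B) \<chi> \<psi>) \<in> sieve_pullback A B \<phi> S"
      by (rule is_sieveD(3)[OF is_sieve_pullback[OF S(2) \<phi> B] c d])
    thus "restr F C D \<chi> (restrict (\<lambda>(C, \<psi>). x (C, compose (carrier A) \<psi> \<phi>)) (sieve_pullback A B \<phi> S) (C, \<psi>)) =
        restrict (\<lambda>(C, \<psi>). x (C, compose (carrier A) \<psi> \<phi>)) (sieve_pullback A B \<phi> S) (D, compose (carrier B) \<chi> \<psi>)"
      using S(5)[OF c'(1) d] c compose_hom_assoc[OF \<phi>, of \<chi> \<psi>] by simp
  qed simp
qed

text \<open>\<open>restr\<close> takes a union over all representatives of a class. Equivalent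
  families have equivalent pullbacks, so this is a union of equal sets.\<close>

lemma restr_plus:
  assumes A: "is_calg A" and B: "is_calg B" and \<phi>: "\<phi> \<in> calg_hom A B" and p: "p \<in> matching_families F A"
  shows "restr (plus_construction F) A B \<phi> (mclass F A p) = mclass F B (matching_pullback A B \<phi> p)"
proof -
  have const: "mclass F B (matching_pullback A B \<phi> q) = mclass F B (matching_pullback A B \<phi> p)" if q: "q \<in> mclass F A p" for q
  proof (rule mclass_eqI[OF B])
    obtain S x S' x' where e: "p = (S, x)" "q = (S', x')" by (metis prod.exhaust)
    have "((S, x), (S', x')) \<in> matching_rel F A" using q by (simp add: mclass_def e)
    then obtain R where R: "(S, x) \<in> matching_families F A" "(S', x') \<in> matching_families F A"
      "zariski_covering A R" "\<And>p. p \<in> R \<Longrightarrow> p \<in> S \<and> p \<in> S' \<and> x p = x' p" by (rule matching_relD) blast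
    note m = matching_pullback[OF A B \<phi> R(2)] matching_pullback[OF A B \<phi> R(1)]
    show "(matching_pullback A B \<phi> q, matching_pullback A B \<phi> p) \<in> matching_rel F B"
      unfolding e using m unfolding matching_pullback_def prod.case
    proof (rule matching_relI)
      show "zariski_covering B (sieve_pullback A B \<phi> R)" by (rule covering_pullback[OF A R(3) \<phi> B])
      fix r assume "r \<in> sieve_pullback A B \<phi> R"
      then obtain C \<psi> where r: "r = (C, \<psi>)" "(C, \<psi>) \<in> sieve_pullback A B \<phi> R" by (cases r) auto
      show "r \<in> sieve_pullback A B \<phi> S' \<and> r \<in> sieve_pullback A B \<phi> S \<and>
         restrict (\<lambda>(C, \<psi>). x' (C, compose (carrier A) \<psi> \<phi>)) (sieve_pullback A B \<phi> S') r =
         restrict (\<lambda>(C, \<psi>). x (C, compose (carrier A) \<psi> \<phi>)) (sieve_pullback A B \<phi> S) r"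
        using r R(4)[of "(C, compose (carrier A) \<psi> \<phi>)"] by (auto simp: sieve_pullback_def)
    qed
  qed
  have "p \<in> mclass F A p"
    unfolding mclass_def using equiv_class_self[OF equiv_matching_rel[OF A] p] .
  hence "mclass F A p \<noteq> {}" by blast
  from SUP_eq_const[OF this const]
  have "(\<Union>q\<in>mclass F A p. mclass F B (matching_pullback A B \<phi> q)) = mclass F B (matching_pullback A B \<phi> p)" .
  thus ?thesis by (simp add: plus_construction_def mclass_def)
qed

lemma sieve_pullback_id:
  assumes "is_sieve A S"
  shows "sieve_pullback A A (id_hom A) S = S"
proof (rule Set.set_eqI)
  fix p :: "'a arrow"
  obtain B \<phi> where e: "p = (B, \<phi>)" by (cases p)
  show "p \<in> sieve_pullback A A (id_hom A) S \<longleftrightarrow> p \<in> S"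
    unfolding e sieve_pullback_def using is_sieveD(1,2)[OF assms, of B \<phi>] compose_id_hom(2)[of \<phi> A B] by auto
qed

lemma functorial_plus:
  fixes F :: "('u, 's) presheaf"
  assumes F: "functorial F"
  shows "functorial (plus_construction F)"
  unfolding functorial_def
proof (intro conjI allI impI; elim conjE)
  fix A B :: "'u calg" and \<phi> x assume h: "is_calg A" "is_calg B" "\<phi> \<in> calg_hom A B" "x \<in> sections (plus_construction F) A"
  obtain S y where y: "(S, y) \<in> matching_families F A" "x = mclass F A (S, y)" using h(4)[unfolded sections_plus] by blast
  obtain R z where z: "matching_pullback A B \<phi> (S, y) = (R, z)" by (cases "matching_pullback A B \<phi> (S, y)")
  hence "(R, z) \<in> matching_families F B" using matching_pullback[OF h(1-3) y(1)] by simp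
  thus "restr (plus_construction F) A B \<phi> x \<in> sections (plus_construction F) B"
    unfolding y(2) restr_plus[OF h(1-3) y(1)] sections_plus z by blast
next
  fix A :: "'u calg" and x assume h: "is_calg A" "x \<in> sections (plus_construction F) A"
  obtain S y where y: "(S, y) \<in> matching_families F A" "x = mclass F A (S, y)" using h(2)[unfolded sections_plus] by blast
  note S = matching_familiesD[OF y(1)]
  have "restrict (\<lambda>(C, \<psi>). y (C, compose (carrier A) \<psi> (id_hom A))) S = y"
  proof
    fix p show "restrict (\<lambda>(C, \<psi>). y (C, compose (carrier A) \<psi> (id_hom A))) S p = y p"
    proof (cases "p \<in> S")
      case True
      obtain B \<phi> where e: "p = (B, \<phi>)" by (cases p)
      show ?thesis unfolding restrict_apply'[OF True] unfolding e prod.case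
        compose_id_hom(2)[OF is_sieveD(2)[OF S(2) True[unfolded e]]] ..
    next
      case False
      thus ?thesis using S(3) unfolding extensional_def by (cases p) auto
    qed
  qed
  hence "matching_pullback A A (id_hom A) (S, y) = (S, y)"
    unfolding matching_pullback_def by (simp add: sieve_pullback_id[OF S(2)])
  thus "restr (plus_construction F) A A (id_hom A) x = x"
    unfolding y(2) restr_plus[OF h(1) h(1) id_hom[OF h(1)] y(1)] by simp
next
  fix A B C :: "'u calg" and \<phi> \<psi> x
  assume h: "is_calg A" "is_calg B" "is_calg C" "\<phi> \<in> calg_hom A B" "\<psi> \<in> calg_hom B C" "x \<in> sections (plus_construction F) A"
  obtain S y where y: "(S, y) \<in> matching_families F A" "x = mclass F A (S, y)" using h(6)[unfolded sections_plus] by blast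
  note S = matching_familiesD[OF y(1)]
  note cmp = calg_hom_compose[OF h(4,5,1)]
  have sv: "sieve_pullback B C \<psi> (sieve_pullback A B \<phi> S) = sieve_pullback A C (compose (carrier A) \<psi> \<phi>) S"
    using calg_hom_compose[OF h(5) _ h(2)] by (auto simp: sieve_pullback_def compose_hom_assoc[OF h(4)])
  have "matching_pullback B C \<psi> (matching_pullback A B \<phi> (S, y)) = matching_pullback A C (compose (carrier A) \<psi> \<phi>) (S, y)"
    unfolding matching_pullback_def prod.case sv
  proof (intro arg_cong2[where f = Pair] refl restrict_ext)
    fix p assume p: "p \<in> sieve_pullback A C (compose (carrier A) \<psi> \<phi>) S"
    obtain D \<chi> where e: "p = (D, \<chi>)" by (cases p)
    have "(D, \<chi>) \<in> sieve_pullback B C \<psi> (sieve_pullback A B \<phi> S)" using p e sv by simp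
    hence "(D, compose (carrier B) \<chi> \<psi>) \<in> sieve_pullback A B \<phi> S" by (simp add: sieve_pullback_def)
    thus "(case p of (D, \<chi>) \<Rightarrow> restrict (\<lambda>(C, \<psi>). y (C, compose (carrier A) \<psi> \<phi>)) (sieve_pullback A B \<phi> S) (D, compose (carrier B) \<chi> \<psi>)) =
      (case p of (D, \<chi>) \<Rightarrow> y (D, compose (carrier A) \<chi> (compose (carrier A) \<psi> \<phi>)))"
      unfolding e by (simp add: compose_hom_assoc[OF h(4)])
  qed
  thus "restr (plus_construction F) B C \<psi> (restr (plus_construction F) A B \<phi> x) =
      restr (plus_construction F) A C (compose (carrier A) \<psi> \<phi>) x"
    unfolding y(2) restr_plus[OF h(1,2,4) y(1)] restr_plus[OF h(1,3) cmp y(1)]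
      restr_plus[OF h(2,3,5) matching_pullback[OF h(1,2,4) y(1)]] by simp
qed

text \<open>A correspondence between two presheaves is a subpresheaf of their product. If both projections
  are locally bijective, it sheafifies to the graph of an isomorphism.\<close>

definition correspondence :: "('u, 's) presheaf \<Rightarrow> ('u, 'r) presheaf \<Rightarrow> ('u calg \<Rightarrow> 's \<Rightarrow> 'r \<Rightarrow> bool) \<Rightarrow> bool" where
  "correspondence F G \<rho> \<longleftrightarrow> (\<forall>A x y. is_calg A \<and> \<rho> A x y \<longrightarrow> x \<in> sections F A \<and> y \<in> sections G A \<and>
     (\<forall>B \<phi>. is_calg B \<and> \<phi> \<in> calg_hom A B \<longrightarrow> \<rho> B (restr F A B \<phi> x) (restr G A B \<phi> y)))"

lemma correspondenceD:
  assumes "correspondence F G \<rho>" "is_calg A" "\<rho> A x y"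
  shows "x \<in> sections F A" "y \<in> sections G A"
    "is_calg B \<Longrightarrow> \<phi> \<in> calg_hom A B \<Longrightarrow> \<rho> B (restr F A B \<phi> x) (restr G A B \<phi> y)"
  using assms unfolding correspondence_def by blast+

definition locally_total :: "('u, 's) presheaf \<Rightarrow> ('u calg \<Rightarrow> 's \<Rightarrow> 'r \<Rightarrow> bool) \<Rightarrow> bool" where
  "locally_total F \<rho> \<longleftrightarrow> (\<forall>A. is_calg A \<longrightarrow> (\<forall>x\<in>sections F A. \<exists>S. zariski_covering A S \<and>
     (\<forall>(B, \<phi>)\<in>S. \<exists>y. \<rho> B (restr F A B \<phi> x) y)))"

definition locally_unique :: "('u, 'r) presheaf \<Rightarrow> ('u calg \<Rightarrow> 's \<Rightarrow> 'r \<Rightarrow> bool) \<Rightarrow> bool" where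
  "locally_unique G \<rho> \<longleftrightarrow> (\<forall>A x y y'. is_calg A \<and> \<rho> A x y \<and> \<rho> A x y' \<longrightarrow>
     (\<exists>S. zariski_covering A S \<and> (\<forall>(B, \<phi>)\<in>S. restr G A B \<phi> y = restr G A B \<phi> y')))"

definition strictly_unique :: "('u calg \<Rightarrow> 's \<Rightarrow> 'r \<Rightarrow> bool) \<Rightarrow> bool" where
  "strictly_unique \<rho> \<longleftrightarrow> (\<forall>A x y y'. is_calg A \<and> \<rho> A x y \<and> \<rho> A x y' \<longrightarrow> y = y')"

lemma strictly_uniqueD:
  "strictly_unique \<rho> \<Longrightarrow> is_calg A \<Longrightarrow> \<rho> A x y \<Longrightarrow> \<rho> A x y' \<Longrightarrow> y = y'"
  unfolding strictly_unique_def by blast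

text \<open>The plus construction of the subpresheaf \<open>\<rho>\<close> of the product, seen as a
  relation between classes.\<close>

definition plus_corr :: "('u, 's) presheaf \<Rightarrow> ('u, 'r) presheaf \<Rightarrow> ('u calg \<Rightarrow> 's \<Rightarrow> 'r \<Rightarrow> bool) \<Rightarrow> 'u calg \<Rightarrow>
    ('u arrow set \<times> ('u arrow \<Rightarrow> 's)) set \<Rightarrow> ('u arrow set \<times> ('u arrow \<Rightarrow> 'r)) set \<Rightarrow> bool" where
  "plus_corr F G \<rho> A c d \<longleftrightarrow> (\<exists>S x y. (S, x) \<in> matching_families F A \<and> (S, y) \<in> matching_families G A \<and>
     c = mclass F A (S, x) \<and> d = mclass G A (S, y) \<and> (\<forall>p\<in>S. \<rho> (fst p) (x p) (y p)))"

lemma plus_corr_conversep: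
  "plus_corr G F (\<lambda>A x y. \<rho> A y x) = (\<lambda>A x y. plus_corr F G \<rho> A y x)"
  unfolding plus_corr_def by (intro ext) blast

lemma correspondence_conversep:
  "correspondence F G \<rho> \<Longrightarrow> correspondence G F (\<lambda>A x y. \<rho> A y x)"
  unfolding correspondence_def by blast

lemma strictly_unique_imp:
  "strictly_unique \<rho> \<Longrightarrow> locally_unique G \<rho>"
  unfolding strictly_unique_def locally_unique_def using covering_max by blast

lemma correspondence_plus:
  fixes F :: "('u, 's) presheaf" and G :: "('u, 'r) presheaf"
  assumes "correspondence F G \<rho>"
  shows "correspondence (plus_construction F) (plus_construction G) (plus_corr F G \<rho>)"
  unfolding correspondence_def
proof (intro conjI allI impI; elim conjE)
  fix A :: "'u calg" and c d assume A: "is_calg A" "plus_corr F G \<rho> A c d"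
  then obtain S x y where S: "(S, x) \<in> matching_families F A" "(S, y) \<in> matching_families G A"
    "c = mclass F A (S, x)" "d = mclass G A (S, y)" "\<forall>p\<in>S. \<rho> (fst p) (x p) (y p)" unfolding plus_corr_def by blast
  show "c \<in> sections (plus_construction F) A" "d \<in> sections (plus_construction G) A"
    unfolding sections_plus using S by blast+
  fix B \<phi> assume B: "is_calg B" "\<phi> \<in> calg_hom A B"
  note m = matching_pullback[OF A(1) B S(1)] matching_pullback[OF A(1) B S(2)]
  show "plus_corr F G \<rho> B (restr (plus_construction F) A B \<phi> c) (restr (plus_construction G) A B \<phi> d)"
    unfolding S(3,4) restr_plus[OF A(1) B S(1)] restr_plus[OF A(1) B S(2)] plus_corr_def
    using m S(5) unfolding matching_pullback_def prod.case
    by (intro exI conjI) (assumption | rule refl | force simp: sieve_pullback_def)+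
qed

text \<open>Two partners of one family agree only after a further covering of each member. The
  members on which they agree outright form a sieve, which covers by transitivity; hence their
  classes coincide.\<close>

lemma strictly_unique_plus:
  fixes F :: "('u, 's) presheaf" and G :: "('u, 'r) presheaf"
  assumes c: "correspondence F G \<rho>" and u: "locally_unique G \<rho>"
  shows "strictly_unique (plus_corr F G \<rho>)"
  unfolding strictly_unique_def
proof (intro allI impI; elim conjE)
  fix A :: "'u calg" and c d d' assume A: "is_calg A" and cd: "plus_corr F G \<rho> A c d" "plus_corr F G \<rho> A c d'"
  obtain S x y where S: "(S, x) \<in> matching_families F A" "(S, y) \<in> matching_families G A"
    "c = mclass F A (S, x)" "d = mclass G A (S, y)" "\<And>p. p\<in>S \<Longrightarrow> \<rho> (fst p) (x p) (y p)"
    using cd(1) unfolding plus_corr_def by blast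
  obtain S' x' y' where S': "(S', x') \<in> matching_families F A" "(S', y') \<in> matching_families G A"
    "c = mclass F A (S', x')" "d' = mclass G A (S', y')" "\<And>p. p\<in>S' \<Longrightarrow> \<rho> (fst p) (x' p) (y' p)"
    using cd(2) unfolding plus_corr_def by blast
  have "((S, x), (S', x')) \<in> matching_rel F A" using mclass_eq[OF A S(1) S'(1)] S(3) S'(3) by simp
  then obtain R where R: "zariski_covering A R" "\<And>p. p \<in> R \<Longrightarrow> p \<in> S \<and> p \<in> S' \<and> x p = x' p" by (rule matching_relD) blast
  note Ss = matching_familiesD[OF S(2)] and Ss' = matching_familiesD[OF S'(2)]
  define Q where "Q = {p \<in> S \<inter> S'. y p = y' p}"
  have Qs: "is_sieve A Q"
  proof (rule is_sieveI)
    fix B \<phi> assume b: "(B, \<phi>) \<in> Q"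
    thus "is_calg B \<and> \<phi> \<in> calg_hom A B" using is_sieveD[OF Ss(2)] by (auto simp: Q_def)
    fix C \<psi> assume "is_calg C" "\<psi> \<in> calg_hom B C"
    thus "(C, compose (carrier A) \<psi> \<phi>) \<in> Q" using b Ss(5)[of B \<phi> C \<psi>] Ss'(5)[of B \<phi> C \<psi>] is_sieveD(3)[OF Ss(2)] is_sieveD(3)[OF Ss'(2)]
      unfolding Q_def by (metis (mono_tags, lifting) Int_iff mem_Collect_eq)
  qed
  have Q: "zariski_covering A Q"
  proof (rule covering_trans[OF A R(1) Qs])
    fix B \<phi> assume b: "(B, \<phi>) \<in> R"
    have B: "is_calg B" "\<phi> \<in> calg_hom A B" using is_sieveD[OF zariski_covering_sieve[OF R(1)] b] by auto
    have bS: "(B, \<phi>) \<in> S" "(B, \<phi>) \<in> S'" "x (B, \<phi>) = x' (B, \<phi>)" using R(2)[OF b] by auto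
    have "\<rho> B (x (B, \<phi>)) (y (B, \<phi>))" "\<rho> B (x (B, \<phi>)) (y' (B, \<phi>))" using S(5)[OF bS(1)] S'(5)[OF bS(2)] bS(3) by auto
    then obtain P where P: "zariski_covering B P" "\<forall>(C, \<psi>)\<in>P. restr G B C \<psi> (y (B, \<phi>)) = restr G B C \<psi> (y' (B, \<phi>))"
      using u B(1) unfolding locally_unique_def by meson
    have "P \<subseteq> sieve_pullback A B \<phi> Q"
    proof (rule subrelI)
      fix C \<psi> assume p: "(C, \<psi>) \<in> P"
      have C: "is_calg C" "\<psi> \<in> calg_hom B C" using is_sieveD[OF zariski_covering_sieve[OF P(1)] p] by auto
      have "y (C, compose (carrier A) \<psi> \<phi>) = y' (C, compose (carrier A) \<psi> \<phi>)"
        using Ss(5)[OF bS(1) C] Ss'(5)[OF bS(2) C] P(2) p by fastforce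
      thus "(C, \<psi>) \<in> sieve_pullback A B \<phi> Q" using C is_sieveD(3)[OF Ss(2) bS(1) C] is_sieveD(3)[OF Ss'(2) bS(2) C]
        by (simp add: sieve_pullback_def Q_def)
    qed
    thus "zariski_covering B (sieve_pullback A B \<phi> Q)" using covering_subset[OF P(1) is_sieve_pullback[OF Qs B(2,1)]] by blast
  qed
  have "((S, y), (S', y')) \<in> matching_rel G A" by (rule matching_relI[OF S(2) S'(2) Q]) (auto simp: Q_def)
  thus "d = d'" unfolding S(4) S'(4) by (rule mclass_eqI[OF A])
qed

lemma constant_family:
  fixes F :: "('u, 's) presheaf"
  assumes F: "functorial F" and A: "is_calg A" and S: "zariski_covering A S" and x: "x \<in> sections F A"
  shows "(S, \<lambda>(B, \<phi>)\<in>S. restr F A B \<phi> x) \<in> matching_families F A"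
proof (rule matching_familiesI[OF S])
  note sv = is_sieveD[OF zariski_covering_sieve[OF S]]
  fix B \<phi> assume b: "(B, \<phi>) \<in> S"
  show "(\<lambda>(B, \<phi>)\<in>S. restr F A B \<phi> x) (B, \<phi>) \<in> sections F B"
    using functorialD(1)[OF F A x] sv(1,2)[OF b] b by simp
  fix C \<psi> assume c: "is_calg C" "\<psi> \<in> calg_hom B C"
  show "restr F B C \<psi> ((\<lambda>(B, \<phi>)\<in>S. restr F A B \<phi> x) (B, \<phi>)) = (\<lambda>(B, \<phi>)\<in>S. restr F A B \<phi> x) (C, compose (carrier A) \<psi> \<phi>)"
    using sv(3)[OF b c] b functorialD(3)[OF F A x sv(1)[OF b] c(1) sv(2)[OF b] c(2)] by simp
qed simp

text \<open>On a member of its own covering sieve a matching family is represented by the single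
  section that it assigns to this member.\<close>

lemma restr_plus_component:
  fixes F :: "('u, 's) presheaf"
  assumes F: "functorial F" and A: "is_calg A" and m: "(S, x) \<in> matching_families F A" and b: "(B, \<phi>) \<in> S"
    and R: "zariski_covering B R"
  shows "restr (plus_construction F) A B \<phi> (mclass F A (S, x)) = mclass F B (R, \<lambda>(C, \<psi>)\<in>R. restr F B C \<psi> (x (B, \<phi>)))"
proof -
  note S = matching_familiesD[OF m]
  have B: "is_calg B" "\<phi> \<in> calg_hom A B" using is_sieveD[OF S(2) b] by auto
  note k = constant_family[OF F B(1) R S(4)[OF b]]
  have "(matching_pullback A B \<phi> (S, x), (R, \<lambda>(C, \<psi>)\<in>R. restr F B C \<psi> (x (B, \<phi>)))) \<in> matching_rel F B"
    using matching_pullback[OF A B m] k unfolding matching_pullback_def prod.case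
  proof (rule matching_relI[OF _ _ R])
    fix p assume p: "p \<in> R"
    obtain C \<psi> where e: "p = (C, \<psi>)" by (cases p)
    have C: "is_calg C" "\<psi> \<in> calg_hom B C" using is_sieveD[OF zariski_covering_sieve[OF R]] p e by auto
    show "p \<in> sieve_pullback A B \<phi> S \<and> p \<in> R \<and> restrict (\<lambda>(C, \<psi>). x (C, compose (carrier A) \<psi> \<phi>)) (sieve_pullback A B \<phi> S) p =
       (\<lambda>(C, \<psi>)\<in>R. restr F B C \<psi> (x (B, \<phi>))) p"
      using is_sieveD(3)[OF S(2) b C] S(5)[OF b C] C p e by (simp add: sieve_pullback_def)
  qed
  thus ?thesis unfolding restr_plus[OF A B m] by (rule mclass_eqI[OF B(1)])
qed

text \<open>A class is locally a single section by \<open>restr_plus_component\<close>, and a single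
  section locally has a partner.\<close>

lemma locally_total_plus:
  fixes F :: "('u, 's) presheaf" and G :: "('u, 'r) presheaf"
  assumes F: "functorial F" and G: "functorial G" and c: "correspondence F G \<rho>" and t: "locally_total F \<rho>"
  shows "locally_total (plus_construction F) (plus_corr F G \<rho>)"
  unfolding locally_total_def
proof (intro allI impI ballI)
  fix A :: "'u calg" and c assume A: "is_calg A" and cF: "c \<in> sections (plus_construction F) A"
  obtain S x where m: "(S, x) \<in> matching_families F A" and cx: "c = mclass F A (S, x)" using cF[unfolded sections_plus] by blast
  note S = matching_familiesD[OF m]
  note Fp = functorial_plus[OF F] and Gp = functorial_plus[OF G]
  note cp = correspondence_plus[OF c]
  define Q where "Q = {(B, \<phi>). is_calg B \<and> \<phi> \<in> calg_hom A B \<and> (\<exists>d. plus_corr F G \<rho> B (restr (plus_construction F) A B \<phi> c) d)}"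
  have Qs: "is_sieve A Q"
  proof (rule is_sieveI)
    fix B \<phi> assume b: "(B, \<phi>) \<in> Q"
    thus B: "is_calg B \<and> \<phi> \<in> calg_hom A B" by (auto simp: Q_def)
    fix C \<psi> assume C: "is_calg C" "\<psi> \<in> calg_hom B C"
    obtain d where d: "plus_corr F G \<rho> B (restr (plus_construction F) A B \<phi> c) d" using b by (auto simp: Q_def)
    have "plus_corr F G \<rho> C (restr (plus_construction F) A C (compose (carrier A) \<psi> \<phi>) c) (restr (plus_construction G) B C \<psi> d)"
      using correspondenceD(3)[OF cp conjunct1[OF B] d C]
      unfolding functorialD(3)[OF Fp A cF conjunct1[OF B] C(1) conjunct2[OF B] C(2)] .
    thus "(C, compose (carrier A) \<psi> \<phi>) \<in> Q" unfolding Q_def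
      using C calg_hom_compose[OF conjunct2[OF B] C(2) A] by blast
  qed
  have "zariski_covering A Q"
  proof (rule covering_trans[OF A S(1) Qs])
    fix B \<phi> assume b: "(B, \<phi>) \<in> S"
    have B: "is_calg B" "\<phi> \<in> calg_hom A B" using is_sieveD[OF S(2) b] by auto
    obtain P where P: "zariski_covering B P" "\<And>C \<psi>. (C, \<psi>)\<in>P \<Longrightarrow> \<exists>y. \<rho> C (restr F B C \<psi> (x (B, \<phi>))) y"
      using t B(1) S(4)[OF b] unfolding locally_total_def by fastforce
    have "P \<subseteq> sieve_pullback A B \<phi> Q"
    proof (rule subrelI)
      fix C \<psi> assume p: "(C, \<psi>) \<in> P"
      have C: "is_calg C" "\<psi> \<in> calg_hom B C" using is_sieveD[OF zariski_covering_sieve[OF P(1)] p] by auto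
      note sC = is_sieveD(3)[OF S(2) b C]
      obtain y where y: "\<rho> C (x (C, compose (carrier A) \<psi> \<phi>)) y" using P(2)[OF p] S(5)[OF b C] by auto
      note M = covering_max[OF C(1)]
      have xs: "x (C, compose (carrier A) \<psi> \<phi>) \<in> sections F C" "y \<in> sections G C" using correspondenceD[OF c C(1) y] by auto
      have "plus_corr F G \<rho> C (restr (plus_construction F) A C (compose (carrier A) \<psi> \<phi>) c)
         (mclass G C (max_sieve C, \<lambda>(D, \<chi>)\<in>max_sieve C. restr G C D \<chi> y))"
        unfolding plus_corr_def cx restr_plus_component[OF F A m sC M]
        using constant_family[OF F C(1) M xs(1)] constant_family[OF G C(1) M xs(2)] correspondenceD(3)[OF c C(1) y]
        by (intro exI conjI) (assumption | rule refl | force simp: max_sieve_def)+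
      thus "(C, \<psi>) \<in> sieve_pullback A B \<phi> Q" using C calg_hom_compose[OF B(2) C(2) A] by (auto simp: sieve_pullback_def Q_def)
    qed
    thus "zariski_covering B (sieve_pullback A B \<phi> Q)" using covering_subset[OF P(1) is_sieve_pullback[OF Qs B(2,1)]] by blast
  qed
  moreover have "\<forall>(B, \<phi>)\<in>Q. \<exists>d. plus_corr F G \<rho> B (restr (plus_construction F) A B \<phi> c) d" by (auto simp: Q_def)
  ultimately show "\<exists>S. zariski_covering A S \<and> (\<forall>(B, \<phi>)\<in>S. \<exists>d. plus_corr F G \<rho> B (restr (plus_construction F) A B \<phi> c) d)" by blast
qed

text \<open>Locally existing partners form a matching family because they are unique. So existence
  is gained at the second plus construction, after uniqueness at the first.\<close>

lemma total_plus:
  fixes F :: "('u, 's) presheaf" and G :: "('u, 'r) presheaf"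
  assumes F: "functorial F" and G: "functorial G" and c: "correspondence F G \<rho>" and t: "locally_total F \<rho>" and u: "strictly_unique \<rho>"
    and A: "is_calg A" and cF: "c \<in> sections (plus_construction F) A"
  shows "\<exists>d. plus_corr F G \<rho> A c d"
proof -
  obtain S x where m: "(S, x) \<in> matching_families F A" and cx: "c = mclass F A (S, x)" using cF[unfolded sections_plus] by blast
  note S = matching_familiesD[OF m]
  \<comment> \<open>The members that already have a partner. They form a covering sieve, and passing
    to it does not change the class.\<close>
  define Q where "Q = {(B, \<phi>) \<in> S. \<exists>y. \<rho> B (x (B, \<phi>)) y}"
  define y where "y = (\<lambda>p\<in>Q. THE z. \<rho> (fst p) (x p) z)"
  have y: "\<rho> B (x (B, \<phi>)) (y (B, \<phi>))" and yI: "\<And>z. \<rho> B (x (B, \<phi>)) z \<Longrightarrow> y (B, \<phi>) = z" if b: "(B, \<phi>) \<in> Q" for B \<phi>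
  proof -
    have bS: "(B, \<phi>) \<in> S" using b by (simp add: Q_def)
    obtain z where z: "\<rho> B (x (B, \<phi>)) z" using b by (auto simp: Q_def)
    have uz: "z' = z" if "\<rho> B (x (B, \<phi>)) z'" for z'
      using u is_sieveD(1)[OF S(2) bS] z that unfolding strictly_unique_def by blast
    have e: "y (B, \<phi>) = z" unfolding y_def restrict_apply'[OF b] fst_conv 
      by (rule the_equality[where P = "\<lambda>z. \<rho> B (x (B, \<phi>)) z" and a = z, OF z uz])
    show "\<rho> B (x (B, \<phi>)) (y (B, \<phi>))" unfolding e by (rule z)
    fix z' assume "\<rho> B (x (B, \<phi>)) z'"
    from uz[OF this] show "y (B, \<phi>) = z'" unfolding e by (rule sym)
  qed
  have step: "\<rho> C (x (C, compose (carrier A) \<psi> \<phi>)) (restr G B C \<psi> (y (B, \<phi>)))" "(C, compose (carrier A) \<psi> \<phi>) \<in> Q"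
    if b: "(B, \<phi>) \<in> Q" and C: "is_calg C" "\<psi> \<in> calg_hom B C" for B \<phi> C \<psi>
  proof -
    have bS: "(B, \<phi>) \<in> S" using b by (simp add: Q_def)
    show r: "\<rho> C (x (C, compose (carrier A) \<psi> \<phi>)) (restr G B C \<psi> (y (B, \<phi>)))"
      using correspondenceD(3)[OF c is_sieveD(1)[OF S(2) bS] y[OF b] C] unfolding S(5)[OF bS C] .
    thus "(C, compose (carrier A) \<psi> \<phi>) \<in> Q" unfolding Q_def using is_sieveD(3)[OF S(2) bS C] by blast
  qed
  have Qh: "is_calg B \<and> \<phi> \<in> calg_hom A B" if b: "(B, \<phi>) \<in> Q" for B \<phi>
  proof -
    have bS: "(B, \<phi>) \<in> S" using b by (simp add: Q_def)
    show ?thesis by (rule conjI[OF is_sieveD(1)[OF S(2) bS] is_sieveD(2)[OF S(2) bS]])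
  qed
  have Qs: "is_sieve A Q" by (rule is_sieveI[OF Qh step(2)])
  have Q: "zariski_covering A Q"
  proof (rule covering_trans[OF A S(1) Qs])
    fix B \<phi> assume b: "(B, \<phi>) \<in> S"
    have B: "is_calg B" "\<phi> \<in> calg_hom A B" using is_sieveD[OF S(2) b] by auto
    obtain P where P: "zariski_covering B P" "\<And>C \<psi>. (C, \<psi>)\<in>P \<Longrightarrow> \<exists>y. \<rho> C (restr F B C \<psi> (x (B, \<phi>))) y"
      using t B(1) S(4)[OF b] unfolding locally_total_def by fastforce
    have "P \<subseteq> sieve_pullback A B \<phi> Q"
    proof (rule subrelI)
      fix C \<psi> assume p: "(C, \<psi>) \<in> P"
      have C: "is_calg C" "\<psi> \<in> calg_hom B C" using is_sieveD[OF zariski_covering_sieve[OF P(1)] p] by auto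
      show "(C, \<psi>) \<in> sieve_pullback A B \<phi> Q"
        using is_sieveD(3)[OF S(2) b C] P(2)[OF p] S(5)[OF b C] C by (simp add: sieve_pullback_def Q_def)
    qed
    thus "zariski_covering B (sieve_pullback A B \<phi> Q)" using covering_subset[OF P(1) is_sieve_pullback[OF Qs B(2,1)]] by blast
  qed
  have QS: "Q \<subseteq> S" by (auto simp: Q_def)
  have mx: "(Q, restrict x Q) \<in> matching_families F A"
  proof (rule matching_familiesI[OF Q])
    fix B \<phi> assume b: "(B, \<phi>) \<in> Q"
    have bS: "(B, \<phi>) \<in> S" using b QS by blast
    show "restrict x Q (B, \<phi>) \<in> sections F B" unfolding restrict_apply'[OF b] by (rule S(4)[OF bS])
    fix C \<psi> assume C: "is_calg C" "\<psi> \<in> calg_hom B C"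
    show "restr F B C \<psi> (restrict x Q (B, \<phi>)) = restrict x Q (C, compose (carrier A) \<psi> \<phi>)"
      unfolding restrict_apply'[OF b] restrict_apply'[OF step(2)[OF b C]] by (rule S(5)[OF bS C])
  qed simp
  have my: "(Q, y) \<in> matching_families G A"
  proof (rule matching_familiesI[OF Q])
    show "y \<in> extensional Q" by (simp add: y_def)
    fix B \<phi> assume b: "(B, \<phi>) \<in> Q"
    have bS: "(B, \<phi>) \<in> S" using b QS by blast
    show "y (B, \<phi>) \<in> sections G B" by (rule correspondenceD(2)[OF c is_sieveD(1)[OF S(2) bS] y[OF b]])
    fix C \<psi> assume C: "is_calg C" "\<psi> \<in> calg_hom B C"
    show "restr G B C \<psi> (y (B, \<phi>)) = y (C, compose (carrier A) \<psi> \<phi>)"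
      by (rule yI[OF step(2)[OF b C] step(1)[OF b C], symmetric])
  qed
  have "((S, x), (Q, restrict x Q)) \<in> matching_rel F A" by (rule matching_relI[OF m mx Q]) (use QS in auto)
  hence e: "c = mclass F A (Q, restrict x Q)" unfolding cx by (rule mclass_eqI[OF A])
  have pr: "\<forall>p\<in>Q. \<rho> (fst p) (restrict x Q p) (y p)"
  proof
    fix p assume p: "p \<in> Q"
    obtain B \<phi> where e: "p = (B, \<phi>)" by (cases p)
    show "\<rho> (fst p) (restrict x Q p) (y p)" unfolding restrict_apply'[OF p] unfolding e fst_conv by (rule y[OF p[unfolded e]])
  qed
  show ?thesis unfolding plus_corr_def by (intro exI conjI, rule mx, rule my, rule e, rule refl, rule pr)
qed

theorem sheafification_iso:
  fixes F :: "('u, 's) presheaf" and G :: "('u, 'r) presheaf"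
  assumes F: "functorial F" and G: "functorial G" and c: "correspondence F G \<rho>"
    and t: "locally_total F \<rho>" "locally_total G (\<lambda>A x y. \<rho> A y x)"
    and u: "locally_unique G \<rho>" "locally_unique F (\<lambda>A x y. \<rho> A y x)"
  shows "presheaf_iso (sheafification F) (sheafification G)"
proof -
  note c' = correspondence_conversep[OF c]
  let ?F1 = "plus_construction F" and ?G1 = "plus_construction G" and ?\<rho>1 = "plus_corr F G \<rho>"
  let ?F2 = "plus_construction ?F1" and ?G2 = "plus_construction ?G1" and ?\<rho>2 = "plus_corr ?F1 ?G1 ?\<rho>1"
  note f1 = functorial_plus[OF F] and g1 = functorial_plus[OF G] and c1 = correspondence_plus[OF c]
  note c1' = correspondence_conversep[OF c1]
  note u1 = strictly_unique_plus[OF c u(1)] and u1' = strictly_unique_plus[OF c' u(2), unfolded plus_corr_conversep[of G F \<rho>]]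
  note t1 = locally_total_plus[OF F G c t(1)] and t1' = locally_total_plus[OF G F c' t(2), unfolded plus_corr_conversep[of G F \<rho>]]
  note c2 = correspondence_plus[OF c1]
  note u2 = strictly_unique_plus[OF c1 strictly_unique_imp[OF u1]]
  note u2' = strictly_unique_plus[OF c1' strictly_unique_imp[OF u1'], unfolded plus_corr_conversep[of ?G1 ?F1 ?\<rho>1]]
  have ex: "\<exists>d. ?\<rho>2 A c d" if "is_calg A" "c \<in> sections ?F2 A" for A c
    by (rule total_plus[OF f1 g1 c1 t1 u1 that])
  have ex': "\<exists>c. ?\<rho>2 A c d" if "is_calg A" "d \<in> sections ?G2 A" for A d
    using total_plus[OF g1 f1 c1' t1' u1' that] unfolding plus_corr_conversep[of ?G1 ?F1 ?\<rho>1] .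
  define \<eta> where "\<eta> A c = (THE d. ?\<rho>2 A c d)" for A c
  have \<eta>I: "\<eta> A c = d" if A: "is_calg A" and cd: "?\<rho>2 A c d" for A c d
    unfolding \<eta>_def
    by (rule the_equality[where P = "\<lambda>d. ?\<rho>2 A c d", OF cd strictly_uniqueD[OF u2 A _ cd]])
  have \<eta>: "?\<rho>2 A c (\<eta> A c)" if "is_calg A" "c \<in> sections ?F2 A" for A c
    using ex[OF that] \<eta>I[OF that(1)] by metis
  have "presheaf_iso ?F2 ?G2"
    unfolding presheaf_iso_def
  proof (intro exI[of _ \<eta>] conjI allI impI ballI; (elim conjE)?)
    fix A :: "'u calg" assume A: "is_calg A"
    show "bij_betw (\<eta> A) (sections ?F2 A) (sections ?G2 A)"
    proof (rule bij_betw_imageI)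
      show "inj_on (\<eta> A) (sections ?F2 A)"
      proof (rule inj_onI)
        fix c c' assume h: "c \<in> sections ?F2 A" "c' \<in> sections ?F2 A" "\<eta> A c = \<eta> A c'"
        show "c = c'" by (rule strictly_uniqueD[OF u2' A \<eta>[OF A h(1)] \<eta>[OF A h(2), folded h(3)]])
      qed
      show "\<eta> A ` sections ?F2 A = sections ?G2 A"
      proof (rule subset_antisym; rule subsetI)
        fix d assume "d \<in> \<eta> A ` sections ?F2 A"
        thus "d \<in> sections ?G2 A" using \<eta>[OF A] correspondenceD(2)[OF c2 A] by blast
      next
        fix d assume "d \<in> sections ?G2 A"
        then obtain c where c: "?\<rho>2 A c d" using ex'[OF A] by blast
        thus "d \<in> \<eta> A ` sections ?F2 A" using correspondenceD(1)[OF c2 A c] \<eta>I[OF A c] by blast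
      qed
    qed
  next
    fix A B :: "'u calg" and \<phi> c assume h: "is_calg A" "is_calg B" "\<phi> \<in> calg_hom A B" "c \<in> sections ?F2 A"
    show "\<eta> B (restr ?F2 A B \<phi> c) = restr ?G2 A B \<phi> (\<eta> A c)"
      by (rule \<eta>I[OF h(2) correspondenceD(3)[OF c2 h(1) \<eta>[OF h(1,4)] h(2,3)]])
  qed
  thus ?thesis unfolding sheafification_def .
qed

section \<open>A universal coefficient ring\<close>

text \<open>Algebras with an explicit carrier are handled through one ring type that maps onto all of
  them: the product of \<open>\<complex>\<close> and of all algebras in the universe. The factor \<open>\<complex>\<close> only serves to
  ensure \<open>0 \<noteq> 1\<close>. Computations in an algebra \<open>A\<close> become computations in this type modulo the
  kernel of the projection \<open>pev A\<close>.\<close>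

typedef 'u univ = "{p :: complex \<times> ('u calg \<Rightarrow> 'u). \<forall>A. if is_calg A then snd p A \<in> carrier A else snd p A = undefined}"
proof -
  have "\<zero>\<^bsub>A\<^esub> \<in> carrier A" if "is_calg A" for A :: "'u calg"
  proof -
    interpret cring A using is_calgD(2)[OF that] .
    show ?thesis by simp
  qed
  thus ?thesis by (intro exI[of _ "(0, \<lambda>A. if is_calg A then \<zero>\<^bsub>A\<^esub> else undefined)"]) auto
qed

definition pev :: "'u calg \<Rightarrow> 'u univ \<Rightarrow> 'u" where "pev A p = snd (Rep_univ p) A"

definition pcst :: "'u univ \<Rightarrow> complex" where "pcst p = fst (Rep_univ p)"

definition mkp :: "complex \<Rightarrow> ('u calg \<Rightarrow> 'u) \<Rightarrow> 'u univ" where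
  "mkp c f = Abs_univ (c, \<lambda>A. if is_calg A then f A else undefined)"

lemma pev_closed [simp]: "is_calg A \<Longrightarrow> pev A p \<in> carrier A"
  using Rep_univ[of p] by (auto simp: pev_def)

lemma mkp:
  assumes "\<And>A. is_calg A \<Longrightarrow> f A \<in> carrier A"
  shows "pcst (mkp c f) = c" "is_calg A \<Longrightarrow> pev A (mkp c f) = f A"
  using assms unfolding pcst_def pev_def mkp_def by (subst Abs_univ_inverse; auto)+

lemma univ_eqI:
  assumes "pcst p = pcst q" "\<And>A. is_calg A \<Longrightarrow> pev A p = pev A q"
  shows "p = q"
proof -
  have "snd (Rep_univ p) A = snd (Rep_univ q) A" for A
    using assms(2)[of A] Rep_univ[of p] Rep_univ[of q] by (cases "is_calg A") (auto simp: pev_def)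
  hence "Rep_univ p = Rep_univ q" using assms(1) by (auto simp: pcst_def prod_eq_iff)
  thus ?thesis by (simp add: Rep_univ_inject)
qed

instantiation univ :: (type) "{zero, one, plus, times, uminus, minus}"
begin
definition "zero_univ = mkp 0 (\<lambda>A. \<zero>\<^bsub>A\<^esub>)"
definition "one_univ = mkp 1 (\<lambda>A. \<one>\<^bsub>A\<^esub>)"
definition "plus_univ p q = mkp (pcst p + pcst q) (\<lambda>A. pev A p \<oplus>\<^bsub>A\<^esub> pev A q)"
definition "times_univ p q = mkp (pcst p * pcst q) (\<lambda>A. pev A p \<otimes>\<^bsub>A\<^esub> pev A q)"
definition "uminus_univ p = mkp (- pcst p) (\<lambda>A. \<ominus>\<^bsub>A\<^esub> pev A p)"
definition "minus_univ p q = mkp (pcst p - pcst q) (\<lambda>A. pev A p \<ominus>\<^bsub>A\<^esub> pev A q)"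
instance ..
end

lemma
  fixes A :: "'u calg"
  shows pcst_simps [simp]: "pcst (0 :: 'u univ) = 0" "pcst (1 :: 'u univ) = 1" "pcst (p + q) = pcst p + pcst q"
    "pcst (p * q) = pcst p * pcst q" "pcst (- p) = - pcst p" "pcst (p - q) = pcst p - pcst q"
  and pev_simps [simp]: "is_calg A \<Longrightarrow> pev A 0 = \<zero>\<^bsub>A\<^esub>" "is_calg A \<Longrightarrow> pev A 1 = \<one>\<^bsub>A\<^esub>"
    "is_calg A \<Longrightarrow> pev A (p + q) = pev A p \<oplus>\<^bsub>A\<^esub> pev A q" "is_calg A \<Longrightarrow> pev A (p * q) = pev A p \<otimes>\<^bsub>A\<^esub> pev A q"
    "is_calg A \<Longrightarrow> pev A (- p) = \<ominus>\<^bsub>A\<^esub> pev A p" "is_calg A \<Longrightarrow> pev A (p - q) = pev A p \<ominus>\<^bsub>A\<^esub> pev A q"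
proof -
  note r = ring.ring_simprules
  have c: "\<zero>\<^bsub>A\<^esub> \<in> carrier A" "\<one>\<^bsub>A\<^esub> \<in> carrier A" "pev A p \<oplus>\<^bsub>A\<^esub> pev A q \<in> carrier A" "pev A p \<otimes>\<^bsub>A\<^esub> pev A q \<in> carrier A"
    "\<ominus>\<^bsub>A\<^esub> pev A p \<in> carrier A" "pev A p \<ominus>\<^bsub>A\<^esub> pev A q \<in> carrier A" if "is_calg A" for A :: "'u calg" and p q
    using that is_calgD(3)[OF that] by (simp_all add: r)
  show "pcst (0 :: 'u univ) = 0" "pcst (1 :: 'u univ) = 1" "pcst (p + q) = pcst p + pcst q"
    "pcst (p * q) = pcst p * pcst q" "pcst (- p) = - pcst p" "pcst (p - q) = pcst p - pcst q"
    unfolding zero_univ_def one_univ_def plus_univ_def times_univ_def uminus_univ_def minus_univ_def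
    using c by (simp_all add: mkp)
  show "is_calg A \<Longrightarrow> pev A 0 = \<zero>\<^bsub>A\<^esub>" "is_calg A \<Longrightarrow> pev A 1 = \<one>\<^bsub>A\<^esub>"
    "is_calg A \<Longrightarrow> pev A (p + q) = pev A p \<oplus>\<^bsub>A\<^esub> pev A q" "is_calg A \<Longrightarrow> pev A (p * q) = pev A p \<otimes>\<^bsub>A\<^esub> pev A q"
    "is_calg A \<Longrightarrow> pev A (- p) = \<ominus>\<^bsub>A\<^esub> pev A p" "is_calg A \<Longrightarrow> pev A (p - q) = pev A p \<ominus>\<^bsub>A\<^esub> pev A q"
    unfolding zero_univ_def one_univ_def plus_univ_def times_univ_def uminus_univ_def minus_univ_def
    using c by (simp_all add: mkp)
qed

instance univ :: (type) comm_ring_1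
proof
  fix a b c :: "'a univ"
  have A: "cring A" "ring A" if "is_calg A" for A :: "'a calg" using is_calgD[OF that] by auto
  note r = cring.cring_simprules[OF A(1)]
  show "a * b * c = a * (b * c)" "a * b = b * a" "1 * a = a" "a + b + c = a + (b + c)" "a + b = b + a"
    "0 + a = a" "- a + a = 0" "a - b = a + - b" "(a + b) * c = a * c + b * c"
    by (rule univ_eqI; simp add: r algebra_simps)+
  have "pcst (0 :: 'a univ) \<noteq> pcst (1 :: 'a univ)" by simp
  thus "(0 :: 'a univ) \<noteq> 1" by metis
qed

lemma pev_surj:
  assumes A: "is_calg A" and x: "x \<in> carrier A"
  obtains p where "pev A p = x"
proof -
  have "\<And>B. is_calg B \<Longrightarrow> (if B = A then x else \<zero>\<^bsub>B\<^esub>) \<in> carrier B"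
    using x is_calgD(3) ring.ring_simprules(2) by fastforce
  from mkp(2)[OF this A, of 0] show ?thesis using that by simp
qed

definition plift :: "'u calg \<Rightarrow> 'u \<Rightarrow> 'u univ" where
  "plift A x = (if x = \<zero>\<^bsub>A\<^esub> then 0 else SOME p. pev A p = x)"

lemma plift [simp]: "is_calg A \<Longrightarrow> x \<in> carrier A \<Longrightarrow> pev A (plift A x) = x"
  unfolding plift_def by (auto intro: someI elim: pev_surj)

lemma plift_zero [simp]: "plift A \<zero>\<^bsub>A\<^esub> = 0" by (simp add: plift_def)

lemma pev_power: "is_calg A \<Longrightarrow> pev A (p ^ k) = pev A p [^]\<^bsub>A\<^esub> k"
proof -
  assume A: "is_calg A"
  interpret cring A using is_calgD(2)[OF A] .
  show ?thesis by (induction k) (simp_all add: A m_comm)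
qed

definition ker :: "'u calg \<Rightarrow> 'u univ set" where "ker A = {p. pev A p = \<zero>\<^bsub>A\<^esub>}"

lemma pev_eq_iff: "is_calg A \<Longrightarrow> pev A p = pev A q \<longleftrightarrow> p - q \<in> ker A"
proof -
  assume A: "is_calg A"
  interpret cring A using is_calgD(2)[OF A] .
  show ?thesis using A by (simp add: ker_def)
qed

definition scal :: "complex \<Rightarrow> 'u univ" where "scal c = mkp c (\<lambda>A. scalar A c)"

lemma scal_simps [simp]: "is_calg A \<Longrightarrow> pev A (scal c) = scalar A c" "pcst (scal c) = c"
  unfolding scal_def using mkp[of "\<lambda>A. scalar A c"] scalar_simps(1) by blast+

lemma scal_0 [simp]: "scal 0 = 0" and scal_1 [simp]: "scal 1 = 1"
  by (rule univ_eqI; simp add: scalar_simps)+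

text \<open>The endomorphism that replaces the component at \<open>B\<close> by the image under \<open>\<phi>\<close> of the component
  at \<open>A\<close>; it lifts \<open>\<phi>\<close> along the two projections.\<close>

definition push :: "'u calg \<Rightarrow> 'u calg \<Rightarrow> ('u \<Rightarrow> 'u) \<Rightarrow> 'u univ \<Rightarrow> 'u univ" where
  "push A B \<phi> p = mkp (pcst p) (\<lambda>C. if C = B then \<phi> (pev A p) else pev C p)"

lemma push_simps:
  assumes "is_calg A" "is_calg B" "\<phi> \<in> calg_hom A B"
  shows "pcst (push A B \<phi> p) = pcst p" "is_calg C \<Longrightarrow> pev C (push A B \<phi> p) = (if C = B then \<phi> (pev A p) else pev C p)"
proof -
  have "\<And>C. is_calg C \<Longrightarrow> (if C = B then \<phi> (pev A p) else pev C p) \<in> carrier C"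
    using calg_homD(3)[OF assms(3)] assms by simp
  from mkp(1)[OF this, of "pcst p"] mkp(2)[OF this, of C "pcst p"]
  show "pcst (push A B \<phi> p) = pcst p" "is_calg C \<Longrightarrow> pev C (push A B \<phi> p) = (if C = B then \<phi> (pev A p) else pev C p)"
    unfolding push_def by blast+
qed

lemma pev_push: "is_calg A \<Longrightarrow> is_calg B \<Longrightarrow> \<phi> \<in> calg_hom A B \<Longrightarrow> pev B (push A B \<phi> p) = \<phi> (pev A p)"
  using push_simps(2)[of A B \<phi> B p] by simp

lemma push_hom:
  assumes "is_calg A" "is_calg B" "\<phi> \<in> calg_hom A B"
  shows "comm_ring_hom (push A B \<phi>)"
proof -
  note h = calg_homD[OF assms(3)] calg_hom_zero[OF assms]
  show ?thesis
    by unfold_locales (rule univ_eqI; simp add: push_simps[OF assms] assms h)+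
qed

lemma push_scal [simp]:
  assumes "is_calg A" "is_calg B" "\<phi> \<in> calg_hom A B"
  shows "push A B \<phi> (scal c) = scal c"
  by (rule univ_eqI) (simp_all add: push_simps[OF assms] assms calg_hom_scalar[OF assms(1,3)])

lemma push_ker:
  assumes "is_calg A" "is_calg B" "\<phi> \<in> calg_hom A B" "p \<in> ker A"
  shows "push A B \<phi> p \<in> ker B"
  using assms(4) calg_hom_zero[OF assms(1-3)] by (simp add: ker_def pev_push[OF assms(1-3)])

section \<open>Ideals of coefficients and minors\<close>

text \<open>Instantiated with \<open>ker A\<close>, whose congruence is equality in
  \<open>A\<close>, and with the ideals \<open>KF K\<close> of series derived from it.\<close>

locale coeff_ideal =
  fixes K :: "'a::comm_ring_1 set"
  assumes K0 [simp]: "0 \<in> K"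
    and K_add: "x \<in> K \<Longrightarrow> y \<in> K \<Longrightarrow> x + y \<in> K"
    and K_mult: "x \<in> K \<Longrightarrow> c * x \<in> K"
begin

lemma K_mult2: "x \<in> K \<Longrightarrow> x * c \<in> K" using K_mult[of x c] by (simp add: mult.commute)

lemma K_uminus: "x \<in> K \<Longrightarrow> - x \<in> K" using K_mult[of x "-1"] by simp

lemma K_diff: "x \<in> K \<Longrightarrow> y \<in> K \<Longrightarrow> x - y \<in> K" using K_add[of x "- y"] K_uminus by simp

lemma K_sum: "(\<And>i. i \<in> I \<Longrightarrow> f i \<in> K) \<Longrightarrow> sum f I \<in> K"
  by (induction I rule: infinite_finite_induct) (auto intro: K_add)

lemma K_cong: "x - y \<in> K \<Longrightarrow> y \<in> K \<longleftrightarrow> x \<in> K"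
  using K_add[of "x - y" y] K_diff[of x "x - y"] by auto

lemma cong_sym: "x - y \<in> K \<Longrightarrow> y - x \<in> K" using K_uminus[of "x - y"] by simp

lemma cong_trans: "x - y \<in> K \<Longrightarrow> y - z \<in> K \<Longrightarrow> x - z \<in> K" using K_add[of "x - y" "y - z"] by simp

lemma cong_add: "x - y \<in> K \<Longrightarrow> x' - y' \<in> K \<Longrightarrow> (x + x') - (y + y') \<in> K"
  using K_add[of "x - y" "x' - y'"] by (simp add: algebra_simps)

lemma cong_mult: "x - y \<in> K \<Longrightarrow> x' - y' \<in> K \<Longrightarrow> x * x' - y * y' \<in> K"
  using K_add[OF K_mult2[of "x - y" x'] K_mult[of "x' - y'" y]] by (simp add: algebra_simps)

lemma cong_sum: "(\<And>i. i \<in> I \<Longrightarrow> f i - g i \<in> K) \<Longrightarrow> sum f I - sum g I \<in> K"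
  using K_sum[of I "\<lambda>i. f i - g i"] by (simp add: sum_subtractf)

lemma cong_prod: "(\<And>i. i \<in> I \<Longrightarrow> f i - g i \<in> K) \<Longrightarrow> prod f I - prod g I \<in> K"
  by (induction I rule: infinite_finite_induct) (auto intro: cong_mult)

lemma cong_det:
  assumes "A \<in> carrier_mat m m" "B \<in> carrier_mat m m" "\<And>i j. i < m \<Longrightarrow> j < m \<Longrightarrow> index_mat A (i, j) - index_mat B (i, j) \<in> K"
  shows "det A - det B \<in> K"
  unfolding det_def'[OF assms(1)] det_def'[OF assms(2)]
proof (rule cong_sum)
  fix p assume "p \<in> {p. p permutes {0..<m}}"
  hence p: "p i < m" if "i < m" for i using that permutes_in_image[of p "{0..<m}" i] by auto
  have "(\<Prod>i = 0..<m. index_mat A (i, p i)) - (\<Prod>i = 0..<m. index_mat B (i, p i)) \<in> K"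
    by (rule cong_prod) (use assms(3) p in auto)
  thus "signof p * (\<Prod>i = 0..<m. index_mat A (i, p i)) - signof p * (\<Prod>i = 0..<m. index_mat B (i, p i)) \<in> K"
    using K_mult[of _ "signof p"] by (simp add: right_diff_distrib[symmetric])
qed

end

lemma (in coeff_ideal) K_power: "x - y \<in> K \<Longrightarrow> x ^ k - y ^ k \<in> K"
  by (induction k) (auto intro: cong_mult)

section \<open>Maximal minors and the Cauchy-Binet expansion\<close>

text \<open>Ordered choices of \<open>m\<close> columns, so each minor occurs once for every order
  of its columns. Being the identity from \<open>m\<close> on matches the index set of
  \<open>det_linear_rows_sum\<close> and keeps the set finite.\<close>

definition minor_sets :: "nat \<Rightarrow> nat \<Rightarrow> (nat \<Rightarrow> nat) set" where
  "minor_sets m p = {f. inj_on f {..<m} \<and> (\<forall>i<m. f i < p) \<and> (\<forall>i\<ge>m. f i = i)}"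

lemma finite_minor_sets: "finite (minor_sets m p)"
proof -
  have "minor_sets m p \<subseteq> (\<lambda>g i. if i < m then g i else i) ` (PiE {..<m} (\<lambda>_. {..<p}))"
  proof
    fix f assume "f \<in> minor_sets m p"
    hence "f = (\<lambda>i. if i < m then restrict f {..<m} i else i)" "restrict f {..<m} \<in> PiE {..<m} (\<lambda>_. {..<p})"
      by (auto simp: minor_sets_def)
    thus "f \<in> (\<lambda>g i. if i < m then g i else i) ` (PiE {..<m} (\<lambda>_. {..<p}))" by blast
  qed
  thus ?thesis using finite_PiE[of "{..<m}" "\<lambda>_. {..<p}"] finite_subset by blast
qed

text \<open>The Cauchy-Binet formula before terms with the same set of columns are collected: the
  determinant is multilinear in the columns of the product, and a choice with a repeated column
  contributes zero.\<close>

lemma det_expand_minors: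
  fixes P Q :: "nat \<Rightarrow> nat \<Rightarrow> 'a::comm_ring_1"
  shows "det (mat m m (\<lambda>(i, j). \<Sum>k<p. P i k * Q k j)) =
    (\<Sum>f\<in>minor_sets m p. (\<Prod>j<m. Q (f j) j) * det (mat m m (\<lambda>(i, j). P i (f j))))"
proof -
  let ?v = "\<lambda>k. vec m (\<lambda>i. P i k)"
  let ?F = "{f. (\<forall>i\<in>{0..<m}. f i \<in> {..<p}) \<and> (\<forall>i. i \<notin> {0..<m} \<longrightarrow> f i = i)}"
  let ?M = "mat m m (\<lambda>(i, j). \<Sum>k<p. P i k * Q k j)"
  have T: "transpose_mat ?M = mat\<^sub>r m m (\<lambda>j. finsum_vec TYPE('a) m (\<lambda>k. Q k j \<cdot>\<^sub>v ?v k) {..<p})"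
    by (rule eq_matI) (auto simp: index_finsum_vec mult.commute intro!: sum.cong)
  have T2: "transpose_mat (mat m m (\<lambda>(i, j). P i (f j))) = mat\<^sub>r m m (\<lambda>j. ?v (f j))" for f
    by (rule eq_matI) auto
  have "det ?M = det (transpose_mat ?M)" by (rule det_transpose[symmetric, of _ m]) auto
  also have "\<dots> = (\<Sum>f\<in>?F. det (mat\<^sub>r m m (\<lambda>j. Q (f j) j \<cdot>\<^sub>v ?v (f j))))"
    unfolding T by (rule det_linear_rows_sum) auto
  also have "\<dots> = (\<Sum>f\<in>?F. prod (\<lambda>j. Q (f j) j) {0..<m} * det (mat\<^sub>r m m (\<lambda>j. ?v (f j))))"
    by (intro sum.cong refl det_rows_mul) auto
  also have "\<dots> = (\<Sum>f\<in>?F. (\<Prod>j<m. Q (f j) j) * det (mat m m (\<lambda>(i, j). P i (f j))))"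
  proof (intro sum.cong refl)
    fix f
    have "det (mat\<^sub>r m m (\<lambda>j. ?v (f j))) = det (mat m m (\<lambda>(i, j). P i (f j)))"
      unfolding T2[symmetric] by (rule det_transpose[of _ m]) auto
    thus "prod (\<lambda>j. Q (f j) j) {0..<m} * det (mat\<^sub>r m m (\<lambda>j. ?v (f j))) = (\<Prod>j<m. Q (f j) j) * det (mat m m (\<lambda>(i, j). P i (f j)))"
      by (simp add: lessThan_atLeast0)
  qed
  also have "\<dots> = (\<Sum>f\<in>minor_sets m p. (\<Prod>j<m. Q (f j) j) * det (mat m m (\<lambda>(i, j). P i (f j))))"
  proof (rule sum.mono_neutral_right)
    have "?F \<subseteq> (\<lambda>g i. if i < m then g i else i) ` (PiE {..<m} (\<lambda>_. {..<p}))"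
    proof
      fix f assume "f \<in> ?F"
      hence "f = (\<lambda>i. if i < m then restrict f {..<m} i else i)" "restrict f {..<m} \<in> PiE {..<m} (\<lambda>_. {..<p})"
        by auto
      thus "f \<in> (\<lambda>g i. if i < m then g i else i) ` (PiE {..<m} (\<lambda>_. {..<p}))" by blast
    qed
    thus "finite ?F" using finite_PiE[of "{..<m}" "\<lambda>_. {..<p}"] finite_subset by blast
    show "minor_sets m p \<subseteq> ?F" by (auto simp: minor_sets_def)
    show "\<forall>f\<in>?F - minor_sets m p. (\<Prod>j<m. Q (f j) j) * det (mat m m (\<lambda>(i, j). P i (f j))) = 0"
    proof
      fix f assume f: "f \<in> ?F - minor_sets m p"
      hence "\<not> inj_on f {..<m}" by (auto simp: minor_sets_def)
      then obtain i j where ij: "i < m" "j < m" "i \<noteq> j" "f i = f j" by (auto simp: inj_on_def)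
      have "det (mat m m (\<lambda>(i, j). P i (f j))) = 0"
        by (rule det_identical_columns[of _ m i j]) (use ij in auto)
      thus "(\<Prod>j<m. Q (f j) j) * det (mat m m (\<lambda>(i, j). P i (f j))) = 0" by simp
    qed
  qed
  finally show ?thesis .
qed

text \<open>If P Q = 1 modulo \<open>K\<close>, the Cauchy-Binet formula writes 1 as a combination
  of the maximal minors \<open>s f\<close> of \<open>P\<close>. The matrix \<open>U f\<close> is the
  adjugate of the square block that \<open>f\<close> selects.\<close>

lemma (in coeff_ideal) minors_generate:
  fixes P Q :: "nat \<Rightarrow> nat \<Rightarrow> 'a"
  assumes PQ: "\<And>i j. i < m \<Longrightarrow> j < m \<Longrightarrow> (\<Sum>k<p. P i k * Q k j) - (if i = j then 1 else 0) \<in> K"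
  obtains c s U where "(\<Sum>f\<in>minor_sets m p. c f * s f) - 1 \<in> K"
    "\<And>f i j. i < m \<Longrightarrow> j < m \<Longrightarrow> (\<Sum>k<m. P i (f k) * U f k j) = (if i = j then s f else 0)"
    "\<And>f i j. i < m \<Longrightarrow> j < m \<Longrightarrow> (\<Sum>k<m. U f i k * P k (f j)) = (if i = j then s f else 0)"
proof -
  let ?X = "\<lambda>f. mat m m (\<lambda>(i, j). P i (f j))"
  define c where "c f = (\<Prod>j<m. Q (f j) j)" for f
  define s where "s f = det (?X f)" for f
  define U where "U f i j = index_mat (adj_mat (?X f)) (i, j)" for f i j
  have "det (mat m m (\<lambda>(i, j). \<Sum>k<p. P i k * Q k j)) - det (1\<^sub>m m) \<in> K"
    by (rule cong_det[of _ m]) (use PQ in auto)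
  hence "(\<Sum>f\<in>minor_sets m p. c f * s f) - 1 \<in> K"
    unfolding det_expand_minors c_def s_def by simp
  moreover have "(\<Sum>k<m. P i (f k) * U f k j) = (if i = j then s f else 0)"
    "(\<Sum>k<m. U f i k * P k (f j)) = (if i = j then s f else 0)" if ij: "i < m" "j < m" for f i j
  proof -
    have c: "?X f \<in> carrier_mat m m" by simp
    note a = adj_mat[OF c]
    have e2: "index_mat (?X f * adj_mat (?X f)) (i, j) = (\<Sum>k<m. P i (f k) * U f k j)"
      using ij a(1) by (auto simp: scalar_prod_def U_def lessThan_atLeast0 intro!: sum.cong)
    have "index_mat (?X f * adj_mat (?X f)) (i, j) = (if i = j then s f else 0)" unfolding a(2) using ij by (simp add: s_def)
    thus "(\<Sum>k<m. P i (f k) * U f k j) = (if i = j then s f else 0)" unfolding e2 .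
    have e3: "index_mat (adj_mat (?X f) * ?X f) (i, j) = (\<Sum>k<m. U f i k * P k (f j))"
      using ij a(1) by (auto simp: scalar_prod_def U_def lessThan_atLeast0 intro!: sum.cong)
    have "index_mat (adj_mat (?X f) * ?X f) (i, j) = (if i = j then s f else 0)" unfolding a(3) using ij by (simp add: s_def)
    thus "(\<Sum>k<m. U f i k * P k (f j)) = (if i = j then s f else 0)" unfolding e3 .
  qed
  ultimately show ?thesis using that by blast
qed

lemma mat_assoc4:
  assumes "h \<in> carrier_mat n n" "k \<in> carrier_mat n n" "H \<in> carrier_mat n n"
  shows "(h * k) * (h * H) = h * (k * h) * H"
  using assms by (simp add: assoc_mult_mat[of _ n n _ n _ n])

text \<open>With \<open>H\<close> the adjugate of \<open>h\<close>, evaluate h k h H in two ways: as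
  \<open>det h\<close> times h k, and through k h = d as d times \<open>det h\<close>. Multiplying
  by \<open>det k\<close> replaces \<open>det h\<close> by a power of \<open>d\<close>, which can be
  cancelled.\<close>

lemma (in coeff_ideal) left_right_inverse:
  fixes k h :: "nat \<Rightarrow> nat \<Rightarrow> 'a"
  assumes kh: "\<And>i j. i < n \<Longrightarrow> j < n \<Longrightarrow> (\<Sum>l<n. k i l * h l j) - (if i = j then d else 0) \<in> K"
    and cancel: "\<And>x. d * x \<in> K \<Longrightarrow> x \<in> K"
    and ij: "i < n" "j < n"
  shows "(\<Sum>l<n. h i l * k l j) - (if i = j then d else 0) \<in> K"
proof -
  let ?k = "mat n n (\<lambda>(i, j). k i j)" and ?h = "mat n n (\<lambda>(i, j). h i j)"
  let ?H = "adj_mat ?h"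
  have c: "?k \<in> carrier_mat n n" "?h \<in> carrier_mat n n" by auto
  note a = adj_mat[OF c(2)]
  have KH: "index_mat (?k * ?h) (i, j) - index_mat (d \<cdot>\<^sub>m 1\<^sub>m n) (i, j) \<in> K" if "i < n" "j < n" for i j
  proof -
    have "index_mat (?k * ?h) (i, j) = (\<Sum>l<n. k i l * h l j)" using that by (simp add: scalar_prod_def lessThan_atLeast0)
    moreover have "index_mat (d \<cdot>\<^sub>m 1\<^sub>m n) (i, j) = (if i = j then d else 0)" using that by simp
    ultimately show ?thesis using kh[OF that] by (simp only:)
  qed
  have "det (?k * ?h) - det (d \<cdot>\<^sub>m 1\<^sub>m n) \<in> K" by (rule cong_det[of _ n]) (use KH in auto)
  hence D: "det ?k * det ?h - d ^ n \<in> K" using det_mult[OF c] by simp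
  have E: "index_mat ((?h * ?k) * (?h * ?H)) (i, j) = index_mat (?h * (?k * ?h) * ?H) (i, j)"
    by (simp only: mat_assoc4[OF c(2,1) a(1)])
  have "(?h * ?k) * (det ?h \<cdot>\<^sub>m 1\<^sub>m n) = det ?h \<cdot>\<^sub>m (?h * ?k)"
    by (subst mult_smult_distrib[of _ n n _ n]) (use c in auto)
  hence L: "index_mat ((?h * ?k) * (?h * ?H)) (i, j) = det ?h * index_mat (?h * ?k) (i, j)"
    unfolding a(2) using ij by (simp only: index_smult_mat index_mult_mat dim_row_mat dim_col_mat)
  have hh: "index_mat (?h * M) (i, j) - index_mat (?h * M') (i, j) \<in> K"
    if "M \<in> carrier_mat n n" "M' \<in> carrier_mat n n" "i < n" "j < n" "\<And>i j. i < n \<Longrightarrow> j < n \<Longrightarrow> index_mat M (i, j) - index_mat M' (i, j) \<in> K" for M M' i j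
  proof -
    have "index_mat (?h * M) (i, j) - index_mat (?h * M') (i, j) = (\<Sum>l<n. h i l * (index_mat M (l, j) - index_mat M' (l, j)))"
      using that(1-4) by (simp add: scalar_prod_def lessThan_atLeast0 sum_subtractf right_diff_distrib)
    thus ?thesis using that(4,5) by (auto intro!: K_sum K_mult)
  qed
  have hH: "index_mat (M * ?H) (i, j) - index_mat (M' * ?H) (i, j) \<in> K"
    if "M \<in> carrier_mat n n" "M' \<in> carrier_mat n n" "i < n" "j < n" "\<And>i j. i < n \<Longrightarrow> j < n \<Longrightarrow> index_mat M (i, j) - index_mat M' (i, j) \<in> K" for M M' i j
  proof -
    have "index_mat (M * ?H) (i, j) - index_mat (M' * ?H) (i, j) = (\<Sum>l<n. (index_mat M (i, l) - index_mat M' (i, l)) * index_mat ?H (l, j))"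
      using that(1-4) a(1) by (simp add: scalar_prod_def lessThan_atLeast0 sum_subtractf left_diff_distrib)
    thus ?thesis using that(3,5) by (auto intro!: K_sum K_mult2)
  qed
  have "index_mat (?h * (?k * ?h) * ?H) (i, j) - index_mat (?h * (d \<cdot>\<^sub>m 1\<^sub>m n) * ?H) (i, j) \<in> K"
    by (rule hH[OF _ _ ij hh]) (use c KH ij in auto)
  moreover have "index_mat (?h * (d \<cdot>\<^sub>m 1\<^sub>m n) * ?H) (i, j) = det ?h * (if i = j then d else 0)"
  proof -
    have "?h * (d \<cdot>\<^sub>m 1\<^sub>m n) * ?H = d \<cdot>\<^sub>m (?h * ?H)"
      using c a(1) by (simp add: mult_smult_distrib[of _ n n _ n] mult_smult_assoc_mat[of _ n n _ n])
    thus ?thesis unfolding a(2) using ij by (simp add: mult.commute)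
  qed
  ultimately have a1: "det ?h * index_mat (?h * ?k) (i, j) - det ?h * (if i = j then d else 0) \<in> K" using E L by (simp only:)
  define x where "x = index_mat (?h * ?k) (i, j) - (if i = j then d else 0)"
  have "det ?h * x \<in> K" using a1 unfolding x_def right_diff_distrib .
  hence "det ?k * (det ?h * x) \<in> K" by (rule K_mult)
  hence a2: "det ?k * det ?h * x \<in> K" unfolding mult.assoc .
  have "d ^ n * x \<in> K" using K_diff[OF a2 K_mult2[OF D, of x]] unfolding left_diff_distrib by (simp only: diff_diff_eq2 add_diff_cancel_left')
  moreover have pw: "d ^ e * y \<in> K \<Longrightarrow> y \<in> K" for e y
  proof (induction e)
    case (Suc e)
    thus ?case using cancel[of "d ^ e * y"] by (simp only: power_Suc mult.assoc)
  qed (simp only: power_0 mult_1_left)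
  ultimately have "x \<in> K" by blast
  hence "index_mat (?h * ?k) (i, j) - (if i = j then d else 0) \<in> K" unfolding x_def .
  thus ?thesis using ij by (simp add: scalar_prod_def lessThan_atLeast0)
qed

section \<open>Modules of row vectors\<close>

text \<open>Vectors are functions \<open>w :: nat \<Rightarrow> 'a fps\<close>, of which only the entries \<open>w i\<close> with \<open>i < n\<close>
  matter; the series variable is \<open>t\<close>. All statements are modulo an ideal \<open>K\<close> of coefficients.\<close>

definition KF :: "'a::comm_ring_1 set \<Rightarrow> 'a fps set" where "KF K = {f. \<forall>j. fps_nth f j \<in> K}"

lemma KF_nth: "f \<in> KF K \<Longrightarrow> fps_nth f j \<in> K" by (simp add: KF_def)

lemma (in coeff_ideal) coeff_ideal_KF: "coeff_ideal (KF K)"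
  by unfold_locales (auto simp: KF_def fps_mult_nth intro: K_add K_sum K_mult)

lemma (in coeff_ideal) KF_const: "c \<in> K \<Longrightarrow> fps_const c \<in> KF K"
  by (auto simp: KF_def fps_const_def)

lemma KF_shift: "f \<in> KF K \<Longrightarrow> fps_shift k f \<in> KF K" by (simp add: KF_def)

lemma (in coeff_ideal) KF_X: "fps_X ^ N * f \<in> KF K \<longleftrightarrow> f \<in> KF K"
proof
  assume a: "fps_X ^ N * f \<in> KF K"
  have "fps_nth f j = fps_nth (fps_X ^ N * f) (j + N)" for j by (simp add: fps_X_power_mult_nth)
  thus "f \<in> KF K" using a by (simp add: KF_def)
next
  assume "f \<in> KF K"
  thus "fps_X ^ N * f \<in> KF K" by (simp add: KF_def fps_X_power_mult_nth)
qed

definition lc :: "nat \<Rightarrow> (nat \<Rightarrow> 'a::comm_ring_1) \<Rightarrow> (nat \<Rightarrow> nat \<Rightarrow> 'a fps) \<Rightarrow> nat \<Rightarrow> 'a fps" where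
  "lc m c b = (\<lambda>i. \<Sum>l<m. fps_const (c l) * b l i)"

lemma fps_const_sum: "fps_const (\<Sum>i\<in>I. f i) = (\<Sum>i\<in>I. fps_const (f i))"
  by (induction I rule: infinite_finite_induct) (auto simp flip: fps_const_add)

lemma lc_lc: "lc m c (\<lambda>k. lc p (Q k) b) = lc p (\<lambda>j. \<Sum>k<m. c k * Q k j) b"
proof
  fix i
  have "lc m c (\<lambda>k. lc p (Q k) b) i = (\<Sum>k<m. \<Sum>j<p. fps_const (c k) * (fps_const (Q k j) * b j i))"
    by (simp add: lc_def sum_distrib_left)
  also have "\<dots> = (\<Sum>j<p. \<Sum>k<m. fps_const (c k) * (fps_const (Q k j) * b j i))" by (rule sum.swap)
  also have "\<dots> = lc p (\<lambda>j. \<Sum>k<m. c k * Q k j) b i"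
    by (simp add: lc_def sum_distrib_right fps_const_sum mult.assoc flip: fps_const_mult)
  finally show "lc m c (\<lambda>k. lc p (Q k) b) i = lc p (\<lambda>j. \<Sum>k<m. c k * Q k j) b i" .
qed

lemma lc_add: "lc m (\<lambda>l. c l + d l) b i = lc m c b i + lc m d b i"
  by (simp add: lc_def distrib_right sum.distrib flip: fps_const_add)

lemma lc_diff: "lc m (\<lambda>l. c l - d l) b i = lc m c b i - lc m d b i"
  by (simp add: lc_def left_diff_distrib sum_subtractf flip: fps_const_sub)

lemma lc_smult: "lc m (\<lambda>l. x * c l) b i = fps_const x * lc m c b i"
  by (simp add: lc_def sum_distrib_left mult.assoc flip: fps_const_mult)

lemma lc_smult_fun: "lc m (\<lambda>l. x * c l) b = (\<lambda>i. fps_const x * lc m c b i)"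
  by (rule ext) (rule lc_smult)

lemma lc_delta: "l < m \<Longrightarrow> lc m (\<lambda>k. if k = l then x else 0) b i = fps_const x * b l i"
proof -
  assume "l < m"
  have "lc m (\<lambda>k. if k = l then x else 0) b i = (\<Sum>k<m. if k = l then fps_const x * b l i else 0)"
    unfolding lc_def by (intro sum.cong) auto
  thus ?thesis using \<open>l < m\<close> by simp
qed

text \<open>\<open>L_K\<close> makes membership depend only on the first \<open>n\<close> entries
  modulo \<open>K\<close>, so \<open>L\<close> is the preimage of a submodule of A[[t]]^n.
  \<open>L_X\<close> says that a power of t kills the quotient.\<close>

locale lattice0 = coeff_ideal K for K :: "'a::comm_ring_1 set" +
  fixes n :: nat and L :: "(nat \<Rightarrow> 'a fps) set"
  assumes L_add: "w \<in> L \<Longrightarrow> w' \<in> L \<Longrightarrow> (\<lambda>i. w i + w' i) \<in> L"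
    and L_smult: "w \<in> L \<Longrightarrow> (\<lambda>i. q * w i) \<in> L"
    and L_K: "(\<And>i. i < n \<Longrightarrow> w i \<in> KF K) \<Longrightarrow> w \<in> L"
    and L_X: "\<exists>N. \<forall>w. (\<lambda>i. fps_X ^ N * w i) \<in> L"
begin

sublocale F: coeff_ideal "KF K" by (rule coeff_ideal_KF)

lemma L_cong: "w \<in> L \<Longrightarrow> (\<And>i. i < n \<Longrightarrow> w' i - w i \<in> KF K) \<Longrightarrow> w' \<in> L"
  using L_add[of w "\<lambda>i. w' i - w i"] L_K[of "\<lambda>i. w' i - w i"] by simp

lemma L_eq: "w \<in> L \<Longrightarrow> (\<And>i. i < n \<Longrightarrow> w' i = w i) \<Longrightarrow> w' \<in> L"
  by (rule L_cong) auto

lemma L_0: "(\<lambda>i. 0) \<in> L" by (rule L_K) simp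

lemma L_diff: "w \<in> L \<Longrightarrow> w' \<in> L \<Longrightarrow> (\<lambda>i. w i - w' i) \<in> L"
  using L_add[of w "\<lambda>i. - 1 * w' i"] L_smult[of w' "-1"] by simp

lemma L_sum: "(\<And>x. x \<in> I \<Longrightarrow> b x \<in> L) \<Longrightarrow> (\<lambda>i. \<Sum>x\<in>I. b x i) \<in> L"
  by (induction I rule: infinite_finite_induct) (auto intro: L_0 L_add)

lemma L_lc: "(\<And>l. l < m \<Longrightarrow> b l \<in> L) \<Longrightarrow> lc m c b \<in> L"
  unfolding lc_def using L_sum[of "{..<m}" "\<lambda>l i. fps_const (c l) * b l i"] L_smult by auto

lemma L_lc_K: "(\<And>l. l < m \<Longrightarrow> c l \<in> K) \<Longrightarrow> lc m c b i \<in> KF K"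
  unfolding lc_def by (auto intro!: F.K_sum F.K_mult2 KF_const)

definition eqv :: "(nat \<Rightarrow> 'a fps) \<Rightarrow> (nat \<Rightarrow> 'a fps) \<Rightarrow> bool" where
  "eqv w w' \<longleftrightarrow> (\<lambda>i. w i - w' i) \<in> L"

lemma eqv_sym: "eqv w w' \<Longrightarrow> eqv w' w" unfolding eqv_def using L_smult[of "\<lambda>i. w i - w' i" "-1"] by simp

lemma eqv_trans: "eqv u v \<Longrightarrow> eqv v w \<Longrightarrow> eqv u w"
  unfolding eqv_def using L_add[of "\<lambda>i. u i - v i" "\<lambda>i. v i - w i"] by simp

lemma eqv_lc: "(\<And>l. l < m \<Longrightarrow> eqv (b l) (b' l)) \<Longrightarrow> eqv (lc m c b) (lc m c b')"
  unfolding eqv_def using L_lc[of m "\<lambda>l i. b l i - b' l i" c]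
  by (simp add: lc_def right_diff_distrib sum_subtractf)

lemma eqv_smult: "eqv w w' \<Longrightarrow> eqv (\<lambda>i. q * w i) (\<lambda>i. q * w' i)"
  unfolding eqv_def using L_smult[of "\<lambda>i. w i - w' i" q] by (simp add: right_diff_distrib)

lemma eqv_mem: "eqv w w' \<Longrightarrow> w \<in> L \<longleftrightarrow> w' \<in> L"
  unfolding eqv_def using L_add[of w' "\<lambda>i. w i - w' i"] L_diff[of w "\<lambda>i. w i - w' i"] by auto

text \<open>Freeness of the quotient by \<open>L\<close> over the coefficient ring, not over the
  power series: \<open>lc\<close> has constant coefficients.\<close>

definition free :: "nat \<Rightarrow> (nat \<Rightarrow> nat \<Rightarrow> 'a fps) \<Rightarrow> bool" where
  "free m b \<longleftrightarrow> (\<forall>w. \<exists>c. eqv w (lc m c b)) \<and> (\<forall>c. lc m c b \<in> L \<longrightarrow> (\<forall>l<m. c l \<in> K))"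

lemma free_indep: "free m b \<Longrightarrow> lc m c b \<in> L \<Longrightarrow> l < m \<Longrightarrow> c l \<in> K"
  unfolding free_def by blast

text \<open>Freeness of the quotient after inverting \<open>s\<close>, with denominators cleared in
  the same way as in \<open>locally_free\<close>.\<close>

definition lfree :: "nat \<Rightarrow> 'a \<Rightarrow> (nat \<Rightarrow> nat \<Rightarrow> 'a fps) \<Rightarrow> bool" where
  "lfree m s b \<longleftrightarrow> (\<forall>w. \<exists>k c. eqv (\<lambda>i. fps_const (s ^ k) * w i) (lc m c b)) \<and>
     (\<forall>c. lc m c b \<in> L \<longrightarrow> (\<forall>l<m. \<exists>k. s ^ k * c l \<in> K))"

lemma lfree_one: "lfree m 1 b \<longleftrightarrow> free m b"
  unfolding lfree_def free_def by simp

lemma lfree_unit: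
  assumes s: "v * s - 1 \<in> K" and l: "lfree m s b"
  shows "free m b"
proof -
  have vs: "v ^ k * s ^ k - 1 \<in> K" for k using K_power[OF s, of k] by (simp add: power_mult_distrib)
  show ?thesis unfolding free_def
  proof (intro conjI allI impI)
    fix w
    obtain k c where kc: "eqv (\<lambda>i. fps_const (s ^ k) * w i) (lc m c b)" using l unfolding lfree_def by blast
    have e1: "eqv (\<lambda>i. fps_const (v ^ k) * (fps_const (s ^ k) * w i)) (\<lambda>i. fps_const (v ^ k) * lc m c b i)"
      by (rule eqv_smult[OF kc])
    have e2: "eqv (\<lambda>i. fps_const (v ^ k) * (fps_const (s ^ k) * w i)) w"
      unfolding eqv_def
    proof (rule L_K)
      fix i
      have "fps_const (v ^ k) * (fps_const (s ^ k) * w i) - w i = fps_const (v ^ k * s ^ k - 1) * w i"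
        by (simp add: left_diff_distrib mult.assoc flip: fps_const_mult fps_const_sub)
      thus "fps_const (v ^ k) * (fps_const (s ^ k) * w i) - w i \<in> KF K" using F.K_mult2[OF KF_const[OF vs]] by simp
    qed
    have "eqv w (\<lambda>i. fps_const (v ^ k) * lc m c b i)" by (rule eqv_trans[OF eqv_sym[OF e2] e1])
    hence "eqv w (lc m (\<lambda>l. v ^ k * c l) b)" unfolding lc_smult_fun .
    thus "\<exists>c. eqv w (lc m c b)" by blast
  next
    fix c l assume "lc m c b \<in> L" "l < m"
    then obtain k where "s ^ k * c l \<in> K" using l unfolding lfree_def by blast
    hence "v ^ k * s ^ k * c l \<in> K" using K_mult[of "s ^ k * c l" "v ^ k"] by (simp add: mult.assoc)
    thus "c l \<in> K" using K_diff[OF _ K_mult2[OF vs[of k], of "c l"]] by (fastforce simp: left_diff_distrib)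
  qed
qed

text \<open>Expanding the longer basis in the shorter one and back factors the identity of size m'
  through m. There is no injective choice of m' columns among m, so the expansion of 1 into minors
  is an empty sum.\<close>

lemma free_rank_le:
  assumes "free m b" "free m' b'" "m < m'"
  shows "1 \<in> K"
proof -
  have "\<forall>l. \<exists>c. eqv (b' l) (lc m c b)" "\<forall>l. \<exists>c. eqv (b l) (lc m' c b')" using assms unfolding free_def by auto
  from choice[OF this(1)] choice[OF this(2)]
  obtain P Q where PQ: "\<And>l. eqv (b' l) (lc m (P l) b)" "\<And>l. eqv (b l) (lc m' (Q l) b')" by blast
  have "(\<Sum>k<m. P l k * Q k j) - (if l = j then 1 else 0) \<in> K" if l: "l < m'" and j: "j < m'" for l j
  proof -
    have "eqv (lc m (P l) b) (lc m (P l) (\<lambda>k. lc m' (Q k) b'))" by (rule eqv_lc) (rule PQ)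
    hence "eqv (lc m' (\<lambda>j. \<Sum>k<m. P l k * Q k j) b') (b' l)"
      unfolding lc_lc by (intro eqv_sym[OF eqv_trans[OF PQ(1)[of l]]])
    hence "(\<lambda>i. lc m' (\<lambda>j. (\<Sum>k<m. P l k * Q k j) - (if j = l then 1 else 0)) b' i) \<in> L"
      unfolding eqv_def lc_diff lc_delta[OF l] by simp
    from free_indep[OF assms(2) this j] show ?thesis unfolding eq_commute[of l] .
  qed
  then obtain c s :: "(nat \<Rightarrow> nat) \<Rightarrow> 'a" where "(\<Sum>f\<in>minor_sets m' m. c f * s f) - 1 \<in> K"
    by (rule minors_generate[where m = m' and p = m and P = P and Q = Q])
  moreover have "minor_sets m' m = {}"
  proof -
    have False if "inj_on f {..<m'}" "\<forall>i<m'. f i < m" for f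
      using card_inj_on_le[OF that(1), of "{..<m}"] that(2) assms(3) by auto
    thus ?thesis by (auto simp: minor_sets_def)
  qed
  ultimately show ?thesis using K_uminus[of "-1"] by simp
qed

subsection \<open>Projectivity from a dual basis\<close>

end

text \<open>The transpose of \<open>E\<close> stacked on 1 - E; the rows of these two matrices
  appear as columns so that \<open>minors_generate\<close> chooses among them.\<close>

definition stack :: "nat \<Rightarrow> (nat \<Rightarrow> nat \<Rightarrow> 'a::comm_ring_1) \<Rightarrow> nat \<Rightarrow> nat \<Rightarrow> 'a" where
  "stack r E i k = (if k < r then E k i else (if k - r = i then 1 else 0) - E (k - r) i)"

lemma sum_stack:
  fixes f :: "nat \<Rightarrow> 'a::comm_monoid_add"
  shows "(\<Sum>k<r + q. f k) = (\<Sum>k<r. f k) + (\<Sum>k<q. f (r + k))"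
  by (induction q) (simp_all add: add.assoc)

text \<open>Row j of E and row j of 1 - E add up to a unit vector, so two stacked identity matrices
  form a right inverse, as \<open>minors_generate\<close> requires.\<close>

lemma (in lattice0) stack_inverse:
  assumes "i < r" "j < r"
  shows "(\<Sum>k<r + r. stack r E i k * (if k < r then if k = j then 1 else 0 else if k - r = j then 1 else 0)) = (if i = j then 1 else 0)"
  unfolding sum_stack using assms by (simp add: stack_def if_distrib[of "\<lambda>x. _ * x"] cong: if_cong)

text \<open>The rows of the idempotent \<open>E\<close> and of \<open>1 - E\<close> contain a basis of the ambient space wherever a
  maximal minor \<open>s\<close> is invertible; those chosen from \<open>E\<close> are then a basis of its image.\<close>

lemma (in lattice0) dual_basis_free:
  assumes A1: "\<And>w. eqv w (lc r (\<lambda>\<alpha>. \<kappa> \<alpha> w) \<beta>)"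
    and A2: "\<And>w \<alpha>. w \<in> L \<Longrightarrow> \<alpha> < r \<Longrightarrow> \<kappa> \<alpha> w \<in> K"
    and A3: "\<And>\<alpha> m c b. \<kappa> \<alpha> (lc m c b) = (\<Sum>l<m. c l * \<kappa> \<alpha> (b l))"
    and f: "f \<in> minor_sets r (r + r)"
    and U: "\<And>i j. i < r \<Longrightarrow> j < r \<Longrightarrow> (\<Sum>k<r. stack r (\<lambda>\<alpha> \<gamma>. \<kappa> \<gamma> (\<beta> \<alpha>)) i (f k) * U k j) = (if i = j then s else 0)"
      "\<And>i j. i < r \<Longrightarrow> j < r \<Longrightarrow> (\<Sum>k<r. U i k * stack r (\<lambda>\<alpha> \<gamma>. \<kappa> \<gamma> (\<beta> \<alpha>)) k (f j)) = (if i = j then s else 0)"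
    and s: "v * s - 1 \<in> K"
  shows "\<exists>m b. free m b"
proof -
  \<comment> \<open>The idempotent defined by the composite free module -> quotient -> free module:
    row \<alpha> lists the coordinates of the generator \<open>\<beta> \<alpha>\<close>.\<close>
  define E where "E = (\<lambda>\<alpha> \<gamma>. \<kappa> \<gamma> (\<beta> \<alpha>))"
  define W where "W j i = stack r E i (f j)" for i j
  define J where "J = {j. j < r \<and> f j < r}"
  \<comment> \<open>A column taken from 1 - E represents zero in the quotient, so only the choices
    in \<open>J\<close> contribute basis vectors.\<close>
  define d where "d j = (if j \<in> J then \<beta> (f j) else (\<lambda>i. 0))" for j
  have fin: "finite J" unfolding J_def by simp
  obtain \<sigma> where \<sigma>: "bij_betw \<sigma> {..<card J} J" using ex_bij_betw_nat_finite[OF fin] by (auto simp: lessThan_atLeast0)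
  define m where "m = card J"
  define b where "b l = \<beta> (f (\<sigma> l))" for l
  have \<sigma>J: "\<sigma> l \<in> J" if "l < m" for l using \<sigma> that unfolding m_def bij_betw_def by auto
  have reidx: "lc r c d i = lc m (\<lambda>l. c (\<sigma> l)) b i" for c i
  proof -
    have "lc r c d i = (\<Sum>j\<in>J. fps_const (c j) * d j i)"
      unfolding lc_def by (rule sum.mono_neutral_right) (auto simp: J_def d_def)
    also have "\<dots> = (\<Sum>l<m. fps_const (c (\<sigma> l)) * d (\<sigma> l) i)"
      unfolding m_def by (rule sum.reindex_bij_betw[OF \<sigma>, symmetric])
    also have "\<dots> = lc m (\<lambda>l. c (\<sigma> l)) b i"
      unfolding lc_def by (intro sum.cong refl) (use \<sigma>J in \<open>auto simp: d_def b_def\<close>)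
    finally show ?thesis .
  qed
  have Wd: "eqv (lc r (W j) \<beta>) (d j)" if j: "j < r" for j
  proof (cases "f j < r")
    case True
    have "W j = (\<lambda>\<alpha>. \<kappa> \<alpha> (\<beta> (f j)))" unfolding W_def stack_def E_def using True by auto
    moreover have "d j = \<beta> (f j)" using True j by (simp add: d_def J_def)
    ultimately show ?thesis using eqv_sym[OF A1[of "\<beta> (f j)"]] by simp
  next
    case False
    define q where "q = f j - r"
    have q: "q < r" using False f j by (auto simp: q_def minor_sets_def)
    have "W j = (\<lambda>\<alpha>. (if \<alpha> = q then 1 else 0) - \<kappa> \<alpha> (\<beta> q))" unfolding W_def stack_def E_def q_def using False by auto
    hence "lc r (W j) \<beta> = (\<lambda>i. \<beta> q i - lc r (\<lambda>\<alpha>. \<kappa> \<alpha> (\<beta> q)) \<beta> i)" unfolding lc_diff[abs_def] by (auto simp: lc_diff lc_delta[OF q])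
    moreover have "d j = (\<lambda>i. 0)" using False by (simp add: d_def J_def)
    ultimately show ?thesis using A1[of "\<beta> q"] by (simp add: eqv_def)
  qed
  have span: "\<exists>c. eqv w (lc m c b)" for w
  proof -
    \<comment> \<open>Cramer's rule: the coordinates of s w in the chosen rows, obtained from
      \<open>U\<close>.\<close>
    define x where "x = (\<lambda>k. \<Sum>j<r. \<kappa> j w * U k j)"
    have "(\<Sum>k<r. x k * W k i) = s * \<kappa> i w" if i: "i < r" for i
    proof -
      have "(\<Sum>k<r. x k * W k i) = (\<Sum>k<r. \<Sum>j<r. \<kappa> j w * (W k i * U k j))"
        unfolding x_def by (intro sum.cong refl, simp only: sum_distrib_right, simp only: mult_ac)
      also have "\<dots> = (\<Sum>j<r. \<kappa> j w * (\<Sum>k<r. W k i * U k j))"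
        by (subst sum.swap) (simp add: sum_distrib_left)
      also have "\<dots> = (\<Sum>j<r. if j = i then \<kappa> j w * s else 0)"
        by (intro sum.cong refl) (use U(1)[OF i] in \<open>auto simp: W_def E_def\<close>)
      also have "\<dots> = s * \<kappa> i w" using i by (simp add: mult.commute)
      finally show ?thesis .
    qed
    hence e: "lc r (\<lambda>i. \<Sum>k<r. x k * W k i) \<beta> = lc r (\<lambda>i. s * \<kappa> i w) \<beta>" unfolding lc_def by (auto intro!: sum.cong)
    have "eqv (lc r x (\<lambda>k. lc r (W k) \<beta>)) (lc r x d)" by (rule eqv_lc) (rule Wd)
    hence "eqv (lc r (\<lambda>i. s * \<kappa> i w) \<beta>) (lc r x d)" unfolding lc_lc e .
    hence "eqv (\<lambda>i. fps_const s * lc r (\<lambda>i. \<kappa> i w) \<beta> i) (lc r x d)" unfolding lc_smult_fun .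
    hence 1: "eqv (\<lambda>i. fps_const s * w i) (lc r x d)" by (rule eqv_trans[OF eqv_smult[OF A1[of w], of "fps_const s"]])
    have "eqv (\<lambda>i. fps_const v * (fps_const s * w i)) (\<lambda>i. fps_const v * lc r x d i)" by (rule eqv_smult[OF 1])
    hence 2: "eqv (\<lambda>i. fps_const v * (fps_const s * w i)) (lc m (\<lambda>l. v * x (\<sigma> l)) b)" unfolding lc_smult_fun reidx .
    have "eqv (\<lambda>i. fps_const v * (fps_const s * w i)) w" unfolding eqv_def
    proof (rule L_K)
      fix i
      have "fps_const v * (fps_const s * w i) - w i = fps_const (v * s - 1) * w i"
        by (simp add: left_diff_distrib mult.assoc flip: fps_const_mult fps_const_sub)
      thus "fps_const v * (fps_const s * w i) - w i \<in> KF K" using F.K_mult2[OF KF_const[OF s]] by simp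
    qed
    from eqv_trans[OF eqv_sym[OF this] 2] show ?thesis by blast
  qed
  have indep: "c l \<in> K" if cL: "lc m c b \<in> L" and l: "l < m" for c l
  proof -
    \<comment> \<open>The given relation, extended by zero to all chosen rows. \<open>A2\<close>
      puts its coordinates into \<open>K\<close>, and \<open>U\<close> recovers \<open>s\<close>
      times each coefficient from them.\<close>
    define x where "x j = (if j \<in> J then c (the_inv_into {..<m} \<sigma> j) else 0)" for j
    have x\<sigma>: "x (\<sigma> l) = c l" if "l < m" for l
      unfolding x_def using \<sigma>J[OF that] the_inv_into_f_f[of \<sigma> "{..<m}" l] \<sigma> that by (auto simp: bij_betw_def m_def)
    have "lc r x d = lc m c b" unfolding lc_def[of m]
      using reidx[of x] x\<sigma> by (auto simp: lc_def fun_eq_iff)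
    hence "(\<Sum>j<r. x j * \<kappa> i (d j)) \<in> K" if "i < r" for i using A2[OF cL that] A3[of i r x d] by simp
    moreover have "(\<Sum>j<r. x j * \<kappa> i (d j)) = (\<Sum>j<r. x j * W j i)" for i
      by (intro sum.cong refl) (auto simp: x_def d_def W_def stack_def E_def J_def)
    ultimately have xW: "(\<Sum>j<r. x j * W j i) \<in> K" if "i < r" for i using that by simp
    define j where "j = \<sigma> l"
    have jr: "j < r" using \<sigma>J[OF l] by (simp add: j_def J_def)
    have "(\<Sum>i<r. U j i * (\<Sum>k<r. x k * W k i)) \<in> K" by (intro K_sum K_mult xW) simp
    also have "(\<Sum>i<r. U j i * (\<Sum>k<r. x k * W k i)) = (\<Sum>i<r. \<Sum>k<r. x k * (U j i * W k i))"
      by (intro sum.cong refl, simp only: sum_distrib_left, simp only: mult_ac)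
    also have "\<dots> = (\<Sum>k<r. x k * (\<Sum>i<r. U j i * W k i))" by (subst sum.swap) (simp add: sum_distrib_left)
    also have "\<dots> = (\<Sum>k<r. if k = j then x k * s else 0)"
      by (intro sum.cong refl) (use U(2)[OF jr] in \<open>auto simp: W_def E_def\<close>)
    also have "\<dots> = x j * s" using jr by simp
    finally have "v * (x j * s) \<in> K" by (rule K_mult)
    hence "v * s * x j \<in> K" by (simp add: mult_ac)
    hence "x j \<in> K" using K_diff[OF _ K_mult2[OF s, of "x j"]] by (fastforce simp: left_diff_distrib)
    thus "c l \<in> K" using x\<sigma>[OF l] by (simp add: j_def)
  qed
  show ?thesis unfolding free_def using span indep by blast
qed


subsection \<open>The lattice of a matrix\<close>

text \<open>Split \<open>u\<close> into its terms u_p t^p with p < N and t^N times the rest;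
  dividing t^p h by t^N leaves the shift of \<open>h\<close> by N - p. These shifts are the vectors
  of \<open>matdual\<close>.\<close>

lemma fps_shift_mult:
  fixes u h :: "'a::comm_ring_1 fps"
  shows "fps_shift N (u * h) = (\<Sum>p<N. fps_const (fps_nth u p) * fps_shift (N - p) h) + fps_shift N u * h"
proof (induction N)
  case 0
  then show ?case by simp
next
  case (Suc N)
  have one: "fps_shift 1 (f * g) = fps_const (fps_nth f 0) * fps_shift 1 g + fps_shift 1 f * g" for f g :: "'a fps"
  proof (rule fps_ext)
    fix j
    have "fps_nth (f * g) (Suc j) = (\<Sum>i=0..Suc j. fps_nth f i * fps_nth g (Suc j - i))" by (rule fps_mult_nth)
    also have "\<dots> = fps_nth f 0 * fps_nth g (Suc j) + (\<Sum>i=0..j. fps_nth f (Suc i) * fps_nth g (j - i))"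
      by (subst sum.atLeast0_atMost_Suc_shift) simp
    also have "\<dots> = fps_nth (fps_const (fps_nth f 0) * fps_shift 1 g + fps_shift 1 f * g) j"
      unfolding fps_add_nth fps_mult_nth[of "fps_shift 1 f" g] fps_mult_left_const_nth fps_shift_nth Suc_eq_plus1 ..
    finally show "fps_nth (fps_shift 1 (f * g)) j = fps_nth (fps_const (fps_nth f 0) * fps_shift 1 g + fps_shift 1 f * g) j"
      unfolding fps_shift_nth Suc_eq_plus1 .
  qed
  have "fps_shift (Suc N) (u * h) = fps_shift 1 (fps_shift N (u * h))" by (rule fps_ext) simp
  also have "\<dots> = fps_shift 1 (\<Sum>p<N. fps_const (fps_nth u p) * fps_shift (N - p) h) + fps_shift 1 (fps_shift N u * h)"
    unfolding Suc by (rule fps_ext) simp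
  also have "fps_shift 1 (\<Sum>p<N. fps_const (fps_nth u p) * fps_shift (N - p) h) = (\<Sum>p<N. fps_const (fps_nth u p) * fps_shift (Suc N - p) h)"
    by (rule fps_ext) (auto simp: fps_sum_nth Suc_diff_le intro!: sum.cong)
  also have "fps_shift 1 (fps_shift N u * h) = fps_const (fps_nth u N) * fps_shift 1 h + fps_shift (Suc N) u * h"
  proof -
    have "fps_shift 1 (fps_shift N u) = fps_shift (Suc N) u" by (rule fps_ext) simp
    moreover have "fps_nth (fps_shift N u) 0 = fps_nth u N" by simp
    ultimately show ?thesis unfolding one by (simp only:)
  qed
  finally show ?case by (simp add: add.assoc)
qed

text \<open>For \<open>g = t\<^sup>-\<^sup>N k\<close> these are the \<open>w\<close> for which \<open>w g\<close> has no pole.\<close>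

definition matlat :: "'a::comm_ring_1 set \<Rightarrow> nat \<Rightarrow> nat \<Rightarrow> (nat \<Rightarrow> nat \<Rightarrow> 'a fps) \<Rightarrow> (nat \<Rightarrow> 'a fps) set" where
  "matlat K n N k = {w. \<forall>j<n. \<forall>q<N. fps_nth (\<Sum>i<n. w i * k i j) q \<in> K}"

lemma (in coeff_ideal) lattice0_matlat: "lattice0 K n (matlat K n N k)"
proof (intro lattice0.intro lattice0_axioms.intro)
  show "coeff_ideal K" by unfold_locales
  interpret F: coeff_ideal "KF K" by (rule coeff_ideal_KF)
  fix w w' q
  show "(\<lambda>i. w i + w' i) \<in> matlat K n N k" if "w \<in> matlat K n N k" "w' \<in> matlat K n N k"
    using that K_add by (auto simp: matlat_def distrib_right sum.distrib)
  show "(\<lambda>i. q * w i) \<in> matlat K n N k" if w: "w \<in> matlat K n N k"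
    unfolding matlat_def
  proof (intro CollectI allI impI)
    fix j e assume j: "j < n" and e: "e < N"
    have "(\<Sum>i<n. q * w i * k i j) = q * (\<Sum>i<n. w i * k i j)" by (simp add: sum_distrib_left mult.assoc)
    moreover have "fps_nth (q * (\<Sum>i<n. w i * k i j)) e \<in> K"
      unfolding fps_mult_nth by (intro K_sum K_mult) (use w j e in \<open>auto simp: matlat_def\<close>)
    ultimately show "fps_nth (\<Sum>i<n. q * w i * k i j) e \<in> K" by simp
  qed
  show "w \<in> matlat K n N k" if "\<And>i. i < n \<Longrightarrow> w i \<in> KF K"
  proof -
    have "(\<Sum>i<n. w i * k i j) \<in> KF K" for j by (intro F.K_sum F.K_mult2 that) simp
    thus ?thesis by (auto simp: matlat_def KF_def)
  qed
  show "\<exists>M. \<forall>w. (\<lambda>i. fps_X ^ M * w i) \<in> matlat K n N k"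
  proof (intro exI allI)
    fix w
    have "(\<Sum>i<n. fps_X ^ N * w i * k i j) = fps_X ^ N * (\<Sum>i<n. w i * k i j)" for j
      by (simp add: sum_distrib_left mult.assoc)
    thus "(\<lambda>i. fps_X ^ N * w i) \<in> matlat K n N k" by (simp add: matlat_def fps_X_power_mult_nth)
  qed
qed

text \<open>An index \<alpha> below n N encodes the row i = \<alpha> div N and the exponent p =
  \<alpha> mod N. For g^-1 = h this is the part without pole of t^(p - N) times row i of
  \<open>h\<close>.\<close>

definition matdual :: "nat \<Rightarrow> nat \<Rightarrow> (nat \<Rightarrow> nat \<Rightarrow> 'a::comm_ring_1 fps) \<Rightarrow> nat \<Rightarrow> nat \<Rightarrow> 'a fps" where
  "matdual n N h \<alpha> = (\<lambda>j. fps_shift (N - \<alpha> mod N) (h (\<alpha> div N) j))"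

text \<open>For g = t^-N k this is the coefficient of t^(p - N) in entry i of w g, with \<alpha>
  encoding i and p as above: polar coefficients serve as coordinates of the quotient.\<close>

definition matcoord :: "nat \<Rightarrow> nat \<Rightarrow> (nat \<Rightarrow> nat \<Rightarrow> 'a::comm_ring_1 fps) \<Rightarrow> nat \<Rightarrow> (nat \<Rightarrow> 'a fps) \<Rightarrow> 'a" where
  "matcoord n N k \<alpha> w = fps_nth (\<Sum>l<n. w l * k l (\<alpha> div N)) (\<alpha> mod N)"

lemma sum_div_mod:
  fixes f :: "nat \<Rightarrow> nat \<Rightarrow> 'a::comm_monoid_add"
  shows "(\<Sum>\<alpha><n * N. f (\<alpha> div N) (\<alpha> mod N)) = (\<Sum>i<n. \<Sum>p<N. f i p)"
proof (cases "N = 0")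
  case False
  show ?thesis
  proof (induction n)
    case (Suc n)
    have "(\<Sum>\<alpha><Suc n * N. f (\<alpha> div N) (\<alpha> mod N)) = (\<Sum>\<alpha><n * N + N. f (\<alpha> div N) (\<alpha> mod N))" by (simp add: add.commute)
    also have "\<dots> = (\<Sum>i<n. \<Sum>p<N. f i p) + (\<Sum>p<N. f ((n * N + p) div N) ((n * N + p) mod N))"
      unfolding sum_stack Suc ..
    also have "(\<Sum>p<N. f ((n * N + p) div N) ((n * N + p) mod N)) = (\<Sum>p<N. f n p)"
      by (intro sum.cong refl) auto
    finally show ?case by simp
  qed simp
qed simp

text \<open>\<open>matdual\<close> and \<open>matcoord\<close> are a dual basis of the quotient: splitting \<open>w g\<close> into its polar and
  its regular part and multiplying by \<open>g\<^sup>-\<^sup>1 = h\<close> expresses \<open>w\<close>.\<close>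

lemma (in coeff_ideal) matlat_free:
  fixes k h :: "nat \<Rightarrow> nat \<Rightarrow> 'a fps"
  assumes kh: "\<And>i j. i < n \<Longrightarrow> j < n \<Longrightarrow> (\<Sum>l<n. k i l * h l j) - (if i = j then fps_X ^ N else 0) \<in> KF K"
    and hk: "\<And>i j. i < n \<Longrightarrow> j < n \<Longrightarrow> (\<Sum>l<n. h i l * k l j) - (if i = j then fps_X ^ N else 0) \<in> KF K"
    and f: "f \<in> minor_sets (n * N) (n * N + n * N)"
    and U: "\<And>i j. i < n * N \<Longrightarrow> j < n * N \<Longrightarrow> (\<Sum>\<alpha><n * N. stack (n * N) (\<lambda>\<alpha> \<gamma>. matcoord n N k \<gamma> (matdual n N h \<alpha>)) i (f \<alpha>) * U \<alpha> j) = (if i = j then s else 0)"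
      "\<And>i j. i < n * N \<Longrightarrow> j < n * N \<Longrightarrow> (\<Sum>\<alpha><n * N. U i \<alpha> * stack (n * N) (\<lambda>\<alpha> \<gamma>. matcoord n N k \<gamma> (matdual n N h \<alpha>)) \<alpha> (f j)) = (if i = j then s else 0)"
    and s: "v * s - 1 \<in> K"
  shows "\<exists>m b. lattice0.free K (matlat K n N k) m b"
proof -
  interpret lattice0 K n "matlat K n N k" by (rule lattice0_matlat)
  show ?thesis
  proof (rule dual_basis_free[OF _ _ _ f U s])
    fix w
    define u where "u i = (\<Sum>l<n. w l * k l i)" for i
    have uh: "(\<Sum>i<n. u i * h i j) - fps_X ^ N * w j \<in> KF K" if j: "j < n" for j
    proof -
      have "(\<Sum>i<n. u i * h i j) = (\<Sum>i<n. \<Sum>l<n. w l * (k l i * h i j))" unfolding u_def by (simp add: sum_distrib_right mult.assoc)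
      also have "\<dots> = (\<Sum>l<n. w l * (\<Sum>i<n. k l i * h i j))" by (subst sum.swap) (simp add: sum_distrib_left)
      finally have e: "(\<Sum>i<n. u i * h i j) = (\<Sum>l<n. w l * (\<Sum>i<n. k l i * h i j))" .
      have "(\<Sum>l<n. w l * (\<Sum>i<n. k l i * h i j)) - (\<Sum>l<n. w l * (if l = j then fps_X ^ N else 0)) \<in> KF K"
      proof (rule F.cong_sum)
        fix l assume "l \<in> {..<n}"
        hence "w l * ((\<Sum>i<n. k l i * h i j) - (if l = j then fps_X ^ N else 0)) \<in> KF K" using kh j by (intro F.K_mult) auto
        thus "w l * (\<Sum>i<n. k l i * h i j) - w l * (if l = j then fps_X ^ N else 0) \<in> KF K" by (simp only: right_diff_distrib)
      qed
      moreover have "(\<Sum>l<n. w l * (if l = j then fps_X ^ N else 0)) = fps_X ^ N * w j"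
        using j by (simp add: if_distrib[of "\<lambda>x. _ * x"] mult.commute cong: if_cong)
      ultimately show ?thesis unfolding e by simp
    qed
    have lcu: "lc (n * N) (\<lambda>\<alpha>. matcoord n N k \<alpha> w) (matdual n N h) j = (\<Sum>i<n. \<Sum>p<N. fps_const (fps_nth (u i) p) * fps_shift (N - p) (h i j))" for j
      unfolding lc_def matcoord_def matdual_def u_def
      by (rule sum_div_mod[where f = "\<lambda>i p. fps_const (fps_nth (\<Sum>l<n. w l * k l i) p) * fps_shift (N - p) (h i j)"])
    \<comment> \<open>The contribution of the regular part of w g. Multiplying it by
      \<open>k\<close> gives a multiple of t^N modulo \<open>K\<close>, so it lies in the
      lattice.\<close>
    define w' where "w' j = (\<Sum>i<n. fps_shift N (u i) * h i j)" for j
    have sh: "fps_shift N (\<Sum>i<n. u i * h i j) = lc (n * N) (\<lambda>\<alpha>. matcoord n N k \<alpha> w) (matdual n N h) j + w' j" for j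
    proof -
      have "fps_shift N (\<Sum>i<n. u i * h i j) = (\<Sum>i<n. fps_shift N (u i * h i j))" by (rule fps_ext) (simp add: fps_sum_nth)
      thus ?thesis unfolding lcu w'_def fps_shift_mult by (simp add: sum.distrib)
    qed
    have w'L: "w' \<in> matlat K n N k" unfolding matlat_def
    proof (intro CollectI allI impI)
      fix l q assume l: "l < n" and q: "q < N"
      have "(\<Sum>j<n. w' j * k j l) = (\<Sum>j<n. \<Sum>i<n. fps_shift N (u i) * (h i j * k j l))" unfolding w'_def by (simp add: sum_distrib_right mult.assoc)
      also have "\<dots> = (\<Sum>i<n. fps_shift N (u i) * (\<Sum>j<n. h i j * k j l))" by (subst sum.swap) (simp add: sum_distrib_left)
      finally have e: "(\<Sum>j<n. w' j * k j l) = (\<Sum>i<n. fps_shift N (u i) * (\<Sum>j<n. h i j * k j l))" .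
      have "(\<Sum>i<n. fps_shift N (u i) * (\<Sum>j<n. h i j * k j l)) - (\<Sum>i<n. fps_shift N (u i) * (if i = l then fps_X ^ N else 0)) \<in> KF K"
      proof (rule F.cong_sum)
        fix i assume "i \<in> {..<n}"
        hence "fps_shift N (u i) * ((\<Sum>j<n. h i j * k j l) - (if i = l then fps_X ^ N else 0)) \<in> KF K" using hk l by (intro F.K_mult) auto
        thus "fps_shift N (u i) * (\<Sum>j<n. h i j * k j l) - fps_shift N (u i) * (if i = l then fps_X ^ N else 0) \<in> KF K" by (simp only: right_diff_distrib)
      qed
      moreover have "(\<Sum>i<n. fps_shift N (u i) * (if i = l then fps_X ^ N else 0)) = fps_X ^ N * fps_shift N (u l)"
        using l by (simp add: if_distrib[of "\<lambda>x. _ * x"] mult.commute cong: if_cong)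
      ultimately have "(\<Sum>j<n. w' j * k j l) - fps_X ^ N * fps_shift N (u l) \<in> KF K" unfolding e by simp
      hence "fps_nth ((\<Sum>j<n. w' j * k j l) - fps_X ^ N * fps_shift N (u l)) q \<in> K" by (rule KF_nth)
      thus "fps_nth (\<Sum>j<n. w' j * k j l) q \<in> K" using q by (simp add: fps_X_power_mult_nth)
    qed
    show "eqv w (lc (n * N) (\<lambda>\<alpha>. matcoord n N k \<alpha> w) (matdual n N h))"
      unfolding eqv_def
    proof (rule L_cong[OF w'L])
      fix j assume j: "j < n"
      have "fps_shift N ((\<Sum>i<n. u i * h i j) - fps_X ^ N * w j) \<in> KF K" by (rule KF_shift[OF uh[OF j]])
      also have "fps_shift N ((\<Sum>i<n. u i * h i j) - fps_X ^ N * w j) = fps_shift N (\<Sum>i<n. u i * h i j) - w j"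
        by (rule fps_ext) (simp add: fps_X_power_mult_nth)
      finally have "w j - fps_shift N (\<Sum>i<n. u i * h i j) \<in> KF K" by (rule F.cong_sym)
      thus "w j - lc (n * N) (\<lambda>\<alpha>. matcoord n N k \<alpha> w) (matdual n N h) j - w' j \<in> KF K" unfolding sh by (simp add: algebra_simps)
    qed
  next
    fix w \<alpha> assume w: "w \<in> matlat K n N k" and a: "\<alpha> < n * N"
    have "0 < N" using a by (cases "N = 0") auto
    hence "\<alpha> div N < n" "\<alpha> mod N < N" using less_mult_imp_div_less[OF a] by simp_all
    thus "matcoord n N k \<alpha> w \<in> K" using w by (simp add: matlat_def matcoord_def)
  next
    fix \<alpha> m c b
    have "(\<Sum>l<n. lc m c b l * k l (\<alpha> div N)) = (\<Sum>l<n. \<Sum>x<m. fps_const (c x) * (b x l * k l (\<alpha> div N)))"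
      unfolding lc_def by (simp add: sum_distrib_right mult.assoc)
    also have "\<dots> = (\<Sum>x<m. fps_const (c x) * (\<Sum>l<n. b x l * k l (\<alpha> div N)))" by (subst sum.swap) (simp add: sum_distrib_left)
    finally show "matcoord n N k \<alpha> (lc m c b) = (\<Sum>l<m. c l * matcoord n N k \<alpha> (b l))"
      unfolding matcoord_def by (simp add: fps_sum_nth)
  qed
qed

subsection \<open>Presentations of lattices with free quotient\<close>

definition unitv :: "nat \<Rightarrow> nat \<Rightarrow> 'a::comm_ring_1 fps" where
  "unitv k = (\<lambda>i. if i = k then 1 else 0)"

definition shiftv :: "(nat \<Rightarrow> 'a::comm_ring_1 fps) \<Rightarrow> nat \<Rightarrow> 'a fps" where
  "shiftv w = (\<lambda>i. fps_shift 1 (w i))"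

lemma fps_split: "f = fps_const (fps_nth f 0) + fps_X * fps_shift 1 f" for f :: "'a::comm_ring_1 fps"
  by (rule fps_ext) (auto simp: fps_X_mult_nth not_gr0)

lemma sum_assoc: "(\<Sum>l\<in>I. (\<Sum>i\<in>J. C i * x i l) * y l) = (\<Sum>i\<in>J. C i * (\<Sum>l\<in>I. x i l * y l))"
  for C :: "'i \<Rightarrow> 'a::comm_ring_1"
  unfolding sum_distrib_right sum_distrib_left by (subst sum.swap) (simp add: mult.assoc)

lemma sum_pick: "j < n \<Longrightarrow> (\<Sum>i<n. q i * (if i = j then c else 0)) = c * q j" for q :: "nat \<Rightarrow> 'a::comm_ring_1"
  by (subst sum.cong[OF refl, of _ _ "\<lambda>i. if i = j then c * q j else 0"]) (auto simp: mult.commute)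

context lattice0
begin

text \<open>\<open>t L\<close>, up to coefficients in \<open>K\<close>.\<close>

definition tL :: "(nat \<Rightarrow> 'a fps) set" where
  "tL = {w. \<exists>w'\<in>L. \<forall>i<n. w i - fps_X * w' i \<in> KF K}"

lemma tL_I: "w' \<in> L \<Longrightarrow> (\<And>i. i < n \<Longrightarrow> w i - fps_X * w' i \<in> KF K) \<Longrightarrow> w \<in> tL"
  unfolding tL_def by blast

lemma tL_K: "(\<And>i. i < n \<Longrightarrow> w i \<in> KF K) \<Longrightarrow> w \<in> tL"
  by (rule tL_I[OF L_0]) simp

lemma tL_add: assumes "w \<in> tL" "w' \<in> tL" shows "(\<lambda>i. w i + w' i) \<in> tL"
proof -
  obtain u u' where u: "u \<in> L" "\<And>i. i < n \<Longrightarrow> w i - fps_X * u i \<in> KF K" "u' \<in> L" "\<And>i. i < n \<Longrightarrow> w' i - fps_X * u' i \<in> KF K"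
    using assms unfolding tL_def by blast
  show ?thesis by (rule tL_I[OF L_add[OF u(1,3)]]) (use F.cong_add[OF u(2,4)] in \<open>simp add: distrib_left\<close>)
qed

lemma tL_smult: assumes "w \<in> tL" shows "(\<lambda>i. q * w i) \<in> tL"
proof -
  obtain u where u: "u \<in> L" "\<And>i. i < n \<Longrightarrow> w i - fps_X * u i \<in> KF K" using assms unfolding tL_def by blast
  show ?thesis by (rule tL_I[OF L_smult[OF u(1), of q]]) (use F.K_mult[OF u(2), of _ q] in \<open>simp add: right_diff_distrib mult_ac\<close>)
qed

lemma tL_eq: "w \<in> tL \<Longrightarrow> (\<And>i. i < n \<Longrightarrow> w' i = w i) \<Longrightarrow> w' \<in> tL"
  unfolding tL_def by auto

lemma tL_lc: "(\<And>l. l < m \<Longrightarrow> b l \<in> tL) \<Longrightarrow> lc m c b \<in> tL"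
proof -
  assume a: "\<And>l. l < m \<Longrightarrow> b l \<in> tL"
  have "(\<lambda>i. \<Sum>l\<in>I. fps_const (c l) * b l i) \<in> tL" if "\<forall>l\<in>I. b l \<in> tL" for I
    using that
  proof (induction I rule: infinite_finite_induct)
    case (insert x I)
    thus ?case using tL_add[OF tL_smult[of "b x" "fps_const (c x)"], of "\<lambda>i. \<Sum>l\<in>I. fps_const (c l) * b l i"] by simp
  qed (simp_all add: tL_K)
  thus ?thesis using a unfolding lc_def by auto
qed

text \<open>Generation of L / t L over the coefficient ring; \<open>generates_span\<close> upgrades
  it to generation of \<open>L\<close> over the power series.\<close>

definition generates :: "nat \<Rightarrow> (nat \<Rightarrow> nat \<Rightarrow> 'a fps) \<Rightarrow> bool" where
  "generates p z \<longleftrightarrow> (\<forall>k<p. z k \<in> L) \<and> (\<forall>w\<in>L. \<exists>c. (\<lambda>i. w i - lc p c z i) \<in> tL)"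

text \<open>Any vector is w(0) + t w', and w' can be expanded in the basis modulo \<open>L\<close>.
  So the \<open>n\<close> unit vectors and the \<open>m\<close> vectors t b_l, each corrected by its
  own expansion so as to lie in \<open>L\<close>, generate L / t L. Applied to b_l itself this
  produces a relation among them, and the matrix of these relations has the right inverse
  \<open>Q\<close> formed by the corrections.\<close>

lemma presentation:
  assumes fr: "free m b"
  obtains z P Q where "generates (n + m) z" "\<And>l. l < m \<Longrightarrow> lc (n + m) (P l) z \<in> tL"
    "\<And>i j. i < m \<Longrightarrow> j < m \<Longrightarrow> (\<Sum>k<n + m. P i k * Q k j) - (if i = j then 1 else 0) \<in> K"
proof -
  have "\<forall>w. \<exists>c. eqv w (lc m c b)" using fr unfolding free_def by blast
  from choice[OF this] obtain el where el: "\<And>w. eqv w (lc m (el w) b)" by blast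
  define tb where "tb l = (\<lambda>i. fps_X * b l i)" for l
  define z where "z k = (if k < n then (\<lambda>i. unitv k i - lc m (el (unitv k)) b i) else (\<lambda>i. tb (k - n) i - lc m (el (tb (k - n))) b i))" for k
  \<comment> \<open>Constant terms go with the unit vectors, the coordinates of w' = (w - w(0)) / t
    with the vectors t b_l.\<close>
  define C where "C w k = (if k < n then fps_nth (w k) 0 else el (shiftv w) (k - n))" for w k
  define Q where "Q k = (if k < n then el (unitv k) else el (tb (k - n)))" for k
  \<comment> \<open>The total of the corrections. By \<open>key\<close> it is the coordinate vector
    of \<open>w\<close> in the quotient.\<close>
  define \<gamma> where "\<gamma> w j = (\<Sum>k<n + m. C w k * Q k j)" for w j
  define R where "R w = (\<lambda>i. shiftv w i - lc m (el (shiftv w)) b i)" for w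
  have RL: "R w \<in> L" for w using el[of "shiftv w"] unfolding R_def eqv_def .
  have zL: "z k \<in> L" for k using el[of "unitv k"] el[of "tb (k - n)"] unfolding z_def eqv_def by simp
  have key: "w i = lc (n + m) (C w) z i + fps_X * R w i + lc m (\<gamma> w) b i" if i: "i < n" for w i
  proof -
    define e where "e k = (if k < n then unitv k else tb (k - n))" for k
    have zQ: "z k i = e k i - lc m (Q k) b i" for k by (simp add: z_def e_def Q_def)
    have "lc (n + m) (C w) z i = lc (n + m) (C w) e i - lc (n + m) (C w) (\<lambda>k. lc m (Q k) b) i"
      unfolding lc_def[of "n + m"] zQ by (simp add: right_diff_distrib sum_subtractf)
    also have "lc (n + m) (C w) (\<lambda>k. lc m (Q k) b) = lc m (\<gamma> w) b" unfolding lc_lc \<gamma>_def ..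
    also have "lc (n + m) (C w) e i = fps_const (fps_nth (w i) 0) + fps_X * lc m (el (shiftv w)) b i"
    proof -
      have "(\<Sum>k<n. fps_const (C w k) * e k i) = (\<Sum>k<n. if k = i then fps_const (fps_nth (w i) 0) else 0)"
        by (intro sum.cong refl) (auto simp: C_def e_def unitv_def)
      hence "(\<Sum>k<n. fps_const (C w k) * e k i) = fps_const (fps_nth (w i) 0)" using i by simp
      moreover have "(\<Sum>l<m. fps_const (C w (n + l)) * e (n + l) i) = fps_X * lc m (el (shiftv w)) b i"
        unfolding lc_def sum_distrib_left by (intro sum.cong refl) (simp add: C_def e_def tb_def mult_ac)
      ultimately show ?thesis unfolding lc_def[of "n + m"] sum_stack by simp
    qed
    finally have fin: "lc (n + m) (C w) z i = fps_const (fps_nth (w i) 0) + fps_X * lc m (el (shiftv w)) b i - lc m (\<gamma> w) b i" .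
    have sh: "shiftv w i = fps_shift 1 (w i)" by (simp add: shiftv_def)
    have "fps_const (fps_nth (w i) 0) + fps_X * shiftv w i = w i" unfolding sh by (rule fps_split[symmetric])
    moreover have "p + q = u \<Longrightarrow> u = (p + x - y) + (q - x) + y" for p q u x y :: "'a fps" by auto
    ultimately show ?thesis unfolding fin R_def right_diff_distrib by blast
  qed
  have Rt: "(\<lambda>i. fps_X * R w i) \<in> tL" for w by (rule tL_I[OF RL[of w]]) simp
  have CL: "lc (n + m) (C w) z \<in> L" for w by (rule L_lc) (rule zL)
  have g1: "generates (n + m) z" unfolding generates_def
  proof (intro conjI allI impI ballI zL)
    fix w assume w: "w \<in> L"
    have "(\<lambda>i. w i - lc (n + m) (C w) z i - fps_X * R w i) \<in> L"
      by (rule L_diff[OF L_diff[OF w CL] L_smult[OF RL]])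
    hence "lc m (\<gamma> w) b \<in> L" by (rule L_eq) (use key[of _ w] in \<open>simp add: algebra_simps\<close>)
    hence "\<And>l. l < m \<Longrightarrow> \<gamma> w l \<in> K" using free_indep[OF fr] by blast
    hence "lc m (\<gamma> w) b i \<in> KF K" for i by (rule L_lc_K)
    hence "(\<lambda>i. fps_X * R w i + lc m (\<gamma> w) b i) \<in> tL" by (intro tL_add Rt tL_K)
    hence "(\<lambda>i. w i - lc (n + m) (C w) z i) \<in> tL" by (rule tL_eq) (use key[of _ w] in \<open>simp add: algebra_simps\<close>)
    thus "\<exists>c. (\<lambda>i. w i - lc (n + m) c z i) \<in> tL" by blast
  qed
  \<comment> \<open>A basis vector has a unit vector as coordinates. This gives both the relation in
    \<open>g2\<close> and the equation P Q = 1 modulo \<open>K\<close>.\<close>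
  have \<gamma>K: "\<gamma> (b l) j - (if j = l then 1 else 0) \<in> K" if l: "l < m" and j: "j < m" for l j
  proof -
    have "(\<lambda>i. lc (n + m) (C (b l)) z i + fps_X * R (b l) i) \<in> L" using L_add[OF CL[of "b l"] L_smult[OF RL[of "b l"], where q = fps_X]] by simp
    hence "(\<lambda>i. - 1 * (lc (n + m) (C (b l)) z i + fps_X * R (b l) i)) \<in> L" by (rule L_smult)
    hence "lc m (\<lambda>j. \<gamma> (b l) j - (if j = l then 1 else 0)) b \<in> L"
      by (rule L_eq) (use key[of _ "b l"] in \<open>simp add: lc_diff lc_delta[OF l] algebra_simps\<close>)
    from free_indep[OF fr this j] show ?thesis .
  qed
  have g2: "lc (n + m) (C (b l)) z \<in> tL" if l: "l < m" for l
  proof -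
    have "lc m (\<lambda>j. (if j = l then 1 else 0) - \<gamma> (b l) j) b i \<in> KF K" for i
      by (rule L_lc_K) (rule cong_sym[OF \<gamma>K[OF l]])
    hence "(\<lambda>i. - 1 * (fps_X * R (b l) i) + lc m (\<lambda>j. (if j = l then 1 else 0) - \<gamma> (b l) j) b i) \<in> tL"
      by (intro tL_add tL_smult Rt tL_K)
    thus ?thesis by (rule tL_eq) (use key[of _ "b l"] in \<open>simp add: lc_diff lc_delta[OF l] algebra_simps\<close>)
  qed
  show ?thesis
  proof (rule that[OF g1])
    show "lc (n + m) (C (b l)) z \<in> tL" if "l < m" for l by (rule g2[OF that])
    fix i j assume "i < m" "j < m"
    thus "(\<Sum>k<n + m. C (b i) k * Q k j) - (if i = j then 1 else 0) \<in> K"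
      using \<gamma>K[of i j] unfolding \<gamma>_def eq_commute[of j i] by blast
  qed
qed

text \<open>Where the minor of the relations on the columns \<open>f\<close> is invertible, the
  generators with these \<open>m\<close> indices can be expressed by the others, which leaves
  \<open>n\<close> of them.\<close>

lemma eliminate:
  assumes g: "generates (n + m) z" and rel: "\<And>l. l < m \<Longrightarrow> lc (n + m) (P l) z \<in> tL"
    and f: "f \<in> minor_sets m (n + m)"
    and U: "\<And>i j. i < m \<Longrightarrow> j < m \<Longrightarrow> (\<Sum>k<m. U i k * P k (f j)) = (if i = j then s else 0)"
    and s: "v * s - 1 \<in> K"
  obtains h where "generates n h"
proof -
  define I where "I = f ` {..<m}"
  have inj: "inj_on f {..<m}" and fI: "I \<subseteq> {..<n + m}" using f by (auto simp: minor_sets_def I_def)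
  have "card ({..<n + m} - I) = n"
    using fI card_image[OF inj] by (subst card_Diff_subset) (auto simp: I_def)
  then obtain \<tau> where \<tau>: "bij_betw \<tau> {..<n} ({..<n + m} - I)"
    using ex_bij_betw_nat_finite[of "{..<n + m} - I"] by (auto simp: lessThan_atLeast0)
  define h where "h k = z (\<tau> k)" for k
  have "generates n h" unfolding generates_def
  proof (intro conjI allI impI ballI)
    fix k assume "k < n"
    hence "\<tau> k < n + m" using \<tau> by (auto simp: bij_betw_def)
    thus "h k \<in> L" using g by (simp add: generates_def h_def)
  next
    fix w assume w: "w \<in> L"
    obtain c where c: "(\<lambda>i. w i - lc (n + m) c z i) \<in> tL" using g w unfolding generates_def by blast
    \<comment> \<open>Cramer's rule: the combination of relations whose subtraction cancels the
      coefficients of \<open>c\<close> at the indices \<open>f j\<close>.\<close>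
    define y where "y l = (\<Sum>j<m. v * c (f j) * U j l)" for l
    define c' where "c' k = c k - (\<Sum>l<m. y l * P l k)" for k
    have c'f: "c' (f i) \<in> K" if i: "i < m" for i
    proof -
      have "(\<Sum>l<m. y l * P l (f i)) = (\<Sum>l<m. \<Sum>j<m. v * c (f j) * (U j l * P l (f i)))" unfolding y_def by (simp add: sum_distrib_right mult.assoc)
      also have "\<dots> = (\<Sum>j<m. v * c (f j) * (\<Sum>l<m. U j l * P l (f i)))" by (subst sum.swap) (simp add: sum_distrib_left)
      also have "\<dots> = (\<Sum>j<m. if j = i then v * c (f j) * s else 0)" by (intro sum.cong refl) (use U i in auto)
      also have "\<dots> = v * c (f i) * s" using i by simp
      finally have "c' (f i) = - ((v * s - 1) * c (f i))" by (simp add: c'_def algebra_simps)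
      thus ?thesis using K_uminus[OF K_mult2[OF s]] by simp
    qed
    have "lc m y (\<lambda>l. lc (n + m) (P l) z) \<in> tL" by (rule tL_lc) (rule rel)
    hence yz: "lc (n + m) (\<lambda>k. \<Sum>l<m. y l * P l k) z \<in> tL" unfolding lc_lc .
    have c'e: "c' = (\<lambda>k. c k - (\<Sum>l<m. y l * P l k))" by (simp add: c'_def fun_eq_iff)
    have 1: "(\<lambda>i. w i - lc (n + m) c' z i) \<in> tL"
      by (rule tL_eq[OF tL_add[OF c yz]]) (simp add: c'e lc_diff)
    have lcI: "lc (n + m) c' z i - lc n (\<lambda>k. c' (\<tau> k)) h i \<in> KF K" for i
    proof -
      have "lc (n + m) c' z i = (\<Sum>k\<in>I. fps_const (c' k) * z k i) + (\<Sum>k\<in>{..<n + m} - I. fps_const (c' k) * z k i)"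
        unfolding lc_def using sum.subset_diff[OF fI, of "\<lambda>k. fps_const (c' k) * z k i"] by (simp add: add.commute)
      also have "(\<Sum>k\<in>{..<n + m} - I. fps_const (c' k) * z k i) = lc n (\<lambda>k. c' (\<tau> k)) h i"
        unfolding lc_def h_def by (rule sum.reindex_bij_betw[OF \<tau>, symmetric])
      finally have "lc (n + m) c' z i - lc n (\<lambda>k. c' (\<tau> k)) h i = (\<Sum>k\<in>I. fps_const (c' k) * z k i)" by simp
      moreover have "(\<Sum>k\<in>I. fps_const (c' k) * z k i) \<in> KF K" by (intro F.K_sum F.K_mult2 KF_const) (auto simp: I_def c'f)
      ultimately show ?thesis by simp
    qed
    have "(\<lambda>i. (w i - lc (n + m) c' z i) + (lc (n + m) c' z i - lc n (\<lambda>k. c' (\<tau> k)) h i)) \<in> tL"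
      by (rule tL_add[OF 1 tL_K]) (rule lcI)
    thus "\<exists>c. (\<lambda>i. w i - lc n c h i) \<in> tL" by auto
  qed
  thus ?thesis using that by blast
qed

text \<open>Nakayama: iterating the division by \<open>t\<close> yields the coefficient series.\<close>

lemma generates_span:
  assumes g: "generates n h" and w: "w \<in> L"
  shows "\<exists>C. \<forall>j<n. w j - (\<Sum>i<n. C i * h i j) \<in> KF K"
proof -
  have "\<forall>w. \<exists>d w'. w \<in> L \<longrightarrow> w' \<in> L \<and> (\<forall>j<n. w j - lc n d h j - fps_X * w' j \<in> KF K)"
    using g unfolding generates_def tL_def by blast
  then obtain d w' where dw: "\<And>w. w \<in> L \<Longrightarrow> w' w \<in> L" "\<And>w j. w \<in> L \<Longrightarrow> j < n \<Longrightarrow> w j - lc n (d w) h j - fps_X * w' w j \<in> KF K" by metis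
  \<comment> \<open>\<open>W e\<close> is what remains after \<open>e\<close> divisions by t, and
    \<open>d (W e)\<close> supplies the coefficients of t^e in \<open>C\<close>.\<close>
  define W where "W e = (w' ^^ e) w" for e
  have WL: "W e \<in> L" for e by (induction e) (use w dw(1) in \<open>auto simp: W_def\<close>)
  define C where "C i = Abs_fps (\<lambda>e. d (W e) i)" for i
  define Ct where "Ct e i = (\<Sum>p<e. fps_const (d (W p) i) * fps_X ^ p)" for e i
  have step: "w j - (\<Sum>i<n. Ct e i * h i j) - fps_X ^ e * W e j \<in> KF K" if j: "j < n" for e j
  proof (induction e)
    case 0 then show ?case by (simp add: Ct_def W_def)
  next
    case (Suc e)
    have e1: "fps_X ^ e * (W e j - lc n (d (W e)) h j - fps_X * W (Suc e) j) \<in> KF K"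
      using dw(2)[OF WL j, of e] by (intro F.K_mult) (simp add: W_def)
    have CtS: "Ct (Suc e) i * h i j = Ct e i * h i j + fps_X ^ e * (fps_const (d (W e) i) * h i j)" for i
      by (simp add: Ct_def distrib_right distrib_left mult_ac)
    have e2: "(\<Sum>i<n. Ct (Suc e) i * h i j) = (\<Sum>i<n. Ct e i * h i j) + fps_X ^ e * lc n (d (W e)) h j"
      unfolding CtS sum.distrib lc_def sum_distrib_left ..
    have "w j - (\<Sum>i<n. Ct (Suc e) i * h i j) - fps_X ^ Suc e * W (Suc e) j =
      (w j - (\<Sum>i<n. Ct e i * h i j) - fps_X ^ e * W e j) + fps_X ^ e * (W e j - lc n (d (W e)) h j - fps_X * W (Suc e) j)"
      unfolding e2 by (simp add: algebra_simps)
    thus ?case using F.K_add[OF Suc e1] by (simp only:)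
  qed
  have "w j - (\<Sum>i<n. C i * h i j) \<in> KF K" if j: "j < n" for j
    unfolding KF_def
  proof (intro CollectI allI)
    fix q
    have cut: "fps_nth (C i * h i j) q = fps_nth (Ct (Suc q) i * h i j) q" for i
    proof -
      have "fps_nth (C i) p = fps_nth (Ct (Suc q) i) p" if "p \<le> q" for p
      proof -
        have "fps_nth (Ct (Suc q) i) p = (\<Sum>x<Suc q. if x = p then d (W x) i else 0)"
          unfolding Ct_def fps_sum_nth by (intro sum.cong refl) (auto simp: fps_X_power_mult_right_nth)
        thus ?thesis using that by (simp add: C_def)
      qed
      thus ?thesis unfolding fps_mult_nth by (intro sum.cong[OF refl]) auto
    qed
    have "fps_nth (w j - (\<Sum>i<n. Ct (Suc q) i * h i j) - fps_X ^ Suc q * W (Suc q) j) q \<in> K"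
      by (rule KF_nth[OF step[OF j, of "Suc q"]])
    moreover have "fps_nth (fps_X ^ Suc q * W (Suc q) j) q = 0" by (simp only: fps_X_power_mult_nth lessI if_True)
    ultimately show "fps_nth (w j - (\<Sum>i<n. C i * h i j)) q \<in> K" by (simp only: fps_sub_nth fps_sum_nth cut diff_zero)
  qed
  thus ?thesis by (intro exI[of _ C]) auto
qed

text \<open>Since the rows of \<open>h\<close> generate, t^N = k h for some \<open>k\<close>, and
  then h k = t^N as well because t^N can be cancelled. A vector C h satisfies (C h) k = t^N C;
  conversely, if w k = t^N C then cancelling t^N after multiplication by \<open>h\<close> gives w =
  C h.\<close>

lemma generates_matlat:
  assumes g: "generates n h"
  obtains N k where
    "\<And>i j. i < n \<Longrightarrow> j < n \<Longrightarrow> (\<Sum>l<n. k i l * h l j) - (if i = j then fps_X ^ N else 0) \<in> KF K"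
    "\<And>i j. i < n \<Longrightarrow> j < n \<Longrightarrow> (\<Sum>l<n. h i l * k l j) - (if i = j then fps_X ^ N else 0) \<in> KF K"
    "L = matlat K n N k"
proof -
  obtain N where N: "\<And>w. (\<lambda>i. fps_X ^ N * w i) \<in> L" using L_X by blast
  have "\<forall>i. \<exists>C. \<forall>j<n. fps_X ^ N * unitv i j - (\<Sum>l<n. C l * h l j) \<in> KF K"
  proof
    fix i show "\<exists>C. \<forall>j<n. fps_X ^ N * unitv i j - (\<Sum>l<n. C l * h l j) \<in> KF K"
      using generates_span[OF g N[of "unitv i"]] by simp
  qed
  from choice[OF this] obtain k where k: "\<And>i j. j < n \<Longrightarrow> fps_X ^ N * unitv i j - (\<Sum>l<n. k i l * h l j) \<in> KF K" by blast
  have kh: "(\<Sum>l<n. k i l * h l j) - (if i = j then fps_X ^ N else 0) \<in> KF K" if "i < n" "j < n" for i j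
  proof -
    have u: "fps_X ^ N * unitv i j = (if i = j then fps_X ^ N else 0)" unfolding unitv_def by (cases "i = j") simp_all
    show ?thesis using F.cong_sym[OF k[OF that(2), of i]] unfolding u .
  qed
  have hk: "(\<Sum>l<n. h i l * k l j) - (if i = j then fps_X ^ N else 0) \<in> KF K" if "i < n" "j < n" for i j
    by (rule F.left_right_inverse[OF kh _ that]) (auto simp: KF_X)
  have del: "(\<Sum>i<n. q i * (if i = j then fps_X ^ N else 0)) = fps_X ^ N * q j" if "j < n" for q :: "nat \<Rightarrow> 'a fps" and j
    by (rule sum_pick[OF that])
  have assoc: "(\<Sum>l<n. (\<Sum>i<n. C i * x i l) * y l j) - fps_X ^ N * C j \<in> KF K"
    if xy: "\<And>i j. i < n \<Longrightarrow> j < n \<Longrightarrow> (\<Sum>l<n. x i l * y l j) - (if i = j then fps_X ^ N else 0) \<in> KF K" and j: "j < n"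
    for C :: "nat \<Rightarrow> 'a fps" and x y j
  proof -
    have e: "(\<Sum>l<n. (\<Sum>i<n. C i * x i l) * y l j) = (\<Sum>i<n. C i * (\<Sum>l<n. x i l * y l j))" by (rule sum_assoc)
    have "(\<Sum>i<n. C i * (\<Sum>l<n. x i l * y l j)) - (\<Sum>i<n. C i * (if i = j then fps_X ^ N else 0)) \<in> KF K"
    proof (rule F.cong_sum)
      fix i assume "i \<in> {..<n}"
      hence "C i * ((\<Sum>l<n. x i l * y l j) - (if i = j then fps_X ^ N else 0)) \<in> KF K" using xy j by (intro F.K_mult) auto
      thus "C i * (\<Sum>l<n. x i l * y l j) - C i * (if i = j then fps_X ^ N else 0) \<in> KF K" by (simp only: right_diff_distrib)
    qed
    thus ?thesis unfolding e del[OF j] .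
  qed
  have LL: "L = matlat K n N k"
  proof (rule subset_antisym; rule subsetI)
    fix w assume "w \<in> L"
    from generates_span[OF g this]
    obtain C where C: "\<And>j. j < n \<Longrightarrow> w j - (\<Sum>i<n. C i * h i j) \<in> KF K" by blast
    show "w \<in> matlat K n N k" unfolding matlat_def
    proof (intro CollectI allI impI)
      fix j q assume j: "j < n" and q: "q < N"
      have "(\<Sum>l<n. w l * k l j) - (\<Sum>l<n. (\<Sum>i<n. C i * h i l) * k l j) \<in> KF K"
        by (rule F.cong_sum, rule F.cong_mult) (use C in auto)
      hence "(\<Sum>l<n. w l * k l j) - fps_X ^ N * C j \<in> KF K" by (rule F.cong_trans[OF _ assoc[OF hk j]])
      hence "fps_nth ((\<Sum>l<n. w l * k l j) - fps_X ^ N * C j) q \<in> K" by (rule KF_nth)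
      thus "fps_nth (\<Sum>i<n. w i * k i j) q \<in> K" using q by (simp add: fps_X_power_mult_nth)
    qed
  next
    fix w assume w: "w \<in> matlat K n N k"
    define u where "u j = (\<Sum>i<n. w i * k i j)" for j
    define C where "C j = fps_shift N (u j)" for j
    have uC: "u j - fps_X ^ N * C j \<in> KF K" if j: "j < n" for j
      unfolding KF_def using w j by (auto simp: matlat_def u_def[symmetric] C_def fps_X_power_mult_nth)
    have CL: "(\<lambda>j. \<Sum>i<n. C i * h i j) \<in> L"
      using L_sum[of "{..<n}" "\<lambda>i j. C i * h i j"] L_smult g unfolding generates_def by auto
    show "w \<in> L"
    proof (rule L_cong[OF CL])
      fix j assume j: "j < n"
      have 1: "(\<Sum>l<n. u l * h l j) - fps_X ^ N * w j \<in> KF K" unfolding u_def by (rule assoc[OF kh j])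
      have "(\<Sum>l<n. u l * h l j) - (\<Sum>l<n. fps_X ^ N * C l * h l j) \<in> KF K"
        by (rule F.cong_sum, rule F.cong_mult) (use uC in auto)
      from F.cong_trans[OF F.cong_sym[OF 1] this]
      have "fps_X ^ N * (w j - (\<Sum>l<n. C l * h l j)) \<in> KF K" by (simp add: right_diff_distrib sum_distrib_left mult.assoc)
      thus "w j - (\<Sum>i<n. C i * h i j) \<in> KF K" by (simp only: KF_X)
    qed
  qed
  show ?thesis by (rule that[OF _ _ LL], erule (1) kh, erule (1) hk)
qed

end

subsection \<open>Base change of lattices\<close>

definition mapf :: "('a::comm_ring_1 \<Rightarrow> 'b::comm_ring_1) \<Rightarrow> 'a fps \<Rightarrow> 'b fps" where
  "mapf \<sigma> f = Abs_fps (\<lambda>j. \<sigma> (fps_nth f j))"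

lemma mapf_nth [simp]: "fps_nth (mapf \<sigma> f) j = \<sigma> (fps_nth f j)" by (simp add: mapf_def)

lemma (in comm_ring_hom) mapf_simps:
  shows "mapf hom 0 = 0" "mapf hom 1 = 1" "mapf hom (f + g) = mapf hom f + mapf hom g"
    "mapf hom (f - g) = mapf hom f - mapf hom g" "mapf hom (f * g) = mapf hom f * mapf hom g"
    "mapf hom (fps_const c) = fps_const (hom c)" "mapf hom (fps_X ^ N) = fps_X ^ N" "mapf hom fps_X = fps_X"
    "mapf hom (fps_shift N f) = fps_shift N (mapf hom f)"
  by (rule fps_ext; simp add: hom_distribs fps_mult_nth fps_X_power_nth fps_X_nth)+

lemma (in comm_ring_hom) mapf_sum: "mapf hom (sum f I) = (\<Sum>i\<in>I. mapf hom (f i))"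
  by (induction I rule: infinite_finite_induct) (auto simp: mapf_simps)

text \<open>Multiplication by x on remainders modulo f, that is, x^n is replaced by the sum of the
  a_i x^i; equivalently the row vector \<open>w\<close> times the companion matrix.\<close>

definition xmul :: "(nat \<Rightarrow> 'a::comm_ring_1 fps) \<Rightarrow> nat \<Rightarrow> (nat \<Rightarrow> 'a fps) \<Rightarrow> nat \<Rightarrow> 'a fps" where
  "xmul a n w = (\<lambda>i. (if i = 0 then 0 else w (i - 1)) + a i * w (n - 1))"

text \<open>The base change of \<open>L\<close>. Only constants appear as multipliers, so inductions
  over the rules stay finite; the power series act nevertheless, because \<open>high\<close>
  supplies everything divisible by t^N.\<close>

inductive_set ext :: "('a::comm_ring_1 \<Rightarrow> 'b::comm_ring_1) \<Rightarrow> 'b set \<Rightarrow> nat \<Rightarrow> nat \<Rightarrow> (nat \<Rightarrow> 'a fps) set \<Rightarrow> (nat \<Rightarrow> 'b fps) set"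
  for \<sigma> K' n N L where
  base: "w \<in> L \<Longrightarrow> (\<lambda>i. mapf \<sigma> (w i)) \<in> ext \<sigma> K' n N L"
| kern: "(\<And>i. i < n \<Longrightarrow> w i \<in> KF K') \<Longrightarrow> w \<in> ext \<sigma> K' n N L"
| high: "(\<lambda>i. fps_X ^ N * w i) \<in> ext \<sigma> K' n N L"
| add: "w \<in> ext \<sigma> K' n N L \<Longrightarrow> w' \<in> ext \<sigma> K' n N L \<Longrightarrow> (\<lambda>i. w i + w' i) \<in> ext \<sigma> K' n N L"
| scal: "w \<in> ext \<sigma> K' n N L \<Longrightarrow> (\<lambda>i. fps_const c * w i) \<in> ext \<sigma> K' n N L"

lemma fps_trunc: "q = (\<Sum>e<N. fps_const (fps_nth q e) * fps_X ^ e) + fps_X ^ N * fps_shift N q" for q :: "'a::comm_ring_1 fps"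
proof (rule fps_ext)
  fix j
  have "(\<Sum>e<N. fps_nth (fps_const (fps_nth q e) * fps_X ^ e) j) = (\<Sum>e<N. if e = j then fps_nth q j else 0)"
    by (intro sum.cong refl) (auto simp: fps_X_power_nth)
  thus "fps_nth q j = fps_nth ((\<Sum>e<N. fps_const (fps_nth q e) * fps_X ^ e) + fps_X ^ N * fps_shift N q) j"
    by (auto simp: fps_sum_nth fps_X_power_mult_nth)
qed

locale base_change = lattice0 K n L + \<sigma>: comm_ring_hom \<sigma> + K': coeff_ideal K'
  for K :: "'a::comm_ring_1 set" and n L and \<sigma> :: "'a \<Rightarrow> 'b::comm_ring_1" and K' :: "'b set" +
  fixes N :: nat
  assumes \<sigma>K: "x \<in> K \<Longrightarrow> \<sigma> x \<in> K'" and highL: "\<And>w. (\<lambda>i. fps_X ^ N * w i) \<in> L"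
begin

abbreviation "E \<equiv> ext \<sigma> K' n N L"

sublocale F': coeff_ideal "KF K'" by (rule K'.coeff_ideal_KF)

lemmas E_base = ext.base[where \<sigma> = \<sigma> and K' = K' and n = n and N = N and L = L]
  and E_kern = ext.kern[where \<sigma> = \<sigma> and K' = K' and n = n and N = N and L = L]
  and E_high = ext.high[where \<sigma> = \<sigma> and K' = K' and n = n and N = N and L = L]
  and E_add = ext.add[where \<sigma> = \<sigma> and K' = K' and n = n and N = N and L = L]
  and E_scal = ext.scal[where \<sigma> = \<sigma> and K' = K' and n = n and N = N and L = L]

lemma mapf_KF: "f \<in> KF K \<Longrightarrow> mapf \<sigma> f \<in> KF K'" by (simp add: KF_def \<sigma>K)

lemma E_eq: assumes "w \<in> E" "\<And>i. i < n \<Longrightarrow> w' i = w i" shows "w' \<in> E"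
proof -
  have "(\<lambda>i. w' i - w i) \<in> E" by (rule E_kern) (simp add: assms(2))
  from E_add[OF assms(1) this] show ?thesis by simp
qed

lemma E_0: "(\<lambda>i. 0) \<in> E" by (rule E_kern) simp

lemma E_sum: "(\<And>x. x \<in> I \<Longrightarrow> b x \<in> E) \<Longrightarrow> (\<lambda>i. \<Sum>x\<in>I. b x i) \<in> E"
  by (induction I rule: infinite_finite_induct) (auto intro: E_0 E_add)

lemma E_X: "w \<in> E \<Longrightarrow> (\<lambda>i. fps_X * w i) \<in> E"
proof (induction rule: ext.induct)
  case (base w)
  show ?case using E_base[OF L_smult[OF base, of fps_X]] by (simp add: \<sigma>.mapf_simps)
next
  case (kern w)
  show ?case by (rule E_kern) (use kern in \<open>simp add: F'.K_mult\<close>)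
next
  case (high w)
  show ?case using E_high[where w = "\<lambda>i. fps_X * w i"] by (simp add: mult.left_commute)
next
  case (add w w')
  show ?case using E_add[OF add.IH] by (simp add: distrib_left)
next
  case (scal w c)
  show ?case using E_scal[OF scal.IH, of c] by (simp add: mult.left_commute)
qed

lemma E_Xp: "w \<in> E \<Longrightarrow> (\<lambda>i. fps_X ^ e * w i) \<in> E"
proof (induction e)
  case (Suc e)
  show ?case using E_X[OF Suc.IH[OF Suc.prems]] by (simp add: mult.assoc)
qed simp

text \<open>Cut \<open>q\<close> at t^N: the lower terms form a finite combination of powers of t,
  and the rest is an instance of \<open>high\<close>.\<close>

lemma E_smult: assumes w: "w \<in> E" shows "(\<lambda>i. q * w i) \<in> E"
proof -
  have "(\<lambda>i. \<Sum>e<N. fps_const (fps_nth q e) * (fps_X ^ e * w i)) \<in> E" by (intro E_sum E_scal E_Xp w)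
  from E_add[OF this E_high[where w = "\<lambda>i. fps_shift N q * w i"]]
  have "(\<lambda>i. ((\<Sum>e<N. fps_const (fps_nth q e) * fps_X ^ e) + fps_X ^ N * fps_shift N q) * w i) \<in> E"
    by (simp add: distrib_right sum_distrib_right mult.assoc)
  thus ?thesis unfolding fps_trunc[symmetric] .
qed

lemma lattice0_E: "lattice0 K' n E"
  by (intro lattice0.intro lattice0_axioms.intro K'.coeff_ideal_axioms)
    (auto intro: E_add E_smult E_kern E_high)

sublocale L': lattice0 K' n E by (rule lattice0_E)

lemma E_xmul:
  assumes a: "\<And>w. w \<in> L \<Longrightarrow> xmul a n w \<in> L" and n: "n \<ge> 1" and w: "w \<in> E"
  shows "xmul (\<lambda>i. mapf \<sigma> (a i)) n w \<in> E"
  using w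
proof (induction rule: ext.induct)
  case (base w)
  have e: "(\<lambda>i. mapf \<sigma> (xmul a n w i)) = xmul (\<lambda>i. mapf \<sigma> (a i)) n (\<lambda>i. mapf \<sigma> (w i))"
    by (auto simp: xmul_def \<sigma>.mapf_simps)
  show ?case using E_base[OF a[OF base]] unfolding e .
next
  case (kern w)
  show ?case by (rule E_kern) (use kern n in \<open>auto simp: xmul_def intro!: F'.K_add F'.K_mult\<close>)
next
  case (high w)
  have e: "(\<lambda>i. fps_X ^ N * xmul (\<lambda>i. mapf \<sigma> (a i)) n w i) = xmul (\<lambda>i. mapf \<sigma> (a i)) n (\<lambda>i. fps_X ^ N * w i)"
    by (auto simp: xmul_def algebra_simps)
  show ?case unfolding e[symmetric] by (rule E_high)
next
  case (add w w')
  have e: "(\<lambda>i. xmul (\<lambda>i. mapf \<sigma> (a i)) n w i + xmul (\<lambda>i. mapf \<sigma> (a i)) n w' i) = xmul (\<lambda>i. mapf \<sigma> (a i)) n (\<lambda>i. w i + w' i)"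
    by (auto simp: xmul_def algebra_simps)
  show ?case using E_add[OF add.IH] unfolding e .
next
  case (scal w c)
  have e: "(\<lambda>i. fps_const c * xmul (\<lambda>i. mapf \<sigma> (a i)) n w i) = xmul (\<lambda>i. mapf \<sigma> (a i)) n (\<lambda>i. fps_const c * w i)"
    by (auto simp: xmul_def algebra_simps)
  show ?case using E_scal[OF scal.IH, of c] unfolding e .
qed

lemma mapf_lc: "(\<lambda>i. mapf \<sigma> (lc m c b i)) = lc m (\<lambda>l. \<sigma> (c l)) (\<lambda>l i. mapf \<sigma> (b l i))"
  by (auto simp: lc_def \<sigma>.mapf_sum \<sigma>.mapf_simps)

lemma tL_base: assumes "w \<in> tL" shows "(\<lambda>i. mapf \<sigma> (w i)) \<in> L'.tL"
proof -
  obtain u where u: "u \<in> L" "\<And>i. i < n \<Longrightarrow> w i - fps_X * u i \<in> KF K" using assms unfolding tL_def by blast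
  show ?thesis by (rule L'.tL_I[OF E_base[OF u(1)]]) (use mapf_KF[OF u(2)] in \<open>simp add: \<sigma>.mapf_simps\<close>)
qed

text \<open>The exponent of the rule \<open>high\<close> is one larger than one that already works
  for \<open>L\<close>. This leaves a factor t, so that the vectors added by \<open>high\<close> are
  zero in the quotient of the extended lattice by t times itself.\<close>

lemma generates_base:
  assumes g: "generates p z" and M: "N = Suc M" "\<And>w. (\<lambda>i. fps_X ^ M * w i) \<in> L"
  shows "L'.generates p (\<lambda>k i. mapf \<sigma> (z k i))"
  unfolding L'.generates_def
proof (intro conjI allI impI ballI)
  fix k assume "k < p"
  thus "(\<lambda>i. mapf \<sigma> (z k i)) \<in> E" using g by (auto simp: generates_def intro: E_base)
next
  let ?z = "\<lambda>k i. mapf \<sigma> (z k i)"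
  fix w assume "w \<in> E"
  thus "\<exists>c. (\<lambda>i. w i - lc p c ?z i) \<in> L'.tL"
  proof (induction rule: ext.induct)
    case (base w)
    obtain c where "(\<lambda>i. w i - lc p c z i) \<in> tL" using g base unfolding generates_def by blast
    from tL_base[OF this] have "(\<lambda>i. mapf \<sigma> (w i) - lc p (\<lambda>l. \<sigma> (c l)) ?z i) \<in> L'.tL"
      unfolding \<sigma>.mapf_simps using fun_cong[OF mapf_lc[of p c z]] by simp
    thus ?case by blast
  next
    case (kern w)
    have "(\<lambda>i. w i - lc p (\<lambda>_. 0) ?z i) \<in> L'.tL" by (rule L'.tL_K) (simp add: lc_def kern)
    thus ?case by blast
  next
    case (high w)
    \<comment> \<open>t^M w lies in the extended lattice: the constant term of \<open>w\<close> is a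
      combination of unit vectors, for which t^M e_k comes from \<open>L\<close>, and the remaining
      part is an instance of \<open>high\<close>.\<close>
    have "(\<lambda>i. \<Sum>k<n. fps_const (fps_nth (w k) 0) * mapf \<sigma> (fps_X ^ M * unitv k i)) \<in> E"
      by (intro E_sum E_scal E_base M(2))
    moreover have "(\<lambda>i. fps_X ^ N * shiftv w i) \<in> E" by (rule E_high)
    ultimately have s: "(\<lambda>i. (\<Sum>k<n. fps_const (fps_nth (w k) 0) * mapf \<sigma> (fps_X ^ M * unitv k i)) + fps_X ^ N * shiftv w i) \<in> E" by (rule E_add)
    have sp: "p * u = c * p + fps_X * p * v" if "u = c + fps_X * v" for p u c v :: "'b fps"
      unfolding that by (simp add: algebra_simps)
    have "(\<lambda>i. fps_X ^ M * w i) \<in> E"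
    proof (rule E_eq[OF s])
      fix i assume i: "i < n"
      have "(\<Sum>k<n. fps_const (fps_nth (w k) 0) * mapf \<sigma> (fps_X ^ M * unitv k i)) = (\<Sum>k<n. if k = i then fps_const (fps_nth (w i) 0) * fps_X ^ M else 0)"
        by (intro sum.cong refl) (auto simp: unitv_def \<sigma>.mapf_simps)
      also have "\<dots> = fps_const (fps_nth (w i) 0) * fps_X ^ M" using i by simp
      finally show "fps_X ^ M * w i = (\<Sum>k<n. fps_const (fps_nth (w k) 0) * mapf \<sigma> (fps_X ^ M * unitv k i)) + fps_X ^ N * shiftv w i"
        unfolding M(1) power_Suc using sp[OF fps_split[of "w i"], of "fps_X ^ M"] by (simp only: shiftv_def)
    qed
    hence "(\<lambda>i. fps_X ^ N * w i - lc p (\<lambda>_. 0) ?z i) \<in> L'.tL" by (rule L'.tL_I) (simp add: lc_def M(1) mult.assoc)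
    thus ?case by blast
  next
    case (add w w')
    obtain c c' where c: "(\<lambda>i. w i - lc p c ?z i) \<in> L'.tL" "(\<lambda>i. w' i - lc p c' ?z i) \<in> L'.tL" using add.IH by blast
    have "(\<lambda>i. w i + w' i - lc p (\<lambda>l. c l + c' l) ?z i) \<in> L'.tL" using L'.tL_add[OF c] by (simp add: lc_add algebra_simps)
    thus ?case by blast
  next
    case (scal w x)
    obtain c where c: "(\<lambda>i. w i - lc p c ?z i) \<in> L'.tL" using scal.IH by blast
    have "(\<lambda>i. fps_const x * w i - lc p (\<lambda>l. x * c l) ?z i) \<in> L'.tL" using L'.tL_smult[OF c, of "fps_const x"] by (simp add: lc_smult right_diff_distrib)
    thus ?case by blast
  qed
qed

text \<open>The quotient is spanned by the finitely many t^j e_i with j < N, so a coordinate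
  formula, valid up to a power of \<open>s\<close>, can be fixed on these and pushed forward along
  \<open>\<sigma>\<close>. Independence after base change follows from two facts: coordinates of
  elements of \<open>E\<close> vanish up to powers of \<open>s\<close>, and those of the b_l are s^M
  times unit vectors, again up to powers of \<open>s\<close>.\<close>

lemma lfree_base:
  assumes l: "lfree m s b"
  shows "L'.lfree m (\<sigma> s) (\<lambda>l i. mapf \<sigma> (b l i))"
proof -
  let ?b = "\<lambda>l i. mapf \<sigma> (b l i)"
  define \<tau> where "\<tau> i j = (\<lambda>x. fps_X ^ j * unitv i x :: 'a fps)" for i j
  have "\<forall>ij. \<exists>k c. eqv (\<lambda>x. fps_const (s ^ k) * \<tau> (fst ij) (snd ij) x) (lc m c b)" using l unfolding lfree_def by blast
  then obtain k0 c0 where kc: "\<And>ij. eqv (\<lambda>x. fps_const (s ^ k0 ij) * \<tau> (fst ij) (snd ij) x) (lc m (c0 ij) b)" by metis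
  \<comment> \<open>One exponent that clears the denominators of all n N expansions.\<close>
  define M where "M = (\<Sum>i<n. \<Sum>j<N. k0 (i, j))"
  have kM: "k0 (i, j) \<le> M" if "i < n" "j < N" for i j
  proof -
    have "k0 (i, j) \<le> (\<Sum>j<N. k0 (i, j))" using that by (intro member_le_sum) auto
    also have "\<dots> \<le> M" unfolding M_def using that by (intro member_le_sum[of i "{..<n}" "\<lambda>i. \<Sum>j<N. k0 (i, j)"]) auto
    finally show ?thesis .
  qed
  define C where "C i j l = s ^ (M - k0 (i, j)) * c0 (i, j) l" for i j l
  have c: "eqv (\<lambda>x. fps_const (s ^ M) * \<tau> i j x) (lc m (C i j) b)" if ij: "i < n" "j < N" for i j
  proof -
    have "s ^ (M - k0 (i, j)) * s ^ k0 (i, j) = s ^ M" using kM[OF ij] by (simp flip: power_add)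
    hence e: "fps_const (s ^ (M - k0 (i, j))) * (fps_const (s ^ k0 (i, j)) * y) = fps_const (s ^ M) * y" for y
      by (simp only: mult.assoc[symmetric] fps_const_mult)
    show ?thesis using eqv_smult[OF kc[of "(i, j)"], of "fps_const (s ^ (M - k0 (i, j)))"]
      unfolding C_def lc_smult_fun fst_conv snd_conv e .
  qed
  \<comment> \<open>Only coefficients below t^N matter in the quotient, so the coordinates of s^M w
    are a finite linear formula with the constants \<open>C\<close>. \<open>el'\<close> is the same
    formula with their images under \<open>\<sigma>\<close>.\<close>
  define el where "el w l = (\<Sum>i<n. \<Sum>j<N. fps_nth (w i) j * C i j l)" for w :: "nat \<Rightarrow> 'a fps" and l
  define el' where "el' w l = (\<Sum>i<n. \<Sum>j<N. fps_nth (w i) j * \<sigma> (C i j l))" for w :: "nat \<Rightarrow> 'b fps" and l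
  have dec: "w i = (\<Sum>x<n. \<Sum>j<N. fps_const (fps_nth (w x) j) * (fps_X ^ j * unitv x i)) + fps_X ^ N * fps_shift N (w i)"
    if "i < n" for w :: "nat \<Rightarrow> 'c::comm_ring_1 fps" and i
  proof -
    have "(\<Sum>x<n. \<Sum>j<N. fps_const (fps_nth (w x) j) * (fps_X ^ j * unitv x i)) = (\<Sum>x<n. if x = i then \<Sum>j<N. fps_const (fps_nth (w i) j) * fps_X ^ j else 0)"
      by (intro sum.cong refl) (auto simp: unitv_def)
    also have "\<dots> = (\<Sum>j<N. fps_const (fps_nth (w i) j) * fps_X ^ j)" using that by simp
    finally show ?thesis using fps_trunc[of "w i" N] by simp
  qed
  have eqvel: "eqv (\<lambda>x. fps_const (s ^ M) * w x) (lc m (el w) b)" for w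
  proof -
    have "(\<lambda>x. \<Sum>i<n. \<Sum>j<N. fps_const (fps_nth (w i) j) * (fps_const (s ^ M) * \<tau> i j x - lc m (C i j) b x)) \<in> L"
      by (intro L_sum L_smult) (use c in \<open>auto simp: eqv_def\<close>)
    from L_add[OF this highL[of "\<lambda>x. fps_const (s ^ M) * fps_shift N (w x)"]]
    show ?thesis unfolding eqv_def
    proof (rule L_eq)
      fix x assume x: "x < n"
      have "lc m (el w) b x = (\<Sum>l<m. \<Sum>i<n. \<Sum>j<N. fps_const (fps_nth (w i) j) * (fps_const (C i j l) * b l x))"
        unfolding lc_def el_def fps_const_sum sum_distrib_right by (simp add: mult.assoc flip: fps_const_mult)
      also have "\<dots> = (\<Sum>i<n. \<Sum>l<m. \<Sum>j<N. fps_const (fps_nth (w i) j) * (fps_const (C i j l) * b l x))" by (rule sum.swap)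
      also have "\<dots> = (\<Sum>i<n. \<Sum>j<N. \<Sum>l<m. fps_const (fps_nth (w i) j) * (fps_const (C i j l) * b l x))"
        by (rule sum.cong[OF refl]) (rule sum.swap)
      also have "\<dots> = (\<Sum>i<n. \<Sum>j<N. fps_const (fps_nth (w i) j) * lc m (C i j) b x)"
        unfolding lc_def sum_distrib_left ..
      finally have e1: "lc m (el w) b x = (\<Sum>i<n. \<Sum>j<N. fps_const (fps_nth (w i) j) * lc m (C i j) b x)" .
      have e2: "fps_const (s ^ M) * w x = (\<Sum>i<n. \<Sum>j<N. fps_const (fps_nth (w i) j) * (fps_const (s ^ M) * \<tau> i j x)) + fps_X ^ N * (fps_const (s ^ M) * fps_shift N (w x))"
        by (subst dec[OF x, of w]) (simp add: \<tau>_def distrib_left sum_distrib_left mult.left_commute)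
      show "fps_const (s ^ M) * w x - lc m (el w) b x =
        (\<Sum>i<n. \<Sum>j<N. fps_const (fps_nth (w i) j) * (fps_const (s ^ M) * \<tau> i j x - lc m (C i j) b x)) + fps_X ^ N * (fps_const (s ^ M) * fps_shift N (w x))"
        unfolding e1 e2 by (simp add: right_diff_distrib sum_subtractf)
    qed
  qed
  have eqvel': "L'.eqv (\<lambda>x. fps_const (\<sigma> s ^ M) * w x) (lc m (el' w) ?b)" for w
  proof -
    have "(\<lambda>x. mapf \<sigma> (fps_const (s ^ M) * \<tau> i j x - lc m (C i j) b x)) \<in> E" if "i < n" "j < N" for i j
      by (rule E_base) (use c[OF that] in \<open>simp add: eqv_def\<close>)
    hence "(\<lambda>x. \<Sum>i<n. \<Sum>j<N. fps_const (fps_nth (w i) j) * mapf \<sigma> (fps_const (s ^ M) * \<tau> i j x - lc m (C i j) b x)) \<in> E"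
      by (intro E_sum E_scal) auto
    from E_add[OF this E_high[where w = "\<lambda>x. fps_const (\<sigma> s ^ M) * fps_shift N (w x)"]]
    show ?thesis unfolding L'.eqv_def
    proof (rule E_eq)
      fix x assume x: "x < n"
      have "lc m (el' w) ?b x = (\<Sum>l<m. \<Sum>i<n. \<Sum>j<N. fps_const (fps_nth (w i) j) * (fps_const (\<sigma> (C i j l)) * ?b l x))"
        unfolding lc_def el'_def fps_const_sum sum_distrib_right by (simp add: mult.assoc flip: fps_const_mult)
      also have "\<dots> = (\<Sum>i<n. \<Sum>l<m. \<Sum>j<N. fps_const (fps_nth (w i) j) * (fps_const (\<sigma> (C i j l)) * ?b l x))" by (rule sum.swap)
      also have "\<dots> = (\<Sum>i<n. \<Sum>j<N. \<Sum>l<m. fps_const (fps_nth (w i) j) * (fps_const (\<sigma> (C i j l)) * ?b l x))"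
        by (rule sum.cong[OF refl]) (rule sum.swap)
      also have "\<dots> = (\<Sum>i<n. \<Sum>j<N. fps_const (fps_nth (w i) j) * lc m (\<lambda>l. \<sigma> (C i j l)) ?b x)"
        unfolding lc_def sum_distrib_left ..
      also have "\<dots> = (\<Sum>i<n. \<Sum>j<N. fps_const (fps_nth (w i) j) * mapf \<sigma> (lc m (C i j) b x))"
        using fun_cong[OF mapf_lc[of m _ b]] by simp
      finally have e1: "lc m (el' w) ?b x = (\<Sum>i<n. \<Sum>j<N. fps_const (fps_nth (w i) j) * mapf \<sigma> (lc m (C i j) b x))" .
      have \<tau>': "mapf \<sigma> (fps_const (s ^ M) * \<tau> i j x) = fps_const (\<sigma> s ^ M) * (fps_X ^ j * unitv i x)" for i j
        by (auto simp: \<tau>_def unitv_def \<sigma>.mapf_simps \<sigma>.hom_power)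
      have e2: "fps_const (\<sigma> s ^ M) * w x = (\<Sum>i<n. \<Sum>j<N. fps_const (fps_nth (w i) j) * mapf \<sigma> (fps_const (s ^ M) * \<tau> i j x)) + fps_X ^ N * (fps_const (\<sigma> s ^ M) * fps_shift N (w x))"
        unfolding \<tau>' by (subst dec[OF x, of w]) (simp add: distrib_left sum_distrib_left mult.left_commute)
      show "fps_const (\<sigma> s ^ M) * w x - lc m (el' w) ?b x =
        (\<Sum>i<n. \<Sum>j<N. fps_const (fps_nth (w i) j) * mapf \<sigma> (fps_const (s ^ M) * \<tau> i j x - lc m (C i j) b x)) + fps_X ^ N * (fps_const (\<sigma> s ^ M) * fps_shift N (w x))"
        unfolding e1 e2 by (simp add: right_diff_distrib sum_subtractf \<sigma>.mapf_simps(4))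
    qed
  qed
  have ind: "\<exists>k. \<forall>l<m. s ^ k * c l \<in> K" if "lc m c b \<in> L" for c
  proof -
    have "\<forall>l. \<exists>k. l < m \<longrightarrow> s ^ k * c l \<in> K" using l that unfolding lfree_def by blast
    then obtain k where k: "\<And>l. l < m \<Longrightarrow> s ^ k l * c l \<in> K" by metis
    have "s ^ (\<Sum>l<m. k l) * c l \<in> K" if l: "l < m" for l
    proof -
      have "k l \<le> (\<Sum>l<m. k l)" using l by (intro member_le_sum) auto
      hence "s ^ (\<Sum>l<m. k l) * c l = s ^ ((\<Sum>l<m. k l) - k l) * (s ^ k l * c l)" by (simp flip: power_add mult.assoc)
      thus ?thesis using K_mult[OF k[OF l]] by simp
    qed
    thus ?thesis by blast
  qed
  have elL: "\<exists>k. \<forall>l<m. s ^ k * el w l \<in> K" if "w \<in> L" for w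
    using ind eqv_mem[OF eqvel[of w]] L_smult[OF that] by blast
  \<comment> \<open>Since \<open>el'\<close> is linear, it suffices to follow the rules that
    generate \<open>E\<close>; for an image of an element of \<open>L\<close> the claim is the image
    of \<open>elL\<close>.\<close>
  have elE: "\<exists>k. \<forall>l<m. \<sigma> s ^ k * el' w l \<in> K'" if "w \<in> E" for w
    using that
  proof (induction rule: ext.induct)
    case (base w)
    obtain k where k: "\<forall>l<m. s ^ k * el w l \<in> K" using elL[OF base] by blast
    have "\<sigma> (el w l) = el' (\<lambda>i. mapf \<sigma> (w i)) l" for l by (simp add: el_def el'_def hom_distribs)
    hence "\<sigma> s ^ k * el' (\<lambda>i. mapf \<sigma> (w i)) l = \<sigma> (s ^ k * el w l)" for l by (simp add: \<sigma>.hom_mult \<sigma>.hom_power)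
    thus ?case using k \<sigma>K by metis
  next
    case (kern w)
    have "\<sigma> s ^ 0 * el' w l \<in> K'" for l unfolding el'_def
      by (intro K'.K_mult K'.K_sum K'.K_mult2) (use kern in \<open>auto simp: KF_def\<close>)
    thus ?case by blast
  next
    case (high w)
    have "\<sigma> s ^ 0 * el' (\<lambda>i. fps_X ^ N * w i) l = 0" for l by (simp add: el'_def fps_X_power_mult_nth)
    thus ?case using K'.K0 by metis
  next
    case (add w w')
    obtain k k' where k: "\<forall>l<m. \<sigma> s ^ k * el' w l \<in> K'" "\<forall>l<m. \<sigma> s ^ k' * el' w' l \<in> K'" using add.IH by blast
    have "\<sigma> s ^ (k + k') * el' (\<lambda>i. w i + w' i) l = \<sigma> s ^ k' * (\<sigma> s ^ k * el' w l) + \<sigma> s ^ k * (\<sigma> s ^ k' * el' w' l)" for l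
      by (simp add: el'_def distrib_right sum.distrib distrib_left power_add mult_ac)
    hence "\<forall>l<m. \<sigma> s ^ (k + k') * el' (\<lambda>i. w i + w' i) l \<in> K'" using k K'.K_add K'.K_mult by simp
    thus ?case by blast
  next
    case (scal w x)
    obtain k where k: "\<forall>l<m. \<sigma> s ^ k * el' w l \<in> K'" using scal.IH by blast
    have "\<sigma> s ^ k * el' (\<lambda>i. fps_const x * w i) l = x * (\<sigma> s ^ k * el' w l)" for l
      by (simp add: el'_def sum_distrib_left mult_ac)
    hence "\<forall>l<m. \<sigma> s ^ k * el' (\<lambda>i. fps_const x * w i) l \<in> K'" using k K'.K_mult by simp
    thus ?case by blast
  qed
  \<comment> \<open>Both \<open>el (b l)\<close> and s^M times the l-th unit vector are coordinates
    of s^M b_l, so their difference is a relation.\<close>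
  have bb: "\<exists>k. \<forall>j<m. s ^ k * (el (b l) j - (if j = l then s ^ M else 0)) \<in> K" if l: "l < m" for l
  proof (rule ind)
    have "(\<lambda>i. - 1 * (fps_const (s ^ M) * b l i - lc m (el (b l)) b i)) \<in> L" by (rule L_smult) (use eqvel[of "b l"] in \<open>simp add: eqv_def\<close>)
    thus "lc m (\<lambda>j. el (b l) j - (if j = l then s ^ M else 0)) b \<in> L"
      by (rule L_eq) (simp add: lc_diff lc_delta[OF l])
  qed
  then obtain kb where kb: "\<And>l j. l < m \<Longrightarrow> j < m \<Longrightarrow> s ^ kb l * (el (b l) j - (if j = l then s ^ M else 0)) \<in> K" by metis
  define B where "B = (\<Sum>l<m. kb l)"
  have kB: "s ^ B * (el (b l) j - (if j = l then s ^ M else 0)) \<in> K" if lj: "l < m" "j < m" for l j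
  proof -
    have "kb l \<le> B" unfolding B_def using lj by (intro member_le_sum) auto
    hence "s ^ B * x = s ^ (B - kb l) * (s ^ kb l * x)" for x by (simp flip: power_add mult.assoc)
    thus ?thesis using K_mult[OF kb[OF lj]] by metis
  qed
  show ?thesis unfolding L'.lfree_def
  proof (intro conjI allI impI)
    fix w show "\<exists>k c. L'.eqv (\<lambda>i. fps_const (\<sigma> s ^ k) * w i) (lc m c ?b)" using eqvel' by blast
  next
    fix c l assume cE: "lc m c ?b \<in> E" and l: "l < m"
    obtain k where k: "\<forall>l<m. \<sigma> s ^ k * el' (lc m c ?b) l \<in> K'" using elE[OF cE] by blast
    have lin: "el' (lc m c ?b) l = (\<Sum>x<m. c x * el' (?b x) l)"
    proof -
      have "el' (lc m c ?b) l = (\<Sum>i<n. \<Sum>j<N. \<Sum>x<m. c x * (fps_nth (?b x i) j * \<sigma> (c0' i j)))"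
        if "c0' = (\<lambda>i j. C i j l)" for c0'
        unfolding el'_def lc_def that by (simp add: fps_sum_nth sum_distrib_right mult.assoc)
      hence "el' (lc m c ?b) l = (\<Sum>i<n. \<Sum>j<N. \<Sum>x<m. c x * (fps_nth (?b x i) j * \<sigma> (C i j l)))" by blast
      also have "\<dots> = (\<Sum>i<n. \<Sum>x<m. \<Sum>j<N. c x * (fps_nth (?b x i) j * \<sigma> (C i j l)))"
        by (rule sum.cong[OF refl]) (rule sum.swap)
      also have "\<dots> = (\<Sum>x<m. \<Sum>i<n. \<Sum>j<N. c x * (fps_nth (?b x i) j * \<sigma> (C i j l)))" by (rule sum.swap)
      finally show ?thesis unfolding el'_def sum_distrib_left .
    qed
    have elb: "el' (?b x) l = \<sigma> (el (b x) l)" for x by (simp add: el_def el'_def hom_distribs)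
    have t: "c x * \<sigma> s ^ k * (\<sigma> s ^ B * el' (?b x) l - (if x = l then \<sigma> s ^ (B + M) else 0)) \<in> K'" if x: "x < m" for x
    proof -
      have "\<sigma> (s ^ B * (el (b x) l - (if l = x then s ^ M else 0))) \<in> K'" by (rule \<sigma>K[OF kB[OF x l]])
      also have "\<sigma> (s ^ B * (el (b x) l - (if l = x then s ^ M else 0))) = \<sigma> s ^ B * el' (?b x) l - (if x = l then \<sigma> s ^ (B + M) else 0)"
        unfolding elb by (simp add: hom_distribs right_diff_distrib power_add)
      finally show ?thesis by (rule K'.K_mult)
    qed
    have "(\<Sum>x<m. c x * \<sigma> s ^ k * (\<sigma> s ^ B * el' (?b x) l - (if x = l then \<sigma> s ^ (B + M) else 0))) \<in> K'"
      by (rule K'.K_sum) (use t in auto)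
    also have "(\<Sum>x<m. c x * \<sigma> s ^ k * (\<sigma> s ^ B * el' (?b x) l - (if x = l then \<sigma> s ^ (B + M) else 0))) =
      (\<Sum>x<m. \<sigma> s ^ B * (\<sigma> s ^ k * (c x * el' (?b x) l))) - (\<Sum>x<m. if x = l then c x * \<sigma> s ^ k * \<sigma> s ^ (B + M) else 0)"
      unfolding sum_subtractf[symmetric] by (intro sum.cong refl) (simp add: algebra_simps)
    also have "\<dots> = \<sigma> s ^ B * (\<sigma> s ^ k * el' (lc m c ?b) l) - \<sigma> s ^ (k + (B + M)) * c l"
      unfolding lin using l by (simp add: sum_distrib_left power_add mult_ac)
    finally have "\<sigma> s ^ (k + (B + M)) * c l \<in> K'"
      using K'.K_cong[of "\<sigma> s ^ B * (\<sigma> s ^ k * el' (lc m c ?b) l)" "\<sigma> s ^ (k + (B + M)) * c l"] k l K'.K_mult by blast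
    thus "\<exists>k. \<sigma> s ^ k * c l \<in> K'" by blast
  qed
qed

text \<open>Naturality of the correspondence: \<open>matlat\<close> commutes with base change.\<close>

lemma ext_matlat:
  assumes L: "L = matlat K n N0 k"
    and kh: "\<And>i j. i < n \<Longrightarrow> j < n \<Longrightarrow> (\<Sum>l<n. k i l * h l j) - (if i = j then fps_X ^ N0 else 0) \<in> KF K"
    and hk: "\<And>i j. i < n \<Longrightarrow> j < n \<Longrightarrow> (\<Sum>l<n. h i l * k l j) - (if i = j then fps_X ^ N0 else 0) \<in> KF K"
    and N: "N = N0"
  shows "E = matlat K' n N0 (\<lambda>i j. mapf \<sigma> (k i j))"
proof (rule subset_antisym; rule subsetI)
  let ?k = "\<lambda>i j. mapf \<sigma> (k i j)" and ?h = "\<lambda>i j. mapf \<sigma> (h i j)"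
  interpret M: lattice0 K' n "matlat K' n N0 ?k" by (rule K'.lattice0_matlat)
  fix w assume "w \<in> E"
  thus "w \<in> matlat K' n N0 ?k"
  proof (induction rule: ext.induct)
    case (base w)
    have "(\<Sum>i<n. mapf \<sigma> (w i) * ?k i j) = mapf \<sigma> (\<Sum>i<n. w i * k i j)" for j by (simp add: \<sigma>.mapf_sum \<sigma>.mapf_simps)
    thus ?case using base \<sigma>K unfolding L by (simp add: matlat_def)
  next
    case (kern w)
    thus ?case by (rule M.L_K)
  next
    case (high w)
    have "(\<Sum>i<n. fps_X ^ N * w i * ?k i j) = fps_X ^ N * (\<Sum>i<n. w i * ?k i j)" for j
      by (simp add: sum_distrib_left mult.assoc)
    thus ?case unfolding N by (simp add: matlat_def fps_X_power_mult_nth)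
  qed (auto intro: M.L_add M.L_smult)
next
  let ?k = "\<lambda>i j. mapf \<sigma> (k i j)" and ?h = "\<lambda>i j. mapf \<sigma> (h i j)"
  fix w assume w: "w \<in> matlat K' n N0 ?k"
  \<comment> \<open>Dividing w k by t^N and multiplying by \<open>h\<close> returns
    \<open>w\<close>, and the rows of \<open>h\<close> are images of elements of
    \<open>L\<close>.\<close>
  define u where "u j = (\<Sum>i<n. w i * ?k i j)" for j
  have hL: "h i \<in> L" if "i < n" for i
    unfolding L matlat_def
  proof (intro CollectI allI impI)
    fix j q assume jq: "j < n" "q < N0"
    have "fps_nth ((\<Sum>l<n. h i l * k l j) - (if i = j then fps_X ^ N0 else 0)) q \<in> K" by (rule KF_nth[OF hk[OF that jq(1)]])
    thus "fps_nth (\<Sum>l<n. h i l * k l j) q \<in> K" using jq by (auto simp: fps_X_power_nth split: if_splits)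
  qed
  have CL: "(\<lambda>j. \<Sum>i<n. fps_shift N0 (u i) * ?h i j) \<in> E"
    by (intro E_sum E_smult) (use hL in \<open>auto intro: E_base\<close>)
  have kh': "(\<Sum>l<n. ?k i l * ?h l j) - (if i = j then fps_X ^ N0 else 0) \<in> KF K'" if "i < n" "j < n" for i j
  proof -
    have "mapf \<sigma> ((\<Sum>l<n. k i l * h l j) - (if i = j then fps_X ^ N0 else 0)) \<in> KF K'" by (rule mapf_KF[OF kh[OF that]])
    also have "mapf \<sigma> ((\<Sum>l<n. k i l * h l j) - (if i = j then fps_X ^ N0 else 0)) = (\<Sum>l<n. ?k i l * ?h l j) - (if i = j then fps_X ^ N0 else 0)"
      by (simp add: \<sigma>.mapf_sum \<sigma>.mapf_simps)
    finally show ?thesis .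
  qed
  show "w \<in> E"
  proof (rule L'.L_cong[OF CL])
    fix j assume j: "j < n"
    have "(\<Sum>l<n. u l * ?h l j) = (\<Sum>l<n. \<Sum>i<n. w i * (?k i l * ?h l j))" unfolding u_def by (simp add: sum_distrib_right mult.assoc)
    also have "\<dots> = (\<Sum>i<n. w i * (\<Sum>l<n. ?k i l * ?h l j))" by (subst sum.swap) (simp add: sum_distrib_left)
    finally have e: "(\<Sum>l<n. u l * ?h l j) = (\<Sum>i<n. w i * (\<Sum>l<n. ?k i l * ?h l j))" .
    have "(\<Sum>i<n. w i * (\<Sum>l<n. ?k i l * ?h l j)) - (\<Sum>i<n. w i * (if i = j then fps_X ^ N0 else 0)) \<in> KF K'"
      by (rule F'.cong_sum, rule F'.cong_mult) (use kh' j in auto)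
    moreover have "(\<Sum>i<n. w i * (if i = j then fps_X ^ N0 else 0)) = fps_X ^ N0 * w j"
      by (rule sum_pick[OF j])
    ultimately have 1: "(\<Sum>l<n. u l * ?h l j) - fps_X ^ N0 * w j \<in> KF K'" unfolding e by simp
    have "(\<Sum>l<n. u l * ?h l j) - (\<Sum>l<n. fps_X ^ N0 * fps_shift N0 (u l) * ?h l j) \<in> KF K'"
    proof (rule F'.cong_sum, rule F'.cong_mult)
      fix l assume "l \<in> {..<n}"
      thus "u l - fps_X ^ N0 * fps_shift N0 (u l) \<in> KF K'"
        using w by (auto simp: KF_def matlat_def u_def[symmetric] fps_X_power_mult_nth)
    qed simp
    from F'.cong_trans[OF F'.cong_sym[OF 1] this]
    have "fps_X ^ N0 * (w j - (\<Sum>l<n. fps_shift N0 (u l) * ?h l j)) \<in> KF K'" by (simp add: right_diff_distrib sum_distrib_left mult.assoc)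
    thus "w j - (\<Sum>i<n. fps_shift N0 (u i) * ?h i j) \<in> KF K'" by (simp only: K'.KF_X)
  qed
qed

end

section \<open>Rings as images of ring types\<close>

text \<open>A ring with explicit carrier, presented as a quotient of a type-class ring. Such
  presentations pass to Laurent series, power series and quotient rings, so everything down to the
  curve ring can be computed upstairs.\<close>

locale ring_image =
  fixes S :: "('s, 'x) ring_scheme" (structure) and h :: "'r::comm_ring_1 \<Rightarrow> 's"
  assumes im_carrier: "carrier S = range h"
    and im_mult: "h (x * y) = h x \<otimes> h y" and im_add: "h (x + y) = h x \<oplus> h y"
    and im_one: "h 1 = \<one>" and im_zero: "h 0 = \<zero>"
begin

lemma im_closed [simp]: "h x \<in> carrier S" by (simp add: im_carrier)

lemma im_surj: "s \<in> carrier S \<Longrightarrow> \<exists>x. s = h x" by (auto simp: im_carrier)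

lemma im_cring: "cring S"
proof (rule cringI)
  show "abelian_group S"
  proof (rule abelian_groupI)
    fix x y z assume "x \<in> carrier S" "y \<in> carrier S" "z \<in> carrier S"
    then obtain a b c where e: "x = h a" "y = h b" "z = h c" by (auto simp: im_carrier)
    show "x \<oplus> y \<in> carrier S" "x \<oplus> y \<oplus> z = x \<oplus> (y \<oplus> z)" "x \<oplus> y = y \<oplus> x"
      unfolding e im_add[symmetric] by (simp_all add: add_ac)
  next
    fix x assume "x \<in> carrier S"
    then obtain a where e: "x = h a" by (auto simp: im_carrier)
    show "\<zero> \<oplus> x = x" unfolding e im_zero[symmetric] im_add[symmetric] by simp
    have "h (- a) \<oplus> x = \<zero>" unfolding e im_zero[symmetric] im_add[symmetric] by simp
    thus "\<exists>y\<in>carrier S. y \<oplus> x = \<zero>" using im_closed by blast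
  qed (simp add: im_zero[symmetric])
  show "comm_monoid S"
  proof (rule comm_monoidI)
    fix x y z assume "x \<in> carrier S" "y \<in> carrier S" "z \<in> carrier S"
    then obtain a b c where e: "x = h a" "y = h b" "z = h c" by (auto simp: im_carrier)
    show "x \<otimes> y \<in> carrier S" "x \<otimes> y \<otimes> z = x \<otimes> (y \<otimes> z)" "x \<otimes> y = y \<otimes> x" "\<one> \<otimes> x = x"
      unfolding e im_mult[symmetric] im_one[symmetric] by (simp_all add: mult_ac)
  qed (simp add: im_one[symmetric])
  fix x y z assume "x \<in> carrier S" "y \<in> carrier S" "z \<in> carrier S"
  then obtain a b c where e: "x = h a" "y = h b" "z = h c" by (auto simp: im_carrier)
  show "(x \<oplus> y) \<otimes> z = x \<otimes> z \<oplus> y \<otimes> z"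
    unfolding e im_mult[symmetric] im_add[symmetric] by (simp add: distrib_right)
qed

sublocale cring S by (rule im_cring)

lemma im_uminus: "h (- x) = \<ominus> h x"
proof -
  have "h (- x) \<oplus> h x = \<zero>" unfolding im_add[symmetric] by (simp add: im_zero)
  from minus_equality[OF this] show ?thesis by simp
qed

lemma im_diff: "h (x - y) = h x \<ominus> h y"
  using im_add[of x "- y"] by (simp add: im_uminus minus_eq)

lemma im_eq_iff: "h x = h y \<longleftrightarrow> h (x - y) = \<zero>"
  unfolding im_diff by simp

lemma im_sum: "finite I \<Longrightarrow> h (sum f I) = finsum S (\<lambda>i. h (f i)) I"
  by (induction I rule: finite_induct) (simp_all add: im_zero im_add)

text \<open>Zero is lifted to 0, so that lifting the coefficients of a Laurent series keeps them
  zero below the same bound.\<close>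

definition lift :: "'s \<Rightarrow> 'r" where "lift s = (if s = \<zero> then 0 else SOME x. h x = s)"

lemma h_lift: "s \<in> carrier S \<Longrightarrow> h (lift s) = s"
  unfolding lift_def using im_surj[of s] someI[of "\<lambda>x. h x = s"] im_zero by auto

lemma lift_zero: "lift \<zero> = 0" by (simp add: lift_def)

end

lemma (in ring_image) ring_image_laurent: "ring_image (laurent S) (\<lambda>f k. h (fls_nth f k))"
proof
  show "carrier (laurent S) = range (\<lambda>f k. h (fls_nth f k))"
  proof (rule subset_antisym; rule subsetI)
    fix F assume "F \<in> carrier (laurent S)"
    then obtain N where F: "\<And>i. F i \<in> carrier S" "\<And>i. i < N \<Longrightarrow> F i = \<zero>" by (auto simp: laurent_def)
    have "fls_nth (Abs_fls (\<lambda>k. lift (F k))) k = lift (F k)" for k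
      by (rule nth_Abs_fls_lower_bound[of N]) (simp add: F lift_zero)
    hence "F = (\<lambda>k. h (fls_nth (Abs_fls (\<lambda>k. lift (F k))) k))" using F(1) by (simp add: h_lift)
    thus "F \<in> range (\<lambda>f k. h (fls_nth f k))" by (rule range_eqI)
  next
    fix F assume "F \<in> range (\<lambda>f k. h (fls_nth f k))"
    then obtain f where f: "F = (\<lambda>k. h (fls_nth f k))" by blast
    have "\<forall>i<fls_subdegree f. F i = \<zero>" unfolding f by (simp add: fls_eq0_below_subdegree im_zero)
    moreover have "\<forall>i. F i \<in> carrier S" unfolding f by simp
    ultimately have "(\<forall>i. F i \<in> carrier S) \<and> (\<exists>N. \<forall>i<N. F i = \<zero>)" by blast
    thus "F \<in> carrier (laurent S)" by (simp add: laurent_def)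
  qed
  fix f g :: "'r fls"
  show "(\<lambda>k. h (fls_nth (f + g) k)) = (\<lambda>k. h (fls_nth f k)) \<oplus>\<^bsub>laurent S\<^esub> (\<lambda>k. h (fls_nth g k))"
    by (simp add: laurent_def im_add)
  show "(\<lambda>k. h (fls_nth 0 k)) = \<zero>\<^bsub>laurent S\<^esub>" by (simp add: laurent_def im_zero)
  show "(\<lambda>k. h (fls_nth 1 k)) = \<one>\<^bsub>laurent S\<^esub>" by (auto simp: laurent_def im_zero im_one)
  show "(\<lambda>k. h (fls_nth (f * g) k)) = (\<lambda>k. h (fls_nth f k)) \<otimes>\<^bsub>laurent S\<^esub> (\<lambda>k. h (fls_nth g k))"
  proof
    fix k
    let ?D = "{fls_subdegree f..k - fls_subdegree g}"
    let ?I = "{i. h (fls_nth f i) \<noteq> \<zero> \<and> h (fls_nth g (k - i)) \<noteq> \<zero>}"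
    \<comment> \<open>The product in \<open>laurent\<close> sums over pairs of nonzero factors, the
      type-class product over an interval; the surplus terms vanish.\<close>
    have sub: "?I \<subseteq> ?D"
    proof
      fix i assume "i \<in> ?I"
      hence "\<not> i < fls_subdegree f" "\<not> k - i < fls_subdegree g" by (auto simp: fls_eq0_below_subdegree im_zero)
      thus "i \<in> ?D" by auto
    qed
    have "h (fls_nth (f * g) k) = (\<Oplus>i\<in>?D. h (fls_nth f i * fls_nth g (k - i)))"
      unfolding fls_times_nth(2) by (rule im_sum) simp
    also have "\<dots> = (\<Oplus>i\<in>?I. h (fls_nth f i * fls_nth g (k - i)))"
      by (rule add.finprod_mono_neutral_cong_right) (use sub in \<open>auto simp: im_mult\<close>)
    finally show "h (fls_nth (f * g) k) = ((\<lambda>k. h (fls_nth f k)) \<otimes>\<^bsub>laurent S\<^esub> (\<lambda>k. h (fls_nth g k))) k"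
      by (simp add: laurent_def im_mult)
  qed
qed

definition evP :: "('r::comm_ring_1 \<Rightarrow> 's) \<Rightarrow> 'r fps \<Rightarrow> int \<Rightarrow> 's" where
  "evP h f = (\<lambda>k. h (fls_nth (fps_to_fls f) k))"

lemma (in ring_image) evP_nth: "evP h f k = (if k < 0 then \<zero> else h (fps_nth f (nat k)))"
  by (simp add: evP_def im_zero)

lemma (in ring_image) evP_carrier: "carrier (power_series S) = range (evP h)"
proof (rule subset_antisym; rule subsetI)
  fix F assume "F \<in> carrier (power_series S)"
  hence F: "\<And>i. F i \<in> carrier S" "\<And>i. i < 0 \<Longrightarrow> F i = \<zero>" by (auto simp: power_series_def laurent_def)
  have "F = evP h (Abs_fps (\<lambda>j. lift (F (int j))))"
    using F by (auto simp: evP_nth h_lift)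
  thus "F \<in> range (evP h)" by (rule range_eqI)
next
  fix F assume "F \<in> range (evP h)"
  then obtain f where "F = evP h f" by blast
  thus "F \<in> carrier (power_series S)" by (auto simp: power_series_def laurent_def evP_nth)
qed

lemma (in ring_image) ring_image_power_series: "ring_image (power_series S) (evP h)"
proof -
  interpret L: ring_image "laurent S" "\<lambda>f k. h (fls_nth f k)" by (rule ring_image_laurent)
  have ops: "mult (power_series S) = mult (laurent S)" "add (power_series S) = add (laurent S)"
    "one (power_series S) = one (laurent S)" "zero (power_series S) = zero (laurent S)"
    by (simp_all add: power_series_def)
  show ?thesis
    by unfold_locales (simp_all only: evP_carrier ops evP_def[abs_def] fls_times_fps_to_fls fps_to_fls_plus fps_one_to_fls fps_zero_to_fls
        L.im_mult L.im_add L.im_one L.im_zero)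
qed

lemma ring_image_pev: "is_calg A \<Longrightarrow> ring_image A (pev A)"
proof
  assume A: "is_calg A"
  show "carrier A = range (pev A)" using A by (auto elim: pev_surj)
qed simp_all

lemma sum_pick_left: "i < n \<Longrightarrow> (\<Sum>k<n. (if i = k then 1 else 0) * q k) = q i" for q :: "nat \<Rightarrow> 'a::comm_ring_1"
  by (subst sum.cong[OF refl, of _ _ "\<lambda>k. if k = i then q i else 0"]) auto

text \<open>Matrices are handled through their entries.\<close>

context ring_image
begin

abbreviation hM :: "nat \<Rightarrow> (nat \<Rightarrow> nat \<Rightarrow> 'r) \<Rightarrow> 's mat" where
  "hM n g \<equiv> mat n n (\<lambda>(i, j). h (g i j))"

lemma mat_carrier: "carrier (mat_ring S n) = range (hM n)"
proof (rule subset_antisym; rule subsetI)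
  fix M assume "M \<in> carrier (mat_ring S n)"
  hence M: "M \<in> carrier_mat n n" "\<And>i j. i < n \<Longrightarrow> j < n \<Longrightarrow> index_mat M (i, j) \<in> carrier S" by (auto simp: mat_ring_def)
  have "M = hM n (\<lambda>i j. lift (index_mat M (i, j)))" by (rule eq_matI) (use M in \<open>auto simp: h_lift\<close>)
  thus "M \<in> range (hM n)" by (intro image_eqI[where x = "\<lambda>i j. lift (index_mat M (i, j))"]) auto
qed (auto simp: mat_ring_def)

lemma hM_closed: "hM n g \<in> carrier (mat_ring S n)"
  unfolding mat_carrier by (intro image_eqI[where x = g]) auto

lemma mat_mult: "hM n g \<otimes>\<^bsub>mat_ring S n\<^esub> hM n g' = hM n (\<lambda>i j. \<Sum>k<n. g i k * g' k j)"
proof -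
  have "(\<Oplus>k\<in>{..<n}. index_mat (hM n g) (i, k) \<otimes> index_mat (hM n g') (k, j)) = h (\<Sum>k<n. g i k * g' k j)"
    if "i < n" "j < n" for i j
    unfolding im_sum[OF finite_lessThan] by (rule finsum_cong') (use that in \<open>auto simp: im_mult\<close>)
  thus ?thesis unfolding mat_ring_def by (auto intro!: eq_matI)
qed

lemma mat_one: "\<one>\<^bsub>mat_ring S n\<^esub> = hM n (\<lambda>i j. if i = j then 1 else 0)"
  unfolding mat_ring_def by (auto intro!: eq_matI simp: im_one im_zero)

lemma hM_eq: "hM n g = hM n g' \<longleftrightarrow> (\<forall>i<n. \<forall>j<n. h (g i j) = h (g' i j))"
proof
  assume e: "hM n g = hM n g'"
  show "\<forall>i<n. \<forall>j<n. h (g i j) = h (g' i j)"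
  proof (intro allI impI)
    fix i j assume ij: "i < n" "j < n"
    have "index_mat (hM n g) (i, j) = index_mat (hM n g') (i, j)" by (simp only: e)
    thus "h (g i j) = h (g' i j)" unfolding index_mat(1)[OF ij] prod.case .
  qed
next
  assume e: "\<forall>i<n. \<forall>j<n. h (g i j) = h (g' i j)"
  show "hM n g = hM n g'"
  proof (rule eq_matI)
    fix i j assume "i < dim_row (hM n g')" "j < dim_col (hM n g')"
    hence ij: "i < n" "j < n" by simp_all
    show "index_mat (hM n g) (i, j) = index_mat (hM n g') (i, j)" unfolding index_mat(1)[OF ij] prod.case using e ij by blast
  qed simp_all
qed

lemma mat_monoid: "Group.monoid (mat_ring S n)"
proof (rule monoidI)
  fix x y z assume "x \<in> carrier (mat_ring S n)" "y \<in> carrier (mat_ring S n)" "z \<in> carrier (mat_ring S n)"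
  then obtain a b c where e: "x = hM n a" "y = hM n b" "z = hM n c" unfolding mat_carrier by blast
  show "x \<otimes>\<^bsub>mat_ring S n\<^esub> y \<in> carrier (mat_ring S n)" unfolding e mat_mult by (rule hM_closed)
  have "(\<Sum>k<n. (\<Sum>l<n. a i l * b l k) * c k j) = (\<Sum>l<n. a i l * (\<Sum>k<n. b l k * c k j))" for i j
  proof -
    have "(\<Sum>k<n. (\<Sum>l<n. a i l * b l k) * c k j) = (\<Sum>k<n. \<Sum>l<n. a i l * (b l k * c k j))" by (simp add: sum_distrib_right mult.assoc)
    thus ?thesis by (subst (asm) sum.swap) (simp add: sum_distrib_left)
  qed
  thus "x \<otimes>\<^bsub>mat_ring S n\<^esub> y \<otimes>\<^bsub>mat_ring S n\<^esub> z = x \<otimes>\<^bsub>mat_ring S n\<^esub> (y \<otimes>\<^bsub>mat_ring S n\<^esub> z)"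
    unfolding e mat_mult by simp
next
  show "\<one>\<^bsub>mat_ring S n\<^esub> \<in> carrier (mat_ring S n)" unfolding mat_one by (rule hM_closed)
  fix x assume "x \<in> carrier (mat_ring S n)"
  then obtain a where e: "x = hM n a" unfolding mat_carrier by blast
  show "\<one>\<^bsub>mat_ring S n\<^esub> \<otimes>\<^bsub>mat_ring S n\<^esub> x = x" "x \<otimes>\<^bsub>mat_ring S n\<^esub> \<one>\<^bsub>mat_ring S n\<^esub> = x"
    unfolding e mat_one mat_mult hM_eq by (simp_all add: sum_pick sum_pick_left)
qed

lemma GL_group:
  shows "u \<in> GL n S \<Longrightarrow> u' \<in> GL n S \<Longrightarrow> u \<otimes>\<^bsub>mat_ring S n\<^esub> u' \<in> GL n S"
    "u \<in> GL n S \<Longrightarrow> inv\<^bsub>mat_ring S n\<^esub> u \<in> GL n S"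
    "\<one>\<^bsub>mat_ring S n\<^esub> \<in> GL n S"
  unfolding GL_def using monoid.Units_m_closed[OF mat_monoid] monoid.Units_inv_Units[OF mat_monoid] monoid.Units_one_closed[OF mat_monoid] by auto

end

section \<open>Weierstrass division\<close>

lemma fps_mult_nth_0:
  fixes c x :: "'a::comm_ring_1 fps"
  assumes "fps_nth c 0 = 0"
  shows "fps_nth (c * x) e = (\<Sum>p<e. fps_nth c (e - p) * fps_nth x p)"
proof -
  have "fps_nth (x * c) e = (\<Sum>p=0..e. fps_nth x p * fps_nth c (e - p))" by (rule fps_mult_nth)
  moreover have "{0..e} = insert e {..<e}" by auto
  ultimately show ?thesis using assms by (simp add: mult.commute)
qed

text \<open>Coefficients of the quotient q in F = q f + r: comparing coefficients of x^(j+n) gives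
  q_j = F_(j+n) + sum of a_i q_(j+n-i). The indices of q on the right grow, but as the a_i have no
  constant term in t, only exponents below \<open>e\<close> enter and the recursion ends.\<close>

fun wdiv :: "nat \<Rightarrow> (nat \<Rightarrow> 'a::comm_ring_1 fps) \<Rightarrow> 'a fps fps \<Rightarrow> nat \<Rightarrow> nat \<Rightarrow> 'a" where
  "wdiv n a F e j = fps_nth (fps_nth F (j + n)) e +
     (\<Sum>p<e. \<Sum>i<n. fps_nth (a i) (e - p) * wdiv n a F p (j + n - i))"

declare wdiv.simps [simp del]

locale weier =
  fixes n :: nat and a :: "nat \<Rightarrow> 'a::comm_ring_1 fps"
  assumes n1: "n \<ge> 1" and a0: "i < n \<Longrightarrow> fps_nth (a i) 0 = 0"
begin

definition pol :: "(nat \<Rightarrow> 'a fps) \<Rightarrow> 'a fps fps" where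
  "pol w = (\<Sum>i<n. fps_const (w i) * fps_X ^ i)"

definition ft :: "'a fps fps" where "ft = fps_X ^ n - pol a"

lemma pol_nth [simp]: "fps_nth (pol w) j = (if j < n then w j else 0)"
proof -
  have "fps_nth (pol w) j = (\<Sum>i<n. if i = j then w j else 0)"
    unfolding pol_def fps_sum_nth by (intro sum.cong refl) (auto simp: fps_X_power_nth)
  thus ?thesis by simp
qed

lemma pol_add: "pol (\<lambda>i. w i + w' i) = pol w + pol w'"
  and pol_diff: "pol (\<lambda>i. w i - w' i) = pol w - pol w'"
  and pol_smult: "pol (\<lambda>i. c * w i) = fps_const c * pol w"
  by (rule fps_ext; simp)+

lemma ft_nth: "fps_nth ft j = (if j = n then 1 else 0) - (if j < n then a j else 0)"
  by (simp add: ft_def fps_X_power_nth)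

lemma ft_mult_nth:
  "fps_nth (q * ft) j = (if j < n then 0 else fps_nth q (j - n)) - (\<Sum>i<n. if j < i then 0 else a i * fps_nth q (j - i))"
proof -
  have "q * pol a = (\<Sum>i<n. fps_const (a i) * (q * fps_X ^ i))"
    unfolding pol_def sum_distrib_left by (intro sum.cong refl) (simp add: mult.left_commute)
  hence e: "fps_nth (q * pol a) j = (\<Sum>i<n. a i * (if j < i then 0 else fps_nth q (j - i)))"
    by (simp add: fps_sum_nth fps_X_power_mult_right_nth)
  show ?thesis unfolding ft_def right_diff_distrib fps_sub_nth e fps_X_power_mult_right_nth
    by (intro arg_cong2[where f = "(-)"] sum.cong refl) auto
qed

lemma division_ex: obtains q w where "F = q * ft + pol w"
proof -
  define q where "q = Abs_fps (\<lambda>j. Abs_fps (\<lambda>e. wdiv n a F e j))"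
  have q: "fps_nth (fps_nth q j) e = wdiv n a F e j" for j e by (simp add: q_def)
  define w where "w = fps_nth (F - q * ft)"
  have high: "fps_nth F j = fps_nth (q * ft) j" if j: "\<not> j < n" for j
  proof (rule fps_ext)
    fix e
    have "fps_nth (\<Sum>i<n. if j < i then 0 else a i * fps_nth q (j - i)) e = (\<Sum>i<n. \<Sum>p<e. fps_nth (a i) (e - p) * wdiv n a F p (j - i))"
      unfolding fps_sum_nth by (intro sum.cong refl) (use j in \<open>auto simp: fps_mult_nth_0 a0 q\<close>)
    also have "\<dots> = (\<Sum>p<e. \<Sum>i<n. fps_nth (a i) (e - p) * wdiv n a F p (j - i))" by (rule sum.swap)
    finally have s: "fps_nth (\<Sum>i<n. if j < i then 0 else a i * fps_nth q (j - i)) e = \<dots>" .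
    have w: "wdiv n a F e (j - n) = fps_nth (fps_nth F j) e + (\<Sum>p<e. \<Sum>i<n. fps_nth (a i) (e - p) * wdiv n a F p (j - i))"
      using j by (subst wdiv.simps) simp
    have "fps_nth (fps_nth (q * ft) j) e = wdiv n a F e (j - n) - (\<Sum>p<e. \<Sum>i<n. fps_nth (a i) (e - p) * wdiv n a F p (j - i))"
      unfolding ft_mult_nth fps_sub_nth s using j by (simp add: q)
    thus "fps_nth (fps_nth F j) e = fps_nth (fps_nth (q * ft) j) e" unfolding w by simp
  qed
  have "F = q * ft + pol w"
  proof (rule fps_ext)
    fix j show "fps_nth F j = fps_nth (q * ft + pol w) j"
      using high[of j] by (cases "j < n") (auto simp: w_def)
  qed
  thus ?thesis by (rule that)
qed

text \<open>The recursion of \<open>wdiv\<close> read modulo \<open>K\<close>: by induction on the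
  exponent of t all coefficients of \<open>q\<close> lie in \<open>K\<close>, hence so do those of
  the remainder.\<close>

lemma division_unique:
  assumes K: "coeff_ideal K" and z: "q * ft + pol w \<in> KF (KF K)" and i: "i < n"
  shows "w i \<in> KF K"
proof -
  interpret coeff_ideal K by (rule K)
  interpret F: coeff_ideal "KF K" by (rule coeff_ideal_KF)
  have qK: "fps_nth (fps_nth q j) e \<in> K" for j e
  proof (induction e arbitrary: j rule: less_induct)
    case (less e)
    have 1: "fps_nth (fps_nth (q * ft + pol w) (j + n)) e \<in> K" by (intro KF_nth z)
    have 2: "fps_nth (\<Sum>i<n. if j + n < i then 0 else a i * fps_nth q (j + n - i)) e \<in> K"
      unfolding fps_sum_nth by (intro K_sum) (auto simp: fps_mult_nth_0 a0 K0 intro!: K_sum K_mult less.IH)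
    have "fps_nth (fps_nth (q * ft + pol w) (j + n)) e =
      fps_nth (fps_nth q j) e - fps_nth (\<Sum>i<n. if j + n < i then 0 else a i * fps_nth q (j + n - i)) e"
      unfolding fps_add_nth ft_mult_nth by simp
    hence "fps_nth (fps_nth q j) e = fps_nth (fps_nth (q * ft + pol w) (j + n)) e + fps_nth (\<Sum>i<n. if j + n < i then 0 else a i * fps_nth q (j + n - i)) e"
      by simp
    thus ?case using K_add[OF 1 2] by (simp only:)
  qed
  hence qF: "fps_nth q j \<in> KF K" for j by (simp add: KF_def)
  have "fps_nth (q * ft) i \<in> KF K" unfolding ft_mult_nth
    by (intro F.K_diff F.K_sum) (use i qF in \<open>auto intro!: F.K_mult F.K0\<close>)
  hence "fps_nth (q * ft + pol w) i - fps_nth (q * ft) i \<in> KF K" by (intro F.K_diff KF_nth[OF z])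
  thus ?thesis using i by simp
qed

lemma pol_xmul: "pol (xmul a n w) = fps_X * pol w - fps_const (w (n - 1)) * ft"
proof (rule fps_ext)
  fix j
  consider "j = 0" | "0 < j" "j < n" | "j = n" | "j > n" by linarith
  thus "fps_nth (pol (xmul a n w)) j = fps_nth (fps_X * pol w - fps_const (w (n - 1)) * ft) j"
    using n1 by cases (auto simp: xmul_def ft_nth fps_X_mult_nth mult.commute)
qed

text \<open>Modulo \<open>f\<close>, a high power of \<open>x\<close> is divisible by a power of \<open>t\<close>.\<close>

lemma X_power: "\<exists>H q. fps_X ^ (n * N) = fps_const (fps_X ^ N) * H + q * ft"
proof (induction N)
  case 0 show ?case by (intro exI[of _ 1] exI[of _ 0]) simp
next
  case (Suc N)
  then obtain H q where e: "fps_X ^ (n * N) = fps_const (fps_X ^ N) * H + q * ft" by blast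
  define H0 where "H0 = pol (\<lambda>i. fps_shift 1 (a i))"
  \<comment> \<open>All \<open>a i\<close> are divisible by t, so x^n is divisible by t modulo
    f.\<close>
  have pa: "pol a = fps_const fps_X * H0" unfolding H0_def
    by (rule fps_ext) (use a0 in \<open>auto intro!: fps_ext simp: fps_X_mult_nth\<close>)
  have f: "ft + fps_const fps_X * H0 = fps_X ^ n" unfolding pa[symmetric] ft_def by simp
  have "fps_X ^ (n * Suc N) = (fps_X ^ n :: 'a fps fps) * fps_X ^ (n * N)" by (simp add: power_add)
  also have "\<dots> = (ft + fps_const fps_X * H0) * (fps_const (fps_X ^ N) * H + q * ft)" unfolding f e ..
  also have "\<dots> = fps_const (fps_X ^ Suc N) * (H0 * H) + (fps_const (fps_X ^ N) * H + q * ft + fps_const fps_X * H0 * q) * ft"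
    by (simp add: algebra_simps flip: fps_const_mult)
  finally show ?case by blast
qed

section \<open>Lattices of remainders and ideals of the series ring\<close>

text \<open>The preimage in the two-variable series ring of the ideal whose elements have remainders
  in \<open>L\<close>.\<close>

definition Jof :: "'a set \<Rightarrow> (nat \<Rightarrow> 'a fps) set \<Rightarrow> 'a fps fps set" where
  "Jof K L = {F. \<exists>q w. w \<in> L \<and> F - q * ft - pol w \<in> KF (KF K)}"

end

locale weier_lattice = weier n a + lattice0 K n L
  for n and a :: "nat \<Rightarrow> 'a::comm_ring_1 fps" and K :: "'a set" and L +
  assumes xm: "w \<in> L \<Longrightarrow> xmul a n w \<in> L"
begin

sublocale FF: coeff_ideal "KF (KF K)" by (rule F.coeff_ideal_KF)

lemma J_I: "w \<in> L \<Longrightarrow> F - q * ft - pol w \<in> KF (KF K) \<Longrightarrow> F \<in> Jof K L" unfolding Jof_def by blast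

lemma J_KK: "F \<in> KF (KF K) \<Longrightarrow> F \<in> Jof K L"
proof (rule J_I[OF L_0])
  have "pol (\<lambda>i. 0) = 0" by (rule fps_ext) simp
  thus "F \<in> KF (KF K) \<Longrightarrow> F - 0 * ft - pol (\<lambda>i. 0) \<in> KF (KF K)" by simp
qed

lemma J_0: "0 \<in> Jof K L" by (rule J_KK) (rule FF.K0)

lemma J_pol: "w \<in> L \<Longrightarrow> pol w \<in> Jof K L"
  by (rule J_I[where q = 0], assumption, unfold mult_zero_left diff_zero diff_self) (rule FF.K0)

lemma J_ft: "q * ft \<in> Jof K L"
proof (rule J_I[OF L_0])
  have "pol (\<lambda>i. 0) = 0" by (rule fps_ext) simp
  thus "q * ft - q * ft - pol (\<lambda>i. 0) \<in> KF (KF K)" by (simp add: FF.K0)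
qed

lemma J_add: assumes "F \<in> Jof K L" "F' \<in> Jof K L" shows "F + F' \<in> Jof K L"
proof -
  obtain q w q' w' where w: "w \<in> L" "F - q * ft - pol w \<in> KF (KF K)" "w' \<in> L" "F' - q' * ft - pol w' \<in> KF (KF K)"
    using assms unfolding Jof_def by blast
  have e: "(F + F') - (q + q') * ft - pol (\<lambda>i. w i + w' i) = (F - q * ft - pol w) + (F' - q' * ft - pol w')"
    unfolding pol_add by (simp add: algebra_simps)
  have "(F + F') - (q + q') * ft - pol (\<lambda>i. w i + w' i) \<in> KF (KF K)" unfolding e by (rule FF.K_add[OF w(2,4)])
  thus ?thesis by (rule J_I[OF L_add[OF w(1,3)]])
qed

lemma J_sum: "(\<And>x. x \<in> I \<Longrightarrow> F x \<in> Jof K L) \<Longrightarrow> sum F I \<in> Jof K L"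
  by (induction I rule: infinite_finite_induct) (auto intro: J_0 J_add)

lemma J_const: assumes "F \<in> Jof K L" shows "fps_const c * F \<in> Jof K L"
proof -
  obtain q w where w: "w \<in> L" "F - q * ft - pol w \<in> KF (KF K)" using assms unfolding Jof_def by blast
  have e: "fps_const c * F - (fps_const c * q) * ft - pol (\<lambda>i. c * w i) = fps_const c * (F - q * ft - pol w)"
    unfolding pol_smult by (simp add: algebra_simps)
  have "fps_const c * F - (fps_const c * q) * ft - pol (\<lambda>i. c * w i) \<in> KF (KF K)" unfolding e by (rule FF.K_mult[OF w(2)])
  thus ?thesis by (rule J_I[OF L_smult[OF w(1)]])
qed

lemma J_X: assumes "F \<in> Jof K L" shows "fps_X * F \<in> Jof K L"
proof -
  obtain q w where w: "w \<in> L" "F - q * ft - pol w \<in> KF (KF K)" using assms unfolding Jof_def by blast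
  have e: "fps_X * F - (fps_X * q + fps_const (w (n - 1))) * ft - pol (xmul a n w) = fps_X * (F - q * ft - pol w)"
    unfolding pol_xmul by (simp add: algebra_simps)
  have "fps_X * F - (fps_X * q + fps_const (w (n - 1))) * ft - pol (xmul a n w) \<in> KF (KF K)" unfolding e by (rule FF.K_mult[OF w(2)])
  thus ?thesis by (rule J_I[OF xm[OF w(1)]])
qed

lemma J_X_power: "F \<in> Jof K L \<Longrightarrow> fps_X ^ e * F \<in> Jof K L"
  by (induction e) (auto simp: mult.assoc intro: J_X)

lemma J_high: assumes "\<And>w. (\<lambda>i. fps_X ^ N * w i) \<in> L" shows "fps_const (fps_X ^ N) * H \<in> Jof K L"
proof -
  obtain q w where H: "H = q * ft + pol w" by (rule division_ex)
  have e: "fps_const (fps_X ^ N) * H = (fps_const (fps_X ^ N) * q) * ft + pol (\<lambda>i. fps_X ^ N * w i)"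
    unfolding pol_smult H by (simp add: algebra_simps)
  show ?thesis unfolding e by (rule J_add[OF J_ft J_pol[OF assms]])
qed

lemma J_high_X: assumes "\<And>w. (\<lambda>i. fps_X ^ N * w i) \<in> L" shows "fps_X ^ (n * N) * H \<in> Jof K L"
proof -
  obtain G q where e: "fps_X ^ (n * N) = fps_const (fps_X ^ N) * G + q * ft" using X_power by blast
  have f: "fps_X ^ (n * N) * H = fps_const (fps_X ^ N) * (G * H) + (q * H) * ft" unfolding e by (simp add: algebra_simps)
  show ?thesis unfolding f by (rule J_add[OF J_high[OF assms] J_ft])
qed

text \<open>Stability of \<open>L\<close> under \<open>xmul\<close> gives multiplication by x only,
  hence by polynomials in x. The tail of \<open>G\<close> beyond x^(n N) is handled by
  \<open>X_power\<close>: modulo f it is divisible by t^N, and all such series belong to the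
  ideal.\<close>

lemma J_mult: assumes F: "F \<in> Jof K L" shows "G * F \<in> Jof K L"
proof -
  obtain N where N: "\<And>w. (\<lambda>i. fps_X ^ N * w i) \<in> L" using L_X by blast
  have "(\<Sum>e<n * N. fps_const (fps_nth G e) * (fps_X ^ e * F)) + fps_X ^ (n * N) * (fps_shift (n * N) G * F) \<in> Jof K L"
    by (rule J_add[OF J_sum J_high_X[OF N]]) (intro J_const J_X_power F)
  also have "(\<Sum>e<n * N. fps_const (fps_nth G e) * (fps_X ^ e * F)) + fps_X ^ (n * N) * (fps_shift (n * N) G * F)
    = ((\<Sum>e<n * N. fps_const (fps_nth G e) * fps_X ^ e) + fps_X ^ (n * N) * fps_shift (n * N) G) * F"
    by (simp add: distrib_right sum_distrib_right mult.assoc)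
  finally show ?thesis unfolding fps_trunc[symmetric] .
qed

text \<open>Remainders are unique modulo \<open>K\<close>, so passing to the ideal adds no vector to
  \<open>L\<close>.\<close>

lemma J_pol_iff: "pol w \<in> Jof K L \<longleftrightarrow> w \<in> L"
proof
  assume "pol w \<in> Jof K L"
  then obtain q w' where w: "w' \<in> L" "pol w - q * ft - pol w' \<in> KF (KF K)" unfolding Jof_def by blast
  have e: "(- q) * ft + pol (\<lambda>i. w i - w' i) = pol w - q * ft - pol w'" unfolding pol_diff by (simp add: algebra_simps)
  have z: "(- q) * ft + pol (\<lambda>i. w i - w' i) \<in> KF (KF K)" unfolding e by (rule w(2))
  have "w i - w' i \<in> KF K" if "i < n" for i
    by (rule division_unique[OF coeff_ideal_axioms z that])
  thus "w \<in> L" by (rule L_cong[OF w(1)])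
qed (rule J_pol)

text \<open>Openness: \<open>G\<close> may have terms of low order only with coefficients in \<open>K\<close>.\<close>

lemma J_open:
  assumes N: "\<And>w. (\<lambda>i. fps_X ^ N * w i) \<in> L"
    and G: "\<And>i j. i + j < n * N + N \<Longrightarrow> fps_nth (fps_nth G i) j \<in> K"
  shows "G \<in> Jof K L"
proof -
  have c: "fps_const (u - v * y) = fps_const u - fps_const v * fps_const y" for u v y :: "'a fps" by simp
  have lo: "fps_const (fps_nth G e) * fps_X ^ e \<in> Jof K L" if e: "e < n * N" for e
  proof -
    have "fps_nth (fps_nth G e - fps_X ^ N * fps_shift N (fps_nth G e)) j \<in> K" for j
      using G[of e j] e by (cases "j < N") (auto simp: fps_X_power_mult_nth K0)
    hence "fps_nth G e - fps_X ^ N * fps_shift N (fps_nth G e) \<in> KF K" by (simp add: KF_def)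
    hence "fps_const (fps_nth G e - fps_X ^ N * fps_shift N (fps_nth G e)) * fps_X ^ e \<in> KF (KF K)"
      by (intro FF.K_mult2 F.KF_const)
    from J_add[OF J_KK[OF this] J_high[OF N, of "fps_const (fps_shift N (fps_nth G e)) * fps_X ^ e"]]
    show ?thesis unfolding c by (simp only: left_diff_distrib mult.assoc diff_add_cancel)
  qed
  have "(\<Sum>e<n * N. fps_const (fps_nth G e) * fps_X ^ e) + fps_X ^ (n * N) * fps_shift (n * N) G \<in> Jof K L"
    by (rule J_add[OF J_sum J_high_X[OF N]]) (use lo in auto)
  thus ?thesis unfolding fps_trunc[symmetric] .
qed

end

text \<open>The ideal contains f, so division shows that it is determined by the remainders it
  contains; stability under x is \<open>pol_xmul\<close>.\<close>

lemma (in weier) lattice_of_ideal: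
  assumes K: "coeff_ideal K"
    and add: "\<And>F G. F \<in> J \<Longrightarrow> G \<in> J \<Longrightarrow> F + G \<in> J" and mult: "\<And>F G. F \<in> J \<Longrightarrow> G * F \<in> J"
    and ft: "ft \<in> J" and KK: "KF (KF K) \<subseteq> J" and N: "fps_const (fps_X ^ N) \<in> J"
  shows "weier_lattice n a K {w. pol w \<in> J}" "Jof K {w. pol w \<in> J} = J"
proof -
  interpret coeff_ideal K by (rule K)
  interpret F: coeff_ideal "KF K" by (rule coeff_ideal_KF)
  have diff: "F - G \<in> J" if "F \<in> J" "G \<in> J" for F G using add[OF that(1) mult[OF that(2), of "- 1"]] by simp
  show "weier_lattice n a K {w. pol w \<in> J}"
  proof (intro weier_lattice.intro weier_lattice_axioms.intro lattice0.intro lattice0_axioms.intro weier_axioms K CollectI)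
    fix w w' q
    show "pol (\<lambda>i. w i + w' i) \<in> J" if "w \<in> {w. pol w \<in> J}" "w' \<in> {w. pol w \<in> J}" unfolding pol_add using that add by simp
    show "pol (\<lambda>i. q * w i) \<in> J" if "w \<in> {w. pol w \<in> J}" unfolding pol_smult using that mult by simp
    show "pol w \<in> J" if "\<And>i. i < n \<Longrightarrow> w i \<in> KF K"
      using KK that by (auto simp: KF_def[of "KF K"] F.K0)
    show "pol (xmul a n w) \<in> J" if "w \<in> {w. pol w \<in> J}" unfolding pol_xmul using that by (auto intro: diff mult ft)
  next
    have "pol (\<lambda>i. fps_X ^ N * w i) \<in> J" for w
      unfolding pol_smult mult.commute[of "fps_const (fps_X ^ N)"] by (rule mult[OF N])
    thus "\<exists>N. \<forall>w. (\<lambda>i. fps_X ^ N * w i) \<in> {w. pol w \<in> J}" by blast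
  qed
  show "Jof K {w. pol w \<in> J} = J"
  proof (rule subset_antisym; rule subsetI)
    fix F assume "F \<in> Jof K {w. pol w \<in> J}"
    then obtain q w where w: "pol w \<in> J" "F - q * ft - pol w \<in> KF (KF K)" unfolding Jof_def by blast
    from add[OF add[OF subsetD[OF KK w(2)] mult[OF ft, of q]] w(1)] show "F \<in> J" by simp
  next
    fix F assume F: "F \<in> J"
    obtain q w where e: "F = q * ft + pol w" by (rule division_ex)
    have "pol w \<in> J" using diff[OF F mult[OF ft, of q]] unfolding e by simp
    moreover have "0 \<in> KF (KF K)" by (simp add: KF_def K0)
    ultimately show "F \<in> Jof K {w. pol w \<in> J}" unfolding Jof_def e by (intro CollectI exI[of _ q] exI[of _ w]) simp
  qed
qed

section \<open>Ideals of the curve as lattices\<close>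

lemma (in ring_image) ring_image_quot:
  assumes J: "ideal J S"
  shows "ring_image (S Quot J) (\<lambda>x. J +> h x)" "J +> h x = \<zero>\<^bsub>S Quot J\<^esub> \<longleftrightarrow> h x \<in> J"
proof -
  have z: "\<zero>\<^bsub>S Quot J\<^esub> = J" unfolding FactRing_def by simp
  interpret I: ideal J S by (rule J)
  interpret q: ring_hom_ring S "S Quot J" "(+>) J" by (rule I.rcos_ring_hom_ring)
  show "ring_image (S Quot J) (\<lambda>x. J +> h x)"
  proof
    show "carrier (S Quot J) = range (\<lambda>x. J +> h x)" unfolding FactRing_def A_RCOSETS_def' im_carrier by auto
  qed (simp_all add: im_add im_mult im_one im_zero)
  have "J +> h x = J \<longleftrightarrow> h x \<in> J"
  proof
    show "J +> h x = J \<Longrightarrow> h x \<in> J" by (rule a_coset_join1[OF _ im_closed I.a_subgroup])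
    show "h x \<in> J \<Longrightarrow> J +> h x = J" by (rule a_coset_join2[OF im_closed I.a_subgroup])
  qed
  thus "J +> h x = \<zero>\<^bsub>S Quot J\<^esub> \<longleftrightarrow> h x \<in> J" unfolding z .
qed

lemma coeff_ideal_ker: assumes A: "is_calg A" shows "coeff_ideal (ker A)"
proof -
  interpret cring A using is_calgD(2)[OF A] .
  show ?thesis by unfold_locales (auto simp: ker_def A)
qed

lemma scal_diff: "scal (c - d) = scal c - scal d"
proof -
  have "scal (c - d) + scal d = scal c"
    by (rule univ_eqI) (simp_all flip: scalar_simps(4))
  thus ?thesis by (simp add: eq_diff_eq)
qed

definition tf :: "complex fps \<Rightarrow> 'u univ fps" where "tf x = Abs_fps (\<lambda>j. scal (fps_nth x j))"

lemma tf_nth [simp]: "fps_nth (tf x) j = scal (fps_nth x j)" by (simp add: tf_def)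

locale germ =
  fixes n :: nat and a :: "nat \<Rightarrow> complex fps" and A :: "'u calg"
  assumes n: "n \<ge> 1" and a: "i < n \<Longrightarrow> fps_nth (a i) 0 = 0" and A: "is_calg A"
begin

abbreviation "f \<equiv> fps_of_poly (weierstrass n a)"
abbreviation ta :: "nat \<Rightarrow> 'u univ fps" where "ta \<equiv> \<lambda>i. tf (a i)"
abbreviation "K \<equiv> ker A"

sublocale W: weier n ta by unfold_locales (use n a in auto)

sublocale KA: coeff_ideal K by (rule coeff_ideal_ker[OF A])

definition ev :: "'u univ fps fps \<Rightarrow> int \<Rightarrow> int \<Rightarrow> 'u" where "ev = evP (evP (pev A))"

sublocale RA: ring_image A "pev A" by (rule ring_image_pev[OF A])
sublocale RP: ring_image "power_series A" "evP (pev A)" by (rule RA.ring_image_power_series)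
sublocale RQ: ring_image "power_series2 A" ev unfolding power_series2_def ev_def by (rule RP.ring_image_power_series)

lemma ev_nth: "ev F i j = (if i < 0 \<or> j < 0 then \<zero>\<^bsub>A\<^esub> else pev A (fps_nth (fps_nth F (nat i)) (nat j)))"
proof -
  have "\<zero>\<^bsub>power_series A\<^esub> = (\<lambda>k. \<zero>\<^bsub>A\<^esub>)" by (simp add: power_series_def laurent_def)
  thus ?thesis unfolding ev_def RP.evP_nth by (simp add: RA.evP_nth)
qed

lemma ev_zero_iff: "ev F = \<zero>\<^bsub>power_series2 A\<^esub> \<longleftrightarrow> F \<in> KF (KF K)"
proof
  assume "ev F = \<zero>\<^bsub>power_series2 A\<^esub>"
  hence e: "ev F = ev 0" by (simp only: RQ.im_zero)
  have "pev A (fps_nth (fps_nth F i) j) = \<zero>\<^bsub>A\<^esub>" for i j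
    using fun_cong[OF fun_cong[OF e], of "int i" "int j"] A by (simp add: ev_nth)
  thus "F \<in> KF (KF K)" by (simp add: KF_def ker_def)
next
  assume "F \<in> KF (KF K)"
  hence "ev F i j = ev 0 i j" for i j using A by (simp add: ev_nth KF_def ker_def)
  thus "ev F = \<zero>\<^bsub>power_series2 A\<^esub>" unfolding RQ.im_zero[symmetric] by blast
qed

lemma ev_eq: "ev F = ev G \<longleftrightarrow> F - G \<in> KF (KF K)"
  unfolding RQ.im_eq_iff ev_zero_iff ..

lemma equation_eq: "equation f A = ev W.ft"
proof (intro ext)
  fix i j
  have c: "fps_nth f k = (if k = n then 1 else 0) - (if k < n then a k else 0)" for k
    unfolding weierstrass_def by (simp add: coeff_sum)
  have p: "pev A (fps_nth (fps_nth W.ft k) l) = scalar A (fps_nth (fps_nth f k) l)" for k l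
  proof -
    have "fps_nth (fps_nth W.ft k) l = scal (fps_nth (if k = n then 1 else 0) l) - scal (fps_nth (if k < n then a k else 0) l)"
      unfolding W.ft_nth fps_sub_nth by (cases "k = n"; cases "k < n"; cases "l = 0"; simp)
    hence "fps_nth (fps_nth W.ft k) l = scal (fps_nth (fps_nth f k) l)" unfolding c fps_sub_nth scal_diff .
    thus ?thesis using A by simp
  qed
  show "equation f A i j = ev W.ft i j" unfolding equation_def ev_nth p by auto
qed

definition th :: "'u univ fps fps \<Rightarrow> (int \<Rightarrow> int \<Rightarrow> 'u) set" where "th F = curve_class f A (ev F)"

lemma eqideal: "ideal (equation_ideal f A) (power_series2 A)"
  unfolding equation_ideal_def equation_eq by (rule RQ.cgenideal_ideal) simp

sublocale RC: ring_image "curve_ring f A" th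
  unfolding curve_ring_def th_def[abs_def] curve_class_def by (rule RQ.ring_image_quot(1)[OF eqideal])

lemma th_zero: "th F = \<zero>\<^bsub>curve_ring f A\<^esub> \<longleftrightarrow> (\<exists>q. F - q * W.ft \<in> KF (KF K))"
proof -
  have "th F = \<zero>\<^bsub>curve_ring f A\<^esub> \<longleftrightarrow> ev F \<in> equation_ideal f A"
    unfolding curve_ring_def th_def curve_class_def by (rule RQ.ring_image_quot(2)[OF eqideal])
  also have "\<dots> \<longleftrightarrow> (\<exists>q. ev F = ev (q * W.ft))"
    unfolding equation_ideal_def equation_eq cgenideal_def RQ.im_mult RQ.im_carrier by blast
  finally show ?thesis unfolding ev_eq .
qed

lemma th_eq: "th F = th G \<longleftrightarrow> (\<exists>q. F - G - q * W.ft \<in> KF (KF K))"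
  unfolding RC.im_eq_iff th_zero ..

definition latI :: "(nat \<Rightarrow> 'u univ fps) set \<Rightarrow> (int \<Rightarrow> int \<Rightarrow> 'u) set set" where
  "latI L = th ` W.Jof K L"

abbreviation "hlat \<equiv> weier_lattice n ta K"

lemma th_mem:
  assumes L: "hlat L"
  shows "th F \<in> latI L \<longleftrightarrow> F \<in> W.Jof K L"
proof
  interpret L: weier_lattice n ta K L by (rule L)
  assume "th F \<in> latI L"
  then obtain G where G: "G \<in> W.Jof K L" "th F = th G" unfolding latI_def by blast
  then obtain q where q: "F - G - q * W.ft \<in> KF (KF K)" unfolding th_eq by blast
  from L.J_add[OF L.J_add[OF L.J_KK[OF q] L.J_ft[of q]] G(1)] show "F \<in> W.Jof K L" by simp
qed (simp add: latI_def)

lemma th_pol_mem: "hlat L \<Longrightarrow> th (W.pol w) \<in> latI L \<longleftrightarrow> w \<in> L"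
  using th_mem weier_lattice.J_pol_iff by blast

lemma latI_inj: "hlat L \<Longrightarrow> hlat L' \<Longrightarrow> latI L = latI L' \<Longrightarrow> L = L'"
  using th_pol_mem by blast

lemma th_division: obtains w where "th F = th (W.pol w)"
proof -
  obtain q w where e: "F = q * W.ft + W.pol w" by (rule W.division_ex)
  have "F - W.pol w - q * W.ft = 0" unfolding e by simp
  moreover have "0 \<in> KF (KF K)" by (simp add: KF_def KA.K0)
  ultimately have "th F = th (W.pol w)" unfolding th_eq by metis
  thus ?thesis by (rule that)
qed

lemma latI_ideal:
  assumes L: "hlat L"
  shows "ideal (latI L) (curve_ring f A)"
proof -
  interpret L: weier_lattice n ta K L by (rule L)
  have mult: "x \<otimes>\<^bsub>curve_ring f A\<^esub> y \<in> latI L" if y: "y \<in> latI L" and x: "x \<in> carrier (curve_ring f A)" for x y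
  proof -
    obtain F G where e: "x = th F" "y = th G" and G: "G \<in> W.Jof K L" using x y unfolding latI_def RC.im_carrier by blast
    show ?thesis unfolding e RC.im_mult[symmetric] latI_def using L.J_mult[OF G] by blast
  qed
  show ?thesis
  proof (rule idealI[OF RC.ring_axioms])
    show "subgroup (latI L) (add_monoid (curve_ring f A))"
    proof (rule group.subgroupI[OF RC.a_group])
      show "latI L \<subseteq> carrier (add_monoid (curve_ring f A))" by (auto simp: latI_def)
      show "latI L \<noteq> {}" using L.J_0 by (auto simp: latI_def)
      fix x assume "x \<in> latI L"
      then obtain F where x: "x = th F" "F \<in> W.Jof K L" unfolding latI_def by blast
      have "- F \<in> W.Jof K L" using L.J_mult[OF x(2), of "- 1"] by simp
      thus "inv\<^bsub>add_monoid (curve_ring f A)\<^esub> x \<in> latI L"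
        unfolding a_inv_def[symmetric] x(1) RC.im_uminus[symmetric] latI_def by blast
      fix y assume "y \<in> latI L"
      then obtain G where y: "y = th G" "G \<in> W.Jof K L" unfolding latI_def by blast
      have "th (F + G) \<in> latI L" using L.J_add[OF x(2) y(2)] unfolding latI_def by blast
      thus "x \<otimes>\<^bsub>add_monoid (curve_ring f A)\<^esub> y \<in> latI L" by (simp add: x(1) y(1) RC.im_add)
    qed
    fix y x assume yx: "y \<in> latI L" "x \<in> carrier (curve_ring f A)"
    show "x \<otimes>\<^bsub>curve_ring f A\<^esub> y \<in> latI L" by (rule mult[OF yx])
    have "y \<in> carrier (curve_ring f A)" using yx(1) by (auto simp: latI_def)
    thus "y \<otimes>\<^bsub>curve_ring f A\<^esub> x \<in> latI L" using mult[OF yx] RC.m_comm[OF _ yx(2)] by simp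
  qed
qed

lemma latI_open:
  assumes L: "hlat L"
  shows "open_ideal f A (latI L)"
proof -
  interpret L: weier_lattice n ta K L by (rule L)
  obtain N where N: "\<And>w. (\<lambda>i. fps_X ^ N * w i) \<in> L" using L.L_X by blast
  show ?thesis unfolding open_ideal_def
  proof (intro exI[of _ "int (n * N + N)"] ballI impI)
    fix F assume "F \<in> carrier (power_series2 A)" and z: "\<forall>i j. i + j < int (n * N + N) \<longrightarrow> F i j = \<zero>\<^bsub>A\<^esub>"
    then obtain G where F: "F = ev G" unfolding RQ.im_carrier by blast
    \<comment> \<open>The bound n N + N is that of \<open>J_open\<close>: a monomial of at least
      this total degree has x-exponent at least n N or t-exponent at least N.\<close>
    have "G \<in> W.Jof K L"
    proof (rule L.J_open[OF N])
      fix i j :: nat assume "i + j < n * N + N"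
      hence "int i + int j < int (n * N + N)" by (simp only: of_nat_add[symmetric] of_nat_less_iff)
      hence "ev G (int i) (int j) = \<zero>\<^bsub>A\<^esub>" using z unfolding F by blast
      thus "fps_nth (fps_nth G i) j \<in> K" by (simp add: ev_nth ker_def)
    qed
    thus "curve_class f A F \<in> latI L" unfolding F th_def[symmetric] latI_def by blast
  qed
qed

lemma ideal_lattice:
  assumes I: "ideal I (curve_ring f A)" and op: "open_ideal f A I"
  shows "hlat {w. th (W.pol w) \<in> I}" "latI {w. th (W.pol w) \<in> I} = I"
proof -
  interpret I: ideal I "curve_ring f A" by (rule I)
  define J where "J = {F. th F \<in> I}"
  obtain N where N: "\<And>F. F \<in> carrier (power_series2 A) \<Longrightarrow> \<forall>i j. i + j < N \<longrightarrow> F i j = \<zero>\<^bsub>A\<^esub> \<Longrightarrow> curve_class f A F \<in> I"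
    using op unfolding open_ideal_def by blast
  have zero: "F \<in> J" if "F - q * W.ft \<in> KF (KF K)" for F q
    using that th_zero[of F] I.zero_closed unfolding J_def by auto
  \<comment> \<open>This power of t has no term of total degree below N, so openness puts it into
    the ideal; \<open>nat\<close> takes care of a negative bound.\<close>
  have XN: "fps_const (fps_X ^ nat N) \<in> J"
  proof -
    have "ev (fps_const (fps_X ^ nat N)) i j = \<zero>\<^bsub>A\<^esub>" if "i + j < N" for i j
      using that A by (auto simp: ev_nth fps_X_power_nth)
    hence "curve_class f A (ev (fps_const (fps_X ^ nat N))) \<in> I" by (intro N) auto
    thus ?thesis unfolding J_def th_def by simp
  qed
  have J: "weier_lattice n ta K {w. W.pol w \<in> J}" "W.Jof K {w. W.pol w \<in> J} = J"
  proof (atomize (full), intro conjI W.lattice_of_ideal[OF KA.coeff_ideal_axioms _ _ _ _ XN])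
    show "F + G \<in> J" if "F \<in> J" "G \<in> J" for F G using that by (simp add: J_def RC.im_add)
    show "G * F \<in> J" if "F \<in> J" for F G using that by (simp add: J_def RC.im_mult I.I_l_closed)
    show "W.ft \<in> J" by (rule zero[of _ 1]) (simp add: KF_def KA.K0)
    show "KF (KF K) \<subseteq> J" using zero[of _ 0] by auto
    thus "KF (KF K) \<subseteq> J" .
    show "F + G \<in> J" if "F \<in> J" "G \<in> J" for F G using that by (simp add: J_def RC.im_add)
    show "G * F \<in> J" if "F \<in> J" for F G using that by (simp add: J_def RC.im_mult I.I_l_closed)
    show "W.ft \<in> J" by (rule zero[of _ 1]) (simp add: KF_def KA.K0)
  qed
  have "I = th ` J" using I.Icarr unfolding J_def RC.im_carrier by blast
  thus "hlat {w. th (W.pol w) \<in> I}" "latI {w. th (W.pol w) \<in> I} = I" using J unfolding latI_def by (auto simp: J_def)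
qed

section \<open>The quotient by an ideal as a module over the algebra\<close>

definition quo :: "(nat \<Rightarrow> 'u univ fps) set \<Rightarrow> 'u univ fps fps \<Rightarrow> (int \<Rightarrow> int \<Rightarrow> 'u) set set" where
  "quo L F = latI L +>\<^bsub>curve_ring f A\<^esub> th F"

lemma quotient_ops:
  "carrier (quotient_module f A I) = carrier (curve_ring f A Quot I)"
  "mult (quotient_module f A I) = mult (curve_ring f A Quot I)"
  "one (quotient_module f A I) = one (curve_ring f A Quot I)"
  "zero (quotient_module f A I) = zero (curve_ring f A Quot I)"
  "add (quotient_module f A I) = add (curve_ring f A Quot I)"
  by (simp_all add: quotient_module_def ring.defs)

lemma quo_image:
  assumes L: "hlat L"
  shows "ring_image (quotient_module f A (latI L)) (quo L)"
  using RC.ring_image_quot(1)[OF latI_ideal[OF L]]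
  unfolding ring_image_def quotient_ops quo_def[abs_def] .

lemma quo_zero:
  assumes L: "hlat L"
  shows "quo L F = \<zero>\<^bsub>quotient_module f A (latI L)\<^esub> \<longleftrightarrow> F \<in> W.Jof K L"
  unfolding quotient_ops quo_def using RC.ring_image_quot(2)[OF latI_ideal[OF L], of F] th_mem[OF L, of F] by (simp only:)

lemma quo_smult:
  assumes L: "hlat L"
  shows "pev A c \<odot>\<^bsub>quotient_module f A (latI L)\<^esub> quo L F = quo L (fps_const (fps_const c) * F)"
proof -
  interpret Q: ring_image "curve_ring f A Quot latI L" "\<lambda>x. latI L +>\<^bsub>curve_ring f A\<^esub> th x" by (rule RC.ring_image_quot(1)[OF latI_ideal[OF L]])
  have "const2 A (pev A c) = ev (fps_const (fps_const c))"
    unfolding const2_def by (intro ext) (use A in \<open>auto simp: ev_nth nat_eq_iff\<close>)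
  moreover have "pev A c \<odot>\<^bsub>quotient_module f A (latI L)\<^esub> quo L F =
    (latI L +>\<^bsub>curve_ring f A\<^esub> curve_class f A (const2 A (pev A c))) \<otimes>\<^bsub>curve_ring f A Quot latI L\<^esub> quo L F"
    by (simp add: quotient_module_def ring.defs)
  ultimately show ?thesis unfolding quo_def Q.im_mult by (simp only: th_def)
qed

lemma quo_eq:
  assumes L: "hlat L"
  shows "quo L F = quo L G \<longleftrightarrow> F - G \<in> W.Jof K L"
proof -
  interpret M: ring_image "quotient_module f A (latI L)" "quo L" by (rule quo_image[OF L])
  show ?thesis unfolding M.im_eq_iff quo_zero[OF L] ..
qed

lemma quo_lc:
  assumes L: "hlat L" and b: "\<And>l. l < m \<Longrightarrow> b l = quo L (W.pol (b' l))" and c: "\<And>l. l < m \<Longrightarrow> c l = pev A (c' l)"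
  shows "(\<Oplus>\<^bsub>quotient_module f A (latI L)\<^esub> i\<in>{..<m}. c i \<odot>\<^bsub>quotient_module f A (latI L)\<^esub> b i) = quo L (W.pol (lc m c' b'))"
proof -
  interpret M: ring_image "quotient_module f A (latI L)" "quo L" by (rule quo_image[OF L])
  have "W.pol (lc m c' b') = (\<Sum>l<m. fps_const (fps_const (c' l)) * W.pol (b' l))"
    by (rule fps_ext) (simp add: fps_sum_nth lc_def)
  hence "quo L (W.pol (lc m c' b')) = (\<Oplus>\<^bsub>quotient_module f A (latI L)\<^esub> i\<in>{..<m}. quo L (fps_const (fps_const (c' i)) * W.pol (b' i)))"
    by (simp only: M.im_sum[OF finite_lessThan])
  also have "\<dots> = (\<Oplus>\<^bsub>quotient_module f A (latI L)\<^esub> i\<in>{..<m}. c i \<odot>\<^bsub>quotient_module f A (latI L)\<^esub> b i)"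
    by (rule M.finsum_cong') (auto simp: b c quo_smult[OF L])
  finally show ?thesis ..
qed

text \<open>Every class in the quotient is that of some \<open>pol w\<close> by division, and
  coefficients lift along \<open>pev A\<close>. So the two clauses of local freeness become the two
  clauses of \<open>lfree\<close>.\<close>

lemma lfree_quotient:
  assumes L: "hlat L" and b: "\<And>l. l < m \<Longrightarrow> b l = quo L (W.pol (b' l))"
  defines "M \<equiv> quotient_module f A (latI L)"
  shows "(\<forall>y\<in>carrier M. \<exists>k::nat. \<exists>c\<in>{..<m} \<rightarrow> carrier A. pev A p [^]\<^bsub>A\<^esub> k \<odot>\<^bsub>M\<^esub> y = (\<Oplus>\<^bsub>M\<^esub> i\<in>{..<m}. c i \<odot>\<^bsub>M\<^esub> b i)) \<and>
    (\<forall>c\<in>{..<m} \<rightarrow> carrier A. (\<Oplus>\<^bsub>M\<^esub> i\<in>{..<m}. c i \<odot>\<^bsub>M\<^esub> b i) = \<zero>\<^bsub>M\<^esub> \<longrightarrow> (\<forall>i<m. \<exists>k::nat. pev A p [^]\<^bsub>A\<^esub> k \<otimes>\<^bsub>A\<^esub> c i = \<zero>\<^bsub>A\<^esub>))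
    \<longleftrightarrow> lattice0.lfree K L m p b'"
proof -
  interpret L: weier_lattice n ta K L by (rule L)
  interpret M: ring_image M "quo L" unfolding M_def by (rule quo_image[OF L])
  have lift: "\<exists>c'. \<forall>l<m. c l = pev A (c' l)" if "c \<in> {..<m} \<rightarrow> carrier A" for c
    by (rule exI[of _ "\<lambda>l. plift A (c l)"]) (simp add: A funcset_mem[OF that])
  have sm: "pev A p [^]\<^bsub>A\<^esub> k \<odot>\<^bsub>M\<^esub> quo L (W.pol w) = quo L (W.pol (\<lambda>i. fps_const (p ^ k) * w i))" for k w
    unfolding M_def pev_power[OF A, symmetric] quo_smult[OF L] W.pol_smult ..
  have eq: "quo L (W.pol w) = quo L (W.pol w') \<longleftrightarrow> L.eqv w w'" for w w'
    unfolding quo_eq[OF L] L.eqv_def W.pol_diff[symmetric] by (rule L.J_pol_iff)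
  have z: "quo L (W.pol w) = \<zero>\<^bsub>M\<^esub> \<longleftrightarrow> w \<in> L" for w unfolding M_def quo_zero[OF L] by (rule L.J_pol_iff)
  have ker: "pev A p [^]\<^bsub>A\<^esub> k \<otimes>\<^bsub>A\<^esub> pev A c = \<zero>\<^bsub>A\<^esub> \<longleftrightarrow> p ^ k * c \<in> K" for k c
    unfolding ker_def mem_Collect_eq RA.im_mult pev_power[OF A] ..
  have ql': "(\<Oplus>\<^bsub>M\<^esub> i\<in>{..<m}. c i \<odot>\<^bsub>M\<^esub> b i) = quo L (W.pol (lc m c' b'))"
    if "\<And>l. l < m \<Longrightarrow> c l = pev A (c' l)" for c c'
    unfolding M_def by (rule quo_lc[OF L b that])
  have ql: "(\<Oplus>\<^bsub>M\<^esub> i\<in>{..<m}. pev A (c i) \<odot>\<^bsub>M\<^esub> b i) = quo L (W.pol (lc m c b'))" for c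
    by (rule ql') (rule refl)
  have pol: "\<exists>w. y = quo L (W.pol w)" if y: "y \<in> carrier M" for y
  proof -
    obtain F where F: "y = quo L F" using y unfolding M.im_carrier by blast
    obtain w where "th F = th (W.pol w)" by (rule th_division)
    thus ?thesis unfolding F quo_def by auto
  qed
  have "(\<forall>y\<in>carrier M. \<exists>k::nat. \<exists>c\<in>{..<m} \<rightarrow> carrier A. pev A p [^]\<^bsub>A\<^esub> k \<odot>\<^bsub>M\<^esub> y = (\<Oplus>\<^bsub>M\<^esub> i\<in>{..<m}. c i \<odot>\<^bsub>M\<^esub> b i))
    \<longleftrightarrow> (\<forall>w. \<exists>k c. L.eqv (\<lambda>i. fps_const (p ^ k) * w i) (lc m c b'))" (is "?a \<longleftrightarrow> ?b")
  proof
    assume l: ?a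
    show ?b
    proof
      fix w
      obtain k c where c: "c \<in> {..<m} \<rightarrow> carrier A" "pev A p [^]\<^bsub>A\<^esub> (k::nat) \<odot>\<^bsub>M\<^esub> quo L (W.pol w) = (\<Oplus>\<^bsub>M\<^esub> i\<in>{..<m}. c i \<odot>\<^bsub>M\<^esub> b i)"
        using l M.im_closed[of "W.pol w"] by blast
      obtain c' where c': "\<And>l. l < m \<Longrightarrow> c l = pev A (c' l)" using lift[OF c(1)] by blast
      have q: "(\<Oplus>\<^bsub>M\<^esub> i\<in>{..<m}. c i \<odot>\<^bsub>M\<^esub> b i) = quo L (W.pol (lc m c' b'))" by (rule ql') (rule c')
      have "L.eqv (\<lambda>i. fps_const (p ^ k) * w i) (lc m c' b')"
        using c(2) unfolding sm q eq .
      thus "\<exists>k c. L.eqv (\<lambda>i. fps_const (p ^ k) * w i) (lc m c b')" by blast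
    qed
  next
    assume r: ?b
    show ?a
    proof
      fix y assume "y \<in> carrier M"
      then obtain w where y: "y = quo L (W.pol w)" using pol by blast
      obtain k c where c: "L.eqv (\<lambda>i. fps_const (p ^ k) * w i) (lc m c b')" using r by blast
      have 1: "pev A p [^]\<^bsub>A\<^esub> k \<odot>\<^bsub>M\<^esub> y = (\<Oplus>\<^bsub>M\<^esub> i\<in>{..<m}. pev A (c i) \<odot>\<^bsub>M\<^esub> b i)"
        unfolding y sm ql eq by (rule c)
      have 2: "(\<lambda>i. pev A (c i)) \<in> {..<m} \<rightarrow> carrier A" using A by auto
      show "\<exists>k::nat. \<exists>c\<in>{..<m} \<rightarrow> carrier A. pev A p [^]\<^bsub>A\<^esub> k \<odot>\<^bsub>M\<^esub> y = (\<Oplus>\<^bsub>M\<^esub> i\<in>{..<m}. c i \<odot>\<^bsub>M\<^esub> b i)"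
        by (rule exI[of _ k], rule bexI[of _ "\<lambda>i. pev A (c i)"], rule 1, rule 2)
    qed
  qed
  moreover have "(\<forall>c\<in>{..<m} \<rightarrow> carrier A. (\<Oplus>\<^bsub>M\<^esub> i\<in>{..<m}. c i \<odot>\<^bsub>M\<^esub> b i) = \<zero>\<^bsub>M\<^esub> \<longrightarrow> (\<forall>i<m. \<exists>k::nat. pev A p [^]\<^bsub>A\<^esub> k \<otimes>\<^bsub>A\<^esub> c i = \<zero>\<^bsub>A\<^esub>))
    \<longleftrightarrow> (\<forall>c. lc m c b' \<in> L \<longrightarrow> (\<forall>l<m. \<exists>k. p ^ k * c l \<in> K))" (is "?a \<longleftrightarrow> ?b")
  proof
    assume l: ?a
    show ?b
    proof (intro allI impI)
      fix c l assume cL: "lc m c b' \<in> L" and lm: "l < m"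
      have 1: "(\<Oplus>\<^bsub>M\<^esub> i\<in>{..<m}. pev A (c i) \<odot>\<^bsub>M\<^esub> b i) = \<zero>\<^bsub>M\<^esub>"
        unfolding ql z by (rule cL)
      have 2: "(\<lambda>i. pev A (c i)) \<in> {..<m} \<rightarrow> carrier A" using A by auto
      have "\<forall>i<m. \<exists>k::nat. pev A p [^]\<^bsub>A\<^esub> k \<otimes>\<^bsub>A\<^esub> pev A (c i) = \<zero>\<^bsub>A\<^esub>" by (rule mp[OF bspec[OF l 2] 1])
      hence "\<exists>k::nat. pev A p [^]\<^bsub>A\<^esub> k \<otimes>\<^bsub>A\<^esub> pev A (c l) = \<zero>\<^bsub>A\<^esub>" using lm by blast
      thus "\<exists>k. p ^ k * c l \<in> K" unfolding ker .
    qed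
  next
    assume r: ?b
    show ?a
    proof (intro ballI allI impI)
      fix c l assume c: "c \<in> {..<m} \<rightarrow> carrier A" "(\<Oplus>\<^bsub>M\<^esub> i\<in>{..<m}. c i \<odot>\<^bsub>M\<^esub> b i) = \<zero>\<^bsub>M\<^esub>" and lm: "l < m"
      obtain c' where c': "\<And>l. l < m \<Longrightarrow> c l = pev A (c' l)" using lift[OF c(1)] by blast
      have q: "(\<Oplus>\<^bsub>M\<^esub> i\<in>{..<m}. c i \<odot>\<^bsub>M\<^esub> b i) = quo L (W.pol (lc m c' b'))" by (rule ql') (rule c')
      have "lc m c' b' \<in> L" using c(2) unfolding q z .
      hence "\<exists>k. p ^ k * c' l \<in> K" using r lm by blast
      thus "\<exists>k::nat. pev A p [^]\<^bsub>A\<^esub> k \<otimes>\<^bsub>A\<^esub> c l = \<zero>\<^bsub>A\<^esub>" unfolding c'[OF lm] ker .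
    qed
  qed
  ultimately show ?thesis unfolding L.lfree_def by (rule arg_cong2[where f = "(\<and>)"])
qed

text \<open>Sections of \<open>hilb f m\<close> in terms of lattices; \<open>hilb_sections\<close>
  is the bridge.\<close>

definition hsec :: "nat \<Rightarrow> (nat \<Rightarrow> 'u univ fps) set \<Rightarrow> bool" where
  "hsec m L \<longleftrightarrow> hlat L \<and> (\<exists>T\<subseteq>carrier A. genideal A T = carrier A \<and>
     (\<forall>s\<in>T. \<exists>p b. pev A p = s \<and> lattice0.lfree K L m p b))"

lemma locally_free_iff:
  assumes L: "hlat L"
  shows "locally_free A (quotient_module f A (latI L)) m \<longleftrightarrow> hsec m L"
proof -
  interpret M: ring_image "quotient_module f A (latI L)" "quo L" by (rule quo_image[OF L])
  let ?M = "quotient_module f A (latI L)"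
  let ?P = "\<lambda>s b. (\<forall>y\<in>carrier ?M. \<exists>k::nat. \<exists>c\<in>{..<m} \<rightarrow> carrier A. s [^]\<^bsub>A\<^esub> k \<odot>\<^bsub>?M\<^esub> y = (\<Oplus>\<^bsub>?M\<^esub> i\<in>{..<m}. c i \<odot>\<^bsub>?M\<^esub> b i)) \<and>
    (\<forall>c\<in>{..<m} \<rightarrow> carrier A. (\<Oplus>\<^bsub>?M\<^esub> i\<in>{..<m}. c i \<odot>\<^bsub>?M\<^esub> b i) = \<zero>\<^bsub>?M\<^esub> \<longrightarrow> (\<forall>i<m. \<exists>k::nat. s [^]\<^bsub>A\<^esub> k \<otimes>\<^bsub>A\<^esub> c i = \<zero>\<^bsub>A\<^esub>))"
  have "(\<exists>b\<in>{..<m} \<rightarrow> carrier ?M. ?P s b) \<longleftrightarrow> (\<exists>p b. pev A p = s \<and> lattice0.lfree K L m p b)" if s: "s \<in> carrier A" for s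
  proof
    assume "\<exists>b\<in>{..<m} \<rightarrow> carrier ?M. ?P s b"
    then obtain b where b: "b \<in> {..<m} \<rightarrow> carrier ?M" "?P s b" by blast
    have "\<exists>w. l < m \<longrightarrow> b l = quo L (W.pol w)" for l
    proof (cases "l < m")
      case True
      then obtain F where F: "b l = quo L F" using b(1) M.im_carrier by (auto simp: Pi_def)
      obtain w where "th F = th (W.pol w)" by (rule th_division)
      thus ?thesis unfolding F quo_def by auto
    qed simp
    hence "\<forall>l. \<exists>w. l < m \<longrightarrow> b l = quo L (W.pol w)" ..
    from choice[OF this] obtain b' where b': "\<And>l. l < m \<Longrightarrow> b l = quo L (W.pol (b' l))" by blast
    have ps: "pev A (plift A s) = s" using A s by simp
    have "lattice0.lfree K L m (plift A s) b'"
      by (rule iffD1[OF lfree_quotient[OF L b', where p = "plift A s"]]) (use b(2) ps in \<open>simp_all only:\<close>)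
    thus "\<exists>p b. pev A p = s \<and> lattice0.lfree K L m p b" using ps by blast
  next
    assume "\<exists>p b. pev A p = s \<and> lattice0.lfree K L m p b"
    then obtain p b' where p: "pev A p = s" "lattice0.lfree K L m p b'" by blast
    have "?P s (\<lambda>l. quo L (W.pol (b' l)))"
      using iffD2[OF lfree_quotient[OF L, where b = "\<lambda>l. quo L (W.pol (b' l))" and b' = b' and m = m and p = p, OF refl] p(2)] unfolding p(1) .
    moreover have "(\<lambda>l. quo L (W.pol (b' l))) \<in> {..<m} \<rightarrow> carrier ?M" by simp
    ultimately show "\<exists>b\<in>{..<m} \<rightarrow> carrier ?M. ?P s b" by (rule bexI)
  qed
  note key = this
  show ?thesis unfolding locally_free_def hsec_def eqTrueI[OF L] simp_thms
    by (rule ex_cong1, rule conj_cong[OF refl], rule conj_cong[OF refl], rule ball_cong[OF refl], rule key, erule (1) subsetD)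
qed

lemma hilb_sections: "I \<in> sections (hilb f m) A \<longleftrightarrow> (\<exists>L. hsec m L \<and> I = latI L)"
proof
  assume "I \<in> sections (hilb f m) A"
  hence I: "ideal I (curve_ring f A)" "open_ideal f A I" "locally_free A (quotient_module f A I) m" by (auto simp: hilb_def)
  note l = ideal_lattice[OF I(1,2)]
  have h: "hsec m {w. th (W.pol w) \<in> I}"
    by (rule iffD1[OF locally_free_iff[OF l(1)]]) (unfold l(2), rule I(3))
  show "\<exists>L. hsec m L \<and> I = latI L"
    by (rule exI[of _ "{w. th (W.pol w) \<in> I}"], rule conjI, rule h, rule l(2)[symmetric])
next
  assume "\<exists>L. hsec m L \<and> I = latI L"
  then obtain L where L: "hsec m L" "I = latI L" by blast
  hence h: "hlat L" by (simp add: hsec_def)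
  show "I \<in> sections (hilb f m) A" 
    using iffD2[OF locally_free_iff[OF h] L(1)] latI_ideal[OF h] latI_open[OF h] unfolding L(2) hilb_def by simp
qed

end

section \<open>Functoriality of the Hilbert functor\<close>

locale germ_hom = A: germ n a A + B: germ n a B for n a and A B :: "'u calg" +
  fixes \<phi> assumes \<phi>: "\<phi> \<in> calg_hom A B"
begin

abbreviation "\<sigma> \<equiv> push A B \<phi>"

sublocale S: comm_ring_hom \<sigma> by (rule push_hom[OF A.A B.A \<phi>])

lemma pev_\<sigma>: "pev B (\<sigma> p) = \<phi> (pev A p)" by (rule pev_push[OF A.A B.A \<phi>])

lemma \<sigma>_ker: "p \<in> ker A \<Longrightarrow> \<sigma> p \<in> ker B" by (rule push_ker[OF A.A B.A \<phi>])

lemma mapf_tf: "mapf \<sigma> (tf x) = tf x"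
  by (rule fps_ext) (simp add: push_scal[OF A.A B.A \<phi>])

sublocale M: comm_ring_hom "mapf \<sigma>" by unfold_locales (simp_all add: S.mapf_simps)

lemma ev_mapf: "B.ev (mapf (mapf \<sigma>) F) = (\<lambda>i j. \<phi> (A.ev F i j))"
  by (intro ext) (simp add: A.ev_nth B.ev_nth pev_\<sigma> calg_hom_zero[OF A.A B.A \<phi>])

lemma mapf_uminus: "mapf \<sigma> (- x) = - mapf \<sigma> x"
  using S.mapf_simps(4)[of 0 x] by (simp add: S.mapf_simps)

text \<open>The coefficients of f are complex scalars, and \<open>push\<close> fixes these; hence
  one and the same series represents f over both algebras.\<close>

lemma mapf_ft: "mapf (mapf \<sigma>) A.W.ft = A.W.ft"
proof (rule fps_ext)
  fix j
  have "mapf \<sigma> (fps_nth A.W.ft j) = fps_nth A.W.ft j" unfolding A.W.ft_nth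
    by (cases "j = n"; cases "j < n"; simp add: S.mapf_simps mapf_uminus mapf_tf)
  thus "fps_nth (mapf (mapf \<sigma>) A.W.ft) j = fps_nth A.W.ft j" by simp
qed

lemma mapf_pol: "mapf (mapf \<sigma>) (A.W.pol w) = A.W.pol (\<lambda>i. mapf \<sigma> (w i))"
  by (rule fps_ext) (simp add: S.mapf_simps)

context
  fixes N L assumes L: "A.hlat L" and N: "\<And>w. (\<lambda>i. fps_X ^ N * w i) \<in> L"
begin

abbreviation "E \<equiv> ext \<sigma> B.K n N L"

lemma base_change: "base_change A.K n L \<sigma> B.K N"
proof -
  interpret L: weier_lattice n A.ta A.K L by (rule L)
  show ?thesis
    by (intro base_change.intro base_change_axioms.intro L.lattice0_axioms S.comm_ring_hom_axioms B.KA.coeff_ideal_axioms \<sigma>_ker N)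
qed

lemma hlat_ext: "B.hlat E"
proof -
  interpret L: weier_lattice n A.ta A.K L by (rule L)
  interpret bc: base_change A.K n L \<sigma> B.K N by (rule base_change)
  have xm: "xmul B.ta n w \<in> E" if "w \<in> E" for w
    using bc.E_xmul[OF L.xm A.n that] unfolding mapf_tf .
  show ?thesis by (intro weier_lattice.intro weier_lattice_axioms.intro A.W.weier_axioms bc.lattice0_E xm)
qed

lemma high_ext: "(\<lambda>i. fps_X ^ N * w i) \<in> E" by (rule ext.high)

text \<open>The images of the old ideal have remainders in the base change of the lattice.
  Conversely the generated ideal contains each remainder by induction over the rules of
  \<open>ext\<close>.\<close>

lemma restr_latI: "restr (hilb A.f m) A B \<phi> (A.latI L) = B.latI E"
proof -
  interpret L: weier_lattice n A.ta A.K L by (rule L)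
  interpret bc: base_change A.K n L \<sigma> B.K N by (rule base_change)
  interpret E: weier_lattice n B.ta B.K E by (rule hlat_ext)
  let ?G = "(\<lambda>F. B.th (mapf (mapf \<sigma>) F)) ` A.W.Jof A.K L"
  have gen: "{curve_class A.f B (\<lambda>i j. \<phi> (F i j)) | F. F \<in> carrier (power_series2 A) \<and> curve_class A.f A F \<in> A.latI L} = ?G"
  proof (rule subset_antisym; rule subsetI)
    fix x assume "x \<in> {curve_class A.f B (\<lambda>i j. \<phi> (F i j)) | F. F \<in> carrier (power_series2 A) \<and> curve_class A.f A F \<in> A.latI L}"
    then obtain F where F: "x = curve_class A.f B (\<lambda>i j. \<phi> (A.ev F i j))" "A.th F \<in> A.latI L"
      unfolding A.RQ.im_carrier A.th_def by blast
    show "x \<in> ?G" using F A.th_mem[OF L, of F] unfolding ev_mapf[symmetric] B.th_def[symmetric] by blast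
  next
    fix x assume "x \<in> ?G"
    then obtain F where F: "F \<in> A.W.Jof A.K L" "x = B.th (mapf (mapf \<sigma>) F)" by blast
    have "curve_class A.f A (A.ev F) \<in> A.latI L" using F(1) A.th_mem[OF L, of F] unfolding A.th_def by blast
    thus "x \<in> {curve_class A.f B (\<lambda>i j. \<phi> (F i j)) | F. F \<in> carrier (power_series2 A) \<and> curve_class A.f A F \<in> A.latI L}"
      unfolding F(2) B.th_def ev_mapf using A.RQ.im_closed[of F] by blast
  qed
  have Gc: "?G \<subseteq> carrier (curve_ring A.f B)" by auto
  have g: "genideal (curve_ring A.f B) ?G = B.latI E"
  proof (rule subset_antisym)
    show "genideal (curve_ring A.f B) ?G \<subseteq> B.latI E"
    proof (rule B.RC.genideal_minimal[OF B.latI_ideal[OF hlat_ext]], rule subsetI)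
      fix x assume "x \<in> ?G"
      then obtain F where F: "F \<in> A.W.Jof A.K L" "x = B.th (mapf (mapf \<sigma>) F)" by blast
      then obtain q w where w: "w \<in> L" "F - q * A.W.ft - A.W.pol w \<in> KF (KF A.K)" unfolding A.W.Jof_def by blast
      have "mapf (mapf \<sigma>) (F - q * A.W.ft - A.W.pol w) = mapf (mapf \<sigma>) F - mapf (mapf \<sigma>) q * A.W.ft - A.W.pol (\<lambda>i. mapf \<sigma> (w i))"
        by (simp only: M.mapf_simps mapf_ft mapf_pol)
      moreover have "mapf (mapf \<sigma>) (F - q * A.W.ft - A.W.pol w) \<in> KF (KF B.K)"
        using w(2) \<sigma>_ker by (simp add: KF_def)
      ultimately have "mapf (mapf \<sigma>) F - mapf (mapf \<sigma>) q * A.W.ft - A.W.pol (\<lambda>i. mapf \<sigma> (w i)) \<in> KF (KF B.K)" by (simp only:)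
      hence "mapf (mapf \<sigma>) F \<in> A.W.Jof B.K E" by (rule E.J_I[OF ext.base[OF w(1)]])
      thus "x \<in> B.latI E" unfolding F(2) B.latI_def by blast
    qed
  next
    interpret I: ideal "genideal (curve_ring A.f B) ?G" "curve_ring A.f B" by (rule B.RC.genideal_ideal[OF Gc])
    let ?I = "genideal (curve_ring A.f B) ?G"
    define J where "J = {F. B.th F \<in> ?I}"
    have Jadd: "F + G \<in> J" if "F \<in> J" "G \<in> J" for F G using that by (simp add: J_def B.RC.im_add)
    have Jmult: "G * F \<in> J" if "F \<in> J" for F G using that by (simp add: J_def B.RC.im_mult I.I_l_closed)
    have J0: "F \<in> J" if "F \<in> KF (KF B.K)" for F
      using that B.th_zero[of F] I.zero_closed unfolding J_def by (metis (no_types, lifting) diff_zero mem_Collect_eq mult_zero_left)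
    have JJ: "mapf (mapf \<sigma>) F \<in> J" if "F \<in> A.W.Jof A.K L" for F
      using that B.RC.genideal_self[OF Gc] unfolding J_def by blast
    have Jsum: "sum F T \<in> J" if "\<And>x. x \<in> T \<Longrightarrow> F x \<in> J" for F :: "nat \<Rightarrow> 'u univ fps fps" and T
      using that by (induction T rule: infinite_finite_induct) (auto intro: Jadd J0 simp: E.FF.K0)
    have pol: "A.W.pol w \<in> J" if "w \<in> E" for w
      using that
    proof (induction rule: ext.induct)
      case (base w)
      show ?case using JJ[OF L.J_pol[OF base]] unfolding mapf_pol .
    next
      case (kern w)
      have "fps_nth (A.W.pol w) i \<in> KF B.K" for i using kern coeff_ideal.K0[OF B.KA.coeff_ideal_KF] by (cases "i < n") simp_all
      thus ?case by (intro J0) (simp add: KF_def[of "KF B.K"])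
    next
      case (high w)
      \<comment> \<open>A vector t^N w over the new algebra need not be an image, but it is a
        combination of the t^N e_i, and these are images of elements of \<open>L\<close>.\<close>
      have "A.W.pol (\<lambda>j. fps_X ^ N * unitv i j) \<in> J" for i
      proof -
        have e: "(\<lambda>j. mapf \<sigma> (fps_X ^ N * unitv i j)) = (\<lambda>j. fps_X ^ N * unitv i j)"
          by (auto simp: unitv_def S.mapf_simps)
        show ?thesis using JJ[OF L.J_pol[OF N[of "unitv i"]]] unfolding mapf_pol e .
      qed
      hence "(\<Sum>i<n. fps_const (w i) * A.W.pol (\<lambda>j. fps_X ^ N * unitv i j)) \<in> J" by (intro Jsum Jmult)
      also have "(\<Sum>i<n. fps_const (w i) * A.W.pol (\<lambda>j. fps_X ^ N * unitv i j)) = A.W.pol (\<lambda>i. fps_X ^ N * w i)"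
      proof (rule fps_ext)
        fix j
        have "(\<Sum>i<n. w i * (fps_X ^ N * unitv i j)) = (\<Sum>i<n. if i = j then fps_X ^ N * w j else 0)" if "j < n"
          by (intro sum.cong refl) (auto simp: unitv_def mult.commute)
        thus "fps_nth (\<Sum>i<n. fps_const (w i) * A.W.pol (\<lambda>j. fps_X ^ N * unitv i j)) j = fps_nth (A.W.pol (\<lambda>i. fps_X ^ N * w i)) j"
          by (simp add: fps_sum_nth)
      qed
      finally show ?case .
    next
      case (add w w')
      show ?case unfolding A.W.pol_add by (rule Jadd[OF add.IH])
    next
      case (scal w c)
      show ?case unfolding A.W.pol_smult by (rule Jmult[OF scal.IH])
    qed
    show "B.latI E \<subseteq> ?I"
    proof
      fix x assume "x \<in> B.latI E"
      then obtain G where G: "G \<in> A.W.Jof B.K E" "x = B.th G" unfolding B.latI_def by blast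
      then obtain q w where w: "w \<in> E" "G - q * A.W.ft - A.W.pol w \<in> KF (KF B.K)" unfolding A.W.Jof_def by blast
      have "G - A.W.pol w - q * A.W.ft = G - q * A.W.ft - A.W.pol w" by simp
      hence "G - A.W.pol w - q * A.W.ft \<in> KF (KF B.K)" using w(2) by (simp only:)
      hence "B.th G = B.th (A.W.pol w)" unfolding B.th_eq by blast
      thus "x \<in> ?I" using pol[OF w(1)] unfolding G(2) J_def by simp
    qed
  qed
  show ?thesis unfolding hilb_def presheaf.select_convs gen by (rule g)
qed

lemma hsec_ext: assumes h: "A.hsec m L" shows "B.hsec m E"
proof -
  interpret bc: base_change A.K n L \<sigma> B.K N by (rule base_change)
  obtain T where T0: "T \<subseteq> carrier A \<and> genideal A T = carrier A \<and> (\<forall>s\<in>T. \<exists>p b. pev A p = s \<and> bc.lfree m p b)"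
    using conjunct2[OF h[unfolded A.hsec_def]] ..
  note T = T0[THEN conjunct1] T0[THEN conjunct2, THEN conjunct1] T0[THEN conjunct2, THEN conjunct2]
  have "\<forall>s\<in>\<phi> ` T. \<exists>p b. pev B p = s \<and> bc.L'.lfree m p b"
  proof
    fix s assume "s \<in> \<phi> ` T"
    then obtain t where t: "t \<in> T" "s = \<phi> t" by blast
    obtain p where "\<exists>b. pev A p = t \<and> bc.lfree m p b" using bspec[OF T(3) t(1)] ..
    then obtain b where p: "pev A p = t \<and> bc.lfree m p b" ..
    have "pev B (\<sigma> p) = s" unfolding pev_\<sigma> t(2) using p by simp
    moreover have "bc.L'.lfree m (\<sigma> p) (\<lambda>l i. mapf \<sigma> (b l i))" by (rule bc.lfree_base[OF conjunct2[OF p]])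
    ultimately show "\<exists>p b. pev B p = s \<and> bc.L'.lfree m p b" by (intro exI conjI)
  qed
  note l = this
  show ?thesis unfolding B.hsec_def
    by (rule conjI[OF hlat_ext], rule exI[of _ "\<phi> ` T"], intro conjI genideal_image[OF A.A B.A \<phi> T(1,2)] l)
qed

end

end

context germ
begin

lemma hlat_high: "hlat L \<Longrightarrow> \<exists>N. \<forall>w. (\<lambda>i. fps_X ^ N * w i) \<in> L"
proof -
  assume "hlat L"
  then interpret L: weier_lattice n ta K L .
  show ?thesis by (rule L.L_X)
qed

lemma ext_id:
  assumes L: "hlat L" and N: "\<And>w. (\<lambda>i. fps_X ^ N * w i) \<in> L"
  shows "ext (push A A (id_hom A)) K n N L = L"
proof -
  interpret L: weier_lattice n ta K L by (rule L)
  interpret h: germ_hom n a A A "id_hom A" by unfold_locales (rule id_hom[OF A])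
  interpret E: weier_lattice n ta K "ext (push A A (id_hom A)) K n N L" by (rule h.hlat_ext[OF L N])
  have d: "mapf (push A A (id_hom A)) x - x \<in> KF K" for x
  proof -
    have "pev A (push A A (id_hom A) p) = pev A p" for p unfolding h.pev_\<sigma> using A by (simp add: id_hom_def)
    thus ?thesis using pev_eq_iff[OF A] by (simp add: KF_def)
  qed
  show ?thesis
  proof (rule subset_antisym; rule subsetI)
    fix w assume "w \<in> ext (push A A (id_hom A)) K n N L"
    thus "w \<in> L"
    proof (induction rule: ext.induct)
      case (base w)
      show ?case by (rule L.L_cong[OF base d])
    qed (auto intro: L.L_K N L.L_add L.L_smult)
  next
    fix w assume "w \<in> L"
    show "w \<in> ext (push A A (id_hom A)) K n N L"
      by (rule E.L_cong[OF ext.base[OF \<open>w \<in> L\<close>]]) (rule L.F.cong_sym[OF d])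
  qed
qed

end

text \<open>The lifts do not compose strictly: pushing in two stages also changes the component at
  \<open>B\<close>. They agree in the component at \<open>C\<close>, that is modulo
  \<open>ker C\<close>, which is all that the lattice sees.\<close>

lemma ext_compose:
  assumes AB: "germ_hom n a A B \<phi>" and BC: "germ_hom n a B C \<psi>" and L: "weier_lattice n (\<lambda>i. tf (a i)) (ker A) L"
    and N: "\<And>w. (\<lambda>i. fps_X ^ N * w i) \<in> L"
  shows "ext (push B C \<psi>) (ker C) n N (ext (push A B \<phi>) (ker B) n N L) = ext (push A C (compose (carrier A) \<psi> \<phi>)) (ker C) n N L"
    (is "?E2 = ?E3")
proof -
  interpret AB: germ_hom n a A B \<phi> by (rule AB)
  interpret BC: germ_hom n a B C \<psi> by (rule BC)
  interpret AC: germ_hom n a A C "compose (carrier A) \<psi> \<phi>"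
    by unfold_locales (rule calg_hom_compose[OF AB.\<phi> BC.\<phi> AB.A.A])
  interpret L: weier_lattice n AB.A.ta AB.A.K L by (rule L)
  interpret E1: weier_lattice n AB.A.ta AB.B.K "ext (push A B \<phi>) (ker B) n N L" by (rule AB.hlat_ext[OF L N])
  interpret E2: weier_lattice n AB.A.ta BC.B.K ?E2 by (rule BC.hlat_ext[OF AB.hlat_ext[OF L N] AB.high_ext[OF L N]])
  interpret E3: weier_lattice n AB.A.ta BC.B.K ?E3 by (rule AC.hlat_ext[OF L N])
  have d: "mapf (push B C \<psi>) (mapf (push A B \<phi>) x) - mapf (push A C (compose (carrier A) \<psi> \<phi>)) x \<in> KF (ker C)" for x
  proof -
    have "pev C (push B C \<psi> (push A B \<phi> p)) = pev C (push A C (compose (carrier A) \<psi> \<phi>) p)" for p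
      unfolding BC.pev_\<sigma> AB.pev_\<sigma> AC.pev_\<sigma> using AB.A.A by (simp add: compose_def)
    thus ?thesis using pev_eq_iff[OF BC.B.A] by (simp add: KF_def)
  qed
  have in3: "(\<lambda>i. mapf (push B C \<psi>) (w i)) \<in> ?E3" if "w \<in> ext (push A B \<phi>) (ker B) n N L" for w
    using that
  proof (induction rule: ext.induct)
    case (base w)
    show ?case by (rule E3.L_cong[OF ext.base[OF base] d])
  next
    case (kern w)
    show ?case by (rule E3.L_K) (use kern BC.\<sigma>_ker in \<open>auto simp: KF_def\<close>)
  next
    case (high w)
    show ?case unfolding BC.S.mapf_simps by (rule ext.high)
  next
    case (add w w')
    show ?case unfolding BC.S.mapf_simps by (rule ext.add[OF add.IH])
  next
    case (scal w c)
    show ?case unfolding BC.S.mapf_simps by (rule ext.scal[OF scal.IH])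
  qed
  show ?thesis
  proof (rule subset_antisym; rule subsetI)
    fix w assume "w \<in> ?E2"
    thus "w \<in> ?E3" by (induction rule: ext.induct) (auto intro: in3 E3.L_K E3.L_add E3.L_smult ext.high)
  next
    fix w assume "w \<in> ?E3"
    thus "w \<in> ?E2"
    proof (induction rule: ext.induct)
      case (base w)
      show ?case by (rule E2.L_cong[OF ext.base[OF ext.base[OF base]]]) (rule E2.F.cong_sym[OF d])
    qed (auto intro: E2.L_K E2.L_add E2.L_smult ext.high)
  qed
qed

lemma coproduct_simps:
  "x \<in> sections (presheaf_coproduct F) A \<longleftrightarrow> snd x \<in> sections (F (fst x)) A"
  "restr (presheaf_coproduct F) A B \<phi> (m, y) = (m, restr (F m) A B \<phi> y)"
  by (cases x; simp add: presheaf_coproduct_def) (simp add: presheaf_coproduct_def)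

lemma functorial_hilb:
  assumes n: "n \<ge> 1" and a: "\<forall>i<n. fps_nth (a i) 0 = 0"
  shows "functorial (presheaf_coproduct (hilb (fps_of_poly (weierstrass n a))) :: ('u, _) presheaf)"
proof -
  let ?G = "presheaf_coproduct (hilb (fps_of_poly (weierstrass n a))) :: ('u, _) presheaf"
  have g: "germ n a A" if "is_calg A" for A :: "'u calg" using that n a by unfold_locales auto
  have gh: "germ_hom n a A B \<phi>" if "is_calg A" "is_calg B" "\<phi> \<in> calg_hom A B" for A B :: "'u calg" and \<phi>
    using g that by (intro germ_hom.intro germ_hom_axioms.intro) auto
  have sec: "\<exists>m L N. x = (m, germ.latI n a A L) \<and> germ.hsec n a A m L \<and> weier_lattice n (\<lambda>i. tf (a i)) (ker A) L \<and> (\<forall>w. (\<lambda>i. fps_X ^ N * w i) \<in> L)"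
    if A: "is_calg A" and x: "x \<in> sections ?G A" for A x
  proof -
    interpret germ n a A by (rule g[OF A])
    obtain L where L: "hsec (fst x) L" "snd x = latI L" using x hilb_sections[of "snd x" "fst x"] unfolding coproduct_simps by blast
    hence h: "hlat L" by (simp add: hsec_def)
    obtain N where "\<forall>w. (\<lambda>i. fps_X ^ N * w i) \<in> L" using hlat_high[OF h] by blast
    moreover have "x = (fst x, latI L)" by (rule prod_eqI) (simp_all add: L(2))
    ultimately show ?thesis using L(1) h by blast
  qed
  show ?thesis unfolding functorial_def
  proof (intro conjI allI impI; elim conjE)
    fix A B \<phi> x assume A: "is_calg A" and B: "is_calg B" and \<phi>: "\<phi> \<in> calg_hom A B" and x: "x \<in> sections ?G A"
    interpret germ_hom n a A B \<phi> by (rule gh[OF A B \<phi>])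
    obtain m L N where L0: "x = (m, A.latI L) \<and> A.hsec m L \<and> A.hlat L \<and> (\<forall>w. (\<lambda>i. fps_X ^ N * w i) \<in> L)"
      using sec[OF A x] by (elim exE) (rule that)
    note L = conjunct1[OF L0] conjunct1[OF conjunct2[OF L0]] conjunct1[OF conjunct2[OF conjunct2[OF L0]]] spec[OF conjunct2[OF conjunct2[OF conjunct2[OF L0]]]]
    show "restr ?G A B \<phi> x \<in> sections ?G B"
      unfolding L(1) coproduct_simps restr_latI[OF L(3,4)] fst_conv snd_conv B.hilb_sections
      by (rule exI, rule conjI[OF hsec_ext[OF L(3,4,2)] refl])
  next
    fix A x assume A: "is_calg A" and x: "x \<in> sections ?G A"
    interpret germ_hom n a A A "id_hom A" by (rule gh[OF A A id_hom[OF A]])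
    obtain m L N where L0: "x = (m, A.latI L) \<and> A.hsec m L \<and> A.hlat L \<and> (\<forall>w. (\<lambda>i. fps_X ^ N * w i) \<in> L)"
      using sec[OF A x] by (elim exE) (rule that)
    note L = conjunct1[OF L0] conjunct1[OF conjunct2[OF L0]] conjunct1[OF conjunct2[OF conjunct2[OF L0]]] spec[OF conjunct2[OF conjunct2[OF conjunct2[OF L0]]]]
    show "restr ?G A A (id_hom A) x = x"
      unfolding L(1) coproduct_simps restr_latI[OF L(3,4)] A.ext_id[OF L(3,4)] ..
  next
    fix A B C \<phi> \<psi> x assume A: "is_calg A" and B: "is_calg B" and C: "is_calg C" and \<phi>: "\<phi> \<in> calg_hom A B" and \<psi>: "\<psi> \<in> calg_hom B C" and x: "x \<in> sections ?G A"
    interpret AB: germ_hom n a A B \<phi> by (rule gh[OF A B \<phi>])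
    interpret BC: germ_hom n a B C \<psi> by (rule gh[OF B C \<psi>])
    interpret AC: germ_hom n a A C "compose (carrier A) \<psi> \<phi>" by (rule gh[OF A C calg_hom_compose[OF \<phi> \<psi> A]])
    obtain m L N where L0: "x = (m, AB.A.latI L) \<and> AB.A.hsec m L \<and> AB.A.hlat L \<and> (\<forall>w. (\<lambda>i. fps_X ^ N * w i) \<in> L)"
      using sec[OF A x] by (elim exE) (rule that)
    note L = conjunct1[OF L0] conjunct1[OF conjunct2[OF L0]] conjunct1[OF conjunct2[OF conjunct2[OF L0]]] spec[OF conjunct2[OF conjunct2[OF conjunct2[OF L0]]]]
    show "restr ?G B C \<psi> (restr ?G A B \<phi> x) = restr ?G A C (compose (carrier A) \<psi> \<phi>) x"
      unfolding L(1) coproduct_simps AB.restr_latI[OF L(3,4)] AC.restr_latI[OF L(3,4)]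
        BC.restr_latI[OF AB.hlat_ext[OF L(3,4)] AB.high_ext[OF L(3,4)]]
        ext_compose[OF AB.germ_hom_axioms BC.germ_hom_axioms L(3,4)] ..
  qed
qed

section \<open>Matrices of Laurent series\<close>

text \<open>Every matrix over \<open>A((t))\<close> is \<open>t\<^sup>-\<^sup>N k\<close> with \<open>k\<close> integral.\<close>

definition tpole :: "nat \<Rightarrow> 'a::comm_ring_1 fps \<Rightarrow> 'a fls" where "tpole N x = fls_shift (int N) (fps_to_fls x)"

lemma tpole_nth: "fls_nth (tpole N x) q = (if q + int N < 0 then 0 else fps_nth x (nat (q + int N)))"
  by (simp add: tpole_def)

lemma tpole_mult: "tpole N x * tpole M y = tpole (N + M) (x * y)"
  unfolding tpole_def by (simp add: fls_shifted_times_simps fls_times_fps_to_fls add.commute)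

lemma tpole_sum: "tpole N (\<Sum>i\<in>I. x i) = (\<Sum>i\<in>I. tpole N (x i))"
  by (rule fls_eqI) (simp add: tpole_nth fls_nth_sum fps_sum_nth)

lemma tpole_delta: "tpole N (if b then fps_X ^ N else 0) = (if b then 1 else 0)"
  by (rule fls_eqI) (auto simp: tpole_nth fps_X_power_nth nat_eq_iff)

lemma tpole_shift: "tpole (N + M) (fps_X ^ M * x) = tpole N x"
proof (rule fls_eqI)
  fix q
  show "fls_nth (tpole (N + M) (fps_X ^ M * x)) q = fls_nth (tpole N x) q"
  proof (cases "q + int N < 0")
    case True
    thus ?thesis by (auto simp: tpole_nth fps_X_power_mult_nth)
  next
    case False
    hence "nat (q + int (N + M)) = nat (q + int N) + M" by simp
    thus ?thesis using False by (simp add: tpole_nth fps_X_power_mult_nth)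
  qed
qed

section \<open>Integral matrices modulo coefficients in an ideal\<close>

definition mprod :: "nat \<Rightarrow> (nat \<Rightarrow> nat \<Rightarrow> 'a::comm_ring_1 fps) \<Rightarrow> (nat \<Rightarrow> nat \<Rightarrow> 'a fps) \<Rightarrow> nat \<Rightarrow> nat \<Rightarrow> 'a fps" where
  "mprod n k h = (\<lambda>i j. \<Sum>l<n. k i l * h l j)"

definition mdel :: "nat \<Rightarrow> nat \<Rightarrow> nat \<Rightarrow> 'a::comm_ring_1 fps" where
  "mdel N = (\<lambda>i j. if i = j then fps_X ^ N else 0)"

definition meq :: "'a::comm_ring_1 set \<Rightarrow> nat \<Rightarrow> (nat \<Rightarrow> nat \<Rightarrow> 'a fps) \<Rightarrow> (nat \<Rightarrow> nat \<Rightarrow> 'a fps) \<Rightarrow> bool" where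
  "meq K n k h \<longleftrightarrow> (\<forall>i<n. \<forall>j<n. k i j - h i j \<in> KF K)"

text \<open>For g = t^-N k this says that g is invertible with the integral inverse
  \<open>h\<close>.\<close>

definition minv :: "'a::comm_ring_1 set \<Rightarrow> nat \<Rightarrow> nat \<Rightarrow> (nat \<Rightarrow> nat \<Rightarrow> 'a fps) \<Rightarrow> (nat \<Rightarrow> nat \<Rightarrow> 'a fps) \<Rightarrow> bool" where
  "minv K n N k h \<longleftrightarrow> meq K n (mprod n k h) (mdel N) \<and> meq K n (mprod n h k) (mdel N)"

context coeff_ideal
begin

lemma matlat_cong: assumes "meq K n k k'" shows "matlat K n N k = matlat K n N k'"
proof -
  interpret F: coeff_ideal "KF K" by (rule coeff_ideal_KF)
  have "fps_nth (\<Sum>i<n. w i * k i j) q \<in> K \<longleftrightarrow> fps_nth (\<Sum>i<n. w i * k' i j) q \<in> K" if "j < n" for w j q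
  proof -
    have "(\<Sum>i<n. w i * k i j) - (\<Sum>i<n. w i * k' i j) \<in> KF K"
      by (rule F.cong_sum, rule F.cong_mult) (use assms that in \<open>auto simp: meq_def F.K0\<close>)
    hence "fps_nth (\<Sum>i<n. w i * k i j) q - fps_nth (\<Sum>i<n. w i * k' i j) q \<in> K" using KF_nth by fastforce
    thus ?thesis using K_cong by blast
  qed
  thus ?thesis unfolding matlat_def by auto
qed

text \<open>Makes the lattice depend on g = t^-N k only, not on the exponent chosen to write
  it.\<close>

lemma matlat_shift: "matlat K n (N + M) (\<lambda>i j. fps_X ^ M * k i j) = matlat K n N k"
proof -
  have "(\<forall>q<N + M. fps_nth (\<Sum>i<n. w i * (fps_X ^ M * k i j)) q \<in> K) \<longleftrightarrow> (\<forall>q<N. fps_nth (\<Sum>i<n. w i * k i j) q \<in> K)" for w j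
  proof -
    have e: "(\<Sum>i<n. w i * (fps_X ^ M * k i j)) = fps_X ^ M * (\<Sum>i<n. w i * k i j)"
      by (simp add: sum_distrib_left mult.left_commute)
    show ?thesis unfolding e fps_X_power_mult_nth
    proof (intro iffI allI impI)
      fix q assume a: "\<forall>q<N + M. (if q < M then 0 else fps_nth (\<Sum>i<n. w i * k i j) (q - M)) \<in> K" and q: "q < N"
      show "fps_nth (\<Sum>i<n. w i * k i j) q \<in> K" using a[rule_format, of "q + M"] q by simp
    qed (auto simp: K0)
  qed
  thus ?thesis unfolding matlat_def by simp
qed

lemma matlat_mult: "matlat K n N k \<subseteq> matlat K n N (mprod n k u)"
proof
  fix w assume w: "w \<in> matlat K n N k"
  show "w \<in> matlat K n N (mprod n k u)" unfolding matlat_def mprod_def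
  proof (intro CollectI allI impI)
    fix j q assume j: "j < n" and q: "q < N"
    have e: "(\<Sum>i<n. w i * (\<Sum>l<n. k i l * u l j)) = (\<Sum>l<n. (\<Sum>i<n. w i * k i l) * u l j)" by (rule sum_assoc[symmetric])
    show "fps_nth (\<Sum>i<n. w i * (\<Sum>l<n. k i l * u l j)) q \<in> K" unfolding e fps_sum_nth
    proof (rule K_sum)
      fix l assume "l \<in> {..<n}"
      hence "fps_nth (\<Sum>i<n. w i * k i l) p \<in> K" if "p \<le> q" for p using w q that unfolding matlat_def by auto
      thus "fps_nth ((\<Sum>i<n. w i * k i l) * u l j) q \<in> K" unfolding fps_mult_nth by (intro K_sum K_mult2) auto
    qed
  qed
qed

lemma matlat_rows: assumes "meq K n (mprod n h k) (mdel N)" "i < n" shows "h i \<in> matlat K n N k"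
  unfolding matlat_def
proof (intro CollectI allI impI)
  fix j q assume jq: "j < n" "q < N"
  have "(\<Sum>l<n. h i l * k l j) - (if i = j then fps_X ^ N else 0) \<in> KF K"
    using assms jq unfolding meq_def mprod_def mdel_def by blast
  from KF_nth[OF this, of q] show "fps_nth (\<Sum>l<n. h i l * k l j) q \<in> K"
    using jq by (auto simp: fps_X_power_nth split: if_splits)
qed

text \<open>w = (w g) g^-1 with w g integral, where g = t^-N k and g^-1 = h.\<close>

lemma matlat_span:
  assumes kh: "meq K n (mprod n k h) (mdel N)" and w: "w \<in> matlat K n N k"
  shows "\<exists>u. \<forall>j<n. w j - (\<Sum>i<n. u i * h i j) \<in> KF K"
proof -
  interpret F: coeff_ideal "KF K" by (rule coeff_ideal_KF)
  define u where "u j = (\<Sum>i<n. w i * k i j)" for j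
  define C where "C j = fps_shift N (u j)" for j
  have uC: "u j - fps_X ^ N * C j \<in> KF K" if j: "j < n" for j
    unfolding KF_def using w j K0 by (auto simp: matlat_def u_def[symmetric] C_def fps_X_power_mult_nth)
  have "w j - (\<Sum>i<n. C i * h i j) \<in> KF K" if j: "j < n" for j
  proof -
    have "(\<Sum>i<n. w i * (\<Sum>l<n. k i l * h l j)) - (\<Sum>i<n. w i * (if i = j then fps_X ^ N else 0)) \<in> KF K"
      by (rule F.cong_sum, rule F.cong_mult) (use kh j in \<open>auto simp: meq_def mprod_def mdel_def F.K0\<close>)
    hence 1: "(\<Sum>l<n. u l * h l j) - fps_X ^ N * w j \<in> KF K"
      unfolding sum_pick[OF j] u_def sum_assoc[symmetric] .
    have "(\<Sum>l<n. u l * h l j) - (\<Sum>l<n. fps_X ^ N * C l * h l j) \<in> KF K"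
      by (rule F.cong_sum, rule F.cong_mult) (use uC in \<open>auto simp: F.K0\<close>)
    from F.cong_trans[OF F.cong_sym[OF 1] this]
    have "fps_X ^ N * (w j - (\<Sum>l<n. C l * h l j)) \<in> KF K" by (simp add: right_diff_distrib sum_distrib_left mult.assoc)
    thus ?thesis by (simp only: KF_X)
  qed
  thus ?thesis by (intro exI[of _ C]) simp
qed

end

lemma mprod_mapf: assumes "comm_ring_hom \<sigma>"
  shows "mprod n (\<lambda>i j. mapf \<sigma> (k i j)) (\<lambda>i j. mapf \<sigma> (h i j)) = (\<lambda>i j. mapf \<sigma> (mprod n k h i j))"
proof -
  interpret comm_ring_hom \<sigma> by (rule assms)
  show ?thesis unfolding mprod_def by (simp add: mapf_sum mapf_simps)
qed

lemma minv_mapf: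
  assumes \<sigma>: "comm_ring_hom \<sigma>" and K: "\<And>x. x \<in> K \<Longrightarrow> \<sigma> x \<in> K'" and k: "minv K n N k h"
  shows "minv K' n N (\<lambda>i j. mapf \<sigma> (k i j)) (\<lambda>i j. mapf \<sigma> (h i j))"
proof -
  interpret comm_ring_hom \<sigma> by (rule \<sigma>)
  have d: "mdel N = (\<lambda>i j. mapf \<sigma> (mdel N i j))" unfolding mdel_def by (intro ext) (simp add: mapf_simps)
  have "mapf \<sigma> x - mapf \<sigma> y \<in> KF K'" if "x - y \<in> KF K" for x y
  proof -
    have "mapf \<sigma> (x - y) \<in> KF K'" using that K by (simp add: KF_def)
    thus ?thesis by (simp only: mapf_simps)
  qed
  thus ?thesis using k unfolding minv_def meq_def mprod_mapf[OF \<sigma>] by (subst (1 2) d) blast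
qed

context germ
begin

sublocale RL: ring_image "laurent A" "\<lambda>f k. pev A (fls_nth f k)" by (rule RA.ring_image_laurent)

abbreviation "LM \<equiv> mat_ring (laurent A) n"

definition gm :: "nat \<Rightarrow> (nat \<Rightarrow> nat \<Rightarrow> 'u univ fps) \<Rightarrow> (int \<Rightarrow> 'u) mat" where
  "gm N k = mat n n (\<lambda>(i, j) q. pev A (fls_nth (tpole N (k i j)) q))"

lemma gm_mult: "gm N k \<otimes>\<^bsub>LM\<^esub> gm M h = gm (N + M) (mprod n k h)"
  unfolding gm_def mprod_def tpole_sum tpole_mult[symmetric] by (rule RL.mat_mult)

lemma gm_one: "\<one>\<^bsub>LM\<^esub> = gm N (mdel N)"
  unfolding gm_def mdel_def tpole_delta by (rule RL.mat_one)

lemma gm_closed: "gm N k \<in> carrier LM" unfolding gm_def by (rule RL.hM_closed)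

lemma gm_shift: "gm (N + M) (\<lambda>i j. fps_X ^ M * k i j) = gm N k"
  unfolding gm_def tpole_shift ..

lemma tpole_eq: "(\<lambda>q. pev A (fls_nth (tpole N x) q)) = (\<lambda>q. pev A (fls_nth (tpole N y) q)) \<longleftrightarrow> x - y \<in> KF K"
proof
  assume e: "(\<lambda>q. pev A (fls_nth (tpole N x) q)) = (\<lambda>q. pev A (fls_nth (tpole N y) q))"
  have "pev A (fps_nth x j) = pev A (fps_nth y j)" for j
    using fun_cong[OF e, of "int j - int N"] by (simp add: tpole_nth)
  thus "x - y \<in> KF K" unfolding pev_eq_iff[OF A] by (simp add: KF_def)
next
  assume "x - y \<in> KF K"
  hence "pev A (fps_nth x j) = pev A (fps_nth y j)" for j unfolding pev_eq_iff[OF A] by (simp add: KF_def)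
  thus "(\<lambda>q. pev A (fls_nth (tpole N x) q)) = (\<lambda>q. pev A (fls_nth (tpole N y) q))" by (simp add: tpole_nth fun_eq_iff)
qed

lemma gm_eq: "gm N k = gm N h \<longleftrightarrow> meq K n k h"
  unfolding gm_def RL.hM_eq meq_def tpole_eq ..

lemma gm_ex: assumes "g \<in> carrier LM" obtains N k where "g = gm N k"
proof -
  obtain x where x: "g = RL.hM n x" using assms unfolding RL.mat_carrier by blast
  \<comment> \<open>A sum over all entries bounds every pole order at once.\<close>
  define N where "N = (\<Sum>i<n. \<Sum>j<n. nat (- fls_subdegree (x i j)))"
  define k where "k i j = fls_regpart (fls_shift (- int N) (x i j))" for i j
  have "tpole N (k i j) = x i j" if ij: "i < n" "j < n" for i j
  proof (rule fls_eqI)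
    fix q
    have "nat (- fls_subdegree (x i j)) \<le> (\<Sum>j<n. nat (- fls_subdegree (x i j)))" using ij by (intro member_le_sum) auto
    also have "\<dots> \<le> N" unfolding N_def using ij by (intro member_le_sum[where f = "\<lambda>i. \<Sum>j<n. nat (- fls_subdegree (x i j))"]) auto
    finally have "- int N \<le> fls_subdegree (x i j)" by simp
    hence "fls_nth (x i j) q = 0" if "q + int N < 0" using that by (intro fls_eq0_below_subdegree) simp
    thus "fls_nth (tpole N (k i j)) q = fls_nth (x i j) q" by (simp add: tpole_nth k_def)
  qed
  hence "g = gm N k" unfolding x gm_def by (intro eq_matI) simp_all
  thus ?thesis by (rule that)
qed

lemma gm_inverse: "minv K n N k h \<Longrightarrow> gm N k \<otimes>\<^bsub>LM\<^esub> gm 0 h = \<one>\<^bsub>LM\<^esub>" "minv K n N k h \<Longrightarrow> gm 0 h \<otimes>\<^bsub>LM\<^esub> gm N k = \<one>\<^bsub>LM\<^esub>"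
  unfolding gm_mult gm_one[of N] minv_def by (simp_all add: gm_eq)

section \<open>Cosets of the integral group and their lattices\<close>

abbreviation "GLO \<equiv> GL n (power_series A)"

lemma evP_gm: "RP.hM n u = gm 0 u"
  unfolding gm_def evP_def tpole_def by simp

lemma MP_mult: "gm 0 u \<otimes>\<^bsub>mat_ring (power_series A) n\<^esub> gm 0 u' = gm 0 (mprod n u u')"
  unfolding evP_gm[symmetric] RP.mat_mult mprod_def ..

lemma MP_one: "\<one>\<^bsub>mat_ring (power_series A) n\<^esub> = gm 0 (mdel 0)"
  unfolding evP_gm[symmetric] RP.mat_one mdel_def power_0 ..

lemma MP_carrier: "x \<in> carrier (mat_ring (power_series A) n) \<longleftrightarrow> (\<exists>u. x = gm 0 u)"
  unfolding RP.mat_carrier evP_gm[symmetric] by (simp only: image_iff bex_UNIV)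

lemma GLO_iff: "x \<in> GLO \<longleftrightarrow> (\<exists>u u'. x = gm 0 u \<and> minv K n 0 u u')"
  unfolding GL_def Units_def mem_Collect_eq Bex_def MP_carrier
proof
  assume "(\<exists>u. x = gm 0 u) \<and> (\<exists>y. (\<exists>u. y = gm 0 u) \<and> y \<otimes>\<^bsub>mat_ring (power_series A) n\<^esub> x = \<one>\<^bsub>mat_ring (power_series A) n\<^esub> \<and> x \<otimes>\<^bsub>mat_ring (power_series A) n\<^esub> y = \<one>\<^bsub>mat_ring (power_series A) n\<^esub>)"
  then obtain u u' where u: "x = gm 0 u" "gm 0 u' \<otimes>\<^bsub>mat_ring (power_series A) n\<^esub> gm 0 u = \<one>\<^bsub>mat_ring (power_series A) n\<^esub>"
    "gm 0 u \<otimes>\<^bsub>mat_ring (power_series A) n\<^esub> gm 0 u' = \<one>\<^bsub>mat_ring (power_series A) n\<^esub>" by blast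
  have "minv K n 0 u u'" using u(2,3) unfolding MP_mult MP_one gm_eq minv_def by (intro conjI)
  thus "\<exists>u u'. x = gm 0 u \<and> minv K n 0 u u'" using u(1) by blast
next
  assume "\<exists>u u'. x = gm 0 u \<and> minv K n 0 u u'"
  then obtain u u' where u: "x = gm 0 u" "minv K n 0 u u'" by blast
  have p1: "gm 0 u' \<otimes>\<^bsub>mat_ring (power_series A) n\<^esub> gm 0 u = \<one>\<^bsub>mat_ring (power_series A) n\<^esub>"
    unfolding MP_mult MP_one gm_eq by (rule u(2)[unfolded minv_def, THEN conjunct2])
  have p2: "gm 0 u \<otimes>\<^bsub>mat_ring (power_series A) n\<^esub> gm 0 u' = \<one>\<^bsub>mat_ring (power_series A) n\<^esub>"
    unfolding MP_mult MP_one gm_eq by (rule u(2)[unfolded minv_def, THEN conjunct1])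
  show "(\<exists>u. x = gm 0 u) \<and> (\<exists>y. (\<exists>u. y = gm 0 u) \<and> y \<otimes>\<^bsub>mat_ring (power_series A) n\<^esub> x = \<one>\<^bsub>mat_ring (power_series A) n\<^esub> \<and> x \<otimes>\<^bsub>mat_ring (power_series A) n\<^esub> y = \<one>\<^bsub>mat_ring (power_series A) n\<^esub>)"
    unfolding u(1) by (rule conjI, rule exI, rule refl, rule exI[of _ "gm 0 u'"], rule conjI, rule exI, rule refl, rule conjI, rule p1, rule p2)
qed

interpretation LG: Group.monoid LM by (rule RL.mat_monoid)

lemma GLO_mult: assumes "x \<in> GLO" "y \<in> GLO" shows "x \<otimes>\<^bsub>LM\<^esub> y \<in> GLO"
proof -
  obtain u v where u: "x = gm 0 u" "y = gm 0 v" using assms unfolding GLO_iff by blast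
  have "x \<otimes>\<^bsub>mat_ring (power_series A) n\<^esub> y \<in> GLO" by (rule RP.GL_group(1)[OF assms])
  thus ?thesis unfolding u MP_mult gm_mult by simp
qed

lemma GLO_one: "\<one>\<^bsub>LM\<^esub> \<in> GLO"
  using RP.GL_group(3)[of n] unfolding MP_one gm_one[of 0] .

lemma GLO_inv: assumes "x \<in> GLO" obtains y where "y \<in> GLO" "x \<otimes>\<^bsub>LM\<^esub> y = \<one>\<^bsub>LM\<^esub>"
proof -
  obtain u u' where u: "x = gm 0 u" "minv K n 0 u u'" using assms unfolding GLO_iff by blast
  have "minv K n 0 u' u" using u(2) unfolding minv_def by blast
  hence "gm 0 u' \<in> GLO" unfolding GLO_iff by blast
  thus ?thesis by (rule that) (unfold u(1), rule gm_inverse(1)[OF u(2)])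
qed

lemma GLO_closed: "x \<in> GLO \<Longrightarrow> x \<in> carrier LM" unfolding GLO_iff using gm_closed by blast

definition lcos :: "nat \<Rightarrow> (nat \<Rightarrow> nat \<Rightarrow> 'u univ fps) \<Rightarrow> (int \<Rightarrow> 'u) mat set" where
  "lcos N k = gm N k <#\<^bsub>LM\<^esub> GLO"

lemma cos_mem: "x \<in> lcos N k \<longleftrightarrow> (\<exists>y\<in>GLO. x = gm N k \<otimes>\<^bsub>LM\<^esub> y)"
  unfolding lcos_def l_coset_def by blast

lemma cos_self: "gm N k \<in> lcos N k"
  unfolding cos_mem by (rule bexI[OF _ GLO_one]) (simp add: gm_closed)

lemma coset_absorb: assumes g: "g \<in> carrier LM" and x: "x \<in> GLO" shows "(g \<otimes>\<^bsub>LM\<^esub> x) <#\<^bsub>LM\<^esub> GLO = g <#\<^bsub>LM\<^esub> GLO"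
proof -
  obtain y where y: "y \<in> GLO" "x \<otimes>\<^bsub>LM\<^esub> y = \<one>\<^bsub>LM\<^esub>" using GLO_inv[OF x] .
  show ?thesis
  proof (rule subset_antisym; rule subsetI)
    fix z assume "z \<in> (g \<otimes>\<^bsub>LM\<^esub> x) <#\<^bsub>LM\<^esub> GLO"
    then obtain u where u: "u \<in> GLO" "z = g \<otimes>\<^bsub>LM\<^esub> x \<otimes>\<^bsub>LM\<^esub> u" unfolding l_coset_def by blast
    have "z = g \<otimes>\<^bsub>LM\<^esub> (x \<otimes>\<^bsub>LM\<^esub> u)" unfolding u(2) by (rule LG.m_assoc[OF g GLO_closed[OF x] GLO_closed[OF u(1)]])
    thus "z \<in> g <#\<^bsub>LM\<^esub> GLO" using GLO_mult[OF x u(1)] unfolding l_coset_def by blast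
  next
    fix z assume "z \<in> g <#\<^bsub>LM\<^esub> GLO"
    then obtain u where u: "u \<in> GLO" "z = g \<otimes>\<^bsub>LM\<^esub> u" unfolding l_coset_def by blast
    note c = g GLO_closed[OF x] GLO_closed[OF y(1)] GLO_closed[OF u(1)]
    have "x \<otimes>\<^bsub>LM\<^esub> (y \<otimes>\<^bsub>LM\<^esub> u) = u" using LG.m_assoc[OF c(2,3,4)] c(4) unfolding y(2) by simp
    hence "z = g \<otimes>\<^bsub>LM\<^esub> x \<otimes>\<^bsub>LM\<^esub> (y \<otimes>\<^bsub>LM\<^esub> u)"
      unfolding u(2) using LG.m_assoc[OF c(1,2) LG.m_closed[OF c(3,4)]] by simp
    thus "z \<in> (g \<otimes>\<^bsub>LM\<^esub> x) <#\<^bsub>LM\<^esub> GLO" using GLO_mult[OF y(1) u(1)] unfolding l_coset_def by blast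
  qed
qed

lemma matlat_eq_gm: "gm N k = gm M h \<Longrightarrow> matlat K n N k = matlat K n M h"
proof -
  assume "gm N k = gm M h"
  hence "gm (N + M) (\<lambda>i j. fps_X ^ M * k i j) = gm (N + M) (\<lambda>i j. fps_X ^ N * h i j)"
    using gm_shift[of N M k] gm_shift[of M N h] by (simp add: add.commute)
  from KA.matlat_cong[OF this[unfolded gm_eq], of "N + M"]
  show ?thesis using KA.matlat_shift[of n N M k] KA.matlat_shift[of n M N h] by (simp add: add.commute)
qed

text \<open>A factor from the integral group on the right of g does not affect whether w g is
  integral.\<close>

lemma cos_matlat:
  assumes "lcos N k = lcos M h"
  shows "matlat K n N k = matlat K n M h"
proof -
  have sub: "matlat K n M h \<subseteq> matlat K n N k" if e: "lcos N k = lcos M h" for N k M h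
  proof -
    have "gm N k \<in> lcos M h" using cos_self[of N k] unfolding e .
    then obtain y where y: "y \<in> GLO" "gm N k = gm M h \<otimes>\<^bsub>LM\<^esub> y" unfolding cos_mem by (elim bexE) (rule that)
    obtain u u' where u: "y = gm 0 u \<and> minv K n 0 u u'" using y(1) unfolding GLO_iff by (elim exE) (rule that)
    have "gm N k = gm M (mprod n h u)" unfolding y(2) conjunct1[OF u] gm_mult by simp
    from matlat_eq_gm[OF this] show ?thesis using KA.matlat_mult[of n M h u] by simp
  qed
  show ?thesis using sub[OF assms] sub[OF assms[symmetric]] by blast
qed

text \<open>The rows of g^-1 lie in the lattice of g, hence in that of g', so g^-1 g' is integral.
  By symmetry so is its inverse, and g' differs from g by an element of the integral group.\<close>

lemma matlat_cos:
  assumes k: "minv K n N k h" and k': "minv K n M k' h'" and e: "matlat K n N k = matlat K n M k'"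
  shows "lcos N k = lcos M k'"
proof -
  have row: "\<exists>u. gm M (mprod n h k') = gm 0 u" if k: "minv K n N k h" and e: "matlat K n N k = matlat K n M k'" for N k h M k'
  proof -
    define u where "u i j = fps_shift M (mprod n h k' i j)" for i j
    have "meq K n (mprod n h k') (\<lambda>i j. fps_X ^ M * u i j)" unfolding meq_def
    proof (intro allI impI)
      fix i j assume ij: "i < n" "j < n"
      have "h i \<in> matlat K n M k'" using KA.matlat_rows[of n h k N i] k ij(1) unfolding minv_def e by blast
      hence "fps_nth (mprod n h k' i j) q \<in> K" if "q < M" for q using ij that unfolding matlat_def mprod_def by blast
      thus "mprod n h k' i j - fps_X ^ M * u i j \<in> KF K" by (auto simp: KF_def u_def fps_X_power_mult_nth KA.K0)
    qed
    hence "gm M (mprod n h k') = gm (0 + M) (\<lambda>i j. fps_X ^ M * u i j)" unfolding gm_eq by (simp add: gm_eq)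
    thus ?thesis unfolding gm_shift by blast
  qed
  obtain u where u: "gm 0 h \<otimes>\<^bsub>LM\<^esub> gm M k' = gm 0 u" using row[OF k e] unfolding gm_mult by auto
  obtain u' where u': "gm 0 h' \<otimes>\<^bsub>LM\<^esub> gm N k = gm 0 u'" using row[OF k' e[symmetric]] unfolding gm_mult by auto
  note c = gm_closed[of N k] gm_closed[of 0 h] gm_closed[of M k'] gm_closed[of 0 h']
  note i = gm_inverse[OF k] gm_inverse[OF k']
  have canc: "(p \<otimes>\<^bsub>LM\<^esub> q) \<otimes>\<^bsub>LM\<^esub> (r \<otimes>\<^bsub>LM\<^esub> s) = \<one>\<^bsub>LM\<^esub>"
    if "p \<in> carrier LM" "q \<in> carrier LM" "r \<in> carrier LM" "s \<in> carrier LM" "q \<otimes>\<^bsub>LM\<^esub> r = \<one>\<^bsub>LM\<^esub>" "p \<otimes>\<^bsub>LM\<^esub> s = \<one>\<^bsub>LM\<^esub>" for p q r s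
  proof -
    have "q \<otimes>\<^bsub>LM\<^esub> (r \<otimes>\<^bsub>LM\<^esub> s) = s" using LG.m_assoc[OF that(2,3,4)] that(4,5) by simp
    thus ?thesis using LG.m_assoc[OF that(1,2) LG.m_closed[OF that(3,4)]] that(6) by simp
  qed
  have "gm 0 u \<otimes>\<^bsub>LM\<^esub> gm 0 u' = \<one>\<^bsub>LM\<^esub>" "gm 0 u' \<otimes>\<^bsub>LM\<^esub> gm 0 u = \<one>\<^bsub>LM\<^esub>"
    unfolding u[symmetric] u'[symmetric] by (rule canc[OF c(2,3,4,1) i(3,2)], rule canc[OF c(4,1,2,3) i(1,4)])
  hence "minv K n 0 u u'" unfolding gm_mult gm_one[of 0] minv_def by (simp add: gm_eq)
  hence uG: "gm 0 u \<in> GLO" unfolding GLO_iff by blast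
  have "gm M k' = gm N k \<otimes>\<^bsub>LM\<^esub> gm 0 u"
    unfolding u[symmetric] using LG.m_assoc[OF c(1,2,3)] i(1) c(3) by simp
  thus ?thesis unfolding lcos_def using coset_absorb[OF c(1) uG] by simp
qed

end

section \<open>Springer fibers as lattices\<close>

context coeff_ideal
begin

lemma matlat_high: "(\<lambda>i. fps_X ^ N * w i) \<in> matlat K n N k"
proof -
  have e: "(\<Sum>i<n. fps_X ^ N * w i * k i j) = fps_X ^ N * (\<Sum>i<n. w i * k i j)" for j
    by (simp add: sum_distrib_left mult.assoc)
  show ?thesis unfolding matlat_def by (simp add: e fps_X_power_mult_nth K0)
qed

lemma low_mult:
  assumes "\<And>p. p < M \<Longrightarrow> fps_nth x p \<in> K" "q < M"
  shows "fps_nth (c * x) q \<in> K"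
  unfolding fps_mult_nth by (intro K_sum K_mult assms(1)) (use assms(2) in auto)

lemma low_shift: "(\<And>p. p < M \<Longrightarrow> fps_nth x p \<in> K) \<Longrightarrow> x - fps_X ^ M * fps_shift M x \<in> KF K"
  by (auto simp: KF_def fps_X_power_mult_nth K0)

end

lemma xmul_sum:
  "xmul a n (\<lambda>j. \<Sum>i\<in>I. u i * h i j) j = (\<Sum>i\<in>I. u i * xmul a n (h i) j)"
  by (simp add: xmul_def distrib_left sum.distrib sum_distrib_left mult.left_commute)

context germ
begin

text \<open>With g = t^-N k the conditions say that g^-1 = h is integral and that its lattice is
  stable under x. Together they are equivalent to the two integrality conditions of the fiber, by
  \<open>springer_sections\<close>.\<close>

definition spr :: "nat \<Rightarrow> (nat \<Rightarrow> nat \<Rightarrow> 'u univ fps) \<Rightarrow> (nat \<Rightarrow> nat \<Rightarrow> 'u univ fps) \<Rightarrow> bool" where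
  "spr N k h \<longleftrightarrow> minv K n N k h \<and> (\<forall>w\<in>matlat K n N k. xmul ta n w \<in> matlat K n N k)"

lemma spr_hlat: "spr N k h \<Longrightarrow> hlat (matlat K n N k)"
  unfolding spr_def by (intro weier_lattice.intro weier_lattice_axioms.intro W.weier_axioms KA.lattice0_matlat) blast

definition cmp :: "nat \<Rightarrow> nat \<Rightarrow> 'u univ fps" where
  "cmp i j = (if i = n - 1 then ta j else if j = i + 1 then 1 else 0)"

lemma gamma_gm: "map_mat (fls_scalar A) (companion n a) = gm 0 cmp"
proof (rule eq_matI)
  fix i j assume "i < dim_row (gm 0 cmp)" "j < dim_col (gm 0 cmp)"
  hence ij: "i < n" "j < n" by (simp_all add: gm_def)
  have "scalar A (fls_nth (if i = n - 1 then fps_to_fls (a j) else if j = i + 1 then 1 else 0) q) = pev A (fls_nth (tpole 0 (cmp i j)) q)" for q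
    unfolding cmp_def tpole_nth using A by (auto simp: scalar_simps[OF A] not_less)
  thus "index_mat (map_mat (fls_scalar A) (companion n a)) (i, j) = index_mat (gm 0 cmp) (i, j)"
    using ij by (simp add: companion_def fls_scalar_def gm_def)
qed (simp_all add: gm_def companion_def)

lemma mprod_cmp: assumes j: "j < n" shows "mprod n h cmp i j = xmul ta n (h i) j"
proof -
  obtain m where m: "n = Suc m" using n by (cases n) auto
  have c1: "cmp l j = (if j = Suc l then 1 else 0)" if "l < m" for l j using that m unfolding cmp_def by simp
  have c2: "cmp m j = ta j" using m unfolding cmp_def by simp
  have s: "(\<Sum>l<m. h i l * cmp l j) = (if j = 0 then 0 else h i (j - 1))"
  proof (cases j)
    case 0
    thus ?thesis by (simp add: c1)
  next
    case (Suc j')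
    hence "j' < m" using j m by simp
    have "(\<Sum>l<m. h i l * cmp l j) = (\<Sum>l<m. h i l * (if l = j' then 1 else 0))"
      by (intro sum.cong refl) (auto simp: c1 Suc)
    also have "\<dots> = 1 * h i j'" by (rule sum_pick[OF \<open>j' < m\<close>])
    finally show ?thesis using Suc by simp
  qed
  have "n - 1 = m" using m by simp
  moreover have "mprod n h cmp i j = (\<Sum>l<m. h i l * cmp l j) + h i m * cmp m j"
    unfolding mprod_def m sum.lessThan_Suc ..
  ultimately show ?thesis unfolding s c2 xmul_def by (simp add: mult.commute)
qed

lemma tpole_power:
  "(\<lambda>q. pev A (fls_nth (tpole M x) q)) \<in> carrier (power_series A) \<longleftrightarrow> (\<forall>q<M. fps_nth x q \<in> K)"
proof -
  have "(\<lambda>q. pev A (fls_nth (tpole M x) q)) \<in> carrier (power_series A) \<longleftrightarrow> (\<forall>i<0. pev A (fls_nth (tpole M x) i) = \<zero>\<^bsub>A\<^esub>)"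
    using RL.im_closed[of "tpole M x"] by (simp add: power_series_def)
  also have "\<dots> \<longleftrightarrow> (\<forall>q<M. fps_nth x q \<in> K)"
  proof
    assume z: "\<forall>i<0. pev A (fls_nth (tpole M x) i) = \<zero>\<^bsub>A\<^esub>"
    show "\<forall>q<M. fps_nth x q \<in> K"
    proof (intro allI impI)
      fix q assume "q < M"
      thus "fps_nth x q \<in> K" using z[rule_format, of "int q - int M"] by (simp add: tpole_nth ker_def)
    qed
  next
    assume z: "\<forall>q<M. fps_nth x q \<in> K"
    show "\<forall>i<0. pev A (fls_nth (tpole M x) i) = \<zero>\<^bsub>A\<^esub>"
    proof (intro allI impI)
      fix i :: int assume "i < 0"
      hence "i + int M < 0 \<or> nat (i + int M) < M" by linarith
      thus "pev A (fls_nth (tpole M x) i) = \<zero>\<^bsub>A\<^esub>" using z A by (auto simp: tpole_nth ker_def)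
    qed
  qed
  finally show ?thesis .
qed

lemma mat_vec_gm:
  assumes "i < n"
  shows "vec_index (mat_vec (laurent A) n (gm M h) (map_vec (fls_scalar A) (unit_vec n (n - 1)))) i = (\<lambda>q. pev A (fls_nth (tpole M (h i (n - 1))) q))"
proof -
  let ?e = "\<lambda>x q. pev A (fls_nth x q)"
  have u: "vec_index (map_vec (fls_scalar A) (unit_vec n (n - 1))) l = ?e (if l = n - 1 then 1 else 0)" if "l < n" for l
    using that A n by (auto simp: fls_scalar_def unit_vec_def scalar_simps[OF A])
  have t: "index_mat (gm M h) (i, l) \<otimes>\<^bsub>laurent A\<^esub> vec_index (map_vec (fls_scalar A) (unit_vec n (n - 1))) l
    = ?e (tpole M (h i l) * (if l = n - 1 then 1 else 0))" if "l < n" for l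
  proof -
    have g: "index_mat (gm M h) (i, l) = ?e (tpole M (h i l))" using assms that by (simp add: gm_def)
    show ?thesis unfolding g u[OF that] RL.im_mult ..
  qed
  have "(\<Oplus>\<^bsub>laurent A\<^esub> l\<in>{..<n}. index_mat (gm M h) (i, l) \<otimes>\<^bsub>laurent A\<^esub> vec_index (map_vec (fls_scalar A) (unit_vec n (n - 1))) l)
    = (\<Oplus>\<^bsub>laurent A\<^esub> l\<in>{..<n}. ?e (tpole M (h i l) * (if l = n - 1 then 1 else 0)))"
    by (rule RL.finsum_cong'[OF refl Pi_I[OF RL.im_closed]], rule t) simp
  also have "\<dots> = ?e (\<Sum>l<n. tpole M (h i l) * (if l = n - 1 then 1 else 0))"
    by (rule RL.im_sum[OF finite_lessThan, symmetric])
  also have "(\<Sum>l<n. tpole M (h i l) * (if l = n - 1 then 1 else 0)) = 1 * tpole M (h i (n - 1))"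
    by (rule sum_pick) (use n in simp)
  finally show ?thesis unfolding mat_vec_def index_vec[OF assms] mult_1_left .
qed

abbreviation (input) "vv \<equiv> (companion n a, unit_vec n (n - 1) :: complex fls vec)"

interpretation LG: Group.monoid LM by (rule RL.mat_monoid)

text \<open>As y = g^-1, the action conjugates by y and sends e_n to the last column of y = t^-M
  h.\<close>

lemma act_mem:
  assumes y: "y = gm M h" and g: "g \<in> carrier LM" and yg: "y \<otimes>\<^bsub>LM\<^esub> g = \<one>\<^bsub>LM\<^esub>" "g \<otimes>\<^bsub>LM\<^esub> y = \<one>\<^bsub>LM\<^esub>"
  shows "AdV_act n (laurent A) (inv\<^bsub>LM\<^esub> g) (AdV_scalar A vv) \<in> AdV n (power_series A) \<longleftrightarrow>
    (\<exists>u. y \<otimes>\<^bsub>LM\<^esub> gm 0 cmp \<otimes>\<^bsub>LM\<^esub> g = gm 0 u) \<and> (\<forall>i<n. \<forall>q<M. fps_nth (h i (n - 1)) q \<in> K)"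
proof -
  have yc: "y \<in> carrier LM" unfolding y by (rule gm_closed)
  have i: "inv\<^bsub>LM\<^esub> g = y" by (rule LG.inv_char[OF g yc yg(2,1)])
  have i': "inv\<^bsub>LM\<^esub> y = g" by (rule LG.inv_char[OF yc g yg])
  let ?v = "mat_vec (laurent A) n y (map_vec (fls_scalar A) (unit_vec n (n - 1)))"
  have v: "vec_index ?v i \<in> carrier (power_series A) \<longleftrightarrow> (\<forall>q<M. fps_nth (h i (n - 1)) q \<in> K)" if "i < n" for i
    unfolding y mat_vec_gm[OF that] by (rule tpole_power)
  have d: "?v \<in> carrier_vec n" by (simp add: mat_vec_def)
  have vd: "(?v \<in> carrier_vec n \<and> (\<forall>i<n. vec_index ?v i \<in> carrier (power_series A))) \<longleftrightarrow> (\<forall>i<n. \<forall>q<M. fps_nth (h i (n - 1)) q \<in> K)"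
    using v d by blast
  show ?thesis
    unfolding AdV_act_def AdV_scalar_def AdV_def prod.case i i' gamma_gm mem_Times_iff fst_conv snd_conv MP_carrier mem_Collect_eq vd ..
qed

lemma springer_sections:
  "Y \<in> sections (springer_presheaf n vv) A \<longleftrightarrow> (\<exists>N k h. spr N k h \<and> Y = lcos N k)"
proof
  assume "Y \<in> sections (springer_presheaf n vv) A"
  hence "\<exists>g. Y = g <#\<^bsub>LM\<^esub> GLO \<and> g \<in> GL n (laurent A) \<and> AdV_act n (laurent A) (inv\<^bsub>LM\<^esub> g) (AdV_scalar A vv) \<in> AdV n (power_series A)"
    unfolding springer_presheaf_def presheaf.select_convs mem_Collect_eq .
  then obtain g where g0: "Y = g <#\<^bsub>LM\<^esub> GLO \<and> g \<in> GL n (laurent A) \<and> AdV_act n (laurent A) (inv\<^bsub>LM\<^esub> g) (AdV_scalar A vv) \<in> AdV n (power_series A)" ..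
  note g = conjunct1[OF conjunct2[OF g0]] conjunct2[OF conjunct2[OF g0]] conjunct1[OF g0]
  have U: "g \<in> carrier LM \<and> (\<exists>y\<in>carrier LM. y \<otimes>\<^bsub>LM\<^esub> g = \<one>\<^bsub>LM\<^esub> \<and> g \<otimes>\<^bsub>LM\<^esub> y = \<one>\<^bsub>LM\<^esub>)"
    using g(1) unfolding GL_def Units_def mem_Collect_eq .
  note gc = conjunct1[OF U]
  obtain y where y: "y \<in> carrier LM" "y \<otimes>\<^bsub>LM\<^esub> g = \<one>\<^bsub>LM\<^esub>" "g \<otimes>\<^bsub>LM\<^esub> y = \<one>\<^bsub>LM\<^esub>"
    using conjunct2[OF U] by (elim bexE conjE) (rule that)
  obtain N k where gk: "g = gm N k" using gm_ex[OF gc] .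
  obtain M h' where yh: "y = gm M h'" using gm_ex[OF y(1)] .
  have D: "(\<exists>u. y \<otimes>\<^bsub>LM\<^esub> gm 0 cmp \<otimes>\<^bsub>LM\<^esub> g = gm 0 u) \<and> (\<forall>i<n. \<forall>q<M. fps_nth (h' i (n - 1)) q \<in> K)"
    using g(2) unfolding act_mem[OF yh gc y(2,3)] .
  obtain \<delta> where \<delta>: "y \<otimes>\<^bsub>LM\<^esub> gm 0 cmp \<otimes>\<^bsub>LM\<^esub> g = gm 0 \<delta>" using conjunct1[OF D] ..
  have last: "fps_nth (h' i (n - 1)) q \<in> K" if "i < n" "q < M" for i q using conjunct2[OF D] that by blast
  have "gm 0 \<delta> \<otimes>\<^bsub>LM\<^esub> y = y \<otimes>\<^bsub>LM\<^esub> gm 0 cmp"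
    unfolding \<delta>[symmetric] using LG.m_assoc[OF LG.m_closed[OF y(1) gm_closed] gc y(1), of 0 cmp] y(3)
      LG.r_one[OF LG.m_closed[OF y(1) gm_closed], of 0 cmp] by simp
  hence "gm M (mprod n \<delta> h') = gm M (mprod n h' cmp)" unfolding yh gm_mult by simp
  hence cm: "meq K n (mprod n \<delta> h') (mprod n h' cmp)" unfolding gm_eq .
  have comm: "mprod n \<delta> h' i j - xmul ta n (h' i) j \<in> KF K" if "i < n" "j < n" for i j
    using cm[unfolded meq_def, rule_format, OF that] unfolding mprod_cmp[OF that(2)] .
  \<comment> \<open>Column j + 1 of h' \<gamma> is column j of h' plus a_(j+1) times its last
    column, and it agrees with column j + 1 of \<delta> h'. So column j inherits the vanishing of
    its coefficients below t^M from column j + 1 in all rows and from the last column;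
    \<open>d\<close> is the distance to the last column.\<close>
  have col: "\<forall>i<n. \<forall>q<M. fps_nth (h' i (n - 1 - d)) q \<in> K" if "d < n" for d
    using that
  proof (induction d)
    case 0
    show ?case using last by simp
  next
    case (Suc d)
    define j where "j = n - 1 - Suc d"
    have j: "n - 1 - d = Suc j" "Suc j < n" using Suc.prems by (auto simp: j_def)
    have IH: "fps_nth (h' i (Suc j)) q \<in> K" if "i < n" "q < M" for i q using Suc.IH Suc.prems that unfolding j(1) by auto
    show ?case unfolding j_def[symmetric]
    proof (intro allI impI)
      fix i q assume i: "i < n" and q: "q < M"
      have 1: "fps_nth (mprod n \<delta> h' i (Suc j)) q \<in> K" unfolding mprod_def fps_sum_nth
        by (rule KA.K_sum, rule KA.low_mult[OF IH q]) auto
      have 2: "fps_nth (ta (Suc j) * h' i (n - 1)) q \<in> K" by (rule KA.low_mult[OF last[OF i] q])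
      have "fps_nth (mprod n \<delta> h' i (Suc j) - xmul ta n (h' i) (Suc j)) q \<in> K" by (rule KF_nth[OF comm[OF i j(2)]])
      from KA.K_diff[OF KA.K_diff[OF 1 this] 2]
      show "fps_nth (h' i j) q \<in> K" by (simp add: xmul_def)
    qed
  qed
  have low: "fps_nth (h' i j) q \<in> K" if "i < n" "j < n" "q < M" for i j q
    using col[of "n - 1 - j"] that by auto
  \<comment> \<open>All coefficients below t^M vanish modulo \<open>K\<close>, so the pole of g^-1
    can be divided out.\<close>
  define h where "h i j = fps_shift M (h' i j)" for i j
  have "meq K n h' (\<lambda>i j. fps_X ^ M * h i j)" unfolding meq_def h_def using KA.low_shift low by blast
  hence "y = gm (0 + M) (\<lambda>i j. fps_X ^ M * h i j)" unfolding yh by (simp add: gm_eq)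
  hence yh: "y = gm 0 h" unfolding gm_shift .
  have inv: "minv K n N k h"
    using y(2,3) unfolding gk yh gm_mult gm_one[of N] minv_def by (simp add: gm_eq)
  have "gm (0 + N) (\<lambda>i j. fps_X ^ N * \<delta> i j) = gm N (mprod n (mprod n h cmp) k)"
    unfolding gm_shift \<delta>[symmetric] unfolding yh gk gm_mult by simp
  hence cc: "fps_X ^ N * \<delta> i j - mprod n (mprod n h cmp) k i j \<in> KF K" if "i < n" "j < n" for i j
    using that unfolding add_0 gm_eq meq_def by blast
  \<comment> \<open>Row i of g^-1 \<gamma> times g is row i of the integral matrix \<delta>. The
    rows of \<open>h\<close> span the lattice, so stability under x need only be checked on
    them.\<close>
  have row: "xmul ta n (h i) \<in> matlat K n N k" if i: "i < n" for i
    unfolding matlat_def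
  proof (intro CollectI allI impI)
    fix j q assume j: "j < n" and q: "q < N"
    have "fps_nth (fps_X ^ N * \<delta> i j - mprod n (mprod n h cmp) k i j) q \<in> K" by (rule KF_nth[OF cc[OF i j]])
    hence "fps_nth (mprod n (mprod n h cmp) k i j) q \<in> K" using KA.K_uminus q by (fastforce simp: fps_X_power_mult_nth)
    moreover have "mprod n (mprod n h cmp) k i j = (\<Sum>l<n. xmul ta n (h i) l * k l j)"
      unfolding mprod_def[of n "mprod n h cmp"] by (intro sum.cong refl) (simp add: mprod_cmp)
    ultimately show "fps_nth (\<Sum>l<n. xmul ta n (h i) l * k l j) q \<in> K" by simp
  qed
  interpret L: lattice0 K n "matlat K n N k" by (rule KA.lattice0_matlat)
  have "xmul ta n w \<in> matlat K n N k" if w: "w \<in> matlat K n N k" for w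
  proof -
    obtain u where u: "\<And>j. j < n \<Longrightarrow> w j - (\<Sum>i<n. u i * h i j) \<in> KF K"
      using KA.matlat_span[OF _ w, of h] inv unfolding minv_def by blast
    have s: "(\<lambda>j. \<Sum>i<n. u i * xmul ta n (h i) j) \<in> matlat K n N k"
      by (rule L.L_sum) (use row in \<open>auto intro: L.L_smult\<close>)
    show ?thesis
    proof (rule L.L_cong[OF s])
      fix j assume j: "j < n"
      have n1: "n - 1 < n" using n by simp
      have "(if j = 0 then 0 else w (j - 1)) - (if j = 0 then 0 else \<Sum>i<n. u i * h i (j - 1)) \<in> KF K"
        using u[of "j - 1"] j L.F.K0 by auto
      moreover have "ta j * w (n - 1) - ta j * (\<Sum>i<n. u i * h i (n - 1)) \<in> KF K"
        unfolding right_diff_distrib[symmetric] by (rule L.F.K_mult[OF u[OF n1]])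
      ultimately have "xmul ta n w j - xmul ta n (\<lambda>j. \<Sum>i<n. u i * h i j) j \<in> KF K"
        unfolding xmul_def by (rule L.F.cong_add)
      thus "xmul ta n w j - (\<Sum>i<n. u i * xmul ta n (h i) j) \<in> KF K" unfolding xmul_sum .
    qed
  qed
  hence "spr N k h" using inv unfolding spr_def by blast
  thus "\<exists>N k h. spr N k h \<and> Y = lcos N k" unfolding g(3) gk lcos_def by (intro exI conjI) (assumption, rule refl)
next
  assume "\<exists>N k h. spr N k h \<and> Y = lcos N k"
  then obtain N k h where s: "spr N k h" and Y: "Y = lcos N k" by blast
  have inv: "minv K n N k h" using s by (simp add: spr_def)
  note i = gm_inverse[OF inv]
  have GL: "gm N k \<in> GL n (laurent A)" unfolding GL_def Units_def using gm_closed i by blast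
  define u where "u i j = fps_shift N (mprod n (mprod n h cmp) k i j)" for i j
  have "meq K n (mprod n (mprod n h cmp) k) (\<lambda>i j. fps_X ^ N * u i j)" unfolding meq_def u_def
  proof (intro allI impI KA.low_shift)
    fix i j q assume ij: "i < n" "j < n" and q: "q < N"
    have "h i \<in> matlat K n N k" using KA.matlat_rows[of n h k N i] inv ij(1) unfolding minv_def by blast
    hence "xmul ta n (h i) \<in> matlat K n N k" using s unfolding spr_def by blast
    hence "fps_nth (\<Sum>l<n. xmul ta n (h i) l * k l j) q \<in> K" using ij q unfolding matlat_def by blast
    moreover have "mprod n (mprod n h cmp) k i j = (\<Sum>l<n. xmul ta n (h i) l * k l j)"
      unfolding mprod_def[of n "mprod n h cmp"] by (intro sum.cong refl) (simp add: mprod_cmp)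
    ultimately show "fps_nth (mprod n (mprod n h cmp) k i j) q \<in> K" by simp
  qed
  hence "gm N (mprod n (mprod n h cmp) k) = gm (0 + N) (\<lambda>i j. fps_X ^ N * u i j)" by (simp add: gm_eq)
  hence "gm 0 h \<otimes>\<^bsub>LM\<^esub> gm 0 cmp \<otimes>\<^bsub>LM\<^esub> gm N k = gm 0 u" unfolding gm_shift gm_mult by simp
  \<comment> \<open>g^-1 = h is written with pole order 0, so the condition on the vector is
    vacuous.\<close>
  hence act: "AdV_act n (laurent A) (inv\<^bsub>LM\<^esub> gm N k) (AdV_scalar A vv) \<in> AdV n (power_series A)"
    unfolding act_mem[OF refl gm_closed i(2,1)] by blast
  show "Y \<in> sections (springer_presheaf n vv) A"
    unfolding springer_presheaf_def presheaf.select_convs mem_Collect_eq Y lcos_def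
    by (rule exI[of _ "gm N k"], intro conjI refl GL act)
qed

text \<open>A relation and not a map: the quotient by the lattice of a coset need not have constant
  rank, and a lattice as in \<open>hsec\<close> need not be that of a matrix globally.\<close>

definition rel :: "(int \<Rightarrow> 'u) mat set \<Rightarrow> nat \<times> (int \<Rightarrow> int \<Rightarrow> 'u) set set \<Rightarrow> bool" where
  "rel Y x \<longleftrightarrow> (\<exists>N k h. spr N k h \<and> Y = lcos N k \<and> hsec (fst x) (matlat K n N k) \<and> snd x = latI (matlat K n N k))"

end

context germ_hom
begin

lemma map_gm: "map_mat (\<lambda>F q. \<phi> (F q)) (A.gm N k) = B.gm N (\<lambda>i j. mapf \<sigma> (k i j))"
proof (rule eq_matI)
  fix i j assume "i < dim_row (B.gm N (\<lambda>i j. mapf \<sigma> (k i j)))" "j < dim_col (B.gm N (\<lambda>i j. mapf \<sigma> (k i j)))"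
  hence ij: "i < n" "j < n" by (simp_all add: B.gm_def)
  thus "index_mat (map_mat (\<lambda>F q. \<phi> (F q)) (A.gm N k)) (i, j) = index_mat (B.gm N (\<lambda>i j. mapf \<sigma> (k i j))) (i, j)"
    by (simp add: A.gm_def B.gm_def pev_\<sigma>[symmetric] tpole_nth fun_eq_iff S.hom_zero)
qed (simp_all add: A.gm_def B.gm_def)

text \<open>\<open>restr\<close> takes a union over the representatives of the coset. They differ by
  integral invertible matrices, whose images are again integral and invertible, so all of them give
  the same coset.\<close>

lemma restr_cos: "restr (springer_presheaf n v) A B \<phi> (A.lcos N k) = B.lcos N (\<lambda>i j. mapf \<sigma> (k i j))"
proof -
  have "map_mat (\<lambda>F q. \<phi> (F q)) g <#\<^bsub>mat_ring (laurent B) n\<^esub> GL n (power_series B) = B.lcos N (\<lambda>i j. mapf \<sigma> (k i j))"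
    if g: "g \<in> A.lcos N k" for g
  proof -
    obtain y where y: "y \<in> A.GLO" "g = A.gm N k \<otimes>\<^bsub>A.LM\<^esub> y" using g unfolding A.cos_mem by (elim bexE) (rule that)
    obtain u u' where u0: "y = A.gm 0 u \<and> minv A.K n 0 u u'" using y(1) unfolding A.GLO_iff by (elim exE) (rule that)
    have u: "g = A.gm N k \<otimes>\<^bsub>A.LM\<^esub> A.gm 0 u" "minv A.K n 0 u u'" unfolding y(2) using u0 by simp_all
    have "g = A.gm N (mprod n k u)" unfolding u(1) A.gm_mult by simp
    hence e: "map_mat (\<lambda>F q. \<phi> (F q)) g = B.gm N (\<lambda>i j. mapf \<sigma> (k i j)) \<otimes>\<^bsub>B.LM\<^esub> B.gm 0 (\<lambda>i j. mapf \<sigma> (u i j))"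
      unfolding B.gm_mult mprod_mapf[OF S.comm_ring_hom_axioms] by (simp add: map_gm)
    have mu: "minv B.K n 0 (\<lambda>i j. mapf \<sigma> (u i j)) (\<lambda>i j. mapf \<sigma> (u' i j))"
      by (rule minv_mapf[OF S.comm_ring_hom_axioms \<sigma>_ker u(2)])
    have "B.gm 0 (\<lambda>i j. mapf \<sigma> (u i j)) \<in> B.GLO"
      unfolding B.GLO_iff by (rule exI, rule exI, rule conjI, rule refl, rule mu)
    thus ?thesis unfolding B.lcos_def e by (rule B.coset_absorb[OF B.gm_closed])
  qed
  thus ?thesis unfolding springer_presheaf_def using A.cos_self[of N k] by auto
qed

context
  fixes N k h assumes s: "A.spr N k h"
begin

lemma ext_spr: "ext \<sigma> B.K n N (matlat A.K n N k) = matlat B.K n N (\<lambda>i j. mapf \<sigma> (k i j))"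
proof -
  interpret bc: base_change A.K n "matlat A.K n N k" \<sigma> B.K N by (rule base_change[OF A.spr_hlat[OF s] A.KA.matlat_high])
  show ?thesis
    by (rule bc.ext_matlat[OF refl _ _ refl, of h]) (use s in \<open>auto simp: A.spr_def minv_def meq_def mprod_def mdel_def\<close>)
qed

lemma spr_mapf: "B.spr N (\<lambda>i j. mapf \<sigma> (k i j)) (\<lambda>i j. mapf \<sigma> (h i j))"
proof -
  interpret E: weier_lattice n B.ta B.K "matlat B.K n N (\<lambda>i j. mapf \<sigma> (k i j))"
    using hlat_ext[OF A.spr_hlat[OF s] A.KA.matlat_high] unfolding ext_spr .
  have "minv A.K n N k h" using s by (simp add: A.spr_def)
  from minv_mapf[OF S.comm_ring_hom_axioms \<sigma>_ker this] show ?thesis unfolding B.spr_def using E.xm by blast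
qed

end

lemma rel_restr:
  assumes "A.rel Y x"
  shows "B.rel (restr (springer_presheaf n v) A B \<phi> Y) (restr (presheaf_coproduct (hilb A.f)) A B \<phi> x)"
proof -
  obtain N k h where r: "A.spr N k h \<and> Y = A.lcos N k \<and> A.hsec (fst x) (matlat A.K n N k) \<and> snd x = A.latI (matlat A.K n N k)"
    using assms unfolding A.rel_def by (elim exE) (rule that)
  note s = conjunct1[OF r] and Y = conjunct1[OF conjunct2[OF r]]
    and x = conjunct1[OF conjunct2[OF conjunct2[OF r]]] conjunct2[OF conjunct2[OF conjunct2[OF r]]]
  have "restr (presheaf_coproduct (hilb A.f)) A B \<phi> x = (fst x, restr (hilb A.f (fst x)) A B \<phi> (snd x))"
    using coproduct_simps(2)[of _ A B \<phi> "fst x" "snd x"] by simp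
  also have "restr (hilb A.f (fst x)) A B \<phi> (snd x) = B.latI (matlat B.K n N (\<lambda>i j. mapf \<sigma> (k i j)))"
    unfolding x(2) restr_latI[OF A.spr_hlat[OF s] A.KA.matlat_high] ext_spr[OF s] ..
  finally have e: "restr (presheaf_coproduct (hilb A.f)) A B \<phi> x = (fst x, B.latI (matlat B.K n N (\<lambda>i j. mapf \<sigma> (k i j))))" .
  have hs: "B.hsec (fst x) (matlat B.K n N (\<lambda>i j. mapf \<sigma> (k i j)))"
    using hsec_ext[OF A.spr_hlat[OF s] A.KA.matlat_high x(1)] unfolding ext_spr[OF s] .
  show ?thesis unfolding B.rel_def Y restr_cos e fst_conv snd_conv
    by (rule exI, rule exI, rule exI, rule conjI[OF spr_mapf[OF s] conjI[OF refl conjI[OF hs refl]]])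
qed

end

section \<open>The isomorphism\<close>

lemma functorial_compose:
  assumes "functorial F" "is_calg A" "is_calg B" "is_calg C" "\<phi> \<in> calg_hom A B" "\<psi> \<in> calg_hom B C" "x \<in> sections F A"
  shows "restr F B C \<psi> (restr F A B \<phi> x) = restr F A C (compose (carrier A) \<psi> \<phi>) x"
  using assms unfolding functorial_def by blast

definition inverting_some :: "'u calg \<Rightarrow> 'u set \<Rightarrow> 'u arrow set" where
  "inverting_some A T = (\<Union>s\<in>T. inverting A s)"

lemma covering_inverting_some:
  assumes A: "is_calg A" and T: "T \<subseteq> carrier A" "genideal A T = carrier A"
  shows "zariski_covering A (inverting_some A T)"
proof -
  have "is_sieve A (inverting_some A T)"
  proof (rule is_sieveI)
    fix B \<phi> assume "(B, \<phi>) \<in> inverting_some A T"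
    thus "is_calg B \<and> \<phi> \<in> calg_hom A B" by (auto simp: inverting_some_def inverting_def)
  next
    fix B \<phi> C \<psi> assume "(B, \<phi>) \<in> inverting_some A T" and C: "is_calg C" and \<psi>: "\<psi> \<in> calg_hom B C"
    then obtain s where s: "s \<in> T" "is_calg B" "\<phi> \<in> calg_hom A B" "\<phi> s \<in> Units B"
      by (auto simp: inverting_some_def inverting_def)
    obtain y where y: "y \<in> carrier B" "\<phi> s \<in> carrier B" "y \<otimes>\<^bsub>B\<^esub> \<phi> s = \<one>\<^bsub>B\<^esub>" "\<phi> s \<otimes>\<^bsub>B\<^esub> y = \<one>\<^bsub>B\<^esub>"
      using s(4) unfolding Units_def by blast
    note h = calg_homD[OF \<psi>]
    have "\<psi> (\<phi> s) \<in> Units C" unfolding Units_def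
      using h(3)[OF y(1)] h(3)[OF y(2)] h(4)[OF y(1,2)] h(4)[OF y(2,1)] unfolding y(3,4) h(6) by auto
    moreover have "compose (carrier A) \<psi> \<phi> s = \<psi> (\<phi> s)" using s(1) T(1) by (auto simp: compose_def)
    ultimately have "(C, compose (carrier A) \<psi> \<phi>) \<in> inverting A s"
      using C calg_hom_compose[OF s(3) \<psi> A] by (simp add: inverting_def)
    thus "(C, compose (carrier A) \<psi> \<phi>) \<in> inverting_some A T" using s(1) by (auto simp: inverting_some_def)
  qed
  thus ?thesis unfolding covering_inverting[OF A] using T by (auto simp: inverting_some_def)
qed

lemma inverting_some_mem:
  "(B, \<phi>) \<in> inverting_some A T \<longleftrightarrow> (\<exists>t\<in>T. is_calg B \<and> \<phi> \<in> calg_hom A B \<and> \<phi> t \<in> Units B)"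
  by (auto simp: inverting_some_def inverting_def)

context germ
begin

lemma genideal_unit:
  assumes I: "finite I" and s: "(\<Sum>f\<in>I. c f * s f) - 1 \<in> K"
  shows "genideal A ((\<lambda>f. pev A (s f)) ` I) = carrier A"
proof -
  have sub: "(\<lambda>f. pev A (s f)) ` I \<subseteq> carrier A" by auto
  interpret I: ideal "genideal A ((\<lambda>f. pev A (s f)) ` I)" A by (rule RA.genideal_ideal[OF sub])
  have "pev A (\<Sum>f\<in>J. c f * s f) \<in> genideal A ((\<lambda>f. pev A (s f)) ` I)" if "J \<subseteq> I" for J
    using finite_subset[OF that I] that
  proof (induction J rule: finite_induct)
    case (insert x J)
    have "pev A (s x) \<in> genideal A ((\<lambda>f. pev A (s f)) ` I)" using RA.genideal_self[OF sub] insert.prems by auto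
    hence "pev A (c x * s x) \<in> genideal A ((\<lambda>f. pev A (s f)) ` I)" unfolding RA.im_mult by (rule I.I_l_closed) simp
    thus ?case using insert by (simp add: RA.im_add del: pev_simps)
  qed (simp add: RA.im_zero del: pev_simps)
  hence "pev A (\<Sum>f\<in>I. c f * s f) \<in> genideal A ((\<lambda>f. pev A (s f)) ` I)" by blast
  moreover have "pev A (\<Sum>f\<in>I. c f * s f) = \<one>\<^bsub>A\<^esub>" using s unfolding pev_eq_iff[OF A, symmetric] RA.im_one .
  ultimately show ?thesis using I.one_imp_carrier by simp
qed

lemma hsec_free:
  assumes L: "hlat L" and b: "lattice0.free K L m b"
  shows "hsec m L"
proof -
  interpret L: weier_lattice n ta K L by (rule L)
  have "genideal A ((\<lambda>f. pev A 1) ` {()}) = carrier A"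
    by (rule genideal_unit[where c = "\<lambda>_. 1"]) (simp_all add: KA.K0)
  hence g: "genideal A {pev A 1} = carrier A" by simp
  have "\<forall>s\<in>{pev A 1}. \<exists>p b. pev A p = s \<and> L.lfree m p b" using b unfolding L.lfree_one[symmetric] by blast
  thus ?thesis unfolding hsec_def using L g by (intro conjI exI[of _ "{pev A 1}"]) auto
qed

lemma mapf_id: "mapf (push A A (id_hom A)) x - x \<in> KF K"
proof -
  have "pev A (push A A (id_hom A) p) = pev A p" for p
    unfolding pev_push[OF A A id_hom[OF A]] using A by (simp add: id_hom_def)
  thus ?thesis using pev_eq_iff[OF A] by (simp add: KF_def)
qed

end

context germ_hom
begin

lemma unit_lift: assumes "\<phi> (pev A p) \<in> Units B" shows "\<exists>v. v * \<sigma> p - 1 \<in> B.K"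
proof -
  obtain y where y: "y \<in> carrier B" "y \<otimes>\<^bsub>B\<^esub> \<phi> (pev A p) = \<one>\<^bsub>B\<^esub>" using assms unfolding Units_def by blast
  obtain v where v: "pev B v = y" using pev_surj[OF B.A y(1)] .
  have "pev B (v * \<sigma> p) = pev B 1" unfolding B.RA.im_mult pev_\<sigma> v y(2) B.RA.im_one ..
  thus ?thesis unfolding pev_eq_iff[OF B.A] by blast
qed

text \<open>After a homomorphism that makes the denominator a unit, local freeness is
  freeness.\<close>

lemma free_ext:
  assumes L: "A.hlat L" and N: "\<And>w. (\<lambda>i. fps_X ^ N * w i) \<in> L" and l: "lattice0.lfree A.K L m p b" and u: "\<phi> (pev A p) \<in> Units B"
  shows "\<exists>b. lattice0.free B.K (ext \<sigma> B.K n N L) m b"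
proof -
  interpret bc: base_change A.K n L \<sigma> B.K N by (rule base_change[OF L N])
  obtain v where v: "v * \<sigma> p - 1 \<in> B.K" using unit_lift[OF u] by blast
  from bc.L'.lfree_unit[OF v bc.lfree_base[OF l]] show ?thesis by blast
qed

text \<open>The matrix is computed from \<open>k\<close> and \<open>h\<close> by operations that
  commute with \<open>\<sigma>\<close>, so minors and adjugates found over \<open>A\<close> serve
  over every target.\<close>

lemma stack_mapf:
  "stack r (\<lambda>\<alpha> \<gamma>. matcoord n N (\<lambda>i j. mapf \<sigma> (k i j)) \<gamma> (matdual n N (\<lambda>i j. mapf \<sigma> (h i j)) \<alpha>)) i j =
   \<sigma> (stack r (\<lambda>\<alpha> \<gamma>. matcoord n N k \<gamma> (matdual n N h \<alpha>)) i j)"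
proof -
  have "matcoord n N (\<lambda>i j. mapf \<sigma> (k i j)) \<gamma> (matdual n N (\<lambda>i j. mapf \<sigma> (h i j)) \<alpha>) = \<sigma> (matcoord n N k \<gamma> (matdual n N h \<alpha>))" for \<alpha> \<gamma>
  proof -
    have "(\<Sum>l<n. matdual n N (\<lambda>i j. mapf \<sigma> (h i j)) \<alpha> l * mapf \<sigma> (k l (\<gamma> div N))) = mapf \<sigma> (\<Sum>l<n. matdual n N h \<alpha> l * k l (\<gamma> div N))"
      by (simp add: S.mapf_sum S.mapf_simps matdual_def)
    thus ?thesis unfolding matcoord_def by simp
  qed
  thus ?thesis unfolding stack_def by (simp add: S.hom_zero S.hom_one S.hom_minus)
qed

end

section \<open>Local matching of cosets and ideals\<close>

text \<open>On a common refinement of the two trivializing coverings the quotient has bases of both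
  sizes, so 1 = 0 there. The empty sieve thus covers locally, hence covers.\<close>

lemma (in germ) rank_unique:
  assumes h: "hsec m L" "hsec m' L" "m < m'"
  shows "zariski_covering A {}"
proof -
  have L: "hlat L" using h(1) by (simp add: hsec_def)
  obtain N where N: "\<And>w. (\<lambda>i. fps_X ^ N * w i) \<in> L" using hlat_high[OF L] by blast
  obtain T where T: "T \<subseteq> carrier A \<and> genideal A T = carrier A \<and> (\<forall>s\<in>T. \<exists>p b. pev A p = s \<and> lattice0.lfree K L m p b)"
    using conjunct2[OF h(1)[unfolded hsec_def]] ..
  obtain T' where T': "T' \<subseteq> carrier A \<and> genideal A T' = carrier A \<and> (\<forall>s\<in>T'. \<exists>p b. pev A p = s \<and> lattice0.lfree K L m' p b)"
    using conjunct2[OF h(2)[unfolded hsec_def]] ..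
  have cov: "zariski_covering A (inverting_some A T \<inter> inverting_some A T')"
    by (rule covering_inter[OF A covering_inverting_some[OF A] covering_inverting_some[OF A]]) (use T T' in auto)
  show ?thesis
  proof (rule covering_trans[OF A cov])
    show "is_sieve A {}" by (simp add: is_sieve_def)
    fix B \<phi> assume "(B, \<phi>) \<in> inverting_some A T \<inter> inverting_some A T'"
    hence I0: "(\<exists>t\<in>T. is_calg B \<and> \<phi> \<in> calg_hom A B \<and> \<phi> t \<in> Units B) \<and> (\<exists>t\<in>T'. is_calg B \<and> \<phi> \<in> calg_hom A B \<and> \<phi> t \<in> Units B)"
      unfolding Int_iff inverting_some_mem .
    note I = conjunct1[OF I0] conjunct2[OF I0]
    obtain s where s0: "s \<in> T" "is_calg B \<and> \<phi> \<in> calg_hom A B \<and> \<phi> s \<in> Units B" using I(1) ..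
    obtain s' where s1: "s' \<in> T'" "is_calg B \<and> \<phi> \<in> calg_hom A B \<and> \<phi> s' \<in> Units B" using I(2) ..
    note s = s0(1) s1(1) conjunct1[OF s0(2)] conjunct1[OF conjunct2[OF s0(2)]] conjunct2[OF conjunct2[OF s0(2)]] conjunct2[OF conjunct2[OF s1(2)]]
    interpret H: germ_hom n a A B \<phi>
      by (intro germ_hom.intro germ_hom_axioms.intro germ_axioms s(4)) (unfold_locales, use n a s(3) in auto)
    obtain p b where p: "pev A p = s" "lattice0.lfree K L m p b" using T s(1) by blast
    obtain p' b' where p': "pev A p' = s'" "lattice0.lfree K L m' p' b'" using T' s(2) by blast
    interpret E: weier_lattice n ta "ker B" "ext H.\<sigma> (ker B) n N L" by (rule H.hlat_ext[OF L N])
    obtain c where c: "E.free m c" using H.free_ext[OF L N p(2)] s(5) p(1) by blast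
    obtain c' where c': "E.free m' c'" using H.free_ext[OF L N p'(2)] s(6) p'(1) by blast
    have "1 \<in> ker B" by (rule E.free_rank_le[OF c c' h(3)])
    hence z: "\<one>\<^bsub>B\<^esub> = \<zero>\<^bsub>B\<^esub>" unfolding H.B.RA.im_one[symmetric] by (simp add: ker_def del: pev_simps)
    have "sieve_pullback A B \<phi> {} = {}" by (simp add: sieve_pullback_def)
    thus "zariski_covering B (sieve_pullback A B \<phi> {})" using covering_zero[OF s(3) z, of "{}"] by (simp add: is_sieve_def)
  qed
qed

text \<open>The minors are formed over \<open>A\<close>, where they generate the unit ideal, and
  every arrow of the covering inverts one of them; over its target \<open>matlat_free\<close>
  provides a basis. Its size is the number of rows chosen from the idempotent, so it may depend on
  the minor.\<close>

lemma (in germ) locally_total_springer: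
  assumes s: "spr N k h"
  shows "\<exists>S. zariski_covering A S \<and> (\<forall>(B, \<phi>)\<in>S. \<exists>y. germ.rel n a B (restr (springer_presheaf n v) A B \<phi> (lcos N k)) y)"
proof -
  define r where "r = n * N"
  define P where "P = stack r (\<lambda>\<alpha> \<gamma>. matcoord n N k \<gamma> (matdual n N h \<alpha>))"
  \<comment> \<open>Two stacked identity matrices, the right inverse of
    \<open>stack_inverse\<close>.\<close>
  define Q :: "nat \<Rightarrow> nat \<Rightarrow> 'u univ" where "Q l j = (if l < r then if l = j then 1 else 0 else if l - r = j then 1 else 0)" for l j
  interpret L: lattice0 K n "matlat K n N k" by (rule KA.lattice0_matlat)
  have PQ: "(\<Sum>l<r + r. P i l * Q l j) - (if i = j then 1 else 0) \<in> K" if "i < r" "j < r" for i j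
  proof -
    have e: "(\<Sum>l<r + r. P i l * Q l j) = (if i = j then 1 else 0)"
      unfolding P_def Q_def by (rule L.stack_inverse[OF that])
    show ?thesis unfolding e diff_self by (rule KA.K0)
  qed
  have "\<exists>c s' U. (\<Sum>f\<in>minor_sets r (r + r). c f * s' f) - 1 \<in> K \<and>
    (\<forall>f. \<forall>i<r. \<forall>j<r. (\<Sum>l<r. P i (f l) * U f l j) = (if i = j then s' f else 0)) \<and>
    (\<forall>f. \<forall>i<r. \<forall>j<r. (\<Sum>l<r. U f i l * P l (f j)) = (if i = j then s' f else 0))"
  proof (rule KA.minors_generate[where m = "r" and p = "r + r" and P = P and Q = Q])
    show "(\<Sum>l<r + r. P i l * Q l j) - (if i = j then 1 else 0) \<in> K" if "i < r" "j < r" for i j by (rule PQ[OF that])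
  next
    fix c s' U
    assume 1: "(\<Sum>f\<in>minor_sets r (r + r). c f * s' f) - 1 \<in> K"
      and 2: "\<And>f i j. i < r \<Longrightarrow> j < r \<Longrightarrow> (\<Sum>l<r. P i (f l) * U f l j) = (if i = j then s' f else 0)"
      and 3: "\<And>f i j. i < r \<Longrightarrow> j < r \<Longrightarrow> (\<Sum>l<r. U f i l * P l (f j)) = (if i = j then s' f else 0)"
    show ?thesis by (rule exI[of _ c], rule exI[of _ s'], rule exI[of _ U]) (intro conjI allI impI 1 2 3)
  qed
  then obtain c s' U where cU: "(\<Sum>f\<in>minor_sets r (r + r). c f * s' f) - 1 \<in> K \<and>
    (\<forall>f. \<forall>i<r. \<forall>j<r. (\<Sum>l<r. P i (f l) * U f l j) = (if i = j then s' f else 0)) \<and>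
    (\<forall>f. \<forall>i<r. \<forall>j<r. (\<Sum>l<r. U f i l * P l (f j)) = (if i = j then s' f else 0))"
    by (elim exE) (rule that)
  note c = conjunct1[OF cU]
  have Ub: "(\<Sum>l<r. U f i l * P l (f j)) = (if i = j then s' f else 0)" if "i < r" "j < r" for f i j
    using conjunct2[OF conjunct2[OF cU]] that by blast
  have Ua: "(\<Sum>l<r. P i (f l) * U f l j) = (if i = j then s' f else 0)" if "i < r" "j < r" for f i j
    using conjunct1[OF conjunct2[OF cU]] that by blast
  define T where "T = (\<lambda>f. pev A (s' f)) ` minor_sets r (r + r)"
  have cov: "zariski_covering A (inverting_some A T)"
    unfolding T_def by (rule covering_inverting_some[OF A _ genideal_unit[OF finite_minor_sets c]]) auto
  have "\<exists>y. germ.rel n a B (restr (springer_presheaf n v) A B \<phi> (lcos N k)) y" if BT: "(B, \<phi>) \<in> inverting_some A T" for B \<phi>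
  proof -
    have "\<exists>t\<in>T. is_calg B \<and> \<phi> \<in> calg_hom A B \<and> \<phi> t \<in> Units B" using BT unfolding inverting_some_mem .
    then obtain t where t: "t \<in> T" and I: "is_calg B \<and> \<phi> \<in> calg_hom A B \<and> \<phi> t \<in> Units B" ..
    obtain f where f1: "t = pev A (s' f)" "f \<in> minor_sets r (r + r)" using t unfolding T_def by (elim imageE) (rule that)
    note f = f1(2) conjunct1[OF I] conjunct1[OF conjunct2[OF I]] conjunct2[OF conjunct2[OF I], unfolded f1(1)]
    interpret H: germ_hom n a A B \<phi>
      by (intro germ_hom.intro germ_hom_axioms.intro germ_axioms f(3)) (unfold_locales, use n a f(2) in auto)
    let ?k = "\<lambda>i j. mapf H.\<sigma> (k i j)" and ?h = "\<lambda>i j. mapf H.\<sigma> (h i j)"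
    have s2: "H.B.spr N ?k ?h" by (rule H.spr_mapf[OF s])
    obtain v' where v': "v' * H.\<sigma> (s' f) - 1 \<in> ker B" using H.unit_lift[OF f(4)] by blast
    have U1: "(\<Sum>l<r. stack r (\<lambda>\<alpha> \<gamma>. matcoord n N ?k \<gamma> (matdual n N ?h \<alpha>)) i (f l) * H.\<sigma> (U f l j)) = (if i = j then H.\<sigma> (s' f) else 0)"
      if "i < r" "j < r" for i j
    proof -
      have "H.\<sigma> (\<Sum>l<r. P i (f l) * U f l j) = H.\<sigma> (if i = j then s' f else 0)" unfolding Ua[OF that] ..
      thus ?thesis unfolding H.stack_mapf P_def[symmetric] by (simp add: H.S.hom_sum H.S.hom_mult H.S.hom_zero split: if_splits)
    qed
    have U2: "(\<Sum>l<r. H.\<sigma> (U f i l) * stack r (\<lambda>\<alpha> \<gamma>. matcoord n N ?k \<gamma> (matdual n N ?h \<alpha>)) l (f j)) = (if i = j then H.\<sigma> (s' f) else 0)"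
      if "i < r" "j < r" for i j
    proof -
      have "H.\<sigma> (\<Sum>l<r. U f i l * P l (f j)) = H.\<sigma> (if i = j then s' f else 0)" unfolding Ub[OF that] ..
      thus ?thesis unfolding H.stack_mapf P_def[symmetric] by (simp add: H.S.hom_sum H.S.hom_mult H.S.hom_zero split: if_splits)
    qed
    have mi: "minv (ker B) n N ?k ?h" using s2 by (simp add: H.B.spr_def)
    have "\<exists>m b. lattice0.free (ker B) (matlat (ker B) n N ?k) m b"
    proof (rule H.B.KA.matlat_free[OF _ _ f(1)[unfolded r_def] U1[unfolded r_def] U2[unfolded r_def] v'])
      fix i j assume "i < n" "j < n"
      thus "(\<Sum>l<n. ?k i l * ?h l j) - (if i = j then fps_X ^ N else 0) \<in> KF (ker B)"
        "(\<Sum>l<n. ?h i l * ?k l j) - (if i = j then fps_X ^ N else 0) \<in> KF (ker B)"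
        using mi unfolding minv_def meq_def mprod_def mdel_def by blast+
    qed
    then obtain m b where "lattice0.free (ker B) (matlat (ker B) n N ?k) m b" by blast
    hence hs: "H.B.hsec m (matlat (ker B) n N ?k)" by (rule H.B.hsec_free[OF H.B.spr_hlat[OF s2]])
    have "H.B.rel (H.B.lcos N ?k) (m, H.B.latI (matlat (ker B) n N ?k))"
      unfolding H.B.rel_def fst_conv snd_conv by (rule exI, rule exI, rule exI, rule conjI[OF s2 conjI[OF refl conjI[OF hs refl]]])
    thus ?thesis unfolding H.restr_cos by (rule exI)
  qed
  thus ?thesis using cov by blast
qed

text \<open>The presentation of \<open>L\<close> and its minors are formed over \<open>A\<close>.
  Where a minor becomes a unit, \<open>m\<close> of the n + m generators are eliminated, and the
  remaining \<open>n\<close> are the rows of the inverse \<open>h\<close> of a matrix with the given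
  lattice.\<close>

lemma (in germ) trivialization:
  assumes L: "hlat L" and hs: "hsec m L" and fr: "lattice0.free K L m b"
  shows "\<exists>S. zariski_covering A S \<and> (\<forall>(B, \<phi>)\<in>S. \<exists>Y. germ.rel n a B Y (restr (presheaf_coproduct (hilb f)) A B \<phi> (m, latI L)))"
proof -
  interpret L: weier_lattice n ta K L by (rule L)
  obtain M where M: "\<And>w. (\<lambda>i. fps_X ^ M * w i) \<in> L" using L.L_X by blast
  \<comment> \<open>One more power of t than \<open>L\<close> contains, as
    \<open>generates_base\<close> requires.\<close>
  have N: "(\<lambda>i. fps_X ^ Suc M * w i) \<in> L" for w
    using M[of "\<lambda>i. fps_X * w i"] by (simp add: mult.left_commute mult.assoc)
  have "\<exists>z P Q. L.generates (n + m) z \<and> (\<forall>l<m. lc (n + m) (P l) z \<in> L.tL) \<and>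
    (\<forall>i<m. \<forall>j<m. (\<Sum>k<n + m. P i k * Q k j) - (if i = j then 1 else 0) \<in> K)"
  proof (rule L.presentation[OF fr])
    fix z P Q
    assume 1: "L.generates (n + m) z" and 2: "\<And>l. l < m \<Longrightarrow> lc (n + m) (P l) z \<in> L.tL"
      and 3: "\<And>i j. i < m \<Longrightarrow> j < m \<Longrightarrow> (\<Sum>k<n + m. P i k * Q k j) - (if i = j then 1 else 0) \<in> K"
    show ?thesis by (rule exI[of _ z], rule exI[of _ P], rule exI[of _ Q]) (intro conjI allI impI 1 2 3)
  qed
  then obtain z P Q where zP: "L.generates (n + m) z \<and> (\<forall>l<m. lc (n + m) (P l) z \<in> L.tL) \<and>
    (\<forall>i<m. \<forall>j<m. (\<Sum>k<n + m. P i k * Q k j) - (if i = j then 1 else 0) \<in> K)" by (elim exE) (rule that)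
  note g = conjunct1[OF zP]
  have rel: "lc (n + m) (P l) z \<in> L.tL" if "l < m" for l using zP that by blast
  have PQ: "(\<Sum>k<n + m. P i k * Q k j) - (if i = j then 1 else 0) \<in> K" if "i < m" "j < m" for i j
    using conjunct2[OF conjunct2[OF zP]] that by blast
  have "\<exists>c s' U. (\<Sum>f\<in>minor_sets m (n + m). c f * s' f) - 1 \<in> K \<and>
    (\<forall>f. \<forall>i<m. \<forall>j<m. (\<Sum>l<m. P i (f l) * U f l j) = (if i = j then s' f else 0)) \<and>
    (\<forall>f. \<forall>i<m. \<forall>j<m. (\<Sum>l<m. U f i l * P l (f j)) = (if i = j then s' f else 0))"
  proof (rule KA.minors_generate[where m = "m" and p = "n + m" and P = P and Q = Q])
    show "(\<Sum>l<n + m. P i l * Q l j) - (if i = j then 1 else 0) \<in> K" if "i < m" "j < m" for i j by (rule PQ[OF that])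
  next
    fix c s' U
    assume 1: "(\<Sum>f\<in>minor_sets m (n + m). c f * s' f) - 1 \<in> K"
      and 2: "\<And>f i j. i < m \<Longrightarrow> j < m \<Longrightarrow> (\<Sum>l<m. P i (f l) * U f l j) = (if i = j then s' f else 0)"
      and 3: "\<And>f i j. i < m \<Longrightarrow> j < m \<Longrightarrow> (\<Sum>l<m. U f i l * P l (f j)) = (if i = j then s' f else 0)"
    show ?thesis by (rule exI[of _ c], rule exI[of _ s'], rule exI[of _ U]) (intro conjI allI impI 1 2 3)
  qed
  then obtain c s' U where cU: "(\<Sum>f\<in>minor_sets m (n + m). c f * s' f) - 1 \<in> K \<and>
    (\<forall>f. \<forall>i<m. \<forall>j<m. (\<Sum>l<m. P i (f l) * U f l j) = (if i = j then s' f else 0)) \<and>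
    (\<forall>f. \<forall>i<m. \<forall>j<m. (\<Sum>l<m. U f i l * P l (f j)) = (if i = j then s' f else 0))"
    by (elim exE) (rule that)
  note c = conjunct1[OF cU]
  have U: "(\<Sum>l<m. U f i l * P l (f j)) = (if i = j then s' f else 0)" if "i < m" "j < m" for f i j
    using conjunct2[OF conjunct2[OF cU]] that by blast
  define T where "T = (\<lambda>f. pev A (s' f)) ` minor_sets m (n + m)"
  have cov: "zariski_covering A (inverting_some A T)"
    unfolding T_def by (rule covering_inverting_some[OF A _ genideal_unit[OF finite_minor_sets c]]) auto
  have "\<exists>Y. germ.rel n a B Y (restr (presheaf_coproduct (hilb f)) A B \<phi> (m, latI L))" if BT: "(B, \<phi>) \<in> inverting_some A T" for B \<phi>
  proof -
    have "\<exists>t\<in>T. is_calg B \<and> \<phi> \<in> calg_hom A B \<and> \<phi> t \<in> Units B" using BT unfolding inverting_some_mem .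
    then obtain t where t: "t \<in> T" and I: "is_calg B \<and> \<phi> \<in> calg_hom A B \<and> \<phi> t \<in> Units B" ..
    obtain f' where f1: "t = pev A (s' f')" "f' \<in> minor_sets m (n + m)" using t unfolding T_def by (elim imageE) (rule that)
    note f = f1(2) conjunct1[OF I] conjunct1[OF conjunct2[OF I]] conjunct2[OF conjunct2[OF I], unfolded f1(1)]
    interpret H: germ_hom n a A B \<phi>
      by (intro germ_hom.intro germ_hom_axioms.intro germ_axioms f(3)) (unfold_locales, use n a f(2) in auto)
    let ?E = "ext H.\<sigma> (ker B) n (Suc M) L"
    interpret bc: base_change K n L H.\<sigma> "ker B" "Suc M" by (rule H.base_change[OF L N])
    interpret E: weier_lattice n ta "ker B" ?E by (rule H.hlat_ext[OF L N])
    obtain v' where v': "v' * H.\<sigma> (s' f') - 1 \<in> ker B" using H.unit_lift[OF f(4)] by blast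
    let ?z = "\<lambda>k i. mapf H.\<sigma> (z k i)"
    have g2: "bc.L'.generates (n + m) ?z" by (rule bc.generates_base[OF g refl M])
    have rel2: "lc (n + m) (\<lambda>k. H.\<sigma> (P l k)) ?z \<in> bc.L'.tL" if "l < m" for l
      using bc.tL_base[OF rel[OF that]] unfolding bc.mapf_lc .
    have U2: "(\<Sum>l<m. H.\<sigma> (U f' i l) * H.\<sigma> (P l (f' j))) = (if i = j then H.\<sigma> (s' f') else 0)" if "i < m" "j < m" for i j
    proof -
      have "H.\<sigma> (\<Sum>l<m. U f' i l * P l (f' j)) = H.\<sigma> (if i = j then s' f' else 0)" unfolding U[OF that] ..
      thus ?thesis by (simp add: H.S.hom_sum H.S.hom_mult H.S.hom_zero split: if_splits)
    qed
    have "\<exists>h. bc.L'.generates n h"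
    proof (rule bc.L'.eliminate[where P = "\<lambda>l k. H.\<sigma> (P l k)" and U = "\<lambda>i l. H.\<sigma> (U f' i l)", OF g2 _ f(1) _ v'])
      show "lc (n + m) (\<lambda>k. H.\<sigma> (P l k)) ?z \<in> bc.L'.tL" if "l < m" for l by (rule rel2[OF that])
      show "(\<Sum>l<m. H.\<sigma> (U f' i l) * H.\<sigma> (P l (f' j))) = (if i = j then H.\<sigma> (s' f') else 0)" if "i < m" "j < m" for i j
        by (rule U2[OF that])
      show "\<exists>h. bc.L'.generates n h" if "bc.L'.generates n h" for h
        by (rule exI[of _ h]) (rule that)
    qed
    then obtain h where h: "bc.L'.generates n h" ..
    have "\<exists>N' k. minv (ker B) n N' k h \<and> ?E = matlat (ker B) n N' k"
    proof (rule bc.L'.generates_matlat[OF h])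
      fix N' k
      assume 1: "\<And>i j. i < n \<Longrightarrow> j < n \<Longrightarrow> (\<Sum>l<n. k i l * h l j) - (if i = j then fps_X ^ N' else 0) \<in> KF (ker B)"
        and 2: "\<And>i j. i < n \<Longrightarrow> j < n \<Longrightarrow> (\<Sum>l<n. h i l * k l j) - (if i = j then fps_X ^ N' else 0) \<in> KF (ker B)"
        and 3: "?E = matlat (ker B) n N' k"
      have "minv (ker B) n N' k h" unfolding minv_def meq_def mprod_def mdel_def by (intro conjI allI impI 1 2)
      thus "\<exists>N' k. minv (ker B) n N' k h \<and> ?E = matlat (ker B) n N' k" using 3 by (intro exI conjI)
    qed
    then obtain N' k where Nk: "minv (ker B) n N' k h \<and> ?E = matlat (ker B) n N' k" by (elim exE) (rule that)
    note mk = conjunct1[OF Nk] and k = conjunct2[OF Nk]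
    have s: "H.B.spr N' k h" unfolding H.B.spr_def k[symmetric] by (rule conjI[OF mk ballI], rule E.xm)
    have hs2: "H.B.hsec m (matlat (ker B) n N' k)" using H.hsec_ext[OF L N hs] unfolding k .
    have r: "restr (presheaf_coproduct (hilb f)) A B \<phi> (m, latI L) = (m, H.B.latI (matlat (ker B) n N' k))"
      unfolding coproduct_simps H.restr_latI[OF L N] k ..
    have "H.B.rel (H.B.lcos N' k) (m, H.B.latI (matlat (ker B) n N' k))"
      unfolding H.B.rel_def fst_conv snd_conv by (rule exI, rule exI, rule exI, rule conjI[OF s conjI[OF refl conjI[OF hs2 refl]]])
    thus ?thesis unfolding r by (rule exI)
  qed
  thus ?thesis using cov by blast
qed

section \<open>The correspondence is locally bijective\<close>

context
  fixes n :: nat and a :: "nat \<Rightarrow> complex fps"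
  assumes n: "n \<ge> 1" and a: "\<forall>i<n. fps_nth (a i) 0 = 0"
begin

abbreviation "spF \<equiv> springer_presheaf n (companion n a, unit_vec n (n - 1)) :: ('u, _) presheaf"
abbreviation "hiG \<equiv> presheaf_coproduct (hilb (fps_of_poly (weierstrass n a))) :: ('u, _) presheaf"

lemma germ: "is_calg A \<Longrightarrow> germ n a A" using n a by unfold_locales auto

lemma germ_hom: "is_calg A \<Longrightarrow> is_calg B \<Longrightarrow> \<phi> \<in> calg_hom A B \<Longrightarrow> germ_hom n a A B \<phi>"
  using germ by (intro germ_hom.intro germ_hom_axioms.intro) auto

lemma functorial_springer: "functorial (spF :: ('u, _) presheaf)"
  unfolding functorial_def
proof (intro conjI allI impI; elim conjE)
  fix A B :: "'u calg" and \<phi> x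
  assume A: "is_calg A" and B: "is_calg B" and \<phi>: "\<phi> \<in> calg_hom A B" and x: "x \<in> sections spF A"
  interpret germ_hom n a A B \<phi> by (rule germ_hom[OF A B \<phi>])
  obtain N k h where s: "A.spr N k h" "x = A.lcos N k" using x unfolding A.springer_sections by (elim exE conjE) (rule that)
  show "restr spF A B \<phi> x \<in> sections spF B" unfolding s(2) restr_cos B.springer_sections by (rule exI, rule exI, rule exI, rule conjI[OF spr_mapf[OF s(1)] refl])
next
  fix A :: "'u calg" and x assume A: "is_calg A" and x: "x \<in> sections spF A"
  interpret germ_hom n a A A "id_hom A" by (rule germ_hom[OF A A id_hom[OF A]])
  obtain N k h where s: "A.spr N k h" "x = A.lcos N k" using x unfolding A.springer_sections by (elim exE conjE) (rule that)
  have g: "A.gm N (\<lambda>i j. mapf \<sigma> (k i j)) = A.gm N k" unfolding A.gm_eq meq_def using A.mapf_id by blast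
  have e: "A.lcos N (\<lambda>i j. mapf \<sigma> (k i j)) = A.lcos N k" unfolding A.lcos_def g ..
  show "restr spF A A (id_hom A) x = x" unfolding s(2) restr_cos by (rule e)
next
  fix A B C :: "'u calg" and \<phi> \<psi> x
  assume A: "is_calg A" and B: "is_calg B" and C: "is_calg C" and \<phi>: "\<phi> \<in> calg_hom A B" and \<psi>: "\<psi> \<in> calg_hom B C" and x: "x \<in> sections spF A"
  interpret AB: germ_hom n a A B \<phi> by (rule germ_hom[OF A B \<phi>])
  interpret BC: germ_hom n a B C \<psi> by (rule germ_hom[OF B C \<psi>])
  interpret AC: germ_hom n a A C "compose (carrier A) \<psi> \<phi>" by (rule germ_hom[OF A C calg_hom_compose[OF \<phi> \<psi> A]])
  obtain N k h where s: "AB.A.spr N k h" "x = AB.A.lcos N k" using x unfolding AB.A.springer_sections by (elim exE conjE) (rule that)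
  have "mapf BC.\<sigma> (mapf AB.\<sigma> y) - mapf AC.\<sigma> y \<in> KF (ker C)" for y
  proof -
    have "pev C (BC.\<sigma> (AB.\<sigma> p)) = pev C (AC.\<sigma> p)" for p
      unfolding BC.pev_\<sigma> AB.pev_\<sigma> AC.pev_\<sigma> using A by (simp add: compose_def)
    thus ?thesis using pev_eq_iff[OF C] by (simp add: KF_def)
  qed
  hence g: "BC.B.gm N (\<lambda>i j. mapf BC.\<sigma> (mapf AB.\<sigma> (k i j))) = BC.B.gm N (\<lambda>i j. mapf AC.\<sigma> (k i j))"
    unfolding BC.B.gm_eq meq_def by blast
  have e: "BC.B.lcos N (\<lambda>i j. mapf BC.\<sigma> (mapf AB.\<sigma> (k i j))) = BC.B.lcos N (\<lambda>i j. mapf AC.\<sigma> (k i j))"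
    unfolding BC.B.lcos_def g ..
  show "restr spF B C \<psi> (restr spF A B \<phi> x) = restr spF A C (compose (carrier A) \<psi> \<phi>) x"
    unfolding s(2) AB.restr_cos AC.restr_cos BC.restr_cos by (rule e)
qed

lemma correspondence_rel: "correspondence (spF :: ('u, _) presheaf) hiG (\<lambda>A. germ.rel n a A)"
  unfolding correspondence_def
proof (intro allI impI; elim conjE)
  fix A :: "'u calg" and x y assume A: "is_calg A" and r: "germ.rel n a A x y"
  interpret germ n a A by (rule germ[OF A])
  obtain N k h where s0: "spr N k h \<and> x = lcos N k \<and> hsec (fst y) (matlat K n N k) \<and> snd y = latI (matlat K n N k)"
    using r unfolding rel_def by (elim exE) (rule that)
  note s = conjunct1[OF s0] conjunct1[OF conjunct2[OF s0]] conjunct1[OF conjunct2[OF conjunct2[OF s0]]] conjunct2[OF conjunct2[OF conjunct2[OF s0]]]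
  have "x \<in> sections spF A" unfolding springer_sections by (rule exI[of _ N], rule exI[of _ k], rule exI[of _ h], rule conjI[OF s(1,2)])
  moreover have "y \<in> sections hiG A" unfolding coproduct_simps hilb_sections by (rule exI, rule conjI[OF s(3,4)])
  moreover have "germ.rel n a B (restr spF A B \<phi> x) (restr hiG A B \<phi> y)" if B: "is_calg B" and \<phi>: "\<phi> \<in> calg_hom A B" for B \<phi>
    by (rule germ_hom.rel_restr[OF germ_hom[OF A B \<phi>] r])
  ultimately show "x \<in> sections spF A \<and> y \<in> sections hiG A \<and>
    (\<forall>B \<phi>. is_calg B \<and> \<phi> \<in> calg_hom A B \<longrightarrow> germ.rel n a B (restr spF A B \<phi> x) (restr hiG A B \<phi> y))" by blast
qed

lemma locally_total_rel: "locally_total (spF :: ('u, _) presheaf) (\<lambda>A. germ.rel n a A)"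
  unfolding locally_total_def
proof (intro allI impI ballI)
  fix A :: "'u calg" and x assume A: "is_calg A" and x: "x \<in> sections spF A"
  interpret germ n a A by (rule germ[OF A])
  obtain N k h where s: "spr N k h" "x = lcos N k" using x unfolding springer_sections by (elim exE conjE) (rule that)
  show "\<exists>S. zariski_covering A S \<and> (\<forall>(B, \<phi>)\<in>S. \<exists>y. germ.rel n a B (restr spF A B \<phi> x) y)"
    unfolding s(2) by (rule locally_total_springer[OF s(1)])
qed

text \<open>A coset determines its lattice and thereby the ideal. Two different ranks can occur only
  if the empty sieve covers, and on the empty sieve the restrictions agree.\<close>

lemma locally_unique_rel: "locally_unique (hiG :: ('u, _) presheaf) (\<lambda>A. germ.rel n a A)"
  unfolding locally_unique_def
proof (intro allI impI; elim conjE)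
  fix A :: "'u calg" and x y y' assume A: "is_calg A" and r: "germ.rel n a A x y" "germ.rel n a A x y'"
  interpret germ n a A by (rule germ[OF A])
  obtain N k h where s0: "spr N k h \<and> x = lcos N k \<and> hsec (fst y) (matlat K n N k) \<and> snd y = latI (matlat K n N k)"
    using r(1) unfolding rel_def by (elim exE) (rule that)
  note s = conjunct1[OF s0] conjunct1[OF conjunct2[OF s0]] conjunct1[OF conjunct2[OF conjunct2[OF s0]]] conjunct2[OF conjunct2[OF conjunct2[OF s0]]]
  obtain N' k' h' where s1: "spr N' k' h' \<and> x = lcos N' k' \<and> hsec (fst y') (matlat K n N' k') \<and> snd y' = latI (matlat K n N' k')"
    using r(2) unfolding rel_def by (elim exE) (rule that)
  note s' = conjunct1[OF s1] conjunct1[OF conjunct2[OF s1]] conjunct1[OF conjunct2[OF conjunct2[OF s1]]] conjunct2[OF conjunct2[OF conjunct2[OF s1]]]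
  have e: "matlat K n N' k' = matlat K n N k" by (rule cos_matlat) (simp only: s(2)[symmetric] s'(2)[symmetric])
  consider "fst y = fst y'" | "fst y < fst y'" | "fst y' < fst y" by linarith
  thus "\<exists>S. zariski_covering A S \<and> (\<forall>(B, \<phi>)\<in>S. restr hiG A B \<phi> y = restr hiG A B \<phi> y')"
  proof cases
    case 1
    hence "y = y'" using s(4) s'(4) e by (simp add: prod_eq_iff)
    thus ?thesis using covering_max[OF A] by blast
  next
    case 2
    have "zariski_covering A {}" by (rule rank_unique[OF s(3) s'(3)[unfolded e] 2])
    thus ?thesis by blast
  next
    case 3
    have "zariski_covering A {}" by (rule rank_unique[OF s'(3)[unfolded e] s(3) 3])
    thus ?thesis by blast
  qed
qed

text \<open>Equal ideals have equal lattices by \<open>latI_inj\<close>, and the lattice determines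
  the coset by \<open>matlat_cos\<close>; so the cosets are equal over \<open>A\<close>
  itself.\<close>

lemma locally_unique_rel': "locally_unique (spF :: ('u, _) presheaf) (\<lambda>A x y. germ.rel n a A y x)"
  unfolding locally_unique_def
proof (intro allI impI; elim conjE)
  fix A :: "'u calg" and x y y' assume A: "is_calg A" and r: "germ.rel n a A y x" "germ.rel n a A y' x"
  interpret germ n a A by (rule germ[OF A])
  obtain N k h where s0: "spr N k h \<and> y = lcos N k \<and> hsec (fst x) (matlat K n N k) \<and> snd x = latI (matlat K n N k)"
    using r(1) unfolding rel_def by (elim exE) (rule that)
  note s = conjunct1[OF s0] conjunct1[OF conjunct2[OF s0]] conjunct2[OF conjunct2[OF conjunct2[OF s0]]]
  obtain N' k' h' where s1: "spr N' k' h' \<and> y' = lcos N' k' \<and> hsec (fst x) (matlat K n N' k') \<and> snd x = latI (matlat K n N' k')"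
    using r(2) unfolding rel_def by (elim exE) (rule that)
  note s' = conjunct1[OF s1] conjunct1[OF conjunct2[OF s1]] conjunct2[OF conjunct2[OF conjunct2[OF s1]]]
  have e: "matlat K n N k = matlat K n N' k'"
    by (rule latI_inj[OF spr_hlat[OF s(1)] spr_hlat[OF s'(1)]]) (simp only: s(3)[symmetric] s'(3)[symmetric])
  have "y = y'" unfolding s(2) s'(2) 
    by (rule matlat_cos[OF conjunct1[OF s(1)[unfolded spr_def]] conjunct1[OF s'(1)[unfolded spr_def]] e])
  thus "\<exists>S. zariski_covering A S \<and> (\<forall>(B, \<phi>)\<in>S. restr spF A B \<phi> y = restr spF A B \<phi> y')" using covering_max[OF A] by blast
qed

text \<open>Two refinements in succession: first the elements of \<open>T\<close> are inverted,
  which makes the quotient free, then \<open>trivialization\<close> inverts a minor.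
  \<open>R\<close> collects all arrows that acquire a partner, and it covers by
  transitivity.\<close>

lemma locally_total_rel': "locally_total (hiG :: ('u, _) presheaf) (\<lambda>A x y. germ.rel n a A y x)"
  unfolding locally_total_def
proof (intro allI impI ballI)
  fix A :: "'u calg" and x assume A: "is_calg A" and x: "x \<in> sections hiG A"
  note fctr = functorial_compose[OF functorial_hilb[OF n a]]
  interpret germ n a A by (rule germ[OF A])
  obtain L where hs: "hsec (fst x) L" and xL: "snd x = latI L" using x hilb_sections[of "snd x" "fst x"] unfolding coproduct_simps by blast
  have L: "hlat L" using hs by (simp add: hsec_def)
  have xe: "x = (fst x, latI L)" by (rule prod_eqI) (simp_all add: xL)
  obtain N where N: "\<And>w. (\<lambda>i. fps_X ^ N * w i) \<in> L" using hlat_high[OF L] by blast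
  obtain T where T: "T \<subseteq> carrier A \<and> genideal A T = carrier A \<and> (\<forall>s\<in>T. \<exists>p b. pev A p = s \<and> lattice0.lfree K L (fst x) p b)"
    using conjunct2[OF hs[unfolded hsec_def]] ..
  have cov: "zariski_covering A (inverting_some A T)" using covering_inverting_some[OF A] T by blast
  define R where "R = {(B, \<phi>). is_calg B \<and> \<phi> \<in> calg_hom A B \<and> (\<exists>Y. germ.rel n a B Y (restr hiG A B \<phi> x))}"
  have Rmem: "(B, \<phi>) \<in> R \<longleftrightarrow> is_calg B \<and> \<phi> \<in> calg_hom A B \<and> (\<exists>Y. germ.rel n a B Y (restr hiG A B \<phi> x))" for B \<phi>
    unfolding R_def by simp
  have sv: "is_sieve A R"
  proof (rule is_sieveI)
    fix B \<phi> assume "(B, \<phi>) \<in> R"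
    thus "is_calg B \<and> \<phi> \<in> calg_hom A B" unfolding Rmem by (elim conjE) (intro conjI)
  next
    fix B \<phi> C \<psi> assume BR: "(B, \<phi>) \<in> R" and C: "is_calg C" and \<psi>: "\<psi> \<in> calg_hom B C"
    obtain Y where Y: "is_calg B" "\<phi> \<in> calg_hom A B" "germ.rel n a B Y (restr hiG A B \<phi> x)"
      using BR unfolding Rmem by (elim conjE exE) (rule that)
    have e: "restr hiG B C \<psi> (restr hiG A B \<phi> x) = restr hiG A C (compose (carrier A) \<psi> \<phi>) x"
      by (rule fctr[OF A Y(1) C Y(2) \<psi> x])
    have "germ.rel n a C (restr spF B C \<psi> Y) (restr hiG A C (compose (carrier A) \<psi> \<phi>) x)"
      using germ_hom.rel_restr[OF germ_hom[OF Y(1) C \<psi>] Y(3)] unfolding e .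
    hence ex: "\<exists>Y. germ.rel n a C Y (restr hiG A C (compose (carrier A) \<psi> \<phi>) x)" by (rule exI)
    show "(C, compose (carrier A) \<psi> \<phi>) \<in> R" unfolding Rmem by (rule conjI[OF C conjI[OF calg_hom_compose[OF Y(2) \<psi> A] ex]])
  qed
  have cR: "zariski_covering A R"
  proof (rule covering_trans[OF A cov sv])
    fix B \<phi> assume "(B, \<phi>) \<in> inverting_some A T"
    hence "\<exists>t\<in>T. is_calg B \<and> \<phi> \<in> calg_hom A B \<and> \<phi> t \<in> Units B" unfolding inverting_some_mem .
    then obtain s where s0: "s \<in> T" "is_calg B \<and> \<phi> \<in> calg_hom A B \<and> \<phi> s \<in> Units B" ..
    note s = s0(1) conjunct1[OF s0(2)] conjunct1[OF conjunct2[OF s0(2)]] conjunct2[OF conjunct2[OF s0(2)]]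
    interpret H: germ_hom n a A B \<phi> by (rule germ_hom[OF A s(2,3)])
    obtain p b where p: "pev A p = s" "lattice0.lfree K L (fst x) p b" using T s(1) by blast
    let ?E = "ext H.\<sigma> (ker B) n N L"
    obtain b' where b': "lattice0.free (ker B) ?E (fst x) b'" using H.free_ext[OF L N p(2)] s(4) p(1) by blast
    have re: "restr hiG A B \<phi> x = (fst x, H.B.latI ?E)" by (subst xe) (simp only: coproduct_simps H.restr_latI[OF L N])
    obtain S where S0: "zariski_covering B S \<and> (\<forall>(C, \<psi>)\<in>S. \<exists>Y. germ.rel n a C Y (restr hiG B C \<psi> (fst x, H.B.latI ?E)))"
      using H.B.trivialization[OF H.hlat_ext[OF L N] H.hsec_ext[OF L N hs] b'] ..
    note S = conjunct1[OF S0] conjunct2[OF S0]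
    show "zariski_covering B (sieve_pullback A B \<phi> R)"
    proof (rule covering_subset[OF S(1) is_sieve_pullback[OF sv s(3,2)]], rule subsetI)
      fix q assume q: "q \<in> S"
      obtain C \<psi> where qe: "q = (C, \<psi>)" by (cases q)
      note C = is_sieveD(1,2)[OF zariski_covering_sieve[OF S(1)] q[unfolded qe]]
      have "\<exists>Y. germ.rel n a C Y (restr hiG B C \<psi> (restr hiG A B \<phi> x))"
        using bspec[OF S(2) q[unfolded qe]] unfolding prod.case re .
      hence ex: "\<exists>Y. germ.rel n a C Y (restr hiG A C (compose (carrier A) \<psi> \<phi>) x)"
        unfolding fctr[OF A s(2) C(1) s(3) C(2) x] .
      have "(C, compose (carrier A) \<psi> \<phi>) \<in> R"
        unfolding Rmem by (rule conjI[OF C(1) conjI[OF calg_hom_compose[OF s(3) C(2) A] ex]])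
      thus "q \<in> sieve_pullback A B \<phi> R" unfolding qe sieve_pullback_def mem_Collect_eq prod.case by (rule conjI[OF C(1) conjI[OF C(2)]])
    qed
  qed
  show "\<exists>S. zariski_covering A S \<and> (\<forall>(B, \<phi>)\<in>S. \<exists>y. germ.rel n a B y (restr hiG A B \<phi> x))"
  proof (rule exI[of _ R], rule conjI[OF cR], rule ballI)
    fix q assume q: "q \<in> R"
    obtain B \<phi> where qe: "q = (B, \<phi>)" by (cases q)
    show "case q of (B, \<phi>) \<Rightarrow> \<exists>y. germ.rel n a B y (restr hiG A B \<phi> x)"
      using q unfolding qe Rmem prod.case by (elim conjE)
  qed
qed

end

theorem theorem1p2:
  fixes n :: nat and a :: "nat \<Rightarrow> complex fps"
  assumes "n \<ge> 1"
    and "\<forall>i<n. fps_nth (a i) 0 = 0"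
  shows "presheaf_iso
    (springer_fiber n (companion n a, unit_vec n (n - 1)) :: ('u, _) presheaf)
    (hilb_all (fps_of_poly (weierstrass n a)))"
  unfolding springer_fiber_def hilb_all_def
  by (rule sheafification_iso[OF functorial_springer[OF assms] functorial_hilb[OF assms] correspondence_rel[OF assms]
        locally_total_rel[OF assms] locally_total_rel'[OF assms] locally_unique_rel[OF assms] locally_unique_rel'[OF assms]])

end
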